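(* Let $\{Z^{(p)}\}_{p\ge1}$ be a sequence of matrix exponential random variables with mean $\Delta$, $\mathrm{Var}(Z^{(p)})\to0$ as $p\to\infty$, and increasing (minimal) order. Let $\{(L^{(p)}(t),\mathbf A^{(p)}(t),\phi(t))\}$, $p=1,2,\dots$, be the corresponding sequence of QBD-RAP approximations to the fluid queue $\{(X(t),\varphi(t))\}_{t\ge0}$, constructed as in the context from $Z^{(p)}$ with tolerances $\delta_p\to0$, with generators $\mathbf B^{(p)}$ and closing operators $\mathbf V^{(p)}$. Then the QBD-RAP scheme converges weakly to the distribution of the fluid queue as $p\to\infty$: for every initial condition $(X(0),\varphi(0))=(x_0,i)\in[0,b]\times\mathcal S$, every $t\ge0$ and every bounded continuous $f:[0,b]\times\mathcal S\to\mathbb R$, $$\mathbb E\Big[\sum_{\ell,j}\mathbf A^{(p)}(t)\,1(L^{(p)}(t)=\ell,\phi(t)=j)\,\mathbf V^{(p)}_{\ell,j}f\Big]\;\longrightarrow\;\mathbb E\big[f(X(t),\varphi(t))\,\big|\,X(0)=x_0,\varphi(0)=i\big]\qquad(p\to\infty),$$ where the QBD-RAP is started from the initial vector associated with $(x_0,i)$ and the sum is over all pairs $(\ell,j)$ with $1\le\ell\le K$, $j\in\mathcal S$, or $\ell=0$, $j\in\mathcal N$, or $\ell=K+1$, $j\in\mathcal P$; equivalently the left-hand side is $\mathbf e_{k,i,n}^{\mathsf T}e^{\mathbf B^{(p)}t}\mathbf V^{(p)}f$ with $\mathbf e_{k,i,n}$ that initial vector.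
   Context: Fluid queue: $\mathcal S$ is a finite set, $\mathbf T=[T_{ij}]$ is the generator of the continuous-time Markov chain $\varphi$ on $\mathcal S$, $c_i\in\mathbb R\setminus\{0\}$, $\mathcal P=\{i:c_i>0\}$, $\mathcal N=\{i:c_i<0\}$, $0<b<\infty$. The level $X(t)\in[0,b]$ satisfies $\frac{d}{dt}X(t)=c_{\varphi(t)}$ if $0<X(t)<b$, $\max\{0,c_{\varphi(t)}\}$ if $X(t)=0$, and $\min\{0,c_{\varphi(t)}\}$ if $X(t)=b$. Write $\mathbf T_{++},\mathbf T_{+-},\mathbf T_{-+},\mathbf T_{--}$ for the sub-matrices of $\mathbf T$ with rows/columns in $\mathcal P$ ($+$) or $\mathcal N$ ($-$), $\mathbf C_+=\mathrm{diag}(|c_i|,i\in\mathcal P)$, $\mathbf C_-=\mathrm{diag}(|c_i|,i\in\mathcal N)$. Grid (fixed): $K\ge1$ is an integer, $\Delta=b/K$, $y_k=(k-1)\Delta$ for $k=1,\dots,K+1$. For $k=1,\dots,K$, $\mathcal D_{k,i}=[y_k,y_{k+1})$ if $i\in\mathcal P$ and $(y_k,y_{k+1}]$ if $i\in\mathcal N$. Construction from a matrix exponential variable $Z$ (the superscript $(p)$ is omitted; $q$ denotes the order): $Z\ge0$ has mean $\Delta$, no atom at $0$, and $\mathbb P(Z>x)=\boldsymbol\alpha e^{\mathbf Sx}\mathbf 1$ with density $\boldsymbol\alpha e^{\mathbf Sx}\mathbf s$, $x\ge0$, where $\mathbf S$ is a real $q\times q$ matrix, $\boldsymbol\alpha$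 a $1\times q$ row vector, $\mathbf 1$ the vector of ones and $\mathbf s=-\mathbf S\mathbf 1$; the representation is minimal ($q$ is as small as possible and is called the order). Put $\varepsilon=\mathrm{Var}(Z)^{1/3}<1$. The representation is chosen such that for some points $0=t_1<2\varepsilon<t_2<\dots<t_q<\Delta-\varepsilon<t_{q+1}=\Delta$ one has $\boldsymbol\alpha=\mathbf e_1^{\mathsf T}$ and $\mathbf e_n^{\mathsf T}e^{\mathbf Sx}\mathbf 1=\mathbb P(Z-t_n\ge x\mid Z>t_n)$ for $x\ge0$, $n=1,\dots,q$ (these functions of $x$ being linearly independent). The construction has tolerance $\delta>0$ if moreover $$\max_{n=1,\dots,q}|t_n-t_{n+1}|<\tfrac12\delta,\qquad \frac{\boldsymbol\alpha e^{\mathbf St_n}\mathbf s}{\boldsymbol\alpha e^{\mathbf St_n}\mathbf 1}\le\frac{\varepsilon}{\tfrac14\delta\,(1-\varepsilon)}\quad(n=1,\dots,q).$$ Put $$\mathbf D=\int_0^{\Delta-\varepsilon}e^{\mathbf Sy}\mathbf s\,\frac{\boldsymbol\alpha e^{\mathbf Sy}}{\boldsymbol\alpha e^{\mathbf Sy}\mathbf 1}\,dy+\int_{\Delta-\varepsilon}^\infty e^{\mathbf Sy}\mathbf s\,\frac{\boldsymbol\alpha e^{\mathbf S(\Delta-\varepsilon)}}{\boldsymbol\alpha e^{\mathbf S(\Delta-\varepsilon)}\mathbf 1}\,dy .$$ QBD-RAP generator: $\mathbf B$ is the block matrix with blocks $\mathbf B(k,l)$, $k,l\in\{0,\dots,K+1\}$,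 where level $0$ has index set $\mathcal N$, level $K+1$ has index set $\mathcal P$, and levels $1,\dots,K$ have index set $\mathcal S\times\{1,\dots,q\}$ with phases in $\mathcal P$ listed before those in $\mathcal N$. Its nonzero blocks are $\mathbf B(0,0)=\mathbf T_{--}$; $\mathbf B(0,1)=[\mathbf T_{-+}\otimes\boldsymbol\alpha\;\;\mathbf 0]$; $\mathbf B(1,0)=\begin{bmatrix}\mathbf 0\\ \mathbf C_-\otimes\mathbf s\end{bmatrix}$; $\mathbf B(k,k)=\begin{bmatrix}\mathbf C_+\otimes\mathbf S+\mathbf T_{++}\otimes\mathbf I&\mathbf T_{+-}\otimes\mathbf D\\ \mathbf T_{-+}\otimes\mathbf D&\mathbf C_-\otimes\mathbf S+\mathbf T_{--}\otimes\mathbf I\end{bmatrix}$ for $1\le k\le K$; $\mathbf B(k,k+1)=\begin{bmatrix}\mathbf C_+\otimes(\mathbf s\boldsymbol\alpha)&\mathbf 0\\ \mathbf 0&\mathbf 0\end{bmatrix}$ for $1\le k\le K-1$; $\mathbf B(k,k-1)=\begin{bmatrix}\mathbf 0&\mathbf 0\\ \mathbf 0&\mathbf C_-\otimes(\mathbf s\boldsymbol\alpha)\end{bmatrix}$ for $2\le k\le K$; $\mathbf B(K,K+1)=\begin{bmatrix}\mathbf C_+\otimes\mathbf s\\ \mathbf 0\end{bmatrix}$; $\mathbf B(K+1,K)=[\mathbf 0\;\;\mathbf T_{+-}\otimes\boldsymbol\alpha]$; $\mathbf B(K+1,K+1)=\mathbf T_{++}$. $\mathbf e_{k,i,n}$ denotes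 the unit column vector with its $1$ at level $k$, phase $i$, index $n$ (with $n=1$ only when $k\in\{0,K+1\}$). QBD-RAP process $(L,\mathbf A,\phi)$: $L$ is the level, $\phi$ the phase, $\mathbf A(t)$ the row-vector orbit (of length $q$ in levels $1,\dots,K$, identically $1$ in levels $0,K+1$). In levels $1,\dots,K$ and phase $i$: $\frac{d}{dt}\mathbf A=|c_i|(\mathbf A\mathbf S-(\mathbf A\mathbf S\mathbf 1)\mathbf A)$; at intensity $|c_i|\mathbf A\mathbf s$ the level moves by $\operatorname{sgn}(c_i)$ and the orbit is reset to $\boldsymbol\alpha$ (or to $1$ on entering level $0$ or $K+1$); at intensity $T_{ij}$ ($j\ne i$) the phase moves to $j$ and $\mathbf A$ is replaced by $\mathbf A\mathbf D$ if $\operatorname{sgn}c_i\ne\operatorname{sgn}c_j$ and unchanged otherwise. In level $0$ (phase in $\mathcal N$) the phase moves from $i$ to $j$ at rate $T_{ij}$, and if $j\in\mathcal P$ the level becomes $1$ and the orbit $\boldsymbol\alpha$; symmetrically in level $K+1$ (phase in $\mathcal P$), where a move to $j\in\mathcal N$ puts the process in level $K$ with orbit $\boldsymbol\alpha$. Started from $\mathbf e_{k,i,n}$ (level $k$, phase $i$, orbit $\mathbf e_n^{\mathsf T}$), the row vector $\mathbb E[\mathbf A(t)1(L(t)=\ell,\phi(t)=j)]$ is the $(\ell,j)$ block of $\mathbf e_{k,i,n}^{\mathsf T}e^{\mathbf Bt}$. Initial vector for $(x_0,i)$: $\mathbf e_{0,i,1}$ if $x_0=0$, $i\in\mathcal N$;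 $\mathbf e_{K+1,i,1}$ if $x_0=b$, $i\in\mathcal P$; $\mathbf e_{k,i,n}$ if $x_0\in[y_k+t_n,y_k+t_{n+1})$, $i\in\mathcal P$, or if $x_0\in(y_{k+1}-t_{n+1},y_{k+1}-t_n]$, $i\in\mathcal N$. Closing operator: for $1\le\ell\le K$, with $z_{\ell,j}(x)=y_{\ell+1}-x$ if $j\in\mathcal P$ and $z_{\ell,j}(x)=x-y_\ell$ if $j\in\mathcal N$, let $\mathbf v_{\ell,j}(x)=\big(e^{\mathbf Sz_{\ell,j}(x)}+e^{\mathbf S(2\Delta-z_{\ell,j}(x))}\big)[\mathbf I-e^{2\Delta\mathbf S}]^{-1}\mathbf s$ and $\mathbf V_{\ell,j}f=\int_{\mathcal D_{\ell,j}}\mathbf v_{\ell,j}(x)f(x,j)\,dx\in\mathbb R^q$; also $\mathbf V_{0,j}f=f(0,j)$ for $j\in\mathcal N$, $\mathbf V_{K+1,j}f=f(b,j)$ for $j\in\mathcal P$; $\mathbf Vf$ is the column vector of all $\mathbf V_{\ell,j}f$ ordered as the index set of $\mathbf B$. *)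

theory Defs
  imports "HOL-Probability.Probability"
begin

section \<open>Matrices over finite index sets\<close>

text \<open>
  The orders of the matrices vary along the approximating sequence, so matrices and vectors are
  functions on an index type together with an explicit finite index set \<open>I\<close>; only entries
  with indices in \<open>I\<close> are meaningful.
\<close>

definition mat_mul :: "'i set \<Rightarrow> ('i \<Rightarrow> 'i \<Rightarrow> real) \<Rightarrow> ('i \<Rightarrow> 'i \<Rightarrow> real) \<Rightarrow> 'i \<Rightarrow> 'i \<Rightarrow> real" where
  "mat_mul I A B = (\<lambda>i j. \<Sum>k\<in>I. A i k * B k j)"

definition mat_one :: "'i \<Rightarrow> 'i \<Rightarrow> real" where
  "mat_one = (\<lambda>i j. if i = j then 1 else 0)"

primrec mat_pow :: "'i set \<Rightarrow> ('i \<Rightarrow> 'i \<Rightarrow> real) \<Rightarrow> nat \<Rightarrow> 'i \<Rightarrow> 'i \<Rightarrow> real" where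
  "mat_pow I A 0 = mat_one"
| "mat_pow I A (Suc n) = mat_mul I (mat_pow I A n) A"

text \<open>\<open>mat_exp I A x\<close> is $e^{Ax}$.\<close>

definition mat_exp :: "'i set \<Rightarrow> ('i \<Rightarrow> 'i \<Rightarrow> real) \<Rightarrow> real \<Rightarrow> 'i \<Rightarrow> 'i \<Rightarrow> real" where
  "mat_exp I A x = (\<lambda>i j. \<Sum>n. x ^ n / fact n * mat_pow I A n i j)"

text \<open>On \<open>I\<close> the inverse is unique if it exists; entries outside \<open>I\<close> are arbitrary.\<close>

definition mat_inv_on :: "'i set \<Rightarrow> ('i \<Rightarrow> 'i \<Rightarrow> real) \<Rightarrow> 'i \<Rightarrow> 'i \<Rightarrow> real" where
  "mat_inv_on I A = (SOME N. \<forall>i\<in>I. \<forall>j\<in>I.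
     mat_mul I A N i j = mat_one i j \<and> mat_mul I N A i j = mat_one i j)"

definition mat_vec :: "'i set \<Rightarrow> ('i \<Rightarrow> 'i \<Rightarrow> real) \<Rightarrow> ('i \<Rightarrow> real) \<Rightarrow> 'i \<Rightarrow> real" where
  "mat_vec I A v = (\<lambda>i. \<Sum>j\<in>I. A i j * v j)"

definition vec_mat :: "'i set \<Rightarrow> ('i \<Rightarrow> real) \<Rightarrow> ('i \<Rightarrow> 'i \<Rightarrow> real) \<Rightarrow> 'i \<Rightarrow> real" where
  "vec_mat I v A = (\<lambda>j. \<Sum>i\<in>I. v i * A i j)"

definition dot :: "'i set \<Rightarrow> ('i \<Rightarrow> real) \<Rightarrow> ('i \<Rightarrow> real) \<Rightarrow> real" where
  "dot I v w = (\<Sum>i\<in>I. v i * w i)"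

definition ones :: "'i \<Rightarrow> real" where
  "ones = (\<lambda>_. 1)"

definition unit_vec :: "'i \<Rightarrow> 'i \<Rightarrow> real" where
  "unit_vec n = (\<lambda>m. if m = n then 1 else 0)"


section \<open>The fluid queue\<close>

definition generator :: "('s::finite \<Rightarrow> 's \<Rightarrow> real) \<Rightarrow> bool" where
  "generator T \<longleftrightarrow> (\<forall>i j. i \<noteq> j \<longrightarrow> 0 \<le> T i j) \<and> (\<forall>i. (\<Sum>j\<in>UNIV. T i j) = 0)"

definition cadlag_step :: "(real \<Rightarrow> 'a) \<Rightarrow> bool" where
  "cadlag_step g \<longleftrightarrow>
     (\<forall>t\<ge>0. \<exists>h>0. \<forall>u\<in>{t..<t + h}. g u = g t) \<and>
     (\<forall>t>0. \<exists>h>0. \<exists>a. \<forall>u\<in>{t - h<..<t}. g u = a)"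

definition ctmc :: "'w measure \<Rightarrow> ('s::finite \<Rightarrow> 's \<Rightarrow> real) \<Rightarrow> (real \<Rightarrow> 'w \<Rightarrow> 's) \<Rightarrow> bool" where
  "ctmc M T \<phi> \<longleftrightarrow>
     prob_space M \<and>
     (\<forall>t\<ge>0. \<phi> t \<in> measurable M (count_space UNIV)) \<and>
     (\<forall>\<omega>\<in>space M. cadlag_step (\<lambda>t. \<phi> t \<omega>)) \<and>
     (\<forall>(m::nat) (\<tau>::nat \<Rightarrow> real) (\<sigma>::nat \<Rightarrow> 's).
        0 \<le> \<tau> 0 \<and> (\<forall>k\<le>m. \<tau> k \<le> \<tau> (Suc k)) \<longrightarrow>
        measure M {\<omega>\<in>space M. \<forall>k\<le>Suc m. \<phi> (\<tau> k) \<omega> = \<sigma> k} =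
        measure M {\<omega>\<in>space M. \<forall>k\<le>m. \<phi> (\<tau> k) \<omega> = \<sigma> k} *
          mat_exp UNIV T (\<tau> (Suc m) - \<tau> m) (\<sigma> m) (\<sigma> (Suc m)))"

definition level_rate :: "('s \<Rightarrow> real) \<Rightarrow> real \<Rightarrow> real \<Rightarrow> 's \<Rightarrow> real" where
  "level_rate c b x i =
     (if x = 0 then max 0 (c i) else if x = b then min 0 (c i) else c i)"

text \<open>
  The fluid queue started from \<open>(x0, i)\<close>. At jump times of \<open>\<phi>\<close> and at hitting times of the
  boundaries the level is only one-sidedly differentiable; the differential equation is read with
  right derivatives along continuous paths.
\<close>

definition fluid_queue ::
  "'w measure \<Rightarrow> ('s::finite \<Rightarrow> 's \<Rightarrow> real) \<Rightarrow> ('s \<Rightarrow> real) \<Rightarrow> real \<Rightarrow> real \<Rightarrow> 's \<Rightarrow>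
   (real \<Rightarrow> 'w \<Rightarrow> real) \<Rightarrow> (real \<Rightarrow> 'w \<Rightarrow> 's) \<Rightarrow> bool" where
  "fluid_queue M T c b x0 i X \<phi> \<longleftrightarrow>
     ctmc M T \<phi> \<and>
     (\<forall>t\<ge>0. X t \<in> borel_measurable M) \<and>
     (\<forall>\<omega>\<in>space M.
        X 0 \<omega> = x0 \<and> \<phi> 0 \<omega> = i \<and>
        (\<forall>t\<ge>0. X t \<omega> \<in> {0..b}) \<and>
        continuous_on {0..} (\<lambda>t. X t \<omega>) \<and>
        (\<forall>t\<ge>0. ((\<lambda>u. X u \<omega>) has_real_derivative level_rate c b (X t \<omega>) (\<phi> t \<omega>))
                  (at t within {t..})))"


section \<open>Matrix exponential variables\<close>

definition exit_vec :: "nat \<Rightarrow> (nat \<Rightarrow> nat \<Rightarrow> real) \<Rightarrow> nat \<Rightarrow> real" where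
  "exit_vec q S = (\<lambda>n. - mat_vec {1..q} S ones n)"

text \<open>\<open>orbit_num q \<alpha> S x\<close> is the row vector $\alpha e^{Sx}$.\<close>

definition orbit_num :: "nat \<Rightarrow> (nat \<Rightarrow> real) \<Rightarrow> (nat \<Rightarrow> nat \<Rightarrow> real) \<Rightarrow> real \<Rightarrow> nat \<Rightarrow> real" where
  "orbit_num q \<alpha> S x = vec_mat {1..q} \<alpha> (mat_exp {1..q} S x)"

definition me_survival :: "nat \<Rightarrow> (nat \<Rightarrow> real) \<Rightarrow> (nat \<Rightarrow> nat \<Rightarrow> real) \<Rightarrow> real \<Rightarrow> real" where
  "me_survival q \<alpha> S x = dot {1..q} (orbit_num q \<alpha> S x) ones"

definition me_density :: "nat \<Rightarrow> (nat \<Rightarrow> real) \<Rightarrow> (nat \<Rightarrow> nat \<Rightarrow> real) \<Rightarrow> real \<Rightarrow> real" where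
  "me_density q \<alpha> S x = dot {1..q} (orbit_num q \<alpha> S x) (exit_vec q S)"

definition me_rep ::
  "'z measure \<Rightarrow> ('z \<Rightarrow> real) \<Rightarrow> nat \<Rightarrow> (nat \<Rightarrow> real) \<Rightarrow> (nat \<Rightarrow> nat \<Rightarrow> real) \<Rightarrow> bool" where
  "me_rep Q Z q \<alpha> S \<longleftrightarrow>
     (\<forall>x\<ge>0. measure Q {\<omega>\<in>space Q. Z \<omega> > x} = me_survival q \<alpha> S x) \<and>
     distributed Q lborel Z (\<lambda>x. ennreal (if 0 \<le> x then me_density q \<alpha> S x else 0))"

definition minimal_me_rep ::
  "'z measure \<Rightarrow> ('z \<Rightarrow> real) \<Rightarrow> nat \<Rightarrow> (nat \<Rightarrow> real) \<Rightarrow> (nat \<Rightarrow> nat \<Rightarrow> real) \<Rightarrow> bool" where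
  "minimal_me_rep Q Z q \<alpha> S \<longleftrightarrow>
     me_rep Q Z q \<alpha> S \<and> (\<forall>q' \<alpha>' S'. me_rep Q Z q' \<alpha>' S' \<longrightarrow> q \<le> q')"

definition eps :: "'z measure \<Rightarrow> ('z \<Rightarrow> real) \<Rightarrow> real" where
  "eps Q Z = root 3 (prob_space.variance Q Z)"

definition me_construction ::
  "'z measure \<Rightarrow> ('z \<Rightarrow> real) \<Rightarrow> real \<Rightarrow> nat \<Rightarrow> (nat \<Rightarrow> real) \<Rightarrow> (nat \<Rightarrow> nat \<Rightarrow> real) \<Rightarrow>
   (nat \<Rightarrow> real) \<Rightarrow> bool" where
  "me_construction Q Z \<Delta> q \<alpha> S t \<longleftrightarrow>
     prob_space Q \<and> Z \<in> borel_measurable Q \<and>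
     (AE \<omega> in Q. 0 \<le> Z \<omega>) \<and> measure Q {\<omega>\<in>space Q. Z \<omega> = 0} = 0 \<and>
     integrable Q Z \<and> prob_space.expectation Q Z = \<Delta> \<and>
     minimal_me_rep Q Z q \<alpha> S \<and>
     eps Q Z < 1 \<and>
     t 1 = 0 \<and> 0 < 2 * eps Q Z \<and> 2 * eps Q Z < t 2 \<and>
     (\<forall>n\<in>{1..q}. t n < t (n + 1)) \<and>
     t q < \<Delta> - eps Q Z \<and> \<Delta> - eps Q Z < t (q + 1) \<and> t (q + 1) = \<Delta> \<and>
     (\<forall>n\<in>{1..q}. \<alpha> n = unit_vec 1 n) \<and>
     (\<forall>n\<in>{1..q}. \<forall>x\<ge>0.
        me_survival q (unit_vec n) S x = \<P>(\<omega> in Q. x \<le> Z \<omega> - t n \<bar> t n < Z \<omega>)) \<and>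
     (\<forall>a. (\<forall>x\<ge>0. (\<Sum>n\<in>{1..q}. a n * me_survival q (unit_vec n) S x) = 0) \<longrightarrow>
        (\<forall>n\<in>{1..q}. a n = 0))"

definition has_tolerance ::
  "real \<Rightarrow> real \<Rightarrow> nat \<Rightarrow> (nat \<Rightarrow> real) \<Rightarrow> (nat \<Rightarrow> nat \<Rightarrow> real) \<Rightarrow> (nat \<Rightarrow> real) \<Rightarrow> bool" where
  "has_tolerance \<delta> \<epsilon> q \<alpha> S t \<longleftrightarrow>
     0 < \<delta> \<and>
     (\<forall>n\<in>{1..q}. \<bar>t n - t (n + 1)\<bar> < \<delta> / 2) \<and>
     (\<forall>n\<in>{1..q}. me_density q \<alpha> S (t n) / me_survival q \<alpha> S (t n) \<le> \<epsilon> / (\<delta> / 4 * (1 - \<epsilon>)))"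

definition D_mat ::
  "real \<Rightarrow> real \<Rightarrow> nat \<Rightarrow> (nat \<Rightarrow> real) \<Rightarrow> (nat \<Rightarrow> nat \<Rightarrow> real) \<Rightarrow> nat \<Rightarrow> nat \<Rightarrow> real" where
  "D_mat \<Delta> \<epsilon> q \<alpha> S = (\<lambda>n m.
     (LINT y:{0..\<Delta> - \<epsilon>}|lborel. mat_vec {1..q} (mat_exp {1..q} S y) (exit_vec q S) n *
        (orbit_num q \<alpha> S y m / me_survival q \<alpha> S y)) +
     (LINT y:{\<Delta> - \<epsilon>..}|lborel. mat_vec {1..q} (mat_exp {1..q} S y) (exit_vec q S) n *
        (orbit_num q \<alpha> S (\<Delta> - \<epsilon>) m / me_survival q \<alpha> S (\<Delta> - \<epsilon>))))"


section \<open>The QBD-RAP generator\<close>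

definition gridpt :: "real \<Rightarrow> nat \<Rightarrow> nat \<Rightarrow> real" where
  "gridpt b K k = (real k - 1) * (b / real K)"

definition cell :: "('s \<Rightarrow> real) \<Rightarrow> real \<Rightarrow> nat \<Rightarrow> nat \<Rightarrow> 's \<Rightarrow> real set" where
  "cell c b K k i =
     (if 0 < c i then {gridpt b K k..<gridpt b K (k + 1)} else {gridpt b K k<..gridpt b K (k + 1)})"

text \<open>Indices are triples (level, phase, position); boundary levels carry the single position 1.\<close>

definition qbd_index :: "('s \<Rightarrow> real) \<Rightarrow> nat \<Rightarrow> nat \<Rightarrow> (nat \<times> 's \<times> nat) set" where
  "qbd_index c K q =
     {(0, i, 1) | i. c i < 0} \<union> {(K + 1, i, 1) | i. 0 < c i} \<union> {1..K} \<times> UNIV \<times> {1..q}"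

text \<open>
  The entry of the block matrix in row \<open>(k, i, n)\<close> and column \<open>(l, j, m)\<close>. Since
  $(A \otimes B)_{(i,n),(j,m)} = A_{ij} B_{nm}$, the sub-blocks of \<open>B(k,k)\<close> with \<open>c i\<close>, \<open>c j\<close> of
  equal sign are $C_\pm \otimes S + T_{\pm\pm} \otimes I$ and those of opposite sign are
  $T_{\pm\mp} \otimes D$.
\<close>

definition qbd_gen ::
  "('s \<Rightarrow> 's \<Rightarrow> real) \<Rightarrow> ('s \<Rightarrow> real) \<Rightarrow> nat \<Rightarrow> nat \<Rightarrow> (nat \<Rightarrow> real) \<Rightarrow> (nat \<Rightarrow> nat \<Rightarrow> real) \<Rightarrow>
   (nat \<Rightarrow> nat \<Rightarrow> real) \<Rightarrow> nat \<times> 's \<times> nat \<Rightarrow> nat \<times> 's \<times> nat \<Rightarrow> real" where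
  "qbd_gen T c K q \<alpha> S D = (\<lambda>(k, i, n) (l, j, m).
     if k = 0 then
       (if l = 0 then T i j
        else if l = 1 \<and> 0 < c j then T i j * \<alpha> m
        else 0)
     else if k = K + 1 then
       (if l = K + 1 then T i j
        else if l = K \<and> c j < 0 then T i j * \<alpha> m
        else 0)
     else if l = k then
       (if sgn (c i) = sgn (c j)
        then (if i = j then \<bar>c i\<bar> * S n m else 0) + T i j * mat_one n m
        else T i j * D n m)
     else if l = k + 1 \<and> i = j \<and> 0 < c i then
       \<bar>c i\<bar> * exit_vec q S n * (if l = K + 1 then 1 else \<alpha> m)
     else if l + 1 = k \<and> i = j \<and> c i < 0 then
       \<bar>c i\<bar> * exit_vec q S n * (if l = 0 then 1 else \<alpha> m)
     else 0)"

text \<open>\<open>(k, i, n)\<close> is the index of the initial vector for \<open>(x0, i)\<close>.\<close>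

definition initial_index ::
  "('s \<Rightarrow> real) \<Rightarrow> real \<Rightarrow> nat \<Rightarrow> nat \<Rightarrow> (nat \<Rightarrow> real) \<Rightarrow> real \<Rightarrow> 's \<Rightarrow> nat \<Rightarrow> nat \<Rightarrow> bool" where
  "initial_index c b K q t x0 i k n \<longleftrightarrow>
     (if x0 = 0 \<and> c i < 0 then k = 0 \<and> n = 1
      else if x0 = b \<and> 0 < c i then k = K + 1 \<and> n = 1
      else k \<in> {1..K} \<and> n \<in> {1..q} \<and>
        (if 0 < c i
         then x0 \<in> {gridpt b K k + t n..<gridpt b K k + t (n + 1)}
         else x0 \<in> {gridpt b K (k + 1) - t (n + 1)<..gridpt b K (k + 1) - t n}))"


section \<open>The closing operator\<close>

text \<open>
  \<open>closing_vec \<Delta> q S z\<close> is $(e^{Sz} + e^{S(2\Delta - z)}) [I - e^{2\Delta S}]^{-1} s$.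
\<close>

definition closing_vec :: "real \<Rightarrow> nat \<Rightarrow> (nat \<Rightarrow> nat \<Rightarrow> real) \<Rightarrow> real \<Rightarrow> nat \<Rightarrow> real" where
  "closing_vec \<Delta> q S z =
     mat_vec {1..q} (\<lambda>n m. mat_exp {1..q} S z n m + mat_exp {1..q} S (2 * \<Delta> - z) n m)
       (mat_vec {1..q}
          (mat_inv_on {1..q} (\<lambda>n m. mat_one n m - mat_exp {1..q} S (2 * \<Delta>) n m))
          (exit_vec q S))"

definition closing_op ::
  "('s \<Rightarrow> real) \<Rightarrow> real \<Rightarrow> nat \<Rightarrow> nat \<Rightarrow> (nat \<Rightarrow> nat \<Rightarrow> real) \<Rightarrow> (real \<Rightarrow> 's \<Rightarrow> real) \<Rightarrow>
   nat \<times> 's \<times> nat \<Rightarrow> real" where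
  "closing_op c b K q S f = (\<lambda>(l, j, n).
     if l = 0 then f 0 j
     else if l = K + 1 then f b j
     else (LINT x:cell c b K l j|lborel.
       closing_vec (b / real K) q S
         (if 0 < c j then gridpt b K (l + 1) - x else x - gridpt b K l) n * f x j))"


section \<open>The QBD-RAP process\<close>

text \<open>
  A state is (level, phase, orbit). Orbits are functions on positions vanishing outside the range
  of valid positions, so that the orbit of a boundary level, the scalar 1, is \<open>unit_vec 1\<close>.
\<close>

type_synonym 's qstate = "nat \<times> 's \<times> (nat \<Rightarrow> real)"

definition restrict_row :: "nat \<Rightarrow> (nat \<Rightarrow> real) \<Rightarrow> nat \<Rightarrow> real" where
  "restrict_row q a = (\<lambda>n. if n \<in> {1..q} then a n else 0)"

definition valid_state :: "('s \<Rightarrow> real) \<Rightarrow> nat \<Rightarrow> nat \<Rightarrow> 's qstate \<Rightarrow> bool" where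
  "valid_state c K q = (\<lambda>(k, i, a).
     k \<le> K + 1 \<and> (k = 0 \<longrightarrow> c i < 0) \<and> (k = K + 1 \<longrightarrow> 0 < c i) \<and>
     (if k \<in> {1..K} then a = restrict_row q a else a = unit_vec 1))"

definition orbit_drift ::
  "('s \<Rightarrow> real) \<Rightarrow> nat \<Rightarrow> nat \<Rightarrow> (nat \<Rightarrow> nat \<Rightarrow> real) \<Rightarrow> 's qstate \<Rightarrow> nat \<Rightarrow> real" where
  "orbit_drift c K q S = (\<lambda>(k, i, a) n.
     if k \<in> {1..K} \<and> n \<in> {1..q}
     then \<bar>c i\<bar> * (vec_mat {1..q} a S n - dot {1..q} (vec_mat {1..q} a S) ones * a n)
     else 0)"

text \<open>
  Events: \<open>None\<close> is a change of level with reset of the orbit, \<open>Some j\<close> is a change of phase to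
  \<open>j\<close>. Every enabled event changes the level or the phase, so no event is invisible.
\<close>

definition enabled :: "nat \<Rightarrow> 's qstate \<Rightarrow> 's option \<Rightarrow> bool" where
  "enabled K = (\<lambda>(k, i, a) e. case e of None \<Rightarrow> k \<in> {1..K} | Some j \<Rightarrow> j \<noteq> i)"

definition intensity ::
  "('s \<Rightarrow> 's \<Rightarrow> real) \<Rightarrow> ('s \<Rightarrow> real) \<Rightarrow> nat \<Rightarrow> nat \<Rightarrow> (nat \<Rightarrow> nat \<Rightarrow> real) \<Rightarrow>
   's qstate \<Rightarrow> 's option \<Rightarrow> real" where
  "intensity T c K q S = (\<lambda>(k, i, a) e.
     if enabled K (k, i, a) e
     then (case e of None \<Rightarrow> \<bar>c i\<bar> * dot {1..q} a (exit_vec q S) | Some j \<Rightarrow> T i j)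
     else 0)"

definition reset_orbit :: "nat \<Rightarrow> nat \<Rightarrow> (nat \<Rightarrow> real) \<Rightarrow> nat \<Rightarrow> nat \<Rightarrow> real" where
  "reset_orbit K q \<alpha> k = (if k \<in> {1..K} then restrict_row q \<alpha> else unit_vec 1)"

definition target ::
  "('s \<Rightarrow> real) \<Rightarrow> nat \<Rightarrow> nat \<Rightarrow> (nat \<Rightarrow> real) \<Rightarrow> (nat \<Rightarrow> nat \<Rightarrow> real) \<Rightarrow>
   's qstate \<Rightarrow> 's option \<Rightarrow> 's qstate" where
  "target c K q \<alpha> D = (\<lambda>(k, i, a) e. case e of
     None \<Rightarrow> (let k' = (if 0 < c i then k + 1 else k - 1) in (k', i, reset_orbit K q \<alpha> k'))
   | Some j \<Rightarrow>
       if k = 0 then (let k' = (if 0 < c j then 1 else 0) in (k', j, reset_orbit K q \<alpha> k'))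
       else if k = K + 1 then
         (let k' = (if c j < 0 then K else K + 1) in (k', j, reset_orbit K q \<alpha> k'))
       else (k, j, if sgn (c i) \<noteq> sgn (c j) then restrict_row q (vec_mat {1..q} a D) else a))"

text \<open>\<open>left_state Y t y\<close>: the left limit of the path \<open>Y\<close> at \<open>t\<close> is \<open>y\<close>.\<close>

definition left_state :: "(real \<Rightarrow> 's qstate) \<Rightarrow> real \<Rightarrow> 's qstate \<Rightarrow> bool" where
  "left_state Y t = (\<lambda>(k, i, a).
     (\<exists>h>0. \<forall>u\<in>{t - h<..<t}. fst (Y u) = k \<and> fst (snd (Y u)) = i) \<and>
     (\<forall>n. ((\<lambda>u. snd (snd (Y u)) n) \<longlongrightarrow> a n) (at_left t)))"

definition occurs ::
  "('s \<Rightarrow> real) \<Rightarrow> nat \<Rightarrow> nat \<Rightarrow> (nat \<Rightarrow> real) \<Rightarrow> (nat \<Rightarrow> nat \<Rightarrow> real) \<Rightarrow>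
   (real \<Rightarrow> 's qstate) \<Rightarrow> 's option \<Rightarrow> real \<Rightarrow> bool" where
  "occurs c K q \<alpha> D Y e t \<longleftrightarrow>
     (\<exists>y. left_state Y t y \<and> enabled K y e \<and> Y t = target c K q \<alpha> D y e)"

definition event_count ::
  "('s \<Rightarrow> real) \<Rightarrow> nat \<Rightarrow> nat \<Rightarrow> (nat \<Rightarrow> real) \<Rightarrow> (nat \<Rightarrow> nat \<Rightarrow> real) \<Rightarrow>
   (real \<Rightarrow> 's qstate) \<Rightarrow> 's option \<Rightarrow> real \<Rightarrow> real \<Rightarrow> nat" where
  "event_count c K q \<alpha> D Y e u t = card {r\<in>{u<..t}. occurs c K q \<alpha> D Y e r}"

definition qbd_path ::
  "('s \<Rightarrow> real) \<Rightarrow> nat \<Rightarrow> nat \<Rightarrow> (nat \<Rightarrow> real) \<Rightarrow> (nat \<Rightarrow> nat \<Rightarrow> real) \<Rightarrow> (nat \<Rightarrow> nat \<Rightarrow> real) \<Rightarrow>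
   (real \<Rightarrow> 's qstate) \<Rightarrow> bool" where
  "qbd_path c K q \<alpha> S D Y \<longleftrightarrow>
     (\<forall>t\<ge>0. valid_state c K q (Y t)) \<and>
     cadlag_step (\<lambda>t. fst (Y t)) \<and> cadlag_step (\<lambda>t. fst (snd (Y t))) \<and>
     (\<forall>t\<ge>0. \<forall>n. ((\<lambda>u. snd (snd (Y u)) n) has_real_derivative orbit_drift c K q S (Y t) n)
                 (at t within {t..})) \<and>
     (\<forall>t>0. left_state Y t (Y t) \<or> (\<exists>e. occurs c K q \<alpha> D Y e t))"

definition history ::
  "'w measure \<Rightarrow> (real \<Rightarrow> 'w \<Rightarrow> nat) \<Rightarrow> (real \<Rightarrow> 'w \<Rightarrow> 's) \<Rightarrow> (real \<Rightarrow> 'w \<Rightarrow> nat \<Rightarrow> real) \<Rightarrow>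
   real \<Rightarrow> 'w set set" where
  "history M L \<phi> A r = sigma_sets (space M)
     {{\<omega>\<in>space M. L u \<omega> = k \<and> \<phi> u \<omega> = i \<and> A u \<omega> n \<le> x} | u k i n x. u \<in> {0..r}}"

text \<open>
  The QBD-RAP process started from level \<open>k\<close>, phase \<open>i\<close>, orbit \<open>e_n\<close>: a process with paths as in
  \<open>qbd_path\<close> such that, for each event type, the counting process of the events has the prescribed
  stochastic intensity with respect to the history of the process, that is, the expected number
  of events in \<open>(u, t]\<close> on \<open>G\<close> is the expected integrated intensity on \<open>G\<close>, for all \<open>G\<close> in
  the history up to \<open>u\<close>.
\<close>

definition qbd_rap ::
  "'w measure \<Rightarrow> ('s::finite \<Rightarrow> 's \<Rightarrow> real) \<Rightarrow> ('s \<Rightarrow> real) \<Rightarrow> nat \<Rightarrow> nat \<Rightarrow> (nat \<Rightarrow> real) \<Rightarrow>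
   (nat \<Rightarrow> nat \<Rightarrow> real) \<Rightarrow> (nat \<Rightarrow> nat \<Rightarrow> real) \<Rightarrow> nat \<times> 's \<times> nat \<Rightarrow>
   (real \<Rightarrow> 'w \<Rightarrow> nat) \<Rightarrow> (real \<Rightarrow> 'w \<Rightarrow> nat \<Rightarrow> real) \<Rightarrow> (real \<Rightarrow> 'w \<Rightarrow> 's) \<Rightarrow> bool" where
  "qbd_rap M T c K q \<alpha> S D = (\<lambda>(k, i, n) L A \<phi>.
     let Y = (\<lambda>\<omega> t. (L t \<omega>, \<phi> t \<omega>, A t \<omega>)) in
     prob_space M \<and>
     (\<forall>t\<ge>0. L t \<in> measurable M (count_space UNIV) \<and> \<phi> t \<in> measurable M (count_space UNIV) \<and>
        (\<forall>m. (\<lambda>\<omega>. A t \<omega> m) \<in> borel_measurable M)) \<and>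
     (\<forall>\<omega>\<in>space M. Y \<omega> 0 = (k, i, unit_vec n) \<and> qbd_path c K q \<alpha> S D (Y \<omega>)) \<and>
     (\<forall>e u t. 0 \<le> u \<and> u \<le> t \<longrightarrow>
        (\<lambda>\<omega>. real (event_count c K q \<alpha> D (Y \<omega>) e u t)) \<in> borel_measurable M \<and>
        (\<forall>G\<in>history M L \<phi> A u.
           (\<integral>\<^sup>+\<omega>\<in>G. ennreal (real (event_count c K q \<alpha> D (Y \<omega>) e u t)) \<partial>M) =
           (\<integral>\<^sup>+\<omega>\<in>G. (\<integral>\<^sup>+r\<in>{u<..t}. ennreal (intensity T c K q S (Y \<omega> r) e) \<partial>lborel) \<partial>M))))"


section \<open>The approximation of the law of the fluid queue\<close>

definition qbd_expectation ::
  "'w measure \<Rightarrow> ('s::finite \<Rightarrow> real) \<Rightarrow> real \<Rightarrow> nat \<Rightarrow> nat \<Rightarrow> (nat \<Rightarrow> nat \<Rightarrow> real) \<Rightarrow>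
   (real \<Rightarrow> 'w \<Rightarrow> nat) \<Rightarrow> (real \<Rightarrow> 'w \<Rightarrow> nat \<Rightarrow> real) \<Rightarrow> (real \<Rightarrow> 'w \<Rightarrow> 's) \<Rightarrow> real \<Rightarrow>
   (real \<Rightarrow> 's \<Rightarrow> real) \<Rightarrow> real" where
  "qbd_expectation M c b K q S L A \<phi> t f =
     (\<integral>\<omega>. (\<Sum>(l, j, n)\<in>qbd_index c K q.
        A t \<omega> n * of_bool (L t \<omega> = l \<and> \<phi> t \<omega> = j) * closing_op c b K q S f (l, j, n)) \<partial>M)"

definition qbd_matrix_value ::
  "('s::finite \<Rightarrow> 's \<Rightarrow> real) \<Rightarrow> ('s \<Rightarrow> real) \<Rightarrow> real \<Rightarrow> nat \<Rightarrow> nat \<Rightarrow> (nat \<Rightarrow> real) \<Rightarrow>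
   (nat \<Rightarrow> nat \<Rightarrow> real) \<Rightarrow> (nat \<Rightarrow> nat \<Rightarrow> real) \<Rightarrow> nat \<times> 's \<times> nat \<Rightarrow> real \<Rightarrow>
   (real \<Rightarrow> 's \<Rightarrow> real) \<Rightarrow> real" where
  "qbd_matrix_value T c b K q \<alpha> S D y t f =
     dot (qbd_index c K q)
       (vec_mat (qbd_index c K q) (unit_vec y)
          (mat_exp (qbd_index c K q) (qbd_gen T c K q \<alpha> S D) t))
       (closing_op c b K q S f)"

end

theory Submission imports Defs begin

text \<open>
  Along the orbit of an initial vector the residual time of \<open>Z\<close> is, up to errors of order \<open>\<epsilon>\<close>,
  the deterministic time left in the cell, so a column of the QBD-RAP is compared with a function
  of the level of the fluid queue by integrating the latter against the law of the residual time.
  One step of length \<open>h\<close> of the semigroup $e^{Bt}$ is replaced by $e^{hF}(1 + hJ)$, drift followed by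
  jumps. It preserves the columns that are nonnegative on all orbits whose residual density is
  nonnegative, so errors can be propagated by comparison. The one-step error against an Euler step
  of the fluid queue is not uniformly \<open>\<epsilon> h\<close>: it contains the intensity of level changes, which is
  unbounded, and this term is absorbed by a Lyapunov column that decreases at each change of level.
  The Euler schemes converge to the fluid queue because a path of the phase process has finitely
  many jumps. Finally, along the paths of the QBD-RAP process the nonlinear part of the orbit drift
  is compensated by the jumps, so its expectation solves the linear equation with generator \<open>B\<close>.
\<close>

section \<open>Exponentials of finite matrices\<close>

text \<open>Two limits are taken in a fixed order. For one scheme the step \<open>h\<close> tends to
  0, so an error of second order in \<open>h\<close> may carry any constant of the scheme; such
  constants come from Taylor expansion and from linear independence. Only the first order terms must
  be small uniformly in the scheme, and they are kept apart throughout. Estimates on entries cannot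
  do this: orbits are signed, and their entries are controlled only by constants of the scheme.
  Comparisons are therefore made after pairing with orbits whose residual density is nonnegative.
  The intensity of level changes cannot be bounded, but its integral counts crossings of cells, and
  a crossing takes time; this is what the Lyapunov column expresses. The inverse in the closing
  vector is a geometric series in $e^{2 \<Delta> S}$, so the closing operator integrates against the
  residual density folded into one cell by reflection. It differs from the comparison column only
  where the residual time exceeds the cell length. The bounds are proportional to a Lipschitz
  constant. A continuous \<open>f\<close> enters through a polynomial approximation and a supremum
  bound that the scheme preserves.\<close>

definition mat_norm :: "'i set => ('i => 'i => real) => real" where
 "mat_norm I A = (\<Sum>i\<in>I. \<Sum>j\<in>I. \<bar>A i j\<bar>)"

lemma mat_norm_nonneg: "0 <= mat_norm I A"
 by (simp add: mat_norm_def sum_nonneg)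

lemma column_le_mat_norm:
 assumes "finite I" "j \<in> I"
 shows "(\<Sum>k\<in>I. \<bar>A k j\<bar>) <= mat_norm I A"
 unfolding mat_norm_def by (rule sum_mono) (use assms in \<open>auto intro: member_le_sum\<close>)

lemma mat_pow_bound:
 assumes "finite I" "i \<in> I" "j \<in> I"
 shows "\<bar>mat_pow I A n i j\<bar> <= mat_norm I A ^ n"
 using assms(3)
proof (induction n arbitrary: j)
 case 0
 then show ?case by (simp add: mat_one_def)
next
 case (Suc n)
 have "\<bar>mat_pow I A (Suc n) i j\<bar> <= (\<Sum>k\<in>I. \<bar>mat_pow I A n i k\<bar> * \<bar>A k j\<bar>)"
  by (auto simp: mat_mul_def abs_mult[symmetric] intro: sum_abs)
 also have "\<dots> <= (\<Sum>k\<in>I. mat_norm I A ^ n * \<bar>A k j\<bar>)"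
  by (intro sum_mono mult_right_mono Suc.IH) auto
 also have "\<dots> = mat_norm I A ^ n * (\<Sum>k\<in>I. \<bar>A k j\<bar>)"
  by (simp add: sum_distrib_left)
 also have "\<dots> <= mat_norm I A ^ n * mat_norm I A"
  by (intro mult_left_mono column_le_mat_norm) (use assms Suc.prems in \<open>auto simp: mat_norm_nonneg\<close>)
 finally show ?case by (simp add: mult.commute)
qed

lemma mat_exp_term_bound:
 assumes "finite I" "i \<in> I" "j \<in> I"
 shows "\<bar>x ^ n / fact n * mat_pow I A n i j\<bar> <= (\<bar>x\<bar> * mat_norm I A) ^ n / fact n"
proof -
 have "\<bar>x ^ n / fact n * mat_pow I A n i j\<bar> = (\<bar>x\<bar> ^ n / fact n) * \<bar>mat_pow I A n i j\<bar>"
  by (simp add: abs_mult power_abs)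
 also have "\<dots> <= (\<bar>x\<bar> ^ n / fact n) * mat_norm I A ^ n"
  by (intro mult_left_mono mat_pow_bound assms) auto
 finally show ?thesis by (simp add: power_mult_distrib)
qed

lemma exp_series_summable: "summable (\<lambda>n. (x::real) ^ n / fact n)"
 using summable_exp[of x] by (simp add: divide_inverse mult.commute)

lemma mat_exp_summable:
 assumes "finite I" "i \<in> I" "j \<in> I"
 shows "summable (\<lambda>n. x ^ n / fact n * mat_pow I A n i j)"
 by (rule summable_comparison_test'[OF exp_series_summable[of "\<bar>x\<bar> * mat_norm I A"], of 0])
   (use mat_exp_term_bound[OF assms] in auto)

lemma mat_exp_bound:
 assumes "finite I" "i \<in> I" "j \<in> I"
 shows "\<bar>mat_exp I A x i j\<bar> <= exp (\<bar>x\<bar> * mat_norm I A)"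
proof -
 have "norm (\<Sum>n. x ^ n / fact n * mat_pow I A n i j) <= (\<Sum>n. (\<bar>x\<bar> * mat_norm I A) ^ n / fact n)"
  by (rule norm_suminf_le[OF _ exp_series_summable]) (use mat_exp_term_bound[OF assms] in auto)
 then show ?thesis by (simp add: mat_exp_def exp_def divide_inverse mult.commute)
qed

lemma mat_exp_0: "mat_exp I A 0 = mat_one"
proof -
 have "(\<Sum>n. 0 ^ n / fact n * mat_pow I A n i j) = mat_one i j" for i j
  using powser_zero[of "\<lambda>n. mat_pow I A n i j / fact n"] by (simp add: mult.commute)
 then show ?thesis by (simp add: mat_exp_def fun_eq_iff)
qed

lemma sum_mat_one_left:
 assumes "finite I" "i \<in> I" shows "(\<Sum>k\<in>I. mat_one i k * g k) = g i"
 using assms by (simp add: mat_one_def if_distrib[where f="\<lambda>x. x * _"] sum.delta cong: if_cong)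

lemma sum_mat_one_right:
 assumes "finite I" "i \<in> I" shows "(\<Sum>k\<in>I. g k * mat_one k i) = g i"
proof -
 have "(\<Sum>k\<in>I. g k * mat_one k i) = (\<Sum>k\<in>I. mat_one i k * g k)"
  by (intro sum.cong) (auto simp: mat_one_def)
 then show ?thesis using sum_mat_one_left[OF assms] by simp
qed

lemma mat_pow_Suc_left:
 assumes "finite I" "i \<in> I" "j \<in> I"
 shows "mat_pow I A (Suc n) i j = (\<Sum>k\<in>I. A i k * mat_pow I A n k j)"
 using assms(3)
proof (induction n arbitrary: j)
 case 0
 then show ?case using assms
  by (simp add: mat_mul_def sum_mat_one_left sum_mat_one_right)
next
 case (Suc n)
 have "mat_pow I A (Suc (Suc n)) i j = (\<Sum>l\<in>I. mat_pow I A (Suc n) i l * A l j)"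
  by (simp add: mat_mul_def)
 also have "\<dots> = (\<Sum>l\<in>I. (\<Sum>k\<in>I. A i k * mat_pow I A n k l) * A l j)"
  by (intro sum.cong refl) (use Suc.IH in auto)
 also have "\<dots> = (\<Sum>l\<in>I. \<Sum>k\<in>I. A i k * (mat_pow I A n k l * A l j))"
  by (simp add: sum_distrib_right mult.assoc)
 also have "\<dots> = (\<Sum>k\<in>I. A i k * (\<Sum>l\<in>I. mat_pow I A n k l * A l j))"
  by (subst sum.swap) (simp add: sum_distrib_left)
 finally show ?case by (simp add: mat_mul_def)
qed

lemma mat_exp_deriv_aux:
 assumes "finite I" "i \<in> I" "j \<in> I"
 shows "((\<lambda>x. mat_exp I A x i j) has_real_derivative
      (\<Sum>n. x ^ n / fact n * mat_pow I A (Suc n) i j)) (at x)"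
proof -
 define c where "c = (\<lambda>n. mat_pow I A n i j / fact n)"
 have "summable (\<lambda>n. c n * y ^ n)" for y
  using mat_exp_summable[OF assms, of y A] by (simp add: c_def mult.commute)
 from termdiffs_strong_converges_everywhere[of c, OF this]
 have "((\<lambda>x. \<Sum>n. c n * x ^ n) has_real_derivative (\<Sum>n. diffs c n * x ^ n)) (at x)" .
 moreover have "(\<lambda>x. \<Sum>n. c n * x ^ n) = (\<lambda>x. mat_exp I A x i j)"
  by (simp add: mat_exp_def c_def mult.commute)
 moreover have "diffs c n * x ^ n = x ^ n / fact n * mat_pow I A (Suc n) i j" for n
 proof -
  have "diffs c n = mat_pow I A (Suc n) i j / fact n"
   by (simp add: diffs_def c_def del: mat_pow.simps of_nat_Suc)
  then show ?thesis by simp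
 qed
 ultimately show ?thesis by (simp del: mat_pow.simps)
qed

lemma mat_exp_deriv_right:
 assumes "finite I" "i \<in> I" "j \<in> I"
 shows "((\<lambda>x. mat_exp I A x i j) has_real_derivative (\<Sum>k\<in>I. mat_exp I A x i k * A k j)) (at x)"
proof -
 have "(\<Sum>n. x ^ n / fact n * mat_pow I A (Suc n) i j)
   = (\<Sum>n. \<Sum>k\<in>I. x ^ n / fact n * mat_pow I A n i k * A k j)"
  by (simp add: mat_mul_def sum_distrib_left mult.assoc)
 also have "\<dots> = (\<Sum>k\<in>I. \<Sum>n. x ^ n / fact n * mat_pow I A n i k * A k j)"
  by (rule suminf_sum) (intro summable_mult2 mat_exp_summable, use assms in auto)
 also have "\<dots> = (\<Sum>k\<in>I. mat_exp I A x i k * A k j)"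
  unfolding mat_exp_def by (intro sum.cong refl suminf_mult2[symmetric] mat_exp_summable) (use assms in auto)
 finally show ?thesis using mat_exp_deriv_aux[OF assms, of A x] by (simp del: mat_pow.simps)
qed

lemma mat_exp_deriv_left:
 assumes "finite I" "i \<in> I" "j \<in> I"
 shows "((\<lambda>x. mat_exp I A x i j) has_real_derivative (\<Sum>k\<in>I. A i k * mat_exp I A x k j)) (at x)"
proof -
 have "(\<Sum>n. x ^ n / fact n * mat_pow I A (Suc n) i j)
   = (\<Sum>n. \<Sum>k\<in>I. A i k * (x ^ n / fact n * mat_pow I A n k j))"
  by (simp add: mat_pow_Suc_left[OF assms] sum_distrib_left mult_ac del: mat_pow.simps)
 also have "\<dots> = (\<Sum>k\<in>I. \<Sum>n. A i k * (x ^ n / fact n * mat_pow I A n k j))"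
  by (rule suminf_sum) (intro summable_mult mat_exp_summable, use assms in auto)
 also have "\<dots> = (\<Sum>k\<in>I. A i k * mat_exp I A x k j)"
  unfolding mat_exp_def by (intro sum.cong refl suminf_mult mat_exp_summable) (use assms in auto)
 finally show ?thesis using mat_exp_deriv_aux[OF assms, of A x] by (simp del: mat_pow.simps)
qed

lemma mat_exp_deriv_right' [derivative_intros]:
 assumes "(g has_real_derivative g') (at x within X)" "finite I" "i \<in> I" "j \<in> I"
  and "d = (\<Sum>k\<in>I. mat_exp I A (g x) i k * A k j) * g'"
 shows "((\<lambda>x. mat_exp I A (g x) i j) has_real_derivative d) (at x within X)"
 unfolding assms(5) by (rule DERIV_chain2[OF mat_exp_deriv_right[OF assms(2-4)] assms(1)])

lemma mat_exp_continuous: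
 assumes "finite I" "i \<in> I" "j \<in> I"
 shows "continuous_on X (\<lambda>x. mat_exp I A x i j)"
 by (intro DERIV_continuous_on) (rule has_field_derivative_at_within[OF mat_exp_deriv_right[OF assms]])

text \<open>With \<open>u = x + y\<close> held fixed, the product of the exponentials at
  \<open>u - y\<close> and at \<open>y\<close> has derivative zero in \<open>y\<close>: the right
  derivative formula serves the first factor, the left one the second.\<close>

lemma mat_exp_add:
 assumes fin: "finite I" and "i \<in> I" "j \<in> I"
 shows "mat_exp I A (x + y) i j = (\<Sum>k\<in>I. mat_exp I A x i k * mat_exp I A y k j)"
proof -
 let ?E = "mat_exp I A"
 define u where "u = x + y"
 define g where "g = (\<lambda>y. \<Sum>k\<in>I. ?E (u - y) i k * ?E y k j)"
 have "(g has_real_derivative 0) (at z)" for z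
 proof -
  have 1: "(\<Sum>k\<in>I. (\<Sum>l\<in>I. ?E (u - z) i l * A l k) * ?E z k j)
    = (\<Sum>k\<in>I. ?E (u - z) i k * (\<Sum>l\<in>I. A k l * ?E z l j))"
   by (simp add: sum_distrib_left sum_distrib_right mult.assoc) (rule sum.swap)
  have "(g has_real_derivative (\<Sum>k\<in>I. ((\<Sum>l\<in>I. ?E (u - z) i l * A l k) * (-1)) * ?E z k j
    + (\<Sum>l\<in>I. A k l * ?E z l j) * ?E (u - z) i k)) (at z)"
   unfolding g_def
   by (intro DERIV_sum DERIV_mult mat_exp_deriv_right' mat_exp_deriv_left)
     (use assms in \<open>auto intro!: derivative_eq_intros\<close>)
  also have "(\<Sum>k\<in>I. ((\<Sum>l\<in>I. ?E (u - z) i l * A l k) * (-1)) * ?E z k j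
    + (\<Sum>l\<in>I. A k l * ?E z l j) * ?E (u - z) i k) = 0"
   using 1 by (simp add: sum.distrib sum_negf sum_subtractf mult.commute)
  finally show ?thesis .
 qed
 then have "g y = g 0" using DERIV_isconst_all by blast
 moreover have "g 0 = ?E u i j"
  unfolding g_def by (simp add: mat_exp_0 sum_mat_one_right assms)
 moreover have "g y = (\<Sum>k\<in>I. ?E x i k * ?E y k j)"
  by (simp add: g_def u_def)
 ultimately show ?thesis by (simp add: u_def)
qed

text \<open>From the second term on, the series is at most \<open>h\<^sup>2\<close> times the tail
  of an exponential series in the norm. The constant depends on \<open>A\<close>, hence on the
  scheme, so this remainder is of use only where \<open>h\<close> tends to 0 first.\<close>

lemma mat_exp_taylor:
 assumes fin: "finite I"
 obtains C where "0 <= C"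
  "!!h i j. [|\<bar>h\<bar> <= 1; i \<in> I; j \<in> I|] ==> \<bar>mat_exp I A h i j - mat_one i j - h * A i j\<bar> <= C * h\<^sup>2"
proof
 let ?N = "mat_norm I A"
 define C where "C = (\<Sum>n. ?N ^ (n + 2) / fact (n + 2))"
 have summ: "summable (\<lambda>n. ?N ^ (n + 2) / fact (n + 2))"
  using exp_series_summable[of ?N] by (subst summable_iff_shift)
 show "0 <= C" unfolding C_def by (intro suminf_nonneg summ) (simp add: mat_norm_nonneg)
 fix h :: real and i j assume h: "\<bar>h\<bar> <= 1" and ij: "i \<in> I" "j \<in> I"
 let ?f = "\<lambda>n. h ^ n / fact n * mat_pow I A n i j"
 have "mat_pow I A 1 i j = A i j"
  using ij fin by (simp add: mat_mul_def sum_mat_one_left)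
 then have "mat_exp I A h i j - mat_one i j - h * A i j = (\<Sum>n. ?f (n + 2))"
  using suminf_split_initial_segment[OF mat_exp_summable[OF fin ij, of h A], of 2]
  by (simp add: mat_exp_def numeral_2_eq_2)
 moreover have "\<bar>?f (n + 2)\<bar> <= h\<^sup>2 * (?N ^ (n + 2) / fact (n + 2))" for n
 proof -
  have "\<bar>?f (n + 2)\<bar> <= (\<bar>h\<bar> * ?N) ^ (n + 2) / fact (n + 2)"
   by (rule mat_exp_term_bound[OF fin ij])
  also have "\<dots> = \<bar>h\<bar> ^ (n + 2) * (?N ^ (n + 2) / fact (n + 2))"
   by (simp add: power_mult_distrib)
  also have "\<dots> <= \<bar>h\<bar> ^ 2 * (?N ^ (n + 2) / fact (n + 2))"
   by (intro mult_right_mono power_decreasing) (use h in \<open>auto simp: mat_norm_nonneg\<close>)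
  finally show ?thesis by simp
 qed
 then have "norm (\<Sum>n. ?f (n + 2)) <= (\<Sum>n. h\<^sup>2 * (?N ^ (n + 2) / fact (n + 2)))"
  by (intro norm_suminf_le summable_mult summ) auto
 moreover have "(\<Sum>n. h\<^sup>2 * (?N ^ (n + 2) / fact (n + 2))) = C * h\<^sup>2"
  unfolding C_def by (subst suminf_mult[OF summ]) (simp add: mult.commute)
 ultimately show "\<bar>mat_exp I A h i j - mat_one i j - h * A i j\<bar> <= C * h\<^sup>2" by simp
qed

lemma mat_vec_exp_add:
 assumes "finite I" "i \<in> I"
 shows "mat_vec I (mat_exp I A (x + y)) w i = mat_vec I (mat_exp I A x) (mat_vec I (mat_exp I A y) w) i"
proof -
 have "mat_vec I (mat_exp I A (x + y)) w i
   = (\<Sum>j\<in>I. \<Sum>k\<in>I. mat_exp I A x i k * (mat_exp I A y k j * w j))"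
  unfolding mat_vec_def using assms by (simp add: mat_exp_add sum_distrib_right mult.assoc)
 also have "\<dots> = mat_vec I (mat_exp I A x) (mat_vec I (mat_exp I A y) w) i"
  by (subst sum.swap) (simp add: mat_vec_def sum_distrib_left)
 finally show ?thesis .
qed

lemma mat_vec_cong:
 assumes "!!j. j \<in> I ==> v j = w j" shows "mat_vec I A v = mat_vec I A w"
 unfolding mat_vec_def using assms by (intro ext sum.cong) auto

lemma mat_vec_diff: "mat_vec I A (\<lambda>j. v j - w j) i = mat_vec I A v i - mat_vec I A w i"
 by (simp add: mat_vec_def right_diff_distrib sum_subtractf)

text \<open>Column sums govern the sum norm of a column; this norm is chosen because the column sums
  of \<open>mat_one\<close> are 1.\<close>

lemma sum_abs_mat_vec_le:
 assumes "!!i j. i \<in> I ==> j \<in> I ==> \<bar>A i j\<bar> <= C i j"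
 shows "(\<Sum>i\<in>I. \<bar>mat_vec I A w i\<bar>) <= (\<Sum>j\<in>I. (\<Sum>i\<in>I. C i j) * \<bar>w j\<bar>)"
proof -
 have "(\<Sum>i\<in>I. \<bar>mat_vec I A w i\<bar>) <= (\<Sum>i\<in>I. \<Sum>j\<in>I. \<bar>A i j\<bar> * \<bar>w j\<bar>)"
  unfolding mat_vec_def by (intro sum_mono) (auto simp: abs_mult[symmetric] intro: sum_abs)
 also have "\<dots> <= (\<Sum>i\<in>I. \<Sum>j\<in>I. C i j * \<bar>w j\<bar>)"
  by (intro sum_mono mult_right_mono assms) auto
 also have "\<dots> = (\<Sum>j\<in>I. (\<Sum>i\<in>I. C i j) * \<bar>w j\<bar>)"
  by (subst sum.swap) (simp add: sum_distrib_right)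
 finally show ?thesis .
qed

text \<open>The matrices \<open>R h\<close> agree with $e^{hA}$ to first order; their powers are stable because
 \<open>R h\<close> has norm at most \<open>1 + c h\<close>.\<close>

lemma product_formula:
 assumes fin: "finite I" and h0: "0 < h0" and C: "0 <= C"
  and R: "!!h i j. [|0 <= h; h <= h0; i \<in> I; j \<in> I|] ==> \<bar>R h i j - mat_one i j - h * A i j\<bar> <= C * h\<^sup>2"
  and t: "0 <= t" and i: "i \<in> I"
 shows "(\<lambda>m. (mat_vec I (R (t / real m)) ^^ m) w i) \<longlonglongrightarrow> mat_vec I (mat_exp I A t) w i"
proof -
 let ?N = "\<lambda>w. \<Sum>i\<in>I. \<bar>w i :: real\<bar>"
 let ?E = "\<lambda>r. mat_vec I (mat_exp I A r)"
 obtain C' where C': "0 <= C'"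
  "!!h i j. [|\<bar>h\<bar> <= 1; i \<in> I; j \<in> I|] ==> \<bar>mat_exp I A h i j - mat_one i j - h * A i j\<bar> <= C' * h\<^sup>2"
  using mat_exp_taylor[OF fin] by blast
 define h1 where "h1 = min h0 1"
 define C1 where "C1 = (\<Sum>i\<in>I. \<Sum>j\<in>I. \<bar>A i j\<bar> + C)"
 define C2 where "C2 = real (card I) * (C + C')"
 define G where "G = (\<Sum>j\<in>I. (\<Sum>i\<in>I. exp (t * mat_norm I A)) * \<bar>w j\<bar>)"
 have C1: "0 <= C1" unfolding C1_def using C by (intro sum_nonneg) auto
 have C2: "0 <= C2" unfolding C2_def using C C' by auto
 have G0: "0 <= G" unfolding G_def by (intro sum_nonneg mult_nonneg_nonneg) auto
 \<comment> \<open>Stability: the column sums of \<open>mat_one\<close> are 1 and the rest of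
   \<open>R h\<close> is of order \<open>h\<close>, where \<open>h <= 1\<close> lets the second
   order remainder be absorbed.\<close>
 have N1: "?N (mat_vec I (R h) v) <= (1 + C1 * h) * ?N v" if h: "0 <= h" "h <= h1" for h v
 proof -
  have "\<bar>R h i j\<bar> <= mat_one i j + h * (\<bar>A i j\<bar> + C)" if "i \<in> I" "j \<in> I" for i j
  proof -
   have "\<bar>R h i j\<bar> <= \<bar>mat_one i j\<bar> + \<bar>h * A i j\<bar> + C * h\<^sup>2"
    using R[of h i j] h that by (auto simp: h1_def)
   moreover have "C * h\<^sup>2 <= h * C"
   proof -
    have "h * h <= h * 1" using h by (intro mult_left_mono) (auto simp: h1_def)
    from mult_left_mono[OF this C] show ?thesis by (simp add: power2_eq_square mult.commute)
   qed
   moreover have "\<bar>mat_one i j\<bar> = mat_one i j" by (simp add: mat_one_def)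
   ultimately show ?thesis using h by (simp add: abs_mult algebra_simps)
  qed
  from sum_abs_mat_vec_le[of I, OF this]
  have "?N (mat_vec I (R h) v) <= (\<Sum>j\<in>I. (\<Sum>i\<in>I. mat_one i j + h * (\<bar>A i j\<bar> + C)) * \<bar>v j\<bar>)" .
  also have "\<dots> <= (\<Sum>j\<in>I. (1 + C1 * h) * \<bar>v j\<bar>)"
  proof (intro sum_mono mult_right_mono)
   fix j assume j: "j \<in> I"
   have "(\<Sum>i\<in>I. mat_one i j) = (1::real)"
    using sum_mat_one_right[OF fin j, of "\<lambda>_. 1"] by simp
   moreover have "(\<Sum>i\<in>I. \<bar>A i j\<bar> + C) <= C1"
    unfolding C1_def by (intro sum_mono member_le_sum[where f="\<lambda>j. \<bar>A _ j\<bar> + C"]) (use fin j C in auto)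
   ultimately show "(\<Sum>i\<in>I. mat_one i j + h * (\<bar>A i j\<bar> + C)) <= 1 + C1 * h"
    using mult_left_mono[of "\<Sum>i\<in>I. \<bar>A i j\<bar> + C" C1 h] h
    by (subst sum.distrib, subst sum_distrib_left[symmetric]) (simp add: mult.commute)
  qed auto
  finally show ?thesis by (simp add: sum_distrib_left)
 qed
 have N2: "?N (\<lambda>i. mat_vec I (R h) v i - ?E h v i) <= C2 * h\<^sup>2 * ?N v" if h: "0 <= h" "h <= h1" for h v
 proof -
  have "\<bar>R h i j - mat_exp I A h i j\<bar> <= (C + C') * h\<^sup>2" if "i \<in> I" "j \<in> I" for i j
   using R[of h i j] C'(2)[of h i j] h that by (auto simp: h1_def algebra_simps)
  from sum_abs_mat_vec_le[of I "\<lambda>i j. R h i j - mat_exp I A h i j", OF this]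
  have "?N (mat_vec I (\<lambda>i j. R h i j - mat_exp I A h i j) v) <= (\<Sum>j\<in>I. C2 * h\<^sup>2 * \<bar>v j\<bar>)"
   by (simp add: C2_def mult_ac)
  also have "\<dots> = C2 * h\<^sup>2 * ?N v" by (simp add: sum_distrib_left)
  finally show ?thesis by (simp add: mat_vec_def left_diff_distrib sum_subtractf)
 qed
 have N3: "?N (?E r w) <= G" if "0 <= r" "r <= t" for r
  unfolding G_def
 proof (rule sum_abs_mat_vec_le)
  fix i j assume "i \<in> I" "j \<in> I"
  from mat_exp_bound[OF fin this, of A r]
  show "\<bar>mat_exp I A r i j\<bar> <= exp (t * mat_norm I A)"
   by (rule order_trans) (use that in \<open>auto intro!: mult_right_mono simp: mat_norm_nonneg\<close>)
 qed
 \<comment> \<open>Telescoping: a step adds a local error \<open>C2 * h\<^sup>2 * G\<close>,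
   measured on the exact solution that \<open>G\<close> bounds up to time \<open>t\<close>, and
   multiplies the accumulated error by at most \<open>1 + C1 * h\<close>.\<close>
 have step: "?N (\<lambda>i. (mat_vec I (R h) ^^ k) w i - ?E (real k * h) w i) <= (1 + C1 * h) ^ k * real k * C2 * G * h\<^sup>2"
  if h: "0 <= h" "h <= h1" and "real k * h <= t" for h k
  using that(3)
 proof (induction k)
  case 0
  have "(\<Sum>i\<in>I. \<bar>w i - ?E 0 w i\<bar>) = 0"
   using fin by (intro sum.neutral) (auto simp: mat_vec_def mat_exp_0 sum_mat_one_left)
  then show ?case by simp
 next
  case (Suc k)
  let ?v = "(mat_vec I (R h) ^^ k) w" and ?u = "?E (real k * h) w"
  have kh: "0 <= real k * h" "real k * h <= t" using Suc.prems h by (auto simp: algebra_simps)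
  have "?N (\<lambda>i. (mat_vec I (R h) ^^ Suc k) w i - ?E (real (Suc k) * h) w i)
   = ?N (\<lambda>i. mat_vec I (R h) (\<lambda>j. ?v j - ?u j) i + (mat_vec I (R h) ?u i - ?E h ?u i))"
  proof (intro sum.cong refl)
   fix i assume "i \<in> I"
   have "?E (real (Suc k) * h) w i = ?E h ?u i"
    using mat_vec_exp_add[OF fin \<open>i \<in> I\<close>, of A h "real k * h" w] by (simp add: algebra_simps)
   then show "\<bar>(mat_vec I (R h) ^^ Suc k) w i - ?E (real (Suc k) * h) w i\<bar>
     = \<bar>mat_vec I (R h) (\<lambda>j. ?v j - ?u j) i + (mat_vec I (R h) ?u i - ?E h ?u i)\<bar>"
    by (simp add: mat_vec_diff)
  qed
  also have "\<dots> <= ?N (mat_vec I (R h) (\<lambda>j. ?v j - ?u j)) + ?N (\<lambda>i. mat_vec I (R h) ?u i - ?E h ?u i)"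
   unfolding sum.distrib[symmetric] by (intro sum_mono abs_triangle_ineq)
  also have "\<dots> <= (1 + C1 * h) * ?N (\<lambda>j. ?v j - ?u j) + C2 * h\<^sup>2 * ?N ?u"
   by (intro add_mono N1 N2 h)
  also have "\<dots> <= (1 + C1 * h) * ((1 + C1 * h) ^ k * real k * C2 * G * h\<^sup>2) + C2 * h\<^sup>2 * G"
   using Suc.IH[OF kh(2)] N3[OF kh] C1 C2 h by (intro add_mono mult_left_mono) auto
  also have "\<dots> <= (1 + C1 * h) ^ Suc k * real k * C2 * G * h\<^sup>2 + (1 + C1 * h) ^ Suc k * (C2 * G * h\<^sup>2)"
  proof -
   have "1 * (C2 * G * h\<^sup>2) <= (1 + C1 * h) ^ Suc k * (C2 * G * h\<^sup>2)"
    by (intro mult_right_mono one_le_power) (use C1 C2 G0 h in auto)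
   then show ?thesis by (simp add: mult_ac)
  qed
  also have "\<dots> = (1 + C1 * h) ^ Suc k * real (Suc k) * C2 * G * h\<^sup>2"
   by (simp add: algebra_simps)
  finally show ?case .
 qed
 have "(\<lambda>m. (mat_vec I (R (t / real m)) ^^ m) w i - ?E t w i) \<longlonglongrightarrow> 0"
 proof (rule Lim_null_comparison)
  show "(\<lambda>m. exp (C1 * t) * C2 * G * t\<^sup>2 / real m) \<longlonglongrightarrow> 0"
   by (rule lim_const_over_n)
  have "(\<lambda>m. t / real m) \<longlonglongrightarrow> 0"
   by (rule lim_const_over_n)
  then have "eventually (\<lambda>m. t / real m < h1) sequentially"
   by (rule order_tendstoD) (use h0 in \<open>auto simp: h1_def\<close>)
  then show "eventually (\<lambda>m. norm ((mat_vec I (R (t / real m)) ^^ m) w i - ?E t w i) <= exp (C1 * t) * C2 * G * t\<^sup>2 / real m) sequentially"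
   using eventually_gt_at_top[of "0::nat"]
  proof eventually_elim
   case (elim m)
   let ?h = "t / real m"
   have mh: "real m * ?h = t" using elim by simp
   have "norm ((mat_vec I (R ?h) ^^ m) w i - ?E t w i) <= ?N (\<lambda>i. (mat_vec I (R ?h) ^^ m) w i - ?E (real m * ?h) w i)"
    unfolding mh real_norm_def by (rule member_le_sum[of i I "\<lambda>i. \<bar>(mat_vec I (R ?h) ^^ m) w i - ?E t w i\<bar>"]) (use i fin in auto)
   also have "\<dots> <= (1 + C1 * ?h) ^ m * real m * C2 * G * ?h\<^sup>2"
    by (rule step) (use elim t mh in auto)
   also have "\<dots> = (1 + C1 * ?h) ^ m * (C2 * G * t\<^sup>2 / real m)"
    using elim by (simp add: power2_eq_square field_simps)
   also have "\<dots> <= exp (C1 * t) * (C2 * G * t\<^sup>2 / real m)"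
   proof (intro mult_right_mono)
    have "(1 + C1 * ?h) ^ m <= exp (C1 * ?h) ^ m"
     by (intro power_mono exp_ge_add_one_self) (use C1 t in auto)
    also have "\<dots> = exp (C1 * t)" using elim by (simp add: exp_of_nat_mult[symmetric])
    finally show "(1 + C1 * ?h) ^ m <= exp (C1 * t)" .
   qed (use C2 G0 in auto)
   finally show ?case by simp
  qed
 qed
 then show ?thesis by (simp add: LIM_zero_iff)
qed

text \<open>Gaussian elimination over the index set: a pivot \<open>u0\<close> with a nonzero
  coordinate at \<open>n0\<close> exists by separation, and the members of \<open>U\<close>
  vanishing at \<open>n0\<close> form the smaller instance. This turns linear independence of the
  survival functions into spanning by the columns \<open>G _ z\<close>, and injectivity of a matrix
  into surjectivity.\<close>

lemma unit_vec_in_separating_subspace: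
 assumes "finite I"
  and add: "!!u v. u \<in> U ==> v \<in> U ==> (\<lambda>n. u n + v n) \<in> U"
  and scale: "!!u r. u \<in> U ==> (\<lambda>n. r * u n) \<in> U"
  and cong: "!!u v. u \<in> U ==> (!!n. n \<in> I ==> u n = v n) ==> v \<in> U"
  and sep: "!!a. (!!u. u \<in> U ==> (\<Sum>n\<in>I. a n * u n) = 0) ==> (\<forall>n\<in>I. a n = (0::real))"
  and "n \<in> I"
 shows "unit_vec n \<in> U"
 using assms
proof (induction I arbitrary: U n rule: finite_induct)
 case empty
 then show ?case by simp
next
 case (insert n0 I)
 note add = insert.prems(1) and scale = insert.prems(2) and cong = insert.prems(3) and sep = insert.prems(4)
 have "\<exists>u\<in>U. u n0 \<noteq> 0"
 proof (rule ccontr)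
  assume "\<not> ?thesis"
  then have "(\<Sum>n\<in>insert n0 I. unit_vec n0 n * u n) = 0" if "u \<in> U" for u
   using that by (intro sum.neutral) (auto simp: unit_vec_def)
  from sep[OF this] show False by (auto simp: unit_vec_def)
 qed
 then obtain u0 where u0: "u0 \<in> U" "u0 n0 \<noteq> 0" by blast
 \<comment> \<open>Restrictions to \<open>I\<close> of the members of \<open>U\<close> that vanish
   at \<open>n0\<close>.\<close>
 define U' where "U' = {v. \<exists>u\<in>U. u n0 = 0 \<and> (\<forall>n\<in>I. u n = v n)}"
 have IH: "unit_vec n \<in> U'" if "n \<in> I" for n
 proof (rule insert.IH)
  show "n \<in> I" by fact
  fix u v :: "'a => real" and r :: real
  show "(\<lambda>n. u n + v n) \<in> U'" if "u \<in> U'" "v \<in> U'"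
  proof -
   from that obtain u' v' where "u' \<in> U" "u' n0 = 0" "\<forall>n\<in>I. u' n = u n" "v' \<in> U" "v' n0 = 0" "\<forall>n\<in>I. v' n = v n"
    by (auto simp: U'_def)
   then show ?thesis unfolding U'_def using add[of u' v'] by (auto intro!: bexI[of _ "\<lambda>n. u' n + v' n"])
  qed
  show "(\<lambda>n. r * u n) \<in> U'" if "u \<in> U'"
  proof -
   from that obtain u' where "u' \<in> U" "u' n0 = 0" "\<forall>n\<in>I. u' n = u n"
    by (auto simp: U'_def)
   then show ?thesis unfolding U'_def using scale[of u' r] by (auto intro!: bexI[of _ "\<lambda>n. r * u' n"])
  qed
  show "v \<in> U'" if "u \<in> U'" "!!n. n \<in> I ==> u n = v n"
   using that by (auto simp: U'_def)
 next
  fix a :: "'a => real" assume a: "!!u. u \<in> U' ==> (\<Sum>n\<in>I. a n * u n) = 0"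
  \<comment> \<open>The coefficient at \<open>n0\<close> makes the functional vanish on the pivot;
    every member of \<open>U\<close> is a multiple of \<open>u0\<close> plus a vector vanishing at
    \<open>n0\<close>.\<close>
  define a' where "a' = (\<lambda>n. if n = n0 then - (\<Sum>n\<in>I. a n * u0 n) / u0 n0 else a n)"
  have a'I: "(\<Sum>n\<in>I. a' n * u n) = (\<Sum>n\<in>I. a n * u n)" for u
   using insert.hyps by (intro sum.cong) (auto simp: a'_def)
  have "(\<Sum>n\<in>insert n0 I. a' n * u n) = 0" if u: "u \<in> U" for u
  proof -
   define r where "r = u n0 / u0 n0"
   have "(\<lambda>n. u n + (- r) * u0 n) \<in> U" using add[OF u scale[OF u0(1), of "- r"]] by simp
   then have "(\<lambda>n. u n + (- r) * u0 n) \<in> U'"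
    unfolding U'_def using u0(2) by (auto simp: r_def intro!: bexI[of _ "\<lambda>n. u n + (- r) * u0 n"])
   from a[OF this] have "(\<Sum>n\<in>I. a n * u n) = r * (\<Sum>n\<in>I. a n * u0 n)"
    by (simp add: algebra_simps sum_subtractf sum_distrib_left)
   then show ?thesis
    using insert.hyps u0(2) by (simp add: a'I) (simp add: a'_def r_def)
  qed
  from sep[OF this] show "\<forall>n\<in>I. a n = 0"
   using insert.hyps by (auto simp: a'_def split: if_splits)
 qed
 have unit: "unit_vec n \<in> U" if "n \<in> I" for n
 proof -
  from IH[OF that] obtain u where "u \<in> U" "u n0 = 0" "\<forall>m\<in>I. u m = unit_vec n m"
   by (auto simp: U'_def)
  then show ?thesis
   using that insert.hyps by - (rule cong[of u], auto simp: unit_vec_def)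
 qed
 have comb: "(\<lambda>m. r * u0 m + (\<Sum>n\<in>F. g n * unit_vec n m)) \<in> U" if "finite F" "F \<subseteq> I" for F g r
  using that
 proof (induction F rule: finite_induct)
  case empty
  then show ?case using scale[OF u0(1)] by simp
 next
  case (insert x F)
  have "unit_vec x \<in> U" using unit insert.prems by auto
  then have "(\<lambda>m. (r * u0 m + (\<Sum>n\<in>F. g n * unit_vec n m)) + g x * unit_vec x m) \<in> U"
   by (intro add insert.IH scale) (use insert.prems in auto)
  then show ?case using insert.hyps by (simp add: add_ac)
 qed
 \<comment> \<open>Scale the pivot to 1 at \<open>n0\<close> and remove its other coordinates, whose
   unit vectors are already in \<open>U\<close>.\<close>
 have "unit_vec n0 \<in> U"
 proof (rule cong[OF comb[of I "1 / u0 n0" "\<lambda>n. - (u0 n / u0 n0)"]])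
  show "finite I" by fact
  show "I \<subseteq> I" by simp
  fix m assume m: "m \<in> insert n0 I"
  have "(\<Sum>n\<in>I. - (u0 n / u0 n0) * unit_vec n m) = (if m \<in> I then - (u0 m / u0 n0) else 0)"
   using insert.hyps by (simp add: unit_vec_def if_distrib[where f="\<lambda>x. _ * x"] sum.delta cong: if_cong)
  then show "1 / u0 n0 * u0 m + (\<Sum>n\<in>I. - (u0 n / u0 n0) * unit_vec n m) = unit_vec n0 m"
   using m insert.hyps u0(2) by (auto simp: unit_vec_def)
 qed
 then show ?case using unit insert.prems(5) by auto
qed

section \<open>One-sided derivatives and step functions\<close>

text \<open>Paths have only right derivatives at jumps and at the boundaries, so the mean value
  theorem is replaced by continuation: with a small slope as slack, the set where the inequality
  holds has a last point, and a negative right derivative there carries it further.\<close>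

lemma right_deriv_nonpos_imp_le:
 fixes f :: "real => real"
 assumes ab: "a <= b" and cont: "continuous_on {a..b} f"
  and D: "!!x. a <= x ==> x < b ==> \<exists>d\<le>0. (f has_real_derivative d) (at x within {x..})"
 shows "f b <= f a"
proof (rule field_le_epsilon)
 fix e :: real assume e: "0 < e"
 \<comment> \<open>A slope whose total effect over the interval stays below \<open>e\<close>; the
   summand 1 covers \<open>a = b\<close>.\<close>
 define e' where "e' = e / (b - a + 1)"
 have e': "0 < e'" using e ab by (simp add: e'_def)
 define g where "g = (\<lambda>x. f x - f a - e' * (x - a))"
 have contg: "continuous_on {a..b} g" unfolding g_def by (intro continuous_intros cont)
 have "g b <= 0"
 proof (rule ccontr)
  assume gb: "\<not> g b <= 0"
  define A where "A = {x\<in>{a..b}. g x <= 0}"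
  have "closed A" unfolding A_def
   using continuous_on_closed_Collect_le[OF contg, of "\<lambda>_. 0"] by auto
  then have "compact A" unfolding A_def
   by (auto simp: compact_eq_bounded_closed intro: bounded_subset[OF bounded_closed_interval[of a b]])
  moreover have "a \<in> A" using ab by (simp add: A_def g_def)
  ultimately obtain s where s: "s \<in> A" "!!x. x \<in> A ==> x <= s"
   using compact_attains_sup[of A] by auto
  have sb: "a <= s" "s < b" using s gb by (auto simp: A_def order.order_iff_strict)
  obtain d where d: "d <= 0" "(f has_real_derivative d) (at s within {s..})"
   using D sb by blast
  have "(g has_real_derivative (d - e')) (at s within {s..})"
   unfolding g_def using d by (auto intro!: derivative_eq_intros)
  from has_real_derivative_neg_dec_right[OF this] d e'
  obtain h where h: "h > 0" "!!k. 0 < k ==> k < h ==> g (s + k) < g s" by auto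
  define k where "k = min (h / 2) (b - s)"
  have k: "0 < k" "k < h" "s + k <= b" using h sb by (auto simp: k_def)
  have "g (s + k) < 0" using h(2)[OF k(1,2)] s(1) by (auto simp: A_def)
  then have "s + k \<in> A" using k sb by (auto simp: A_def)
  from s(2)[OF this] k show False by simp
 qed
 then have "f b <= f a + e' * (b - a)" by (simp add: g_def)
 also have "e' * (b - a) <= e" using e ab by (simp add: e'_def field_simps)
 finally show "f b <= f a + e" by simp
qed

lemma right_deriv_zero_imp_const:
 fixes f :: "real => real"
 assumes ab: "a <= b" and cont: "continuous_on {a..b} f"
  and D: "!!x. a <= x ==> x < b ==> (f has_real_derivative 0) (at x within {x..})"
 shows "f b = f a"
proof (rule antisym)
 show "f b <= f a" by (rule right_deriv_nonpos_imp_le[OF ab cont]) (use D in blast)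
 have "- f b <= - f a"
 proof (rule right_deriv_nonpos_imp_le[OF ab])
  show "continuous_on {a..b} (\<lambda>x. - f x)" by (intro continuous_intros cont)
  show "\<exists>d\<le>0. ((\<lambda>x. - f x) has_real_derivative d) (at x within {x..})" if "a <= x" "x < b" for x
   using DERIV_minus[OF D[OF that]] by auto
 qed
 then show "f a <= f b" by simp
qed

text \<open>Constancy to the right of each point is part of \<open>cadlag_step\<close>, constancy to
  the left is the assumption; a locally constant function on a connected interval is
  constant.\<close>

lemma cadlag_step_const:
 assumes g: "cadlag_step g" and "0 <= u"
  and J: "!!s. u < s ==> s < v ==> \<exists>h>0. \<forall>r\<in>{s - h<..<s}. g r = g s"
  and "r \<in> {u..<v}"
 shows "g r = g u"
proof (rule connected_local_const[of "{u..<v}"])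
 show "connected {u..<v}" by simp
 show "r \<in> {u..<v}" "u \<in> {u..<v}" using assms by auto
 show "\<forall>a\<in>{u..<v}. \<forall>\<^sub>F b in at a within {u..<v}. g a = g b"
 proof
  fix a assume a: "a \<in> {u..<v}"
  with \<open>0 <= u\<close> g obtain h where h: "h > 0" "!!r. r \<in> {a..<a + h} ==> g r = g a"
   unfolding cadlag_step_def by (meson atLeastLessThan_iff order_trans)
  obtain h' where h': "h' > 0" "!!r. r \<in> {a - h'<..<a} ==> r \<in> {u..<v} ==> g r = g a"
  proof (cases "a = u")
   case True
   then show ?thesis using that[of 1] by auto
  next
   case False
   with J[of a] a that show ?thesis by auto
  qed
  show "\<forall>\<^sub>F b in at a within {u..<v}. g a = g b"
   unfolding eventually_at
  proof (intro exI[of _ "min h h'"] conjI ballI impI)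
   show "0 < min h h'" using h(1) h'(1) by simp
   fix b assume b: "b \<in> {u..<v}" "b \<noteq> a \<and> dist b a < min h h'"
   then have "\<bar>b - a\<bar> < h" "\<bar>b - a\<bar> < h'" by (simp_all add: dist_real_def)
   then have "b \<in> {a..<a + h} \<or> b \<in> {a - h'<..<a}"
    unfolding atLeastLessThan_iff greaterThanLessThan_iff using b by linarith
   then show "g a = g b" using h(2)[of b] h'(2)[of b] b(1) by auto
  qed
 qed
qed

text \<open>A step path is constant on a punctured neighbourhood of each side of a point, so jumps
  cannot accumulate, and a subset of a compact interval without limit points is finite.\<close>

lemma cadlag_step_finite_jumps:
 assumes g: "cadlag_step g"
 shows "finite {s\<in>{0<..t}. \<not> (\<exists>h>0. \<forall>r\<in>{s - h<..<s}. g r = g s)}"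
proof -
 let ?J = "{s\<in>{0<..t}. \<not> (\<exists>h>0. \<forall>r\<in>{s - h<..<s}. g r = g s)}"
 have "\<not> x islimpt ?J" if x: "x \<in> {0..t}" for x
 proof -
  obtain h where h: "h > 0" "!!r. r \<in> {x..<x + h} ==> g r = g x"
   using g x unfolding cadlag_step_def by (meson atLeastAtMost_iff)
  obtain h' where h': "h' > 0" "x > 0 ==> \<exists>a. \<forall>r\<in>{x - h'<..<x}. g r = a"
  proof (cases "x > 0")
   case True
   then show ?thesis using g that unfolding cadlag_step_def by meson
  qed (use that[of 1] in auto)
  have "y \<notin> ?J" if y: "y \<in> ball x (min h h')" "y \<noteq> x" for y
  proof (cases "y > x")
   case True
   have "\<bar>x - y\<bar> < h" using y by (simp add: dist_real_def)
   then have "g r = g x" if "r \<in> {y - (y - x)<..y}" for r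
    using True that by (intro h(2)) auto
   then have "\<forall>r\<in>{y - (y - x)<..<y}. g r = g y" using True by simp
   moreover have "y - x > 0" using True by simp
   ultimately show ?thesis by blast
  next
   case False
   show ?thesis
   proof (cases "0 < y")
    case True
    then have "0 < x" using False y by auto
    with h' obtain a where a: "\<forall>r\<in>{x - h'<..<x}. g r = a" by blast
    have "x - h' < y" using y by (auto simp: dist_real_def abs_if split: if_splits)
    then have "\<forall>r\<in>{y - (y - (x - h'))<..<y}. g r = g y"
     using a y False by auto
    then show ?thesis using \<open>x - h' < y\<close> by (auto intro!: exI[of _ "y - (x - h')"])
   qed auto
  qed
  then have "?J \<inter> ball x (min h h') \<subseteq> {x}" by blast
  moreover have "open (ball x (min h h'))" "x \<in> ball x (min h h')" using h h' by auto
  ultimately show ?thesis unfolding islimpt_def by blast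
 qed
 then have "finite ({0..t} \<inter> ?J)"
  by (intro finite_not_islimpt_in_compact) auto
 moreover have "{0..t} \<inter> ?J = ?J" by auto
 ultimately show ?thesis by simp
qed

section \<open>Matrix exponential variables\<close>

declare One_nat_def [simp del]

lemma set_integral_sum:
 fixes f :: "'i => 'a => real"
 assumes "!!i. i \<in> J ==> set_integrable M A (f i)"
 shows "(LINT x:A|M. \<Sum>i\<in>J. f i x) = (\<Sum>i\<in>J. LINT x:A|M. f i x)"
 using assms unfolding set_lebesgue_integral_def set_integrable_def
 by (simp add: sum_distrib_left)

locale me_scheme =
 fixes Q :: "'z measure" and Z :: "'z => real" and \<Delta> \<epsilon> :: real and q :: nat
  and \<alpha> :: "nat => real" and S :: "nat => nat => real" and \<tau> :: "nat => real"
 assumes construction: "me_construction Q Z \<Delta> q \<alpha> S \<tau>"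
  and eps_eq: "\<epsilon> = eps Q Z" and \<Delta>_pos: "0 < \<Delta>"
begin

abbreviation "I \<equiv> {1..q}"
abbreviation "E \<equiv> mat_exp {1..q} S"
abbreviation "s \<equiv> exit_vec q S"

text \<open>\<open>G n\<close> and \<open>r n\<close> are the survival function and the density of
  the residual time at the orbit \<open>unit_vec n\<close>; \<open>orb y\<close> is the orbit
  reached from \<open>\<alpha>\<close> at age \<open>y\<close> without an event, normalised to total
  mass 1.\<close>

definition G :: "nat => real => real" where "G n x = (\<Sum>m\<in>I. E x n m)"
definition r :: "nat => real => real" where "r n x = mat_vec I (E x) s n"
definition orb :: "real => nat => real" where "orb y m = E y 1 m / G 1 y"

lemma q_pos: "1 \<in> I"
proof -
 have "q \<noteq> 0"
 proof
  assume "q = 0"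
  \<comment> \<open>With \<open>q = 0\<close> the value \<open>\<tau> (q + 1)\<close> would be both
    \<open>\<tau> 1 = 0\<close> and \<open>\<Delta>\<close>.\<close>
  then show False using construction \<Delta>_pos by (auto simp: me_construction_def)
 qed
 then show ?thesis by auto
qed

lemma unit_dot: "n \<in> I ==> (\<Sum>m\<in>I. unit_vec n m * w m) = w n"
proof -
 assume n: "n \<in> I"
 have "(\<Sum>m\<in>I. unit_vec n m * w m) = (\<Sum>m\<in>I. mat_one n m * w m)"
  by (intro sum.cong refl) (auto simp: unit_vec_def mat_one_def)
 then show ?thesis using n by (simp add: sum_mat_one_left)
qed

sublocale prob_space Q
 using construction by (simp add: me_construction_def)

lemma Z_meas [measurable]: "Z \<in> borel_measurable Q"
 using construction by (simp add: me_construction_def)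

lemma eps_bounds: "0 < \<epsilon>" "\<epsilon> < 1" "\<epsilon> < \<Delta>"
 and tau_1: "\<tau> 1 = 0"
 and tau_bounds: "n \<in> I ==> 0 <= \<tau> n" "n \<in> I ==> \<tau> n < \<Delta> - \<epsilon>"
 and tau_Suc: "n \<in> I ==> \<tau> n < \<tau> (n + 1)"
proof -
 note c = construction[unfolded me_construction_def, folded eps_eq]
 from c show tau_Suc: "n \<in> I ==> \<tau> n < \<tau> (n + 1)" for n by auto
 from c show "\<tau> 1 = 0" by auto
 have nonneg: "0 <= \<tau> n" if "1 <= n" "n <= q" for n
  using that
 proof (induction n rule: dec_induct)
  case base
  then show ?case using \<open>\<tau> 1 = 0\<close> by simp
 next
  case (step n)
  then show ?case using tau_Suc[of n, folded Suc_eq_plus1] by auto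
 qed
 have upper: "\<tau> n <= \<tau> q" if "n <= q" "1 <= n" for n
  using that
 proof (induction n rule: inc_induct)
  case base
  then show ?case by simp
 next
  case (step n)
  then show ?case using tau_Suc[of n, folded Suc_eq_plus1] by auto
 qed
 have tq: "\<tau> q < \<Delta> - \<epsilon>" using c by auto
 show "n \<in> I ==> 0 <= \<tau> n" using nonneg by auto
 show "n \<in> I ==> \<tau> n < \<Delta> - \<epsilon>" using upper[of n] tq by auto
 show "0 < \<epsilon>" "\<epsilon> < 1" using c by auto
 show "\<epsilon> < \<Delta>" using nonneg[of q] tq q_pos by auto
qed

lemma alpha_dot: "(\<Sum>m\<in>I. \<alpha> m * w m) = w 1"
proof -
 have "(\<Sum>m\<in>I. \<alpha> m * w m) = (\<Sum>m\<in>I. mat_one 1 m * w m)"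
  using construction by (intro sum.cong refl) (auto simp: me_construction_def unit_vec_def mat_one_def)
 then show ?thesis using sum_mat_one_left[OF _ q_pos] by simp
qed

lemma orbit_num_eq: "orbit_num q \<alpha> S x m = E x 1 m"
 unfolding orbit_num_def vec_mat_def using alpha_dot[of "\<lambda>i. E x i m"] by simp

lemma me_survival_eq: "me_survival q \<alpha> S x = G 1 x"
 by (simp add: me_survival_def dot_def orbit_num_eq ones_def G_def)

lemma me_density_eq: "me_density q \<alpha> S x = r 1 x"
 by (simp add: me_density_def dot_def orbit_num_eq r_def mat_vec_def)

lemma me_survival_unit: "n \<in> I ==> me_survival q (unit_vec n) S x = G n x"
proof -
 assume n: "n \<in> I"
 have "orbit_num q (unit_vec n) S x m = E x n m" for m
  unfolding orbit_num_def vec_mat_def by (rule unit_dot[OF n])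
 then show ?thesis by (simp add: me_survival_def dot_def ones_def G_def)
qed

lemma G_0: "n \<in> I ==> G n 0 = 1"
 using sum_mat_one_left[of I n "\<lambda>_. 1"] by (simp add: G_def mat_exp_0)

lemma r_0: "n \<in> I ==> r n 0 = s n"
 using sum_mat_one_left[of I n s] by (simp add: r_def mat_vec_def mat_exp_0)

lemma G_add: "n \<in> I ==> G n (x + y) = (\<Sum>m\<in>I. E x n m * G m y)"
 unfolding G_def by (subst sum_distrib_left, subst sum.swap) (simp add: mat_exp_add)

lemma r_add: "n \<in> I ==> r n (x + y) = (\<Sum>m\<in>I. E x n m * r m y)"
 unfolding r_def using mat_vec_exp_add[of I n S x y s] by (simp add: mat_vec_def)

lemma G_deriv: "n \<in> I ==> (G n has_real_derivative - r n x) (at x)"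
proof -
 assume n: "n \<in> I"
 have "((\<lambda>x. \<Sum>m\<in>I. E x n m) has_real_derivative (\<Sum>m\<in>I. \<Sum>k\<in>I. E x n k * S k m)) (at x)"
  by (intro DERIV_sum mat_exp_deriv_right) (use n in auto)
 moreover have "(\<Sum>m\<in>I. \<Sum>k\<in>I. E x n k * S k m) = - r n x"
  by (subst sum.swap) (simp add: r_def mat_vec_def exit_vec_def ones_def sum_distrib_left sum_negf)
 moreover have "G n = (\<lambda>x. \<Sum>m\<in>I. E x n m)" by (simp add: G_def fun_eq_iff)
 ultimately show ?thesis by simp
qed

lemma r_cont: "n \<in> I ==> continuous_on X (r n)"
 unfolding r_def mat_vec_def by (intro continuous_intros mat_exp_continuous) auto

lemma G_cont: "n \<in> I ==> continuous_on X (G n)"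
 unfolding G_def by (intro continuous_intros mat_exp_continuous) auto

lemma r_borel [measurable]: "n \<in> I ==> r n \<in> borel_measurable borel"
 by (rule borel_measurable_continuous_onI) (rule r_cont)

lemma G_borel [measurable]: "n \<in> I ==> G n \<in> borel_measurable borel"
 by (rule borel_measurable_continuous_onI) (rule G_cont)

lemma me_rep: "me_rep Q Z q \<alpha> S"
 using construction unfolding me_construction_def minimal_me_rep_def by blast

lemma G1_prob: "0 <= x ==> prob {om\<in>space Q. x < Z om} = G 1 x"
 using me_rep unfolding me_rep_def me_survival_eq by blast

lemma Z_distributed: "distributed Q lborel Z (\<lambda>x. ennreal (if 0 <= x then r 1 x else 0))"
 using me_rep unfolding me_rep_def me_density_eq by blast

lemma G1_antimono: "0 <= x ==> x <= y ==> G 1 y <= G 1 x"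
 by (subst (1 2) G1_prob[symmetric]) (auto intro!: finite_measure_mono)

text \<open>The density in \<open>distributed\<close> is only fixed almost everywhere, and
  \<open>ennreal\<close> hides its sign. Pointwise nonnegativity comes from \<open>r 1\<close> being
  minus the derivative of a decreasing survival function.\<close>

lemma r1_nonneg:
 assumes "0 <= x" shows "0 <= r 1 x"
proof (rule ccontr)
 assume "\<not> 0 <= r 1 x"
 then obtain d where d: "d > 0" "!!h. 0 < h ==> h < d ==> G 1 x < G 1 (x + h)"
  using DERIV_pos_inc_right[OF G_deriv[OF q_pos, of x]] by auto
 from d(2)[of "d / 2"] d(1) G1_antimono[OF assms, of "x + d / 2"] show False by simp
qed

lemma point_prob_0: "prob {om\<in>space Q. Z om = y} = 0"
proof -
 have "emeasure Q (Z -` {y} \<inter> space Q) = (\<integral>\<^sup>+x. ennreal (if 0 <= x then r 1 x else 0) * indicator {y} x \<partial>lborel)"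
  by (rule distributed_emeasure[OF Z_distributed]) simp
 also have "\<dots> = 0"
 proof -
  have "AE x in lborel. ennreal (if 0 <= x then r 1 x else 0) * indicator {y} x = 0"
   using AE_lborel_singleton[of y] by eventually_elim (simp add: indicator_def)
  then show ?thesis by (simp add: nn_integral_cong_AE)
 qed
 also have "Z -` {y} \<inter> space Q = {om\<in>space Q. Z om = y}" by auto
 finally show ?thesis by (simp add: measure_def)
qed

lemma expectation_eq:
 assumes [measurable]: "\<phi> \<in> borel_measurable borel"
 shows "expectation (\<lambda>om. \<phi> (Z om)) = (LINT z:{0..}|lborel. r 1 z * \<phi> z)"
  and "integrable Q (\<lambda>om. \<phi> (Z om)) \<longleftrightarrow> set_integrable lborel {0..} (\<lambda>z. r 1 z * \<phi> z)"
proof -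
 have eq: "(if 0 <= z then r 1 z else 0) * \<phi> z = indicator {0..} z *\<^sub>R (r 1 z * \<phi> z)" for z
  by (simp add: indicator_def)
 have meas: "\<phi> \<in> borel_measurable lborel" by simp
 have nn: "z \<in> space lborel ==> 0 <= (if 0 <= z then r 1 z else 0)" for z using r1_nonneg by auto
 show "expectation (\<lambda>om. \<phi> (Z om)) = (LINT z:{0..}|lborel. r 1 z * \<phi> z)"
  using distributed_integral[OF Z_distributed meas nn] unfolding eq set_lebesgue_integral_def by simp
 show "integrable Q (\<lambda>om. \<phi> (Z om)) \<longleftrightarrow> set_integrable lborel {0..} (\<lambda>z. r 1 z * \<phi> z)"
  using distributed_integrable[OF Z_distributed meas nn] unfolding eq set_integrable_def by simp
qed

lemma Z_moments:
 shows Z_integrable: "integrable Q Z" and Z_mean: "expectation Z = \<Delta>"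
  and Z_square_integrable: "integrable Q (\<lambda>om. (Z om - \<Delta>)\<^sup>2)"
  and Z_variance: "expectation (\<lambda>om. (Z om - \<Delta>)\<^sup>2) = \<epsilon> ^ 3"
proof -
 show int: "integrable Q Z" and mean: "expectation Z = \<Delta>"
  using construction by (auto simp: me_construction_def)
 have e: "\<epsilon> = root 3 (expectation (\<lambda>om. (Z om - \<Delta>)\<^sup>2))"
  by (simp add: eps_eq eps_def mean)
 then show "expectation (\<lambda>om. (Z om - \<Delta>)\<^sup>2) = \<epsilon> ^ 3" by simp
 \<comment> \<open>A square that is not integrable would have integral 0 by convention, but the
   integral is \<open>\<epsilon> ^ 3\<close> and positive.\<close>
 then show "integrable Q (\<lambda>om. (Z om - \<Delta>)\<^sup>2)"
  using eps_bounds(1) not_integrable_integral_eq[of Q "\<lambda>om. (Z om - \<Delta>)\<^sup>2"] by force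
qed

lemma Z_nonneg: "AE om in Q. 0 <= Z om"
 using construction by (simp add: me_construction_def)

lemma abs_dev_integrable: "integrable Q (\<lambda>om. \<bar>Z om - \<Delta>\<bar>)"
 using Z_integrable by auto

text \<open>Young's inequality with weight \<open>\<epsilon>\<close>: the variance
  \<open>\<epsilon> ^ 3\<close> contributes \<open>\<epsilon>\<^sup>2 / 2\<close>, which
  \<open>\<epsilon> < 1\<close> turns into \<open>\<epsilon> / 2\<close>. The approximations of
  residual times below rest on this bound.\<close>

lemma abs_dev_le: "expectation (\<lambda>om. \<bar>Z om - \<Delta>\<bar>) <= \<epsilon>"
proof -
 have "expectation (\<lambda>om. \<bar>Z om - \<Delta>\<bar>) <= expectation (\<lambda>om. \<epsilon> / 2 + (Z om - \<Delta>)\<^sup>2 / (2 * \<epsilon>))"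
 proof (rule integral_mono)
  show "integrable Q (\<lambda>om. \<epsilon> / 2 + (Z om - \<Delta>)\<^sup>2 / (2 * \<epsilon>))"
   using Z_square_integrable by simp
  fix om
  have "0 <= (\<epsilon> - \<bar>Z om - \<Delta>\<bar>)\<^sup>2" by simp
  then have "2 * \<epsilon> * \<bar>Z om - \<Delta>\<bar> <= \<epsilon>\<^sup>2 + (Z om - \<Delta>)\<^sup>2" by (simp add: power2_diff)
  then show "\<bar>Z om - \<Delta>\<bar> <= \<epsilon> / 2 + (Z om - \<Delta>)\<^sup>2 / (2 * \<epsilon>)"
   using eps_bounds by (simp add: field_simps power2_eq_square)
 qed (rule abs_dev_integrable)
 also have "\<dots> = \<epsilon> / 2 + \<epsilon> ^ 3 / (2 * \<epsilon>)"
  using Z_square_integrable Z_variance prob_space by simp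
 also have "\<epsilon> ^ 3 / (2 * \<epsilon>) = \<epsilon> * \<epsilon> / 2"
  using eps_bounds by (simp add: power3_eq_cube)
 also have "\<epsilon> * \<epsilon> / 2 <= \<epsilon> / 2" using eps_bounds by (simp add: mult_left_le)
 finally show ?thesis by simp
qed

text \<open>Chebyshev at distance \<open>\<epsilon>\<close> costs probability
  \<open>\<epsilon> ^ 3 / \<epsilon>\<^sup>2 = \<epsilon>\<close>, the balance that the cube root in
  \<open>eps\<close> provides. It makes conditioning on survival up to
  \<open>\<Delta> - \<epsilon>\<close> harmless.\<close>

lemma G1_lower:
 assumes "0 <= y" "y <= \<Delta> - \<epsilon>" shows "1 - \<epsilon> <= G 1 y"
proof -
 have "prob {om\<in>space Q. \<epsilon> <= \<bar>Z om - \<Delta>\<bar>} <= \<epsilon> ^ 3 / \<epsilon>\<^sup>2"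
 proof -
  have "integrable Q (\<lambda>om. (Z om)\<^sup>2)"
  proof -
   have "integrable Q (\<lambda>om. (Z om - \<Delta>)\<^sup>2 + 2 * \<Delta> * Z om - \<Delta>\<^sup>2)"
    using Z_square_integrable Z_integrable by simp
   moreover have "(Z om)\<^sup>2 = (Z om - \<Delta>)\<^sup>2 + 2 * \<Delta> * Z om - \<Delta>\<^sup>2" for om
    by (simp add: power2_diff)
   ultimately show ?thesis by simp
  qed
  from Chebyshev_inequality[OF Z_meas this eps_bounds(1)] show ?thesis
   using Z_variance by (simp add: Z_mean)
 qed
 also have "\<epsilon> ^ 3 / \<epsilon>\<^sup>2 = \<epsilon>" using eps_bounds by (simp add: power3_eq_cube power2_eq_square)
 finally have "prob {om\<in>space Q. \<epsilon> <= \<bar>Z om - \<Delta>\<bar>} <= \<epsilon>" .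
 moreover have "prob (space Q - {om\<in>space Q. y < Z om}) <= prob {om\<in>space Q. \<epsilon> <= \<bar>Z om - \<Delta>\<bar>}"
  by (rule finite_measure_mono) (use assms in auto)
 moreover have "prob (space Q - {om\<in>space Q. y < Z om}) = 1 - G 1 y"
  by (subst prob_compl) (use G1_prob assms in auto)
 ultimately show ?thesis by simp
qed

lemma G1_pos: "0 <= y ==> y <= \<Delta> - \<epsilon> ==> 0 < G 1 y"
 using G1_lower[of y] eps_bounds by simp

text \<open>The construction conditions with a weak inequality, the survival function has a strict
  one; since the law has a density, a single point carries no mass.\<close>

lemma G_eq_shift:
 assumes n: "n \<in> I" and x: "0 <= x"
 shows "G n x = G 1 (\<tau> n + x) / G 1 (\<tau> n)"
proof -
 have t0: "0 <= \<tau> n" using tau_bounds n by auto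
 have "me_survival q (unit_vec n) S x = \<P>(om in Q. x <= Z om - \<tau> n \<bar> \<tau> n < Z om)"
  using construction n x by (auto simp: me_construction_def)
 also have "\<dots> = prob {om\<in>space Q. x <= Z om - \<tau> n \<and> \<tau> n < Z om} / prob {om\<in>space Q. \<tau> n < Z om}"
  by (simp add: cond_prob_def)
 also have "prob {om\<in>space Q. x <= Z om - \<tau> n \<and> \<tau> n < Z om} = prob {om\<in>space Q. \<tau> n + x < Z om}"
 proof (rule antisym)
  have "prob {om\<in>space Q. x <= Z om - \<tau> n \<and> \<tau> n < Z om}
    <= prob ({om\<in>space Q. \<tau> n + x < Z om} \<union> {om\<in>space Q. Z om = \<tau> n + x})"
   by (rule finite_measure_mono) auto
  also have "\<dots> <= prob {om\<in>space Q. \<tau> n + x < Z om} + prob {om\<in>space Q. Z om = \<tau> n + x}"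
   by (rule measure_Un_le) auto
  finally show "prob {om\<in>space Q. x <= Z om - \<tau> n \<and> \<tau> n < Z om} <= prob {om\<in>space Q. \<tau> n + x < Z om}"
   using point_prob_0 by simp
  show "prob {om\<in>space Q. \<tau> n + x < Z om} <= prob {om\<in>space Q. x <= Z om - \<tau> n \<and> \<tau> n < Z om}"
   by (rule finite_measure_mono) (use x in auto)
 qed
 finally show ?thesis using t0 x n by (simp add: G1_prob me_survival_unit)
qed

lemma lin_indep:
 assumes "!!x. 0 <= x ==> (\<Sum>n\<in>I. a n * G n x) = 0" "n \<in> I" shows "a n = 0"
proof -
 have "\<forall>a. (\<forall>x\<ge>0. (\<Sum>n\<in>I. a n * me_survival q (unit_vec n) S x) = 0) \<longrightarrow> (\<forall>n\<in>I. a n = 0)"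
  using construction unfolding me_construction_def by blast
 moreover have "(\<Sum>n\<in>I. a n * me_survival q (unit_vec n) S x) = (\<Sum>n\<in>I. a n * G n x)" for x
  by (intro sum.cong) (auto simp: me_survival_unit)
 ultimately show ?thesis using assms by auto
qed

text \<open>The initial vectors are points of the orbit of \<open>\<alpha>\<close>.\<close>

lemma unit_vec_eq_orb:
 assumes n: "n \<in> I" and m: "m \<in> I" shows "orb (\<tau> n) m = unit_vec n m"
proof -
 have t0: "0 <= \<tau> n" "0 < G 1 (\<tau> n)" using tau_bounds[of n] n G1_pos by auto
 have "orb (\<tau> n) m - unit_vec n m = 0"
 proof (rule lin_indep[OF _ m])
  fix x :: real assume x: "0 <= x"
  have "(\<Sum>m\<in>I. orb (\<tau> n) m * G m x) = (\<Sum>m\<in>I. E (\<tau> n) 1 m * G m x) / G 1 (\<tau> n)"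
   by (simp add: orb_def sum_divide_distrib)
  also have "\<dots> = G n x" using G_add[OF q_pos, of "\<tau> n" x] G_eq_shift[OF n x] by simp
  finally show "(\<Sum>m\<in>I. (orb (\<tau> n) m - unit_vec n m) * G m x) = 0"
   using unit_dot[OF n, of "\<lambda>m. G m x"] by (simp add: left_diff_distrib sum_subtractf)
 qed
 then show ?thesis by simp
qed

lemma orb_dot: "n \<in> I ==> (\<Sum>m\<in>I. orb (\<tau> n) m * w m) = w n"
proof -
 assume n: "n \<in> I"
 have "(\<Sum>m\<in>I. orb (\<tau> n) m * w m) = (\<Sum>m\<in>I. unit_vec n m * w m)"
  by (intro sum.cong refl) (simp only: unit_vec_eq_orb[OF n])
 then show ?thesis using unit_dot[OF n] by simp
qed

lemma orb_r: "(\<Sum>m\<in>I. orb y m * r m z) = r 1 (y + z) / G 1 y"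
 by (simp add: orb_def r_add[OF q_pos] sum_divide_distrib)

lemma orb_sum: "0 < G 1 y ==> (\<Sum>m\<in>I. orb y m) = 1"
 by (simp add: orb_def sum_divide_distrib[symmetric] G_def)

text \<open>Read off from the equality of the rows \<open>orb (\<tau> n)\<close> and
  \<open>unit_vec n\<close> on \<open>I\<close>; this holds for every real \<open>z\<close>, whereas
  \<open>G_eq_shift\<close> could be differentiated only where \<open>x\<close> is
  nonnegative.\<close>

lemma r_eq_shift: "n \<in> I ==> r n z = r 1 (\<tau> n + z) / G 1 (\<tau> n)"
proof -
 assume n: "n \<in> I"
 show ?thesis using orb_r[of "\<tau> n" z] unfolding orb_dot[OF n] .
qed

lemma r_nonneg: "n \<in> I ==> 0 <= z ==> 0 <= r n z"
 using r_eq_shift[of n z] r1_nonneg[of "\<tau> n + z"] tau_bounds[of n] G1_pos[of "\<tau> n"] by auto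

section \<open>Integration against the residual densities\<close>

text \<open>Linear growth is what the finite mean of \<open>Z\<close> can integrate, and every
  Lipschitz function of the residual time has it.\<close>

definition adm :: "(real => real) => bool" where
 "adm g \<longleftrightarrow> g \<in> borel_measurable borel \<and> (\<exists>C. \<forall>z\<ge>0. \<bar>g z\<bar> <= C * (1 + z))"

text \<open>The expectation of \<open>g\<close> at the residual time of the orbit
  \<open>unit_vec n\<close>. Linear in the orbit, it turns a function of the residual time into a
  column.\<close>

definition IG :: "(real => real) => nat => real" where
 "IG g n = (LINT z:{0..}|lborel. r n z * g z)"

definition rho :: "(nat => real) => real => real" where
 "rho a z = (\<Sum>n\<in>I. a n * r n z)"

text \<open>Entries of an orbit may be negative; what stays nonnegative along the dynamics is its
  residual density \<open>rho a\<close>.\<close>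

definition cone :: "(nat => real) => bool" where
 "cone a \<longleftrightarrow> (\<forall>z\<ge>0. 0 <= rho a z)"

lemma adm_borel: "adm g ==> g \<in> borel_measurable borel"
 by (simp add: adm_def)

lemma adm_bounded: "g \<in> borel_measurable borel ==> (!!z. 0 <= z ==> \<bar>g z\<bar> <= C) ==> adm g"
 unfolding adm_def
proof (intro conjI exI[of _ "\<bar>C\<bar>"] allI impI)
 fix z :: real assume "0 <= z" "!!z. 0 <= z ==> \<bar>g z\<bar> <= C"
 then have "\<bar>g z\<bar> <= \<bar>C\<bar> * 1" by (metis abs_ge_self mult.right_neutral order_trans)
 also have "\<dots> <= \<bar>C\<bar> * (1 + z)" using \<open>0 <= z\<close> by (intro mult_left_mono) auto
 finally show "\<bar>g z\<bar> <= \<bar>C\<bar> * (1 + z)" .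
qed

lemma adm_add: "adm g ==> adm h ==> adm (\<lambda>z. g z + h z)"
 unfolding adm_def
proof (elim conjE exE, intro conjI)
 fix C C' assume "\<forall>z\<ge>0. \<bar>g z\<bar> <= C * (1 + z)" "\<forall>z\<ge>0. \<bar>h z\<bar> <= C' * (1 + z)"
 then have "\<bar>g z + h z\<bar> <= (C + C') * (1 + z)" if "z \<ge> 0" for z
  using that abs_triangle_ineq[of "g z" "h z"] by (fastforce simp: distrib_right)
 then show "\<exists>C. \<forall>z\<ge>0. \<bar>g z + h z\<bar> <= C * (1 + z)" by blast
qed measurable

lemma adm_cmult: "adm g ==> adm (\<lambda>z. c * g z)"
 unfolding adm_def
proof (elim conjE exE, intro conjI)
 fix C assume "\<forall>z\<ge>0. \<bar>g z\<bar> <= C * (1 + z)"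
 then have "\<bar>c * g z\<bar> <= (\<bar>c\<bar> * C) * (1 + z)" if "z \<ge> 0" for z
  using that by (simp add: abs_mult mult.assoc mult_left_mono)
 then show "\<exists>C. \<forall>z\<ge>0. \<bar>c * g z\<bar> <= C * (1 + z)" by blast
qed measurable

lemma adm_diff: "adm g ==> adm h ==> adm (\<lambda>z. g z - h z)"
 using adm_add[of g "\<lambda>z. (-1) * h z"] adm_cmult[of h "-1"] by simp

lemma adm_sum: "finite X ==> (!!i. i \<in> X ==> adm (g i)) ==> adm (\<lambda>z. \<Sum>i\<in>X. g i z)"
 by (induction X rule: finite_induct) (auto intro: adm_add adm_bounded[of _ 0])

lemma adm_const [simp]: "adm (\<lambda>_. c)" by (rule adm_bounded[of _ "\<bar>c\<bar>"]) auto

lemma adm_lipschitz: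
 assumes "!!x y. \<bar>g x - g y\<bar> <= L * \<bar>x - y\<bar>" shows "adm g"
proof -
 have L: "0 <= L" using assms[of 1 0] by (auto intro: order_trans[OF abs_ge_zero])
 have "continuous_on UNIV g"
  using L assms by (intro lipschitz_on_continuous_on[of L]) (auto intro!: lipschitz_onI simp: dist_real_def)
 moreover have "\<bar>g z\<bar> <= (\<bar>g 0\<bar> + L) * (1 + z)" if "0 <= z" for z
 proof -
  have "\<bar>g z\<bar> <= \<bar>g 0\<bar> + L * z" using assms[of z 0] that by auto
  also have "\<dots> <= (\<bar>g 0\<bar> + L) * (1 + z)" using L that by (simp add: algebra_simps)
  finally show ?thesis .
 qed
 ultimately show ?thesis unfolding adm_def by (auto intro: borel_measurable_continuous_onI)
qed

lemma set_integral_shift: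
 fixes g :: "real => real"
 shows "(LINT z:{0..}|lborel. g (y + z)) = (LINT z:{y..}|lborel. g z)"
  and "set_integrable lborel {0..} (\<lambda>z. g (y + z)) \<longleftrightarrow> set_integrable lborel {y..} g"
proof -
 have eq: "indicator {y..} (y + 1 * z) *\<^sub>R g (y + 1 * z) = indicator {0..} z *\<^sub>R g (y + z)" for z
  by (auto simp: indicator_def)
 show "(LINT z:{0..}|lborel. g (y + z)) = (LINT z:{y..}|lborel. g z)"
  using lborel_integral_real_affine[of 1 "\<lambda>z. indicator {y..} z *\<^sub>R g z" y]
  unfolding eq set_lebesgue_integral_def by simp
 show "set_integrable lborel {0..} (\<lambda>z. g (y + z)) \<longleftrightarrow> set_integrable lborel {y..} g"
  using lborel_integrable_real_affine_iff[of 1 "\<lambda>z. indicator {y..} z *\<^sub>R g z" y]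
  unfolding eq set_integrable_def by simp
qed

lemma r1_adm_integrable:
 assumes "adm g" shows "set_integrable lborel {0..} (\<lambda>z. r 1 z * g z)"
proof -
 from assms obtain C where [measurable]: "g \<in> borel_measurable borel" and C: "!!z. z \<ge> 0 ==> \<bar>g z\<bar> <= C * (1 + z)"
  by (auto simp: adm_def)
 have "integrable Q (\<lambda>om. g (Z om))"
 proof (rule Bochner_Integration.integrable_bound)
  show "integrable Q (\<lambda>om. C * (1 + Z om))" using Z_integrable by simp
  show "AE om in Q. norm (g (Z om)) <= norm (C * (1 + Z om))"
   using Z_nonneg by eventually_elim (use C in force)
 qed measurable
 then show ?thesis by (subst (asm) expectation_eq(2)) auto
qed

lemma adm_shift_back: "adm g ==> 0 <= y ==> adm (\<lambda>z. indicator {y..} z * g (z - y))"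
 unfolding adm_def
proof (elim conjE exE, intro conjI)
 fix C assume C: "\<forall>z\<ge>0. \<bar>g z\<bar> <= C * (1 + z)" and y: "0 <= y"
 have C0: "0 <= C" using C[rule_format, of 0] by simp
 have "\<bar>indicator {y..} z * g (z - y)\<bar> <= C * (1 + z)" if "z \<ge> 0" for z
 proof (cases "y <= z")
  case True
  then have "\<bar>g (z - y)\<bar> <= C * (1 + (z - y))" using C by simp
  also have "\<dots> <= C * (1 + z)" using C0 y by (intro mult_left_mono) auto
  finally show ?thesis using True by simp
 qed (use C0 that in auto)
 then show "\<exists>C. \<forall>z\<ge>0. \<bar>indicator {y..} z * g (z - y)\<bar> <= C * (1 + z)" by blast
qed simp_all

lemma set_integral_restrict:
 fixes y :: real
 assumes "0 <= y"
 shows "(LINT z:{0..}|lborel. f z * (indicator {y..} z * g z)) = (LINT z:{y..}|lborel. f z * (g z :: real))"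
  and "set_integrable lborel {0..} (\<lambda>z. f z * (indicator {y..} z * g z)) \<longleftrightarrow> set_integrable lborel {y..} (\<lambda>z. f z * g z)"
proof -
 have eq: "indicator {0..} z *\<^sub>R (f z * (indicator {y..} z * g z)) = indicator {y..} z *\<^sub>R (f z * g z)" for z
  using assms order_trans[of 0 y z] by (auto simp: indicator_def)
 show "(LINT z:{0..}|lborel. f z * (indicator {y..} z * g z)) = (LINT z:{y..}|lborel. f z * g z)"
  unfolding set_lebesgue_integral_def eq ..
 show "set_integrable lborel {0..} (\<lambda>z. f z * (indicator {y..} z * g z)) \<longleftrightarrow> set_integrable lborel {y..} (\<lambda>z. f z * g z)"
  unfolding set_integrable_def eq ..
qed

lemma r1_shift_integrable:
 assumes "adm g" "0 <= y" shows "set_integrable lborel {0..} (\<lambda>z. r 1 (y + z) * g z)"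
 using r1_adm_integrable[OF adm_shift_back[OF assms]]
 unfolding set_integral_restrict(2)[OF assms(2)] set_integral_shift(2)[of "\<lambda>z. r 1 z * g (z - y)" y, symmetric]
 by simp

lemma r_adm_integrable:
 assumes "adm g" "n \<in> I" shows "set_integrable lborel {0..} (\<lambda>z. r n z * g z)"
proof -
 have "set_integrable lborel {0..} (\<lambda>z. (1 / G 1 (\<tau> n)) * (r 1 (\<tau> n + z) * g z))"
  using r1_shift_integrable[OF assms(1), of "\<tau> n"] tau_bounds(1)[OF assms(2)]
  by (intro set_integrable_mult_right) auto
 then show ?thesis by (simp add: r_eq_shift[OF assms(2)])
qed

lemma IG_dot:
 assumes "adm g" shows "(\<Sum>n\<in>I. a n * IG g n) = (LINT z:{0..}|lborel. rho a z * g z)"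
  and "set_integrable lborel {0..} (\<lambda>z. rho a z * g z)"
proof -
 have int: "set_integrable lborel {0..} (\<lambda>z. a n * (r n z * g z))" if "n \<in> I" for n
  using r_adm_integrable[OF assms that] by (rule set_integrable_mult_right)
 have eq: "rho a z * g z = (\<Sum>n\<in>I. a n * (r n z * g z))" for z
  by (simp add: rho_def sum_distrib_right mult.assoc)
 show "set_integrable lborel {0..} (\<lambda>z. rho a z * g z)"
  unfolding eq set_integrable_def scaleR_sum_right
  by (rule Bochner_Integration.integrable_sum) (use int in \<open>auto simp: set_integrable_def\<close>)
 show "(\<Sum>n\<in>I. a n * IG g n) = (LINT z:{0..}|lborel. rho a z * g z)"
  unfolding eq by (subst set_integral_sum) (use int in \<open>auto simp: IG_def\<close>)
qed

lemma IG_add: "adm g ==> adm h ==> n \<in> I ==> IG (\<lambda>z. g z + h z) n = IG g n + IG h n"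
 unfolding IG_def by (simp add: distrib_left set_integral_add r_adm_integrable)

lemma IG_cmult: "IG (\<lambda>z. c * g z) n = c * IG g n"
 unfolding IG_def by (simp add: mult.left_commute)

lemma IG_diff: "adm g ==> adm h ==> n \<in> I ==> IG (\<lambda>z. g z - h z) n = IG g n - IG h n"
 unfolding IG_def by (simp add: right_diff_distrib set_integral_diff r_adm_integrable)

lemma IG_sum: "finite X ==> (!!i. i \<in> X ==> adm (g i)) ==> n \<in> I ==>
  IG (\<lambda>z. \<Sum>i\<in>X. g i z) n = (\<Sum>i\<in>X. IG (g i) n)"
proof (induction X rule: finite_induct)
 case empty
 then show ?case by (simp add: IG_def)
next
 case (insert x F)
 then show ?case using IG_add[of "g x" "\<lambda>z. \<Sum>i\<in>F. g i z" n] adm_sum[of F g] by simp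
qed

lemma IG_cong: "(!!z. 0 <= z ==> g z = h z) ==> IG g n = IG h n"
 unfolding IG_def by (rule set_lebesgue_integral_cong) auto

lemma IG_mono:
 assumes "adm g" "adm h" "cone a" "!!z. 0 <= z ==> g z <= h z"
 shows "(\<Sum>n\<in>I. a n * IG g n) <= (\<Sum>n\<in>I. a n * IG h n)"
 unfolding IG_dot(1)[OF assms(1)] IG_dot(1)[OF assms(2)]
 by (rule set_integral_mono) (use assms IG_dot(2) in \<open>auto simp: cone_def intro!: mult_left_mono\<close>)

text \<open>Both sides are $(e^{Sh} I(g))_n$: drift of the orbit shifts the residual time.\<close>

lemma drift_IG:
 assumes "adm g" "0 <= h" "n \<in> I"
 shows "(\<Sum>m\<in>I. E h n m * IG g m) = IG (\<lambda>z. indicator {h..} z * g (z - h)) n"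
proof -
 have "(\<Sum>m\<in>I. E h n m * IG g m) = (LINT z:{0..}|lborel. r n (h + z) * g z)"
  unfolding IG_dot(1)[OF assms(1)] rho_def r_add[OF assms(3)] ..
 also have "\<dots> = (LINT z:{0..}|lborel. r n (h + z) * g (h + z - h))" by simp
 also have "\<dots> = (LINT z:{h..}|lborel. r n z * g (z - h))"
  by (rule set_integral_shift(1)[of "\<lambda>z. r n z * g (z - h)"])
 also have "\<dots> = IG (\<lambda>z. indicator {h..} z * g (z - h)) n"
  unfolding IG_def set_integral_restrict(1)[OF assms(2)] ..
 finally show ?thesis .
qed

lemma rho_drift: "rho (vec_mat I a (E h)) z = rho a (h + z)"
proof -
 have "rho (vec_mat I a (E h)) z = (\<Sum>n\<in>I. \<Sum>m\<in>I. a m * (E h m n * r n z))"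
  by (simp add: rho_def vec_mat_def sum_distrib_right mult.assoc)
 also have "\<dots> = rho a (h + z)"
  by (subst sum.swap) (simp add: rho_def r_add sum_distrib_left)
 finally show ?thesis .
qed

lemma cone_drift: "cone a ==> 0 <= h ==> cone (vec_mat I a (E h))"
 by (simp add: cone_def rho_drift)

lemma cone_unit: "n \<in> I ==> cone (unit_vec n)"
proof -
 assume n: "n \<in> I"
 then have "rho (unit_vec n) z = r n z" for z
  by (simp add: rho_def unit_dot)
 then show ?thesis using r_nonneg[OF n] by (simp add: cone_def)
qed

lemma cone_orb: "0 <= y ==> y <= \<Delta> - \<epsilon> ==> cone (orb y)"
 unfolding cone_def rho_def orb_r using r1_nonneg G1_pos[of y] by auto

text \<open>Conditioning: the drift for time \<open>y\<close> shifts the residual time of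
  \<open>\<alpha>\<close>, and normalising by \<open>G 1 y\<close> conditions on survival up to
  \<open>y\<close>.\<close>

lemma orb_IG:
 assumes "adm g" "0 <= y"
 shows "(\<Sum>m\<in>I. orb y m * IG g m) = expectation (\<lambda>om. indicator {y..} (Z om) * g (Z om - y)) / G 1 y"
proof -
 note b [measurable] = adm_borel[OF assms(1)]
 have "(\<Sum>m\<in>I. orb y m * IG g m) = (\<Sum>m\<in>I. E y 1 m * IG g m) / G 1 y"
  by (simp add: orb_def sum_divide_distrib)
 also have "(\<Sum>m\<in>I. E y 1 m * IG g m) = IG (\<lambda>z. indicator {y..} z * g (z - y)) 1"
  by (rule drift_IG[OF assms q_pos])
 also have "\<dots> = expectation (\<lambda>om. indicator {y..} (Z om) * g (Z om - y))"
  unfolding IG_def by (rule expectation_eq(1)[symmetric]) measurable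
 finally show ?thesis .
qed

lemma IG_1: "adm g ==> IG g 1 = expectation (\<lambda>om. g (Z om))"
 unfolding IG_def by (rule expectation_eq(1)[symmetric]) (rule adm_borel)

text \<open>The residual density has total mass 1: at \<open>orb (\<tau> n)\<close>, which is the
  unit vector, this is a quotient of two survival probabilities that differ by one point.\<close>

lemma IG_const: "n \<in> I ==> IG (\<lambda>_. c) n = c"
proof -
 assume n: "n \<in> I"
 have t: "0 <= \<tau> n" "0 < G 1 (\<tau> n)" using tau_bounds[OF n] G1_pos by auto
 have "IG (\<lambda>_. 1) n = (\<Sum>m\<in>I. orb (\<tau> n) m * IG (\<lambda>_. 1) m)"
  by (simp add: orb_dot[OF n])
 also have "\<dots> = expectation (\<lambda>om. indicator {\<tau> n..} (Z om)) / G 1 (\<tau> n)"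
  using orb_IG[OF adm_const t(1), of 1] by simp
 also have "expectation (\<lambda>om. indicator {\<tau> n..} (Z om)) = expectation (indicator {om\<in>space Q. \<tau> n <= Z om})"
  by (intro Bochner_Integration.integral_cong) (auto simp: indicator_def)
 also have "\<dots> = prob {om\<in>space Q. \<tau> n <= Z om}" by simp
 also have "\<dots> = prob {om\<in>space Q. \<tau> n < Z om}"
 proof (rule antisym)
  have "prob {om\<in>space Q. \<tau> n <= Z om} <= prob ({om\<in>space Q. \<tau> n < Z om} \<union> {om\<in>space Q. Z om = \<tau> n})"
   by (rule finite_measure_mono) auto
  also have "\<dots> <= prob {om\<in>space Q. \<tau> n < Z om} + prob {om\<in>space Q. Z om = \<tau> n}"
   by (rule measure_Un_le) auto
  finally show "prob {om\<in>space Q. \<tau> n <= Z om} <= prob {om\<in>space Q. \<tau> n < Z om}"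
   using point_prob_0 by simp
 qed (auto intro!: finite_measure_mono)
 finally have "IG (\<lambda>_. 1) n = 1" using t by (simp add: G1_prob)
 then show ?thesis using IG_cmult[of c "\<lambda>_. 1" n] by simp
qed

lemma IG_indicator: "n \<in> I ==> 0 <= h ==> IG (indicator {h..}) n = G n h"
proof -
 assume n: "n \<in> I" and h: "0 <= h"
 have "G n h = (\<Sum>m\<in>I. E h n m * IG (\<lambda>_. 1) m)"
  unfolding G_def by (intro sum.cong refl) (simp only: IG_const mult_1_right)
 also have "\<dots> = IG (\<lambda>z. indicator {h..} z * 1) n" by (rule drift_IG[OF adm_const h n])
 finally show ?thesis by simp
qed

text \<open>Given survival to age \<open>y\<close>, the residual time \<open>Z - y\<close> is
  replaced by \<open>\<Delta> - y\<close>. The mean error is at most \<open>L\<close> times the mean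
  of the deviation of \<open>Z\<close> from \<open>\<Delta>\<close>, and conditioning costs the
  factor \<open>1 / (1 - \<epsilon>)\<close>.\<close>

lemma orb_IG_approx:
 assumes L: "!!x y. \<bar>g x - g y\<bar> <= L * \<bar>x - y\<bar>" and y: "0 <= y" "y <= \<Delta> - \<epsilon>"
 shows "\<bar>(\<Sum>m\<in>I. orb y m * IG g m) - g (\<Delta> - y)\<bar> <= L * \<epsilon> / (1 - \<epsilon>)"
proof -
 have L0: "0 <= L" using L[of 1 0] by (auto intro: order_trans[OF abs_ge_zero])
 have adm: "adm g" by (rule adm_lipschitz[OF L])
 note [measurable] = adm_borel[OF adm]
 have "(\<Sum>m\<in>I. orb y m * IG g m) - g (\<Delta> - y) = (\<Sum>m\<in>I. orb y m * IG (\<lambda>z. g z - g (\<Delta> - y)) m)"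
  using orb_sum[OF G1_pos[OF y]] adm
  by (simp add: IG_diff IG_const right_diff_distrib sum_subtractf sum_distrib_right[symmetric])
 also have "\<dots> = expectation (\<lambda>om. indicator {y..} (Z om) * (g (Z om - y) - g (\<Delta> - y))) / G 1 y"
  by (rule orb_IG[OF _ y(1)]) (intro adm_diff adm adm_const)
 also have "\<bar>\<dots>\<bar> <= (L * \<epsilon>) / (1 - \<epsilon>)"
 proof -
  have "\<bar>expectation (\<lambda>om. indicator {y..} (Z om) * (g (Z om - y) - g (\<Delta> - y)))\<bar> <= expectation (\<lambda>om. L * \<bar>Z om - \<Delta>\<bar>)"
  proof (rule order_trans[OF integral_abs_bound integral_mono'])
   show "integrable Q (\<lambda>om. L * \<bar>Z om - \<Delta>\<bar>)" using abs_dev_integrable by simp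
   show "\<bar>indicator {y..} (Z om) * (g (Z om - y) - g (\<Delta> - y))\<bar> <= L * \<bar>Z om - \<Delta>\<bar>" for om
    using L[of "Z om - y" "\<Delta> - y"] L0 by (auto simp: indicator_def)
  qed (use L0 in auto)
  also have "\<dots> <= L * \<epsilon>" using abs_dev_le L0 by (simp add: mult_left_mono)
  finally show ?thesis
   using G1_lower[OF y] eps_bounds L0 by (simp add: abs_divide frac_le)
 qed
 finally show ?thesis by simp
qed

text \<open>Position 1 is age 0, so no conditioning enters and the factor
  \<open>1 / (1 - \<epsilon>)\<close> disappears.\<close>

lemma IG_1_approx:
 assumes L: "!!x y. \<bar>g x - g y\<bar> <= L * \<bar>x - y\<bar>"
 shows "\<bar>IG g 1 - g \<Delta>\<bar> <= L * \<epsilon>"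
proof -
 have L0: "0 <= L" using L[of 1 0] by (auto intro: order_trans[OF abs_ge_zero])
 have adm: "adm g" by (rule adm_lipschitz[OF L])
 have "IG g 1 - g \<Delta> = expectation (\<lambda>om. g (Z om) - g \<Delta>)"
  using IG_1[OF adm_diff[OF adm adm_const[of "g \<Delta>"]]] adm q_pos by (simp add: IG_diff IG_const)
 also have "\<bar>\<dots>\<bar> <= expectation (\<lambda>om. L * \<bar>Z om - \<Delta>\<bar>)"
 proof (rule order_trans[OF integral_abs_bound integral_mono'])
  show "integrable Q (\<lambda>om. L * \<bar>Z om - \<Delta>\<bar>)" using abs_dev_integrable by simp
 qed (use L L0 in auto)
 also have "\<dots> <= L * \<epsilon>" using abs_dev_le L0 by (simp add: mult_left_mono)
 finally show ?thesis .
qed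

lemma IG_unit_approx:
 assumes L: "!!x y. \<bar>g x - g y\<bar> <= L * \<bar>x - y\<bar>" and n: "n \<in> I"
 shows "\<bar>IG g n - g (\<Delta> - \<tau> n)\<bar> <= L * \<epsilon> / (1 - \<epsilon>)"
proof -
 have "IG g n = (\<Sum>m\<in>I. orb (\<tau> n) m * IG g m)"
  by (simp add: orb_dot[OF n])
 then show ?thesis using orb_IG_approx[OF L, of "\<tau> n"] tau_bounds[OF n] by simp
qed

text \<open>Markov's inequality: \<open>x\<close> times the probability of exceeding
  \<open>x\<close> is at most \<open>\<epsilon> + \<Delta>\<close>. The other positions are shifts
  of position 1.\<close>

lemma G_tendsto_0: "n \<in> I ==> (G n \<longlongrightarrow> 0) at_top"
proof -
 assume n: "n \<in> I"
 have G1: "(G 1 \<longlongrightarrow> 0) at_top"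
 proof (rule tendsto_sandwich[of "\<lambda>_. 0" _ _ "\<lambda>x. (\<epsilon> + \<Delta>) / x"])
  show "\<forall>\<^sub>F x in at_top. 0 <= G 1 x"
   using eventually_ge_at_top[of "0::real"] by eventually_elim (simp add: G1_prob[symmetric])
  show "\<forall>\<^sub>F x in at_top. G 1 x <= (\<epsilon> + \<Delta>) / x"
   using eventually_gt_at_top[of "0::real"]
  proof eventually_elim
   case (elim x)
   have "expectation (\<lambda>om. x * indicator {om\<in>space Q. x < Z om} om) <= expectation (\<lambda>om. \<bar>Z om - \<Delta>\<bar> + \<Delta>)"
    by (rule integral_mono') (use abs_dev_integrable elim \<Delta>_pos in \<open>auto simp: indicator_def\<close>)
   also have "\<dots> <= \<epsilon> + \<Delta>" using abs_dev_integrable abs_dev_le prob_space by simp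
   finally show ?case using elim by (simp add: G1_prob field_simps)
  qed
  show "((\<lambda>x. (\<epsilon> + \<Delta>) / x) \<longlongrightarrow> 0) at_top"
   by (rule tendsto_divide_0[OF tendsto_const filterlim_at_top_imp_at_infinity[OF filterlim_ident]])
 qed simp
 have "((\<lambda>x. G 1 (\<tau> n + x) / G 1 (\<tau> n)) \<longlongrightarrow> 0 / G 1 (\<tau> n)) at_top"
  by (intro tendsto_divide tendsto_const filterlim_compose[OF G1] filterlim_tendsto_add_at_top[OF tendsto_const filterlim_ident])
    (use tau_bounds[OF n] G1_pos[of "\<tau> n"] in auto)
 moreover have "\<forall>\<^sub>F x in at_top. G 1 (\<tau> n + x) / G 1 (\<tau> n) = G n x"
  using eventually_ge_at_top[of "0::real"] by eventually_elim (simp add: G_eq_shift[OF n])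
 ultimately show ?thesis by (auto elim: Lim_transform_eventually)
qed

lemma G_dot_bounds:
 assumes "cone a" "0 <= z"
 shows "0 <= (\<Sum>n\<in>I. a n * G n z)" "(\<Sum>n\<in>I. a n * G n z) <= (\<Sum>n\<in>I. a n)"
proof -
 have eq: "(\<Sum>n\<in>I. a n * G n z) = (\<Sum>n\<in>I. a n * IG (indicator {z..}) n)"
  by (intro sum.cong refl) (simp add: IG_indicator assms)
 have adm: "adm (indicator {z..})" by (rule adm_bounded[of _ 1]) (auto simp: indicator_def)
 have "(\<Sum>n\<in>I. a n * IG (\<lambda>_. 0) n) <= (\<Sum>n\<in>I. a n * IG (indicator {z..}) n)"
  by (rule IG_mono) (use adm assms in auto)
 then show "0 <= (\<Sum>n\<in>I. a n * G n z)" by (simp add: eq IG_const)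
 have "(\<Sum>n\<in>I. a n * IG (indicator {z..}) n) <= (\<Sum>n\<in>I. a n * IG (\<lambda>_. 1) n)"
  by (rule IG_mono) (use adm assms in \<open>auto simp: indicator_def\<close>)
 then show "(\<Sum>n\<in>I. a n * G n z) <= (\<Sum>n\<in>I. a n)" by (simp add: eq IG_const)
qed

lemma cone_sum_nonneg: "cone a ==> 0 <= (\<Sum>n\<in>I. a n)"
 using G_dot_bounds(1)[of a 0] by (simp add: G_0)

text \<open>For each \<open>z\<close> the pairing of an orbit in \<open>cone\<close> with the column
  \<open>G _ z\<close> lies between 0 and its total mass. These columns span because the survival
  functions are independent, so single entries are controlled as well, with a constant that depends
  on the scheme.\<close>

lemma cone_bounded:
 obtains C where "0 <= C" "!!a n. cone a ==> n \<in> I ==> \<bar>a n\<bar> <= C * (\<Sum>n\<in>I. a n)"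
proof -
 define U where "U = {u. \<exists>C\<ge>0. \<forall>a. cone a \<longrightarrow> \<bar>\<Sum>n\<in>I. a n * u n\<bar> <= C * (\<Sum>n\<in>I. a n)}"
 have GU: "(\<lambda>n. G n z) \<in> U" if "0 <= z" for z
  unfolding U_def using G_dot_bounds[OF _ that] by (auto intro!: exI[of _ 1])
 have "unit_vec n \<in> U" if "n \<in> I" for n
 proof (rule unit_vec_in_separating_subspace[of I])
  fix u v :: "nat => real" and x :: real
  show "(\<lambda>n. u n + v n) \<in> U" if "u \<in> U" "v \<in> U"
  proof -
   from that obtain C C' where *: "0 <= C" "\<forall>a. cone a \<longrightarrow> \<bar>\<Sum>n\<in>I. a n * u n\<bar> <= C * (\<Sum>n\<in>I. a n)"
    "0 <= C'" "\<forall>a. cone a \<longrightarrow> \<bar>\<Sum>n\<in>I. a n * v n\<bar> <= C' * (\<Sum>n\<in>I. a n)" by (auto simp: U_def)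
   have "\<bar>\<Sum>n\<in>I. a n * (u n + v n)\<bar> <= (C + C') * (\<Sum>n\<in>I. a n)" if "cone a" for a
   proof -
    have "\<bar>\<Sum>n\<in>I. a n * (u n + v n)\<bar> <= \<bar>\<Sum>n\<in>I. a n * u n\<bar> + \<bar>\<Sum>n\<in>I. a n * v n\<bar>"
     by (simp add: distrib_left sum.distrib)
    then show ?thesis using * that by (fastforce simp: distrib_right)
   qed
   then show ?thesis using *(1,3) by (auto simp: U_def intro!: exI[of _ "C + C'"])
  qed
  show "(\<lambda>n. x * u n) \<in> U" if "u \<in> U"
  proof -
   from that obtain C where *: "0 <= C" "\<forall>a. cone a \<longrightarrow> \<bar>\<Sum>n\<in>I. a n * u n\<bar> <= C * (\<Sum>n\<in>I. a n)"
    by (auto simp: U_def)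
   have "\<bar>\<Sum>n\<in>I. a n * (x * u n)\<bar> <= (\<bar>x\<bar> * C) * (\<Sum>n\<in>I. a n)" if "cone a" for a
   proof -
    have "(\<Sum>n\<in>I. a n * (x * u n)) = x * (\<Sum>n\<in>I. a n * u n)" by (simp add: sum_distrib_left mult_ac)
    then show ?thesis using *(2) that by (simp add: abs_mult mult_left_mono mult.assoc)
   qed
   then show ?thesis using *(1) by (auto simp: U_def intro!: exI[of _ "\<bar>x\<bar> * C"])
  qed
  show "v \<in> U" if "u \<in> U" "!!n. n \<in> I ==> u n = v n"
  proof -
   have "(\<Sum>n\<in>I. a n * u n) = (\<Sum>n\<in>I. a n * v n)" for a
    by (intro sum.cong refl) (simp only: that(2))
   then show ?thesis using that(1) by (simp add: U_def)
  qed
 next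
  fix a assume "!!u. u \<in> U ==> (\<Sum>n\<in>I. a n * u n) = 0"
  then show "\<forall>n\<in>I. a n = 0" using lin_indep[of a] GU by blast
 qed (use that in auto)
 have "\<exists>C\<ge>0. \<forall>a. cone a \<longrightarrow> \<bar>a n\<bar> <= C * (\<Sum>n\<in>I. a n)" if "n \<in> I" for n
 proof -
  have "(\<Sum>m\<in>I. a m * unit_vec n m) = a n" for a
   using unit_dot[OF that, of a] by (simp add: mult.commute)
  then show ?thesis using \<open>!!n. n \<in> I ==> unit_vec n \<in> U\<close>[OF that] by (simp add: U_def)
 qed
 then obtain C where C: "!!n. n \<in> I ==> 0 <= C n" "!!n a. n \<in> I ==> cone a ==> \<bar>a n\<bar> <= C n * (\<Sum>n\<in>I. a n)"
  by metis
 show ?thesis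
 proof (rule that[of "\<Sum>n\<in>I. C n"])
  show "0 <= (\<Sum>n\<in>I. C n)" using C(1) by (rule sum_nonneg)
  fix a n assume a: "cone a" "n \<in> I"
  have "\<bar>a n\<bar> <= C n * (\<Sum>n\<in>I. a n)" by (rule C(2)[OF a(2,1)])
  also have "\<dots> <= (\<Sum>n\<in>I. C n) * (\<Sum>n\<in>I. a n)"
   by (intro mult_right_mono member_le_sum C cone_sum_nonneg) (use a C in auto)
  finally show "\<bar>a n\<bar> <= (\<Sum>n\<in>I. C n) * (\<Sum>n\<in>I. a n)" .
 qed
qed

end

lemma mat_mul_assoc: "mat_mul I (mat_mul I A B) C = mat_mul I A (mat_mul I B C)"
proof (intro ext)
 fix i j
 have "mat_mul I (mat_mul I A B) C i j = (\<Sum>k\<in>I. \<Sum>l\<in>I. A i l * (B l k * C k j))"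
  by (simp add: mat_mul_def sum_distrib_right mult.assoc)
 also have "\<dots> = mat_mul I A (mat_mul I B C) i j"
  by (subst sum.swap) (simp add: mat_mul_def sum_distrib_left)
 finally show "mat_mul I (mat_mul I A B) C i j = mat_mul I A (mat_mul I B C) i j" .
qed

context me_scheme begin

lemma rho_sum: "rho (vec_mat I a A) z = (\<Sum>n\<in>I. a n * (\<Sum>m\<in>I. A n m * r m z))"
proof -
 have "rho (vec_mat I a A) z = (\<Sum>n\<in>I. \<Sum>m\<in>I. a m * (A m n * r n z))"
  by (simp add: rho_def vec_mat_def sum_distrib_right mult.assoc)
 then show ?thesis by (subst (asm) sum.swap) (simp add: sum_distrib_left)
qed

lemma vec_mat_dot: "(\<Sum>m\<in>I. vec_mat I a A m * w m) = (\<Sum>n\<in>I. a n * (\<Sum>m\<in>I. A n m * w m))"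
proof -
 have "(\<Sum>m\<in>I. vec_mat I a A m * w m) = (\<Sum>m\<in>I. \<Sum>n\<in>I. a n * (A n m * w m))"
  by (simp add: vec_mat_def sum_distrib_right mult.assoc)
 then show ?thesis by (subst (asm) sum.swap) (simp add: sum_distrib_left)
qed

lemma IG_nonneg: "adm g ==> cone a ==> (!!z. 0 <= z ==> 0 <= g z) ==> 0 <= (\<Sum>n\<in>I. a n * IG g n)"
 using IG_mono[of "\<lambda>_. 0" g a] by (simp add: IG_const)

lemma IG_const_dot: "(\<Sum>n\<in>I. a n * IG (\<lambda>_. e) n) = e * (\<Sum>n\<in>I. a n)"
proof -
 have "(\<Sum>n\<in>I. a n * IG (\<lambda>_. e) n) = (\<Sum>n\<in>I. a n * e)"
  by (intro sum.cong refl) (simp only: IG_const)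
 then show ?thesis by (simp add: sum_distrib_left mult.commute)
qed

lemma IG_abs_le:
 assumes "adm g" "adm h" "cone a" "!!z. 0 <= z ==> \<bar>g z\<bar> <= h z"
 shows "\<bar>\<Sum>n\<in>I. a n * IG g n\<bar> <= (\<Sum>n\<in>I. a n * IG h n)"
proof -
 have "(\<Sum>n\<in>I. a n * IG g n) <= (\<Sum>n\<in>I. a n * IG h n)"
  by (rule IG_mono) (use assms in \<open>auto intro: order_trans[OF abs_ge_self]\<close>)
 moreover have "(\<Sum>n\<in>I. a n * IG (\<lambda>z. (-1) * g z) n) <= (\<Sum>n\<in>I. a n * IG h n)"
  by (rule IG_mono) (use assms in \<open>auto intro: adm_cmult[of g "-1", simplified] order_trans[OF abs_ge_minus_self]\<close>)
 ultimately show ?thesis unfolding IG_cmult by (simp add: sum_negf)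
qed

section \<open>The matrix applied at changes of direction\<close>

abbreviation "D \<equiv> D_mat \<Delta> \<epsilon> q \<alpha> S"
abbreviation "trunc (y::real) \<equiv> min y (\<Delta> - \<epsilon>)"

lemma orb_borel [measurable]: "m \<in> I ==> (\<lambda>y. orb y m) \<in> borel_measurable borel"
proof -
 assume m: "m \<in> I"
 have [measurable]: "(\<lambda>y. E y 1 m) \<in> borel_measurable borel"
  by (rule borel_measurable_continuous_onI) (use m q_pos in \<open>auto intro: mat_exp_continuous\<close>)
 have [measurable]: "G 1 \<in> borel_measurable borel" using G_borel[OF q_pos] .
 show ?thesis unfolding orb_def by measurable
qed

lemma adm_orb: "m \<in> I ==> adm (\<lambda>y. orb (trunc y) m)"
proof -
 assume m: "m \<in> I"
 have "continuous_on {0..\<Delta> - \<epsilon>} (\<lambda>y. orb y m)"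
  unfolding orb_def using m q_pos G1_pos
  by (intro continuous_intros mat_exp_continuous G_cont) (auto simp: less_le)
 then have "compact ((\<lambda>y. orb y m) ` {0..\<Delta> - \<epsilon>})"
  by (rule compact_continuous_image) simp
 then have "bounded ((\<lambda>y. orb y m) ` {0..\<Delta> - \<epsilon>})" by (rule compact_imp_bounded)
 then obtain C where C: "\<forall>y\<in>{0..\<Delta> - \<epsilon>}. \<bar>orb y m\<bar> <= C"
  by (auto simp: bounded_iff)
 show ?thesis
 proof (rule adm_bounded)
  show "(\<lambda>y. orb (trunc y) m) \<in> borel_measurable borel"
   using measurable_compose[OF _ orb_borel[OF m], of trunc borel] by simp
  show "\<bar>orb (trunc z) m\<bar> <= C" if "0 <= z" for z
   using C[rule_format, of "trunc z"] that eps_bounds by auto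
 qed
qed

text \<open>The first integral in \<open>D_mat\<close> follows the orbit up to age
  \<open>\<Delta> - \<epsilon>\<close>, the second freezes it there; the common endpoint is a null
  set. With \<open>trunc\<close> they are one integral against the residual density.\<close>

lemma D_entry: "n \<in> I ==> m \<in> I ==> D n m = IG (\<lambda>y. orb (trunc y) m) n"
proof -
 assume n: "n \<in> I" and m: "m \<in> I"
 let ?f = "\<lambda>y. r n y * orb (trunc y) m"
 have int: "set_integrable lborel {0..} ?f" by (rule r_adm_integrable[OF adm_orb[OF m] n])
 have int1: "set_integrable lborel {0..\<Delta> - \<epsilon>} ?f" and int2: "set_integrable lborel {\<Delta> - \<epsilon><..} ?f"
  by (rule set_integrable_subset[OF int]; use eps_bounds in force)+
 have D: "D n m = (LINT y:{0..\<Delta> - \<epsilon>}|lborel. r n y * orb y m) + (LINT y:{\<Delta> - \<epsilon>..}|lborel. r n y * orb (\<Delta> - \<epsilon>) m)"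
  unfolding D_mat_def orbit_num_eq me_survival_eq r_def orb_def ..
 have 1: "(LINT y:{0..\<Delta> - \<epsilon>}|lborel. r n y * orb y m) = (LINT y:{0..\<Delta> - \<epsilon>}|lborel. ?f y)"
  by (rule set_lebesgue_integral_cong) auto
 have "(LINT y:{\<Delta> - \<epsilon>..}|lborel. r n y * orb (\<Delta> - \<epsilon>) m) = (LINT y:{\<Delta> - \<epsilon><..}|lborel. ?f y)"
  unfolding set_lebesgue_integral_def
 proof (rule integral_cong_AE)
  show "AE y in lborel. indicator {\<Delta> - \<epsilon>..} y *\<^sub>R (r n y * orb (\<Delta> - \<epsilon>) m) = indicator {\<Delta> - \<epsilon><..} y *\<^sub>R ?f y"
   using AE_lborel_singleton[of "\<Delta> - \<epsilon>"] by eventually_elim (auto simp: indicator_def)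
 qed (use r_borel[OF n] adm_borel[OF adm_orb[OF m]] in simp_all)
 then have "D n m = (LINT y:{0..\<Delta> - \<epsilon>} \<union> {\<Delta> - \<epsilon><..}|lborel. ?f y)"
  unfolding D 1 by (subst set_integral_Un[OF _ int1 int2]) auto
 also have "{0..\<Delta> - \<epsilon>} \<union> {\<Delta> - \<epsilon><..} = {0..}" using eps_bounds by auto
 finally show ?thesis by (simp add: IG_def)
qed

lemma D_dot: "n \<in> I ==> (\<Sum>m\<in>I. D n m * w m) = IG (\<lambda>y. \<Sum>m\<in>I. orb (trunc y) m * w m) n"
proof -
 assume n: "n \<in> I"
 have "(\<Sum>m\<in>I. D n m * w m) = (\<Sum>m\<in>I. IG (\<lambda>y. w m * orb (trunc y) m) n)"
  by (intro sum.cong refl) (simp add: D_entry[OF n] IG_cmult)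
 also have "\<dots> = IG (\<lambda>y. \<Sum>m\<in>I. w m * orb (trunc y) m) n"
  by (rule IG_sum[symmetric]) (use n adm_orb adm_cmult in auto)
 finally show ?thesis by (simp add: mult.commute)
qed

lemma adm_orb_dot: "adm (\<lambda>y. \<Sum>m\<in>I. orb (trunc y) m * w m)"
 by (rule adm_sum) (use adm_orb adm_cmult in \<open>auto simp: mult.commute[of _ "w _"]\<close>)

lemma cut_bounds: "0 <= y ==> 0 <= trunc y" "trunc y <= \<Delta> - \<epsilon>"
 using eps_bounds by auto

text \<open>After a change of direction the orbit is a mixture of the orbits
  \<open>orb (trunc y)\<close> with weights \<open>rho a y\<close>. The weights are nonnegative, and
  the cut at \<open>\<Delta> - \<epsilon>\<close> keeps the mixed orbits where \<open>G 1\<close> is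
  positive.\<close>

lemma cone_D: "cone a ==> cone (vec_mat I a D)"
 unfolding cone_def
proof (intro allI impI)
 fix z :: real assume a: "\<forall>z\<ge>0. 0 <= rho a z" and z: "0 <= z"
 have "rho (vec_mat I a D) z = (\<Sum>n\<in>I. a n * IG (\<lambda>y. \<Sum>m\<in>I. orb (trunc y) m * r m z) n)"
  unfolding rho_sum by (intro sum.cong refl) (simp add: D_dot)
 also have "0 <= \<dots>"
 proof (rule IG_nonneg[OF adm_orb_dot])
  show "cone a" using a by (simp add: cone_def)
  show "0 <= (\<Sum>m\<in>I. orb (trunc y) m * r m z)" if "0 <= y" for y
   using cone_orb[OF cut_bounds(1)[OF that] cut_bounds(2)] z by (simp add: cone_def rho_def)
 qed
 finally show "0 <= rho (vec_mat I a D) z" .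
qed

lemma D_row_sum: "n \<in> I ==> (\<Sum>m\<in>I. D n m) = 1"
proof -
 assume n: "n \<in> I"
 have "(\<Sum>m\<in>I. D n m * 1) = IG (\<lambda>y. \<Sum>m\<in>I. orb (trunc y) m * 1) n" by (rule D_dot[OF n])
 also have "\<dots> = IG (\<lambda>_. 1) n"
  by (rule IG_cong) (use orb_sum G1_pos cut_bounds in auto)
 finally show ?thesis using IG_const[OF n] by simp
qed

text \<open>Residual time beyond the cell length. It has no counterpart in the fluid queue and is
  the way a bad orbit enters the errors of \<open>D\<close> and of the closing operator.\<close>

definition excess :: "real => real" where "excess z = max 0 (z - \<Delta>)"

lemma excess_lipschitz: "\<bar>excess x - excess y\<bar> <= 1 * \<bar>x - y\<bar>"
 by (auto simp: excess_def)

lemma adm_excess: "adm excess"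
 by (rule adm_lipschitz) (rule excess_lipschitz)

lemma excess_nonneg: "0 <= excess z" by (simp add: excess_def)

lemma IG_excess_1: "IG excess 1 <= \<epsilon>"
 using IG_1_approx[of excess 1, OF excess_lipschitz] by (simp add: excess_def)

lemma IG_excess: "n \<in> I ==> IG excess n <= \<epsilon> / (1 - \<epsilon>)"
 using IG_unit_approx[of excess 1 n, OF excess_lipschitz] tau_bounds[of n] by (simp add: excess_def)

text \<open>A change of direction restarts from age \<open>trunc y\<close>, where the residual time
  is close to \<open>\<Delta> - trunc y\<close>, which is below \<open>\<Delta>\<close>. The
  previous excess is forgotten, so it cannot accumulate.\<close>

lemma D_excess:
 assumes "cone a"
 shows "(\<Sum>n\<in>I. a n * (\<Sum>m\<in>I. D n m * IG excess m)) <= \<epsilon> / (1 - \<epsilon>) * (\<Sum>n\<in>I. a n)"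
proof -
 have "(\<Sum>n\<in>I. a n * (\<Sum>m\<in>I. D n m * IG excess m))
   = (\<Sum>n\<in>I. a n * IG (\<lambda>y. \<Sum>m\<in>I. orb (trunc y) m * IG excess m) n)"
  by (intro sum.cong refl) (simp add: D_dot)
 also have "\<dots> <= (\<Sum>n\<in>I. a n * IG (\<lambda>_. \<epsilon> / (1 - \<epsilon>)) n)"
 proof (rule IG_mono[OF adm_orb_dot adm_const assms])
  fix z :: real assume z: "0 <= z"
  have "excess (\<Delta> - trunc z) = 0" using z eps_bounds by (simp add: excess_def)
  then show "(\<Sum>m\<in>I. orb (trunc z) m * IG excess m) <= \<epsilon> / (1 - \<epsilon>)"
   using orb_IG_approx[of excess 1 "trunc z", OF excess_lipschitz cut_bounds(1)[OF z] cut_bounds(2)] by simp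
 qed
 also have "\<dots> = \<epsilon> / (1 - \<epsilon>) * (\<Sum>n\<in>I. a n)"
  by (rule IG_const_dot)
 finally show ?thesis .
qed

text \<open>A change of direction turns the residual time \<open>z\<close> into approximately \<open>\<Delta> - z\<close>.\<close>

lemma D_approx:
 assumes L: "!!x y. \<bar>g x - g y\<bar> <= L * \<bar>x - y\<bar>" and a: "cone a"
 shows "\<bar>\<Sum>n\<in>I. a n * ((\<Sum>m\<in>I. D n m * IG g m) - IG (\<lambda>z. g (\<Delta> - z)) n)\<bar>
   <= L * (\<epsilon> / (1 - \<epsilon>) + \<epsilon>) * (\<Sum>n\<in>I. a n) + L * (\<Sum>n\<in>I. a n * IG excess n)"
proof -
 have L0: "0 <= L" using L[of 1 0] by (auto intro: order_trans[OF abs_ge_zero])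
 let ?e = "L * (\<epsilon> / (1 - \<epsilon>) + \<epsilon>)"
 let ?g = "\<lambda>y. (\<Sum>m\<in>I. orb (trunc y) m * IG g m)"
 have adm: "adm (\<lambda>z. g (\<Delta> - z))"
  by (rule adm_lipschitz[of _ L]) (use L[of "\<Delta> - _" "\<Delta> - _"] in \<open>simp add: abs_minus_commute\<close>)
 have eq: "(\<Sum>n\<in>I. a n * ((\<Sum>m\<in>I. D n m * IG g m) - IG (\<lambda>z. g (\<Delta> - z)) n))
   = (\<Sum>n\<in>I. a n * IG (\<lambda>z. ?g z - g (\<Delta> - z)) n)"
  by (intro sum.cong refl) (simp add: D_dot IG_diff[OF adm_orb_dot adm])
 have "\<bar>\<Sum>n\<in>I. a n * IG (\<lambda>z. ?g z - g (\<Delta> - z)) n\<bar> <= (\<Sum>n\<in>I. a n * IG (\<lambda>z. ?e + L * excess z) n)"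
 proof (rule IG_abs_le[OF adm_diff[OF adm_orb_dot adm] adm_add[OF adm_const adm_cmult[OF adm_excess]] a])
  fix z :: real assume z: "0 <= z"
  have "\<bar>?g z - g (\<Delta> - trunc z)\<bar> <= L * \<epsilon> / (1 - \<epsilon>)"
   by (rule orb_IG_approx[OF L]) (use cut_bounds z in auto)
  \<comment> \<open>Cutting the age at \<open>\<Delta> - \<epsilon>\<close> moves it by at most
    \<open>\<epsilon>\<close> up to \<open>\<Delta>\<close>, and beyond that by the excess in
    addition.\<close>
  moreover have "\<bar>g (\<Delta> - trunc z) - g (\<Delta> - z)\<bar> <= L * (\<epsilon> + excess z)"
   by (rule order_trans[OF L mult_left_mono[OF _ L0]]) (use eps_bounds in \<open>auto simp: excess_def\<close>)
  ultimately show "\<bar>?g z - g (\<Delta> - z)\<bar> <= ?e + L * excess z"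
   by (simp add: algebra_simps)
 qed
 also have "\<dots> = (\<Sum>n\<in>I. a n * (?e + L * IG excess n))"
  by (intro sum.cong refl) (simp add: IG_add adm_cmult adm_excess IG_const IG_cmult)
 also have "\<dots> = ?e * (\<Sum>n\<in>I. a n) + L * (\<Sum>n\<in>I. a n * IG excess n)"
 proof -
  have "(\<Sum>n\<in>I. a n * (e + L * X n)) = e * (\<Sum>n\<in>I. a n) + L * (\<Sum>n\<in>I. a n * X n)" for e X
   by (simp add: distrib_left sum.distrib sum_distrib_left mult_ac)
  then show ?thesis .
 qed
 finally show ?thesis unfolding eq .
qed

section \<open>Short time estimates\<close>

lemma G_taylor:
 obtains C where "0 <= C" "!!h n. [|0 <= h; h <= 1; n \<in> I|] ==> \<bar>1 - G n h - h * s n\<bar> <= C * h\<^sup>2"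
proof -
 obtain C where C: "0 <= C"
  "!!h i j. [|\<bar>h\<bar> <= 1; i \<in> I; j \<in> I|] ==> \<bar>E h i j - mat_one i j - h * S i j\<bar> <= C * h\<^sup>2"
  using mat_exp_taylor[of I S] by blast
 show ?thesis
 proof (rule that[of "real q * C"])
  show "0 <= real q * C" using C by simp
  fix h :: real and n assume h: "0 <= h" "h <= 1" and n: "n \<in> I"
  have eq: "1 - G n h - h * s n = - (\<Sum>m\<in>I. E h n m - mat_one n m - h * S n m)"
   using sum_mat_one_left[of I n "\<lambda>_. 1"] n
   by (simp add: G_def exit_vec_def mat_vec_def ones_def sum_subtractf sum_distrib_left)
  have "\<bar>1 - G n h - h * s n\<bar> <= (\<Sum>m\<in>I. \<bar>E h n m - mat_one n m - h * S n m\<bar>)"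
   unfolding eq abs_minus_cancel by (rule sum_abs)
  also have "\<dots> <= (\<Sum>m\<in>I. C * h\<^sup>2)"
   by (intro sum_mono C) (use h n in auto)
  finally show "\<bar>1 - G n h - h * s n\<bar> <= real q * C * h\<^sup>2" by simp
 qed
qed

lemma IG_initial_indicator: "n \<in> I ==> 0 <= h ==> IG (indicator {..<h}) n = 1 - G n h"
proof -
 assume n: "n \<in> I" and h: "0 <= h"
 have a: "adm (indicator {h..})" by (rule adm_bounded[of _ 1]) (auto simp: indicator_def)
 have "IG (indicator {..<h}) n = IG (\<lambda>z. 1 - indicator {h..} z) n"
  by (rule IG_cong) (auto simp: indicator_def)
 then show ?thesis using n h a by (simp add: IG_diff IG_const IG_indicator)
qed

text \<open>The residual time is below \<open>h\<close> with probability \<open>h * s n\<close> up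
  to second order, and there \<open>g\<close> is within \<open>L * h\<close> of \<open>g0\<close>.
  The constant is fixed before \<open>g\<close>, so one constant serves all iterates of the Euler
  scheme.\<close>

lemma short_time:
 obtains C where "0 <= C"
  "!!g h g0 B L n. [|0 <= h; h <= 1; n \<in> I; adm g; !!z. 0 <= z ==> z < h ==> \<bar>g z - g0\<bar> <= L * h; \<bar>g0\<bar> <= B; 0 <= L|]
    ==> \<bar>IG (\<lambda>z. indicator {..<h} z * g z) n - h * s n * g0\<bar> <= C * (B + L) * h\<^sup>2"
proof -
 obtain C where C: "0 <= C" "!!h n. [|0 <= h; h <= 1; n \<in> I|] ==> \<bar>1 - G n h - h * s n\<bar> <= C * h\<^sup>2"
  using G_taylor by blast
 define C' where "C' = C + (\<Sum>n\<in>I. \<bar>s n\<bar>)"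
 have sC: "\<bar>s n\<bar> + C <= C'" if "n \<in> I" for n
  unfolding C'_def using that member_le_sum[of n I "\<lambda>n. \<bar>s n\<bar>"] by simp
 have C'0: "0 <= C'" unfolding C'_def using C by (simp add: sum_nonneg)
 show ?thesis
 proof (rule that[OF C'0])
  fix g :: "real => real" and h g0 B L :: real and n
  assume h: "0 <= h" "h <= 1" and n: "n \<in> I" and g: "adm g" "!!z. 0 <= z ==> z < h ==> \<bar>g z - g0\<bar> <= L * h"
   and g0: "\<bar>g0\<bar> <= B" and L: "0 <= L"
  have a: "adm (indicator {..<h})" by (rule adm_bounded[of _ 1]) (auto simp: indicator_def)
  have a2: "adm (\<lambda>z. indicator {..<h} z * (g z - g0))"
   using adm_borel[OF g(1)] g(2) L h
   by (intro adm_bounded[of _ "L * h"]) (auto simp: indicator_def)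
  have "IG (\<lambda>z. indicator {..<h} z * g z) n = IG (\<lambda>z. g0 * indicator {..<h} z + indicator {..<h} z * (g z - g0)) n"
   by (rule IG_cong) (auto simp: algebra_simps)
  also have "\<dots> = g0 * (1 - G n h) + IG (\<lambda>z. indicator {..<h} z * (g z - g0)) n"
   using a a2 n h by (simp add: IG_add adm_cmult IG_cmult IG_initial_indicator)
  finally have 1: "IG (\<lambda>z. indicator {..<h} z * g z) n = g0 * (1 - G n h) + IG (\<lambda>z. indicator {..<h} z * (g z - g0)) n" .
  have "\<bar>IG (\<lambda>z. indicator {..<h} z * (g z - g0)) n\<bar> <= IG (\<lambda>z. (L * h) * indicator {..<h} z) n"
   using IG_abs_le[OF a2 adm_cmult[OF a] cone_unit[OF n], of "L * h"] g(2) L h n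
   by (auto simp: indicator_def unit_dot)
  also have "\<dots> = L * h * (1 - G n h)" using n h by (simp add: IG_cmult IG_initial_indicator)
  also have "\<dots> <= L * h * ((\<bar>s n\<bar> + C) * h)"
  proof (intro mult_left_mono)
   have "1 - G n h <= h * s n + C * h\<^sup>2" using C(2)[OF h n] by simp
   also have "\<dots> <= h * \<bar>s n\<bar> + C * h"
    using h C(1) by (intro add_mono mult_left_mono) (auto simp: power2_eq_square mult_left_le)
   finally show "1 - G n h <= (\<bar>s n\<bar> + C) * h" by (simp add: algebra_simps)
  qed (use L h in auto)
  also have "\<dots> <= L * h * (C' * h)"
   using sC[OF n] L h by (intro mult_left_mono mult_right_mono) auto
  finally have 2: "\<bar>IG (\<lambda>z. indicator {..<h} z * (g z - g0)) n\<bar> <= C' * L * h\<^sup>2"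
   by (simp add: power2_eq_square mult_ac)
  have "\<bar>g0 * (1 - G n h) - h * s n * g0\<bar> = \<bar>g0\<bar> * \<bar>1 - G n h - h * s n\<bar>"
   by (simp add: abs_mult[symmetric] algebra_simps)
  also have "\<dots> <= B * (C * h\<^sup>2)" using C(2)[OF h n] g0 by (intro mult_mono) auto
  also have "\<dots> <= B * (C' * h\<^sup>2)"
   using sC[OF n] g0 by (intro mult_left_mono mult_right_mono) auto
  finally have "\<bar>g0 * (1 - G n h) - h * s n * g0\<bar> <= C' * B * h\<^sup>2" by (simp add: mult_ac)
  with 1 2 show "\<bar>IG (\<lambda>z. indicator {..<h} z * g z) n - h * s n * g0\<bar> <= C' * (B + L) * h\<^sup>2"
   by (simp add: algebra_simps)
 qed
qed

section \<open>The closing vector\<close>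

text \<open>Reflection of the half line onto \<open>[0, \<Delta>]\<close>: even and \<open>2\<Delta>\<close>-periodic.\<close>

definition reflect :: "real => real" where
 "reflect z = \<Delta> / pi * arccos (cos (pi * z / \<Delta>))"

lemma reflect_id: "0 <= z ==> z <= \<Delta> ==> reflect z = z"
 using \<Delta>_pos by (simp add: reflect_def arccos_cos field_simps)

lemma reflect_periodic: "reflect (z + 2 * \<Delta>) = reflect z"
proof -
 have "pi * (z + 2 * \<Delta>) / \<Delta> = pi * z / \<Delta> + 2 * pi" using \<Delta>_pos by (simp add: field_simps)
 then show ?thesis by (simp add: reflect_def)
qed

lemma reflect_minus: "reflect (- z) = reflect z"
 by (simp add: reflect_def)

lemma reflect_even: "reflect (2 * \<Delta> - z) = reflect z"
 using reflect_periodic[of "- z"] by (simp add: reflect_minus)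

lemma reflect_bounds: "0 <= reflect z" "reflect z <= \<Delta>"
 using \<Delta>_pos arccos_lbound[of "cos (pi * z / \<Delta>)"] arccos_ubound[of "cos (pi * z / \<Delta>)"]
 by (auto simp: reflect_def field_simps)

lemma reflect_cont: "continuous_on X reflect"
 unfolding reflect_def using \<Delta>_pos by (intro continuous_intros) auto

text \<open>Up to \<open>\<Delta>\<close> folding changes nothing; up to \<open>2 * \<Delta>\<close>
  it moves \<open>z\<close> by exactly twice the excess; further out the displacement is at most
  \<open>z\<close>, which is then less than twice the excess.\<close>

lemma reflect_dev: "0 <= z ==> \<bar>reflect z - z\<bar> <= 2 * excess z"
proof -
 assume z: "0 <= z"
 consider "z <= \<Delta>" | "\<Delta> <= z" "z <= 2 * \<Delta>" | "2 * \<Delta> < z" by linarith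
 then show ?thesis
 proof cases
  case 2
  then have "reflect z = 2 * \<Delta> - z" using reflect_even[of z] reflect_id[of "2 * \<Delta> - z"] by simp
  then show ?thesis using 2 by (simp add: excess_def)
 next
  case 3
  then show ?thesis using reflect_bounds[of z] \<Delta>_pos by (simp add: excess_def)
 qed (use reflect_id[of z] z in \<open>simp add: excess_def\<close>)
qed

text \<open>On the columns \<open>G _ z\<close> the exponential acts as a shift, so it carries them
  to survival probabilities at infinity; these columns span.\<close>

lemma exp_dot_tendsto_0: "n \<in> I ==> ((\<lambda>x. \<Sum>m\<in>I. E x n m * u m) \<longlongrightarrow> 0) at_top"
proof -
 define U where "U = {u. \<forall>n\<in>I. ((\<lambda>x. \<Sum>m\<in>I. E x n m * u m) \<longlongrightarrow> 0) at_top}"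
 have GU: "(\<lambda>m. G m z) \<in> U" for z
 proof -
  have "((\<lambda>x. G n (x + z)) \<longlongrightarrow> 0) at_top" if "n \<in> I" for n
   by (rule filterlim_compose[OF G_tendsto_0[OF that]])
     (rule filterlim_tendsto_add_at_top[OF tendsto_const filterlim_ident, of z, simplified add.commute])
  then show ?thesis by (simp add: U_def G_add)
 qed
 have unit: "unit_vec n \<in> U" if "n \<in> I" for n
 proof (rule unit_vec_in_separating_subspace[of I])
  fix u v :: "nat => real" and x :: real
  show "(\<lambda>n. u n + v n) \<in> U" if "u \<in> U" "v \<in> U"
   using that tendsto_add[where a=0 and b=0]
   by (fastforce simp: U_def distrib_left sum.distrib)
  show "(\<lambda>n. x * u n) \<in> U" if "u \<in> U"
   using that tendsto_mult_right_zero[where c=x]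
   by (auto simp: U_def mult.left_commute[of _ x] sum_distrib_left[symmetric])
  show "v \<in> U" if "u \<in> U" "!!n. n \<in> I ==> u n = v n"
  proof -
   have "(\<Sum>m\<in>I. E x n m * u m) = (\<Sum>m\<in>I. E x n m * v m)" for x n
    by (intro sum.cong refl) (simp only: that(2))
   then show ?thesis using that(1) by (simp add: U_def)
  qed
 next
  fix a assume "!!u. u \<in> U ==> (\<Sum>n\<in>I. a n * u n) = 0"
  then show "\<forall>n\<in>I. a n = 0" using lin_indep[of a] GU by blast
 qed (use that in auto)
 have "((\<lambda>x. E x n m) \<longlongrightarrow> 0) at_top" if "n \<in> I" "m \<in> I" for n m
 proof -
  have "(\<Sum>k\<in>I. E x n k * unit_vec m k) = E x n m" for x
   using unit_dot[OF that(2), of "E x n"] by (simp add: mult.commute)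
  moreover have "((\<lambda>x. \<Sum>k\<in>I. E x n k * unit_vec m k) \<longlongrightarrow> 0) at_top"
   using unit[OF that(2)] that(1) unfolding U_def by blast
  ultimately show ?thesis by simp
 qed
 then show "n \<in> I ==> ((\<lambda>x. \<Sum>m\<in>I. E x n m * u m) \<longlongrightarrow> 0) at_top"
  by (intro tendsto_null_sum tendsto_mult_left_zero) auto
qed

section \<open>Invertibility of the matrix in the closing vector\<close>

abbreviation "A2 \<equiv> (\<lambda>n m. mat_one n m - E (2 * \<Delta>) n m)"

lemma multiples_at_top: "filterlim (\<lambda>k. real k * (2 * \<Delta>) + x) at_top sequentially"
proof -
 have "filterlim (\<lambda>k. x + real k * (2 * \<Delta>)) at_top sequentially"
  by (intro filterlim_tendsto_add_at_top[OF tendsto_const] filterlim_at_top_mult_tendsto_pos[OF tendsto_const] filterlim_real_sequentially)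
    (use \<Delta>_pos in auto)
 then show ?thesis by (simp add: add.commute)
qed

text \<open>A row fixed by $e^{2 \<Delta> S}$ pairs with the survival functions to a periodic
  function that vanishes at infinity, hence to zero; linear independence finishes.\<close>

lemma A2_left_injective:
 assumes a: "!!m. m \<in> I ==> (\<Sum>n\<in>I. a n * A2 n m) = 0" and "n \<in> I" shows "a n = 0"
proof (rule lin_indep[OF _ assms(2)])
 fix x :: real
 define F where "F = (\<lambda>x. \<Sum>n\<in>I. a n * G n x)"
 have am: "a m = (\<Sum>n\<in>I. a n * E (2 * \<Delta>) n m)" if "m \<in> I" for m
  using a[OF that] that by (simp add: right_diff_distrib sum_subtractf sum_mat_one_right)
 have per: "F (2 * \<Delta> + x) = F x" for x
 proof -
  have "F x = (\<Sum>m\<in>I. (\<Sum>n\<in>I. a n * E (2 * \<Delta>) n m) * G m x)"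
   unfolding F_def by (intro sum.cong refl) (simp add: am[symmetric])
  also have "\<dots> = (\<Sum>n\<in>I. \<Sum>m\<in>I. a n * (E (2 * \<Delta>) n m * G m x))"
   by (subst sum.swap) (simp add: sum_distrib_right mult.assoc)
  also have "\<dots> = F (2 * \<Delta> + x)"
   unfolding F_def by (intro sum.cong refl) (simp add: G_add sum_distrib_left)
  finally show ?thesis by simp
 qed
 have "F (real k * (2 * \<Delta>) + x) = F x" for k
 proof (induction k)
  case (Suc k)
  then show ?case using per[of "real k * (2 * \<Delta>) + x"] by (simp add: algebra_simps)
 qed simp
 moreover have "(F \<longlongrightarrow> 0) at_top"
  unfolding F_def by (intro tendsto_null_sum tendsto_mult_right_zero G_tendsto_0)
 then have "(\<lambda>k. F (real k * (2 * \<Delta>) + x)) \<longlonglongrightarrow> 0"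
  by (rule filterlim_compose[OF _ multiples_at_top])
 ultimately have "F x = 0" by (simp add: LIMSEQ_const_iff)
 then show "(\<Sum>n\<in>I. a n * G n x) = 0" by (simp add: F_def)
qed

text \<open>A column fixed by $e^{2 \<Delta> S}$ is fixed by all powers of it, and these tend to
  zero.\<close>

lemma A2_right_injective:
 assumes a: "!!n. n \<in> I ==> (\<Sum>m\<in>I. A2 n m * a m) = 0" and n: "n \<in> I" shows "a n = 0"
proof -
 have an: "a n = (\<Sum>m\<in>I. E (2 * \<Delta>) n m * a m)" if "n \<in> I" for n
  using a[OF that] that by (simp add: left_diff_distrib sum_subtractf sum_mat_one_left)
 have "a n = (\<Sum>m\<in>I. E (real k * (2 * \<Delta>) + 0) n m * a m)" for k
 proof (induction k)
  case 0
  then show ?case using n by (simp add: mat_exp_0 sum_mat_one_left)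
 next
  case (Suc k)
  have "a n = (\<Sum>m\<in>I. E (real k * (2 * \<Delta>) + 0) n m * (\<Sum>l\<in>I. E (2 * \<Delta>) m l * a l))"
  proof -
   have "(\<Sum>m\<in>I. E (real k * (2 * \<Delta>) + 0) n m * (\<Sum>l\<in>I. E (2 * \<Delta>) m l * a l)) = (\<Sum>m\<in>I. E (real k * (2 * \<Delta>) + 0) n m * a m)"
    by (intro sum.cong refl) (simp only: an[symmetric])
   then show ?thesis using Suc.IH by simp
  qed
  also have "\<dots> = mat_vec I (E (real k * (2 * \<Delta>) + 2 * \<Delta>)) a n"
   by (subst mat_vec_exp_add) (use n in \<open>auto simp: mat_vec_def\<close>)
  finally show ?case by (simp add: mat_vec_def algebra_simps)
 qed
 moreover have "(\<lambda>k. \<Sum>m\<in>I. E (real k * (2 * \<Delta>) + 0) n m * a m) \<longlonglongrightarrow> 0"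
  by (rule filterlim_compose[OF exp_dot_tendsto_0[OF n] multiples_at_top])
 ultimately show "a n = 0" by (simp add: LIMSEQ_const_iff)
qed

text \<open>A functional vanishing on the range of \<open>A2\<close> is a row in its left kernel, so
  left injectivity gives a right inverse; right injectivity gives a left inverse in the same
  way.\<close>

lemma A2_inverse:
 obtains N where "!!i j. i \<in> I ==> j \<in> I ==> mat_mul I A2 N i j = mat_one i j"
  "!!i j. i \<in> I ==> j \<in> I ==> mat_mul I N A2 i j = mat_one i j"
proof -
 define U where "U = {u. \<exists>v. \<forall>n\<in>I. (\<Sum>m\<in>I. A2 n m * v m) = u n}"
 define U' where "U' = {u. \<exists>v. \<forall>m\<in>I. (\<Sum>n\<in>I. v n * A2 n m) = u m}"
 have "unit_vec j \<in> U" if "j \<in> I" for j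
 proof (rule unit_vec_in_separating_subspace[of I])
  fix u v :: "nat => real" and x :: real
  show "(\<lambda>n. u n + v n) \<in> U" if "u \<in> U" "v \<in> U"
  proof -
   from that obtain u' v' where "\<forall>n\<in>I. (\<Sum>m\<in>I. A2 n m * u' m) = u n" "\<forall>n\<in>I. (\<Sum>m\<in>I. A2 n m * v' m) = v n"
    by (auto simp: U_def)
   then have "\<forall>n\<in>I. (\<Sum>m\<in>I. A2 n m * (u' m + v' m)) = u n + v n" by (simp add: distrib_left sum.distrib)
   then show ?thesis unfolding U_def mem_Collect_eq by (rule exI[of _ "\<lambda>m. u' m + v' m"])
  qed
  show "(\<lambda>n. x * u n) \<in> U" if "u \<in> U"
  proof -
   from that obtain u' where "\<forall>n\<in>I. (\<Sum>m\<in>I. A2 n m * u' m) = u n" by (auto simp: U_def)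
   then have "\<forall>n\<in>I. (\<Sum>m\<in>I. A2 n m * (x * u' m)) = x * u n"
    by (simp add: mult.left_commute[of _ x] sum_distrib_left[symmetric])
   then show ?thesis unfolding U_def mem_Collect_eq by (rule exI[of _ "\<lambda>m. x * u' m"])
  qed
  show "v \<in> U" if "u \<in> U" "!!n. n \<in> I ==> u n = v n"
   using that by (simp add: U_def)
 next
  fix a assume a: "!!u. u \<in> U ==> (\<Sum>n\<in>I. a n * u n) = 0"
  have "(\<Sum>n\<in>I. a n * A2 n m) = 0" if "m \<in> I" for m
  proof (rule a)
   have "(\<Sum>k\<in>I. A2 n k * mat_one k m) = A2 n m" for n
    by (rule sum_mat_one_right) (use that in auto)
   then show "(\<lambda>n. A2 n m) \<in> U" unfolding U_def mem_Collect_eq by (intro exI[of _ "\<lambda>k. mat_one k m"]) simp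
  qed
  then show "\<forall>n\<in>I. a n = 0" using A2_left_injective by blast
 qed (use that in auto)
 then have "\<forall>j\<in>I. \<exists>v. \<forall>n\<in>I. (\<Sum>m\<in>I. A2 n m * v m) = unit_vec j n"
  by (simp add: U_def)
 from bchoice[OF this] obtain V where V: "\<forall>j\<in>I. \<forall>n\<in>I. (\<Sum>m\<in>I. A2 n m * V j m) = unit_vec j n"
  by blast
 have "unit_vec j \<in> U'" if "j \<in> I" for j
 proof (rule unit_vec_in_separating_subspace[of I])
  fix u v :: "nat => real" and x :: real
  show "(\<lambda>n. u n + v n) \<in> U'" if "u \<in> U'" "v \<in> U'"
  proof -
   from that obtain u' v' where "\<forall>m\<in>I. (\<Sum>n\<in>I. u' n * A2 n m) = u m" "\<forall>m\<in>I. (\<Sum>n\<in>I. v' n * A2 n m) = v m"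
    by (auto simp: U'_def)
   then have "\<forall>m\<in>I. (\<Sum>n\<in>I. (u' n + v' n) * A2 n m) = u m + v m" by (simp add: distrib_right sum.distrib)
   then show ?thesis unfolding U'_def mem_Collect_eq by (rule exI[of _ "\<lambda>n. u' n + v' n"])
  qed
  show "(\<lambda>n. x * u n) \<in> U'" if "u \<in> U'"
  proof -
   from that obtain u' where "\<forall>m\<in>I. (\<Sum>n\<in>I. u' n * A2 n m) = u m" by (auto simp: U'_def)
   then have "\<forall>m\<in>I. (\<Sum>n\<in>I. (x * u' n) * A2 n m) = x * u m"
    by (simp add: mult.assoc sum_distrib_left[symmetric])
   then show ?thesis unfolding U'_def mem_Collect_eq by (rule exI[of _ "\<lambda>n. x * u' n"])
  qed
  show "v \<in> U'" if "u \<in> U'" "!!n. n \<in> I ==> u n = v n"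
   using that by (simp add: U'_def)
 next
  fix a assume a: "!!u. u \<in> U' ==> (\<Sum>n\<in>I. a n * u n) = 0"
  have "(\<Sum>m\<in>I. A2 n m * a m) = 0" if "n \<in> I" for n
  proof -
   have "(\<Sum>k\<in>I. mat_one n k * A2 k m) = A2 n m" for m
    by (rule sum_mat_one_left) (use that in auto)
   then have "(\<lambda>m. A2 n m) \<in> U'" unfolding U'_def mem_Collect_eq by (intro exI[of _ "mat_one n"]) simp
   from a[OF this] show ?thesis by (simp add: mult.commute)
  qed
  then show "\<forall>n\<in>I. a n = 0" using A2_right_injective by blast
 qed (use that in auto)
 then have "\<forall>j\<in>I. \<exists>v. \<forall>m\<in>I. (\<Sum>n\<in>I. v n * A2 n m) = unit_vec j m"
  by (simp add: U'_def)
 from bchoice[OF this] obtain N where N: "\<forall>j\<in>I. \<forall>m\<in>I. (\<Sum>n\<in>I. N j n * A2 n m) = unit_vec j m"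
  by blast
 have NA: "mat_mul I N A2 i j = mat_one i j" if "i \<in> I" "j \<in> I" for i j
  using N[rule_format, OF that] by (auto simp: mat_mul_def unit_vec_def mat_one_def)
 define V' where "V' = (\<lambda>m j. V j m)"
 have AV: "mat_mul I A2 V' i j = mat_one i j" if "i \<in> I" "j \<in> I" for i j
  using V[rule_format, OF that(2,1)] by (simp add: mat_mul_def V'_def unit_vec_def mat_one_def)
 \<comment> \<open>The left and the right inverse agree by associativity, but only on
   \<open>I\<close>.\<close>
 have "N i j = V' i j" if "i \<in> I" "j \<in> I" for i j
 proof -
  have "N i j = (\<Sum>k\<in>I. N i k * mat_one k j)"
   using that sum_mat_one_right[of I j "N i"] by simp
  also have "\<dots> = mat_mul I N (mat_mul I A2 V') i j"
   unfolding mat_mul_def[of I N] by (intro sum.cong refl) (simp only: AV that)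
  also have "\<dots> = mat_mul I (mat_mul I N A2) V' i j" by (simp add: mat_mul_assoc)
  also have "\<dots> = (\<Sum>k\<in>I. mat_one i k * V' k j)"
   unfolding mat_mul_def[of I _ V'] by (intro sum.cong refl) (simp only: NA that)
  also have "\<dots> = V' i j"
   using that sum_mat_one_left[of I i "\<lambda>k. V' k j"] by simp
  finally show ?thesis .
 qed
 then have "mat_mul I A2 N i j = mat_mul I A2 V' i j" if "i \<in> I" "j \<in> I" for i j
  unfolding mat_mul_def by (intro sum.cong refl) (simp only: that)
 then show ?thesis using that[of N] NA AV by simp
qed

text \<open>Both sides solve the same linear system with matrix $I - e^{2\Delta S}$, by the periodicity of
 \<open>reflect\<close>.\<close>

lemma closing_integral:
 assumes cont: "continuous_on {0..\<Delta>} \<phi>" and n: "n \<in> I"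
 shows "(LINT z:{0..\<Delta>}|lborel. closing_vec \<Delta> q S z n * \<phi> z) = IG (\<lambda>z. \<phi> (reflect z)) n"
proof -
 define N where "N = mat_inv_on I A2"
 have N: "mat_mul I A2 N i j = mat_one i j" "mat_mul I N A2 i j = mat_one i j" if "i \<in> I" "j \<in> I" for i j
 proof -
  have "\<exists>N. \<forall>i\<in>I. \<forall>j\<in>I. mat_mul I A2 N i j = mat_one i j \<and> mat_mul I N A2 i j = mat_one i j"
  proof -
   obtain N' where "!!i j. i \<in> I ==> j \<in> I ==> mat_mul I A2 N' i j = mat_one i j"
    "!!i j. i \<in> I ==> j \<in> I ==> mat_mul I N' A2 i j = mat_one i j"
    using A2_inverse by blast
   then show ?thesis by (intro exI[of _ N']) blast
  qed
  from someI_ex[OF this] show "mat_mul I A2 N i j = mat_one i j" "mat_mul I N A2 i j = mat_one i j"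
   using that unfolding N_def mat_inv_on_def by auto
 qed
 define w where "w = mat_vec I N s"
 have Aw: "(\<Sum>k\<in>I. A2 m k * w k) = s m" if "m \<in> I" for m
 proof -
  have "(\<Sum>k\<in>I. A2 m k * w k) = (\<Sum>l\<in>I. mat_mul I A2 N m l * s l)"
   unfolding w_def mat_vec_def mat_mul_def sum_distrib_left sum_distrib_right
   by (subst sum.swap) (simp add: mult.assoc)
  also have "\<dots> = (\<Sum>l\<in>I. mat_one m l * s l)"
   by (intro sum.cong refl) (simp only: N[OF that])
  also have "\<dots> = s m" using that by (simp add: sum_mat_one_left)
  finally show ?thesis .
 qed
 define c where "c = (\<lambda>z n. closing_vec \<Delta> q S z n)"
 have c_eq: "c z n = mat_vec I (E z) w n + mat_vec I (E (2 * \<Delta> - z)) w n" for z n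
  by (simp add: c_def closing_vec_def N_def w_def mat_vec_def distrib_right sum.distrib)
 \<comment> \<open>Exponentials of \<open>S\<close> commute, so \<open>A2\<close> passes through and
   acts on \<open>w\<close>, where it yields \<open>s\<close>.\<close>
 have com: "(\<Sum>n\<in>I. A2 k n * mat_vec I (E z) w n) = r k z" if "k \<in> I" for k z
 proof -
  have "(\<Sum>n\<in>I. A2 k n * mat_vec I (E z) w n) = mat_vec I (E z) w k - mat_vec I (E (2 * \<Delta>)) (mat_vec I (E z) w) k"
   using that by (simp add: left_diff_distrib sum_subtractf sum_mat_one_left mat_vec_def)
  also have "mat_vec I (E (2 * \<Delta>)) (mat_vec I (E z) w) k = mat_vec I (E z) (mat_vec I (E (2 * \<Delta>)) w) k"
   using that mat_vec_exp_add[of I k S "2 * \<Delta>" z w] mat_vec_exp_add[of I k S z "2 * \<Delta>" w] by (simp add: add.commute)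
  also have "mat_vec I (E z) w k - \<dots> = mat_vec I (E z) (\<lambda>m. w m - mat_vec I (E (2 * \<Delta>)) w m) k"
   by (simp add: mat_vec_diff)
  also have "\<dots> = mat_vec I (E z) s k"
  proof (rule fun_cong[OF mat_vec_cong])
   fix m assume m: "m \<in> I"
   then show "w m - mat_vec I (E (2 * \<Delta>)) w m = s m"
    using Aw[OF m] by (simp add: left_diff_distrib sum_subtractf sum_mat_one_left mat_vec_def)
  qed
  finally show ?thesis by (simp add: r_def)
 qed
 have Ac: "(\<Sum>n\<in>I. A2 k n * c z n) = r k z + r k (2 * \<Delta> - z)" if "k \<in> I" for k z
  unfolding c_eq using com[OF that] by (simp add: distrib_left sum.distrib)
 have contE: "continuous_on X (\<lambda>z. mat_vec I (E (g z)) w n)" if "n \<in> I" "continuous_on X g" for g n and X :: "real set"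
  unfolding mat_vec_def using that
  by (intro continuous_intros continuous_on_compose2[OF mat_exp_continuous[of I _ _ UNIV S] that(2)]) auto
 have intc: "set_integrable lborel {0..\<Delta>} (\<lambda>z. c z n * \<phi> z)" if "n \<in> I" for n
  by (rule borel_integrable_atLeastAtMost') (unfold c_eq, intro continuous_intros contE cont that)
 define \<psi> where "\<psi> = (\<lambda>z. \<phi> (reflect z))"
 have cont\<psi>: "continuous_on X \<psi>" for X
  unfolding \<psi>_def by (rule continuous_on_compose2[OF cont reflect_cont]) (use reflect_bounds in auto)
 have adm\<psi>: "adm \<psi>"
 proof -
  have "bounded (\<phi> ` {0..\<Delta>})"
   by (intro compact_imp_bounded compact_continuous_image cont) auto
  then obtain C where "\<forall>z\<in>{0..\<Delta>}. \<bar>\<phi> z\<bar> <= C" by (auto simp: bounded_iff)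
  then show ?thesis
   by (intro adm_bounded[of _ C] borel_measurable_continuous_onI cont\<psi>) (use reflect_bounds in \<open>auto simp: \<psi>_def\<close>)
 qed
 have key: "(\<Sum>n\<in>I. A2 k n * IG \<psi> n) = (\<Sum>n\<in>I. A2 k n * (LINT z:{0..\<Delta>}|lborel. c z n * \<phi> z))" if k: "k \<in> I" for k
 proof -
  have i1: "set_integrable lborel {0..\<Delta>} (\<lambda>z. r k z * \<phi> z)"
   by (rule borel_integrable_atLeastAtMost') (intro continuous_intros r_cont[OF k] cont)
  have i2: "set_integrable lborel {0..\<Delta>} (\<lambda>z. r k (2 * \<Delta> - z) * \<phi> z)"
   by (rule borel_integrable_atLeastAtMost')
     (intro continuous_intros cont continuous_on_compose2[OF r_cont[OF k, of UNIV]], auto)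
  have j2: "set_integrable lborel {\<Delta>..2 * \<Delta>} (\<lambda>z. r k z * \<psi> z)"
   by (rule borel_integrable_atLeastAtMost') (intro continuous_intros r_cont[OF k] cont\<psi>)
  have j1: "set_integrable lborel {0..\<Delta>} (\<lambda>z. r k z * \<psi> z)"
   by (rule borel_integrable_atLeastAtMost') (intro continuous_intros r_cont[OF k] cont\<psi>)
  have "(\<Sum>n\<in>I. A2 k n * (LINT z:{0..\<Delta>}|lborel. c z n * \<phi> z)) = (LINT z:{0..\<Delta>}|lborel. \<Sum>n\<in>I. A2 k n * (c z n * \<phi> z))"
   by (subst set_integral_sum) (use intc in auto)
  also have "\<dots> = (LINT z:{0..\<Delta>}|lborel. r k z * \<phi> z + r k (2 * \<Delta> - z) * \<phi> z)"
   by (simp add: mult.assoc[symmetric] sum_distrib_right[symmetric] Ac[OF k] distrib_right)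
  also have "\<dots> = (LINT z:{0..\<Delta>}|lborel. r k z * \<phi> z) + (LINT z:{0..\<Delta>}|lborel. r k (2 * \<Delta> - z) * \<phi> z)"
   by (rule set_integral_add[OF i1 i2])
  also have "(LINT z:{0..\<Delta>}|lborel. r k z * \<phi> z) = (LINT z:{0..\<Delta>}|lborel. r k z * \<psi> z)"
   by (rule set_lebesgue_integral_cong) (auto simp: \<psi>_def reflect_id)
  \<comment> \<open>The substitution of \<open>2 * \<Delta> - z\<close> for \<open>z\<close> moves
    the reflected half to the second half of the period, where \<open>\<psi>\<close> is even about
    \<open>\<Delta>\<close>.\<close>
  also have "(LINT z:{0..\<Delta>}|lborel. r k (2 * \<Delta> - z) * \<phi> z) = (LINT z:{\<Delta>..2 * \<Delta>}|lborel. r k z * \<psi> z)"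
  proof -
   have "(LINT z:{\<Delta>..2 * \<Delta>}|lborel. r k z * \<psi> z)
    = (\<integral>z. indicator {\<Delta>..2 * \<Delta>} (2 * \<Delta> + (-1) * z) *\<^sub>R (r k (2 * \<Delta> + (-1) * z) * \<psi> (2 * \<Delta> + (-1) * z)) \<partial>lborel)"
    using lborel_integral_real_affine[of "-1" "\<lambda>z. indicator {\<Delta>..2 * \<Delta>} z *\<^sub>R (r k z * \<psi> z)" "2 * \<Delta>"]
    by (simp add: set_lebesgue_integral_def)
   also have "\<dots> = (LINT z:{0..\<Delta>}|lborel. r k (2 * \<Delta> - z) * \<phi> z)"
    unfolding set_lebesgue_integral_def
    by (rule Bochner_Integration.integral_cong) (auto simp: indicator_def \<psi>_def reflect_even reflect_id)
   finally show ?thesis by simp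
  qed
  \<comment> \<open>The two halves form one full period; the tail is split off so that periodicity
    can rewrite it as a shift.\<close>
  also have "(LINT z:{0..\<Delta>}|lborel. r k z * \<psi> z) + (LINT z:{\<Delta>..2 * \<Delta>}|lborel. r k z * \<psi> z)
    = IG (\<lambda>z. \<psi> z - indicator {2 * \<Delta>..} z * \<psi> z) k"
  proof -
   have "(LINT z:{0..\<Delta>}|lborel. r k z * \<psi> z) + (LINT z:{\<Delta>..2 * \<Delta>}|lborel. r k z * \<psi> z)
    = (\<integral>z. indicator {0..\<Delta>} z *\<^sub>R (r k z * \<psi> z) + indicator {\<Delta>..2 * \<Delta>} z *\<^sub>R (r k z * \<psi> z) \<partial>lborel)"
    using j1 j2 by (simp add: set_lebesgue_integral_def set_integrable_def)
   also have "\<dots> = (\<integral>z. indicator {0..} z *\<^sub>R (r k z * (\<psi> z - indicator {2 * \<Delta>..} z * \<psi> z)) \<partial>lborel)"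
   proof (rule integral_cong_AE)
    have [measurable]: "r k \<in> borel_measurable borel" "\<psi> \<in> borel_measurable borel"
     using r_borel[OF k] adm_borel[OF adm\<psi>] by auto
    show "(\<lambda>z. indicator {0..\<Delta>} z *\<^sub>R (r k z * \<psi> z) + indicator {\<Delta>..2 * \<Delta>} z *\<^sub>R (r k z * \<psi> z)) \<in> borel_measurable lborel"
     "(\<lambda>z. indicator {0..} z *\<^sub>R (r k z * (\<psi> z - indicator {2 * \<Delta>..} z * \<psi> z))) \<in> borel_measurable lborel"
     by measurable
    show "AE z in lborel. indicator {0..\<Delta>} z *\<^sub>R (r k z * \<psi> z) + indicator {\<Delta>..2 * \<Delta>} z *\<^sub>R (r k z * \<psi> z)
      = indicator {0..} z *\<^sub>R (r k z * (\<psi> z - indicator {2 * \<Delta>..} z * \<psi> z))"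
     using AE_lborel_singleton[of \<Delta>] AE_lborel_singleton[of "2 * \<Delta>"]
     by eventually_elim (use \<Delta>_pos in \<open>auto simp: indicator_def\<close>)
   qed
   finally show ?thesis by (simp add: IG_def set_lebesgue_integral_def)
  qed
  \<comment> \<open>On the tail \<open>\<psi>\<close> equals its own shift by
    \<open>2 * \<Delta>\<close>, and \<open>drift_IG\<close> reads that shift as multiplication by
    the exponential in \<open>A2\<close>.\<close>
  also have "\<dots> = IG (\<lambda>z. \<psi> z - indicator {2 * \<Delta>..} z * \<psi> (z - 2 * \<Delta>)) k"
   using reflect_periodic[of "z - 2 * \<Delta>" for z] by (simp add: \<psi>_def)
  also have "\<dots> = IG \<psi> k - (\<Sum>m\<in>I. E (2 * \<Delta>) k m * IG \<psi> m)"
   by (subst IG_diff) (use adm\<psi> k \<Delta>_pos in \<open>auto simp: drift_IG intro!: adm_shift_back\<close>)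
  also have "\<dots> = (\<Sum>n\<in>I. A2 k n * IG \<psi> n)"
   using k by (simp add: left_diff_distrib sum_subtractf sum_mat_one_left)
  finally show ?thesis by simp
 qed
 have "IG \<psi> n - (LINT z:{0..\<Delta>}|lborel. c z n * \<phi> z) = 0"
  by (rule A2_right_injective[OF _ n]) (use key in \<open>simp add: right_diff_distrib[of "A2 _ _"] sum_subtractf\<close>)
 then show ?thesis by (simp add: c_def \<psi>_def)
qed

end

section \<open>The generator as an operator\<close>

locale qbd_scheme = me_scheme Q Z \<Delta> \<epsilon> q \<alpha> S \<tau>
 for Q :: "'z measure" and Z \<Delta> \<epsilon> q \<alpha> S \<tau> +
 fixes T :: "'s::finite => 's => real" and c :: "'s => real" and b :: real and K :: nat
 assumes T: "generator T" and c_nz: "c j \<noteq> 0" and K: "1 <= K" and b_pos: "0 < b"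
  and \<Delta>_eq: "\<Delta> = b / real K"
begin

abbreviation "idx \<equiv> qbd_index c K q"
abbreviation "B \<equiv> qbd_gen T c K q \<alpha> S D"
abbreviation "levels \<equiv> {1..K}"

definition nxt :: "nat => 's => nat" where
 "nxt k i = (if 0 < c i then k + 1 else k - 1)"

lemma c_cases: "c j < 0 \<or> 0 < c j"
 using c_nz[of j] by linarith

lemma T_off: "i \<noteq> j ==> 0 <= T i j" and T_sum: "(\<Sum>j\<in>UNIV. T i j) = 0"
 using T by (auto simp: generator_def)

lemma finite_idx: "finite idx"
proof -
 have "{(0::nat, i, 1::nat) | i. c i < 0} = (\<lambda>i. (0, i, 1)) ` {i. c i < 0}"
  "{(K + 1, i, 1::nat) | i. 0 < c i} = (\<lambda>i. (K + 1, i, 1)) ` {i. 0 < c i}" by auto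
 then show ?thesis unfolding qbd_index_def by simp
qed

lemma idx_cases:
 assumes "x \<in> idx"
 obtains (bottom) i where "x = (0, i, 1)" "c i < 0"
 | (top) i where "x = (K + 1, i, 1)" "0 < c i"
 | (inner) k i n where "x = (k, i, n)" "k \<in> levels" "n \<in> I"
 using assms unfolding qbd_index_def by auto

lemma idx_bottom: "c i < 0 ==> (0, i, 1) \<in> idx"
 and idx_top: "0 < c i ==> (K + 1, i, 1) \<in> idx"
 and idx_inner: "k \<in> levels ==> n \<in> I ==> (k, i, n) \<in> idx"
 unfolding qbd_index_def by auto

lemma idx_sum:
 fixes g :: "nat \<times> 's \<times> nat => real"
 shows "(\<Sum>x\<in>idx. g x) = (\<Sum>j\<in>{j. c j < 0}. g (0, j, 1)) + (\<Sum>j\<in>{j. 0 < c j}. g (K + 1, j, 1))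
   + (\<Sum>l\<in>levels. \<Sum>j\<in>UNIV. \<Sum>m\<in>I. g (l, j, m))"
proof -
 let ?A = "(\<lambda>j. (0::nat, j, 1::nat)) ` {j. c j < 0}" and ?B = "(\<lambda>j. (K + 1, j, 1::nat)) ` {j. 0 < c j}"
  and ?C = "levels \<times> (UNIV :: 's set) \<times> I"
 have "idx = ?A \<union> ?B \<union> ?C" unfolding qbd_index_def by auto
 moreover have "?A \<inter> ?B = {}" "(?A \<union> ?B) \<inter> ?C = {}" by auto
 ultimately have "(\<Sum>x\<in>idx. g x) = (\<Sum>x\<in>?A. g x) + (\<Sum>x\<in>?B. g x) + (\<Sum>x\<in>?C. g x)"
  by (simp add: sum.union_disjoint)
 also have "(\<Sum>x\<in>?A. g x) = (\<Sum>j\<in>{j. c j < 0}. g (0, j, 1))"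
  by (subst sum.reindex) (auto simp: inj_on_def)
 also have "(\<Sum>x\<in>?B. g x) = (\<Sum>j\<in>{j. 0 < c j}. g (K + 1, j, 1))"
  by (subst sum.reindex) (auto simp: inj_on_def)
 also have "(\<Sum>x\<in>?C. g x) = (\<Sum>l\<in>levels. \<Sum>j\<in>UNIV. \<Sum>m\<in>I. g (l, j, m))"
  by (simp add: sum.cartesian_product split_def)
 finally show ?thesis .
qed

lemma inner_level_delta:
 fixes g :: "nat => 's => nat => real"
 assumes "k \<in> levels"
 shows "(\<Sum>l\<in>levels. \<Sum>j\<in>UNIV. \<Sum>m\<in>I. if l = k then g l j m else 0) = (\<Sum>j\<in>UNIV. \<Sum>m\<in>I. g k j m)"
proof -
 have "(\<Sum>l\<in>levels. \<Sum>j\<in>UNIV. \<Sum>m\<in>I. if l = k then g l j m else 0)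
   = (\<Sum>l\<in>levels. if l = k then (\<Sum>j\<in>UNIV. \<Sum>m\<in>I. g l j m) else 0)"
  by (intro sum.cong refl) simp
 then show ?thesis using assms by (simp add: sum.delta)
qed

text \<open>Since \<open>\<alpha>\<close> is the first unit vector, every entry into a level is an entry in position 1.\<close>

lemma B_bottom:
 assumes "c i < 0"
 shows "mat_vec idx B w (0, i, 1) = (\<Sum>j\<in>UNIV. T i j * w (if c j < 0 then 0 else 1, j, 1))"
proof -
 have "mat_vec idx B w (0, i, 1) = (\<Sum>j\<in>{j. c j < 0}. T i j * w (0, j, 1))
   + (\<Sum>l\<in>levels. \<Sum>j\<in>UNIV. \<Sum>m\<in>I. if l = 1 then (if 0 < c j then T i j * \<alpha> m else 0) * w (l, j, m) else 0)"
 proof -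
  have "(\<Sum>j\<in>{j. c j < 0}. B (0, i, 1) (0, j, 1) * w (0, j, 1)) = (\<Sum>j\<in>{j. c j < 0}. T i j * w (0, j, 1))"
   by (simp add: qbd_gen_def)
  moreover have "(\<Sum>j\<in>{j. 0 < c j}. B (0, i, 1) (K + 1, j, 1) * w (K + 1, j, 1)) = 0"
   using K by (intro sum.neutral) (auto simp: qbd_gen_def)
  moreover have "(\<Sum>l\<in>levels. \<Sum>j\<in>UNIV. \<Sum>m\<in>I. B (0, i, 1) (l, j, m) * w (l, j, m))
   = (\<Sum>l\<in>levels. \<Sum>j\<in>UNIV. \<Sum>m\<in>I. if l = 1 then (if 0 < c j then T i j * \<alpha> m else 0) * w (l, j, m) else 0)"
   by (intro sum.cong refl) (auto simp: qbd_gen_def)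
  ultimately show ?thesis unfolding mat_vec_def idx_sum by simp
 qed
 also have "(\<Sum>l\<in>levels. \<Sum>j\<in>UNIV. \<Sum>m\<in>I. if l = 1 then (if 0 < c j then T i j * \<alpha> m else 0) * w (l, j, m) else 0)
   = (\<Sum>j\<in>UNIV. \<Sum>m\<in>I. (if 0 < c j then T i j * \<alpha> m else 0) * w (1, j, m))"
  by (rule inner_level_delta) (use K in auto)
 also have "\<dots> = (\<Sum>j\<in>UNIV. if 0 < c j then T i j * w (1, j, 1) else 0)"
 proof (intro sum.cong refl)
  fix j
  have "(\<Sum>m\<in>I. T i j * \<alpha> m * w (1, j, m)) = T i j * w (1, j, 1)"
   using alpha_dot[of "\<lambda>m. w (1, j, m)"] by (simp add: mult.assoc sum_distrib_left[symmetric])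
  then show "(\<Sum>m\<in>I. (if 0 < c j then T i j * \<alpha> m else 0) * w (1, j, m)) = (if 0 < c j then T i j * w (1, j, 1) else 0)"
   by simp
 qed
 also have "(\<Sum>j\<in>{j. c j < 0}. T i j * w (0, j, 1)) = (\<Sum>j\<in>UNIV. if c j < 0 then T i j * w (0, j, 1) else 0)"
  by (simp add: sum.If_cases)
 finally have "mat_vec idx B w (0, i, 1) = (\<Sum>j\<in>UNIV. (if c j < 0 then T i j * w (0, j, 1) else 0) + (if 0 < c j then T i j * w (1, j, 1) else 0))"
  by (simp only: sum.distrib)
 also have "\<dots> = (\<Sum>j\<in>UNIV. T i j * w (if c j < 0 then 0 else 1, j, 1))"
 proof (intro sum.cong refl)
  fix j
  show "(if c j < 0 then T i j * w (0, j, 1) else 0) + (if 0 < c j then T i j * w (1, j, 1) else 0) = T i j * w (if c j < 0 then 0 else 1, j, 1)"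
   using c_cases[of j] by auto
 qed
 finally show ?thesis .
qed

lemma B_top:
 assumes "0 < c i"
 shows "mat_vec idx B w (K + 1, i, 1) = (\<Sum>j\<in>UNIV. T i j * w (if c j < 0 then K else K + 1, j, 1))"
proof -
 have "mat_vec idx B w (K + 1, i, 1) = (\<Sum>j\<in>{j. 0 < c j}. T i j * w (K + 1, j, 1))
   + (\<Sum>l\<in>levels. \<Sum>j\<in>UNIV. \<Sum>m\<in>I. if l = K then (if c j < 0 then T i j * \<alpha> m else 0) * w (l, j, m) else 0)"
 proof -
  have "(\<Sum>j\<in>{j. c j < 0}. B (K + 1, i, 1) (0, j, 1) * w (0, j, 1)) = 0"
   using K by (intro sum.neutral) (auto simp: qbd_gen_def)
  moreover have "(\<Sum>j\<in>{j. 0 < c j}. B (K + 1, i, 1) (K + 1, j, 1) * w (K + 1, j, 1)) = (\<Sum>j\<in>{j. 0 < c j}. T i j * w (K + 1, j, 1))"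
   by (simp add: qbd_gen_def)
  moreover have "(\<Sum>l\<in>levels. \<Sum>j\<in>UNIV. \<Sum>m\<in>I. B (K + 1, i, 1) (l, j, m) * w (l, j, m))
   = (\<Sum>l\<in>levels. \<Sum>j\<in>UNIV. \<Sum>m\<in>I. if l = K then (if c j < 0 then T i j * \<alpha> m else 0) * w (l, j, m) else 0)"
   by (intro sum.cong refl) (auto simp: qbd_gen_def)
  ultimately show ?thesis unfolding mat_vec_def idx_sum by simp
 qed
 also have "(\<Sum>l\<in>levels. \<Sum>j\<in>UNIV. \<Sum>m\<in>I. if l = K then (if c j < 0 then T i j * \<alpha> m else 0) * w (l, j, m) else 0)
   = (\<Sum>j\<in>UNIV. \<Sum>m\<in>I. (if c j < 0 then T i j * \<alpha> m else 0) * w (K, j, m))"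
  by (rule inner_level_delta) (use K in auto)
 also have "\<dots> = (\<Sum>j\<in>UNIV. if c j < 0 then T i j * w (K, j, 1) else 0)"
 proof (intro sum.cong refl)
  fix j
  have "(\<Sum>m\<in>I. T i j * \<alpha> m * w (K, j, m)) = T i j * w (K, j, 1)"
   using alpha_dot[of "\<lambda>m. w (K, j, m)"] by (simp add: mult.assoc sum_distrib_left[symmetric])
  then show "(\<Sum>m\<in>I. (if c j < 0 then T i j * \<alpha> m else 0) * w (K, j, m)) = (if c j < 0 then T i j * w (K, j, 1) else 0)"
   by simp
 qed
 also have "(\<Sum>j\<in>{j. 0 < c j}. T i j * w (K + 1, j, 1)) = (\<Sum>j\<in>UNIV. if 0 < c j then T i j * w (K + 1, j, 1) else 0)"
  by (simp add: sum.If_cases)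
 finally have "mat_vec idx B w (K + 1, i, 1) = (\<Sum>j\<in>UNIV. (if 0 < c j then T i j * w (K + 1, j, 1) else 0) + (if c j < 0 then T i j * w (K, j, 1) else 0))"
  by (simp only: sum.distrib)
 also have "\<dots> = (\<Sum>j\<in>UNIV. T i j * w (if c j < 0 then K else K + 1, j, 1))"
 proof (intro sum.cong refl)
  fix j
  show "(if 0 < c j then T i j * w (K + 1, j, 1) else 0) + (if c j < 0 then T i j * w (K, j, 1) else 0) = T i j * w (if c j < 0 then K else K + 1, j, 1)"
   using c_cases[of j] by auto
 qed
 finally show ?thesis .
qed

definition dirsum :: "nat => 's => nat => (nat \<times> 's \<times> nat => real) => real" where
 "dirsum k i n w = (\<Sum>j\<in>UNIV. T i j *
   (if sgn (c i) = sgn (c j) then w (k, j, n) else (\<Sum>m\<in>I. D n m * w (k, j, m))))"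

lemma B_inner:
 assumes k: "k \<in> levels" and n: "n \<in> I"
 shows "mat_vec idx B w (k, i, n) = \<bar>c i\<bar> * (\<Sum>m\<in>I. S n m * w (k, i, m))
   + \<bar>c i\<bar> * s n * w (nxt k i, i, 1) + dirsum k i n w"
proof -
 \<comment> \<open>\<open>P\<close> holds the entries within level \<open>k\<close>,
   \<open>U\<close> those of the change of level; a boundary level is entered with weight 1, an
   inner one with \<open>\<alpha>\<close>.\<close>
 define P where "P = (\<lambda>j m. (if sgn (c i) = sgn (c j)
    then (if i = j then \<bar>c i\<bar> * S n m else 0) + T i j * mat_one n m
    else T i j * D n m) * w (k, j, m))"
 define U where "U = (\<lambda>l j m. if l = nxt k i \<and> j = i then \<bar>c i\<bar> * s n * (if l \<in> {0, K + 1} then 1 else \<alpha> m) * w (l, j, m) else 0)"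
 have split: "B (k, i, n) (l, j, m) * w (l, j, m) = (if l = k then P j m else 0) + U l j m" for l j m
  using k c_cases[of i] by (auto simp: qbd_gen_def P_def U_def nxt_def)
 have Psum: "(\<Sum>j\<in>UNIV. \<Sum>m\<in>I. P j m) = \<bar>c i\<bar> * (\<Sum>m\<in>I. S n m * w (k, i, m)) + dirsum k i n w"
 proof -
  have "(\<Sum>m\<in>I. P j m) = (if i = j then \<bar>c i\<bar> * (\<Sum>m\<in>I. S n m * w (k, i, m)) else 0)
    + T i j * (if sgn (c i) = sgn (c j) then w (k, j, n) else (\<Sum>m\<in>I. D n m * w (k, j, m)))" for j
  proof -
   have "(\<Sum>m\<in>I. T i j * mat_one n m * w (k, j, m)) = T i j * w (k, j, n)"
    using sum_mat_one_left[of I n "\<lambda>m. w (k, j, m)"] n by (simp add: mult.assoc sum_distrib_left[symmetric])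
   then show ?thesis
    by (auto simp: P_def distrib_right sum.distrib sum_distrib_left mult.assoc)
  qed
  then show ?thesis by (simp add: sum.distrib dirsum_def sum.delta)
 qed
 have U0: "(\<Sum>j\<in>X. g j * of_bool (j = i)) = (if i \<in> X then g i else 0)" for X and g :: "'s => real"
 proof -
  have "g j * of_bool (j = i) = (if j = i then g j else 0)" for j by simp
  then show ?thesis by (simp add: sum.delta)
 qed
 have Usum: "(\<Sum>j\<in>{j. c j < 0}. U 0 j 1) + (\<Sum>j\<in>{j. 0 < c j}. U (K + 1) j 1) + (\<Sum>l\<in>levels. \<Sum>j\<in>UNIV. \<Sum>m\<in>I. U l j m)
   = \<bar>c i\<bar> * s n * w (nxt k i, i, 1)"
 proof -
  have bnd: "nxt k i = 0 ==> c i < 0" "nxt k i = K + 1 ==> 0 < c i"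
   using k c_cases[of i] by (auto simp: nxt_def split: if_splits)
  have 0: "(\<Sum>j\<in>{j. c j < 0}. U 0 j 1) = (if nxt k i = 0 then \<bar>c i\<bar> * s n * w (nxt k i, i, 1) else 0)"
  proof (cases "nxt k i = 0")
   case True
   then have "(\<Sum>j\<in>{j. c j < 0}. U 0 j 1) = (\<Sum>j\<in>{j. c j < 0}. if j = i then \<bar>c i\<bar> * s n * w (0, i, 1) else 0)"
    by (intro sum.cong refl) (simp add: U_def)
   then show ?thesis using bnd True by (simp add: sum.delta)
  qed (simp add: U_def)
  have 1: "(\<Sum>j\<in>{j. 0 < c j}. U (K + 1) j 1) = (if nxt k i = K + 1 then \<bar>c i\<bar> * s n * w (nxt k i, i, 1) else 0)"
  proof (cases "nxt k i = K + 1")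
   case True
   then have "(\<Sum>j\<in>{j. 0 < c j}. U (K + 1) j 1) = (\<Sum>j\<in>{j. 0 < c j}. if j = i then \<bar>c i\<bar> * s n * w (K + 1, i, 1) else 0)"
    by (intro sum.cong refl) (simp add: U_def)
   then show ?thesis using bnd True by (simp add: sum.delta)
  qed (simp add: U_def)
  have 2: "(\<Sum>l\<in>levels. \<Sum>j\<in>UNIV. \<Sum>m\<in>I. U l j m) = (if nxt k i \<in> levels then \<bar>c i\<bar> * s n * w (nxt k i, i, 1) else 0)"
  proof (cases "nxt k i \<in> levels")
   case True
   have "(\<Sum>l\<in>levels. \<Sum>j\<in>UNIV. \<Sum>m\<in>I. U l j m)
     = (\<Sum>l\<in>levels. \<Sum>j\<in>UNIV. \<Sum>m\<in>I. if l = nxt k i then (if j = i then \<bar>c i\<bar> * s n * \<alpha> m * w (l, j, m) else 0) else 0)"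
    using True by (intro sum.cong refl) (auto simp: U_def)
   also have "\<dots> = (\<Sum>j\<in>UNIV. \<Sum>m\<in>I. if j = i then \<bar>c i\<bar> * s n * \<alpha> m * w (nxt k i, j, m) else 0)"
    by (rule inner_level_delta[OF True])
   also have "\<dots> = (\<Sum>j\<in>UNIV. if j = i then (\<Sum>m\<in>I. \<bar>c i\<bar> * s n * \<alpha> m * w (nxt k i, j, m)) else 0)"
    by (intro sum.cong refl) simp
   also have "\<dots> = (\<Sum>m\<in>I. \<bar>c i\<bar> * s n * \<alpha> m * w (nxt k i, i, m))" by (simp add: sum.delta)
   also have "\<dots> = \<bar>c i\<bar> * s n * (\<Sum>m\<in>I. \<alpha> m * w (nxt k i, i, m))"
    by (simp add: sum_distrib_left mult.assoc)
   finally show ?thesis using True by (simp add: alpha_dot)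
  next
   case False
   then have "U l j m = 0" if "l \<in> levels" for l j m using that by (auto simp: U_def)
   then have "(\<Sum>l\<in>levels. \<Sum>j\<in>UNIV. \<Sum>m\<in>I. U l j m) = 0" by (intro sum.neutral ballI)
   then show ?thesis by (simp only: False if_False)
  qed
  have "nxt k i = 0 \<or> nxt k i = K + 1 \<or> nxt k i \<in> levels" using k by (auto simp: nxt_def)
  then show ?thesis unfolding 0 1 2 by auto
 qed
 have "mat_vec idx B w (k, i, n) = (\<Sum>j\<in>{j. c j < 0}. U 0 j 1) + (\<Sum>j\<in>{j. 0 < c j}. U (K + 1) j 1)
   + (\<Sum>l\<in>levels. \<Sum>j\<in>UNIV. \<Sum>m\<in>I. (if l = k then P j m else 0) + U l j m)"
  unfolding mat_vec_def idx_sum split using k by simp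
 also have "(\<Sum>l\<in>levels. \<Sum>j\<in>UNIV. \<Sum>m\<in>I. (if l = k then P j m else 0) + U l j m)
   = (\<Sum>j\<in>UNIV. \<Sum>m\<in>I. P j m) + (\<Sum>l\<in>levels. \<Sum>j\<in>UNIV. \<Sum>m\<in>I. U l j m)"
  by (simp only: sum.distrib inner_level_delta[OF k])
 finally show ?thesis using Usum Psum by simp
qed

section \<open>Splitting of the generator into drift and jumps\<close>

definition F :: "nat \<times> 's \<times> nat => nat \<times> 's \<times> nat => real" where
 "F = (\<lambda>(k, i, n) (l, j, m). if l = k \<and> j = i \<and> k \<in> levels then \<bar>c i\<bar> * S n m else 0)"

definition Ed :: "real => nat \<times> 's \<times> nat => nat \<times> 's \<times> nat => real" where
 "Ed h = (\<lambda>(k, i, n) (l, j, m). if l = k \<and> j = i then (if k \<in> levels then E (\<bar>c i\<bar> * h) n m else mat_one n m) else 0)"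

definition J :: "nat \<times> 's \<times> nat => nat \<times> 's \<times> nat => real" where
 "J x y = B x y - F x y"

text \<open>A plain Euler step with \<open>B\<close> would add a multiple of the derivative of the
  residual density, which has no sign. The exact drift only shifts that density, so the split step
  can preserve the cone while agreeing with \<open>B\<close> to first order.\<close>

definition R :: "real => nat \<times> 's \<times> nat => nat \<times> 's \<times> nat => real" where
 "R h = mat_mul idx (Ed h) (\<lambda>x y. mat_one x y + h * J x y)"

lemma block_inner:
 fixes g :: "nat => real"
 assumes k: "k \<in> levels"
 shows "(\<Sum>x\<in>idx. (case x of (l, j, m) => if l = k \<and> j = i then g m else 0)) = (\<Sum>m\<in>I. g m)"
proof -
 have "(\<Sum>x\<in>idx. (case x of (l, j, m) => if l = k \<and> j = i then g m else 0))
   = (\<Sum>l\<in>levels. \<Sum>j\<in>UNIV. \<Sum>m\<in>I. if l = k then (if j = i then g m else 0) else 0)"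
  unfolding idx_sum using k by (auto intro!: sum.cong)
 also have "\<dots> = (\<Sum>j\<in>UNIV. \<Sum>m\<in>I. if j = i then g m else 0)"
  by (rule inner_level_delta[OF k])
 also have "\<dots> = (\<Sum>j\<in>UNIV. if j = i then (\<Sum>m\<in>I. g m) else 0)"
  by (intro sum.cong refl) simp
 finally show ?thesis by (simp add: sum.delta)
qed

lemma Ed_inner:
 assumes k: "k \<in> levels"
 shows "mat_vec idx (Ed h) w (k, i, n) = (\<Sum>m\<in>I. E (\<bar>c i\<bar> * h) n m * w (k, i, m))"
 unfolding mat_vec_def block_inner[OF k, of i "\<lambda>m. E (\<bar>c i\<bar> * h) n m * w (k, i, m)", symmetric]
proof (intro sum.cong refl)
 fix x
 show "Ed h (k, i, n) x * w x = (case x of (l, j, m) => if l = k \<and> j = i then E (\<bar>c i\<bar> * h) n m * w (k, i, m) else 0)"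
  using k by (cases x) (simp add: Ed_def)
qed

lemma Ed_outer:
 assumes "(k, i, n) \<in> idx" "k \<notin> levels"
 shows "mat_vec idx (Ed h) w (k, i, n) = w (k, i, n)"
proof -
 have "mat_vec idx (Ed h) w (k, i, n) = (\<Sum>y\<in>idx. mat_one (k, i, n) y * w y)"
  unfolding mat_vec_def
 proof (intro sum.cong refl)
  fix y :: "nat \<times> 's \<times> nat"
  have "Ed h (k, i, n) (l, j, m) = mat_one (k, i, n) (l, j, m)" for l j m
   unfolding Ed_def mat_one_def prod.case by (simp only: assms(2) if_False) auto
  then show "Ed h (k, i, n) y * w y = mat_one (k, i, n) y * w y" by (cases y) simp
 qed
 then show ?thesis using sum_mat_one_left[OF finite_idx assms(1)] by simp
qed

lemma F_inner:
 assumes k: "k \<in> levels"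
 shows "mat_vec idx F w (k, i, n) = \<bar>c i\<bar> * (\<Sum>m\<in>I. S n m * w (k, i, m))"
proof -
 have "mat_vec idx F w (k, i, n) = (\<Sum>m\<in>I. \<bar>c i\<bar> * S n m * w (k, i, m))"
  unfolding mat_vec_def block_inner[OF k, of i "\<lambda>m. \<bar>c i\<bar> * S n m * w (k, i, m)", symmetric]
 proof (intro sum.cong refl)
  fix x
  show "F (k, i, n) x * w x = (case x of (l, j, m) => if l = k \<and> j = i then \<bar>c i\<bar> * S n m * w (k, i, m) else 0)"
   using k by (cases x) (simp add: F_def)
 qed
 then show ?thesis by (simp add: sum_distrib_left mult.assoc)
qed

lemma F_outer: "k \<notin> levels ==> mat_vec idx F w (k, i, n) = 0"
 unfolding mat_vec_def F_def by (intro sum.neutral ballI) (simp only: split_def fst_conv simp_thms if_False mult_zero_left)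

lemma J_eq: "mat_vec idx J w x = mat_vec idx B w x - mat_vec idx F w x"
 by (simp add: mat_vec_def J_def left_diff_distrib sum_subtractf)

lemma J_inner:
 "k \<in> levels ==> n \<in> I ==> mat_vec idx J w (k, i, n) = \<bar>c i\<bar> * s n * w (nxt k i, i, 1) + dirsum k i n w"
 by (simp add: J_eq B_inner F_inner)

lemma J_bottom: "c i < 0 ==> mat_vec idx J w (0, i, 1) = (\<Sum>j\<in>UNIV. T i j * w (if c j < 0 then 0 else 1, j, 1))"
 by (simp add: J_eq B_bottom F_outer)

lemma J_top: "0 < c i ==> mat_vec idx J w (K + 1, i, 1) = (\<Sum>j\<in>UNIV. T i j * w (if c j < 0 then K else K + 1, j, 1))"
 by (simp add: J_eq B_top F_outer)

lemma R_eq: "mat_vec idx (R h) w x = mat_vec idx (Ed h) (\<lambda>y. w y + h * mat_vec idx J w y) x"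
proof -
 have 1: "(\<Sum>z\<in>idx. (mat_one y z + h * J y z) * w z) = w y + h * mat_vec idx J w y" if "y \<in> idx" for y
  using sum_mat_one_left[OF finite_idx that, of w]
  by (simp add: distrib_right sum.distrib mat_vec_def sum_distrib_left mult.assoc)
 have "mat_vec idx (R h) w x = (\<Sum>z\<in>idx. \<Sum>y\<in>idx. Ed h x y * ((mat_one y z + h * J y z) * w z))"
  by (simp add: mat_vec_def R_def mat_mul_def sum_distrib_right mult.assoc)
 also have "\<dots> = (\<Sum>y\<in>idx. Ed h x y * (\<Sum>z\<in>idx. (mat_one y z + h * J y z) * w z))"
  by (subst sum.swap) (simp add: sum_distrib_left)
 also have "\<dots> = (\<Sum>y\<in>idx. Ed h x y * (w y + h * mat_vec idx J w y))"
  by (intro sum.cong refl) (simp add: 1)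
 finally show ?thesis by (simp add: mat_vec_def)
qed

section \<open>Positivity\<close>

text \<open>Positivity in inner levels is tested on the orbits in \<open>cone\<close>; unit vectors
  belong to it, so this is stronger than positivity of the entries.\<close>

definition pos :: "(nat \<times> 's \<times> nat => real) => bool" where
 "pos w \<longleftrightarrow> (\<forall>i. c i < 0 \<longrightarrow> 0 <= w (0, i, 1)) \<and> (\<forall>i. 0 < c i \<longrightarrow> 0 <= w (K + 1, i, 1)) \<and>
   (\<forall>k\<in>levels. \<forall>i a. cone a \<longrightarrow> 0 <= (\<Sum>n\<in>I. a n * w (k, i, n)))"

lemma pos_inner: "pos w ==> k \<in> levels ==> cone a ==> 0 <= (\<Sum>n\<in>I. a n * w (k, i, n))"
 by (simp add: pos_def)

lemma pos_entry: "pos w ==> (k, i, n) \<in> idx ==> 0 <= w (k, i, n)"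
proof -
 assume w: "pos w" and x: "(k, i, n) \<in> idx"
 from x show ?thesis
 proof (cases rule: idx_cases)
  case (inner k' i' n')
  then show ?thesis using pos_inner[OF w, of k "unit_vec n" i] cone_unit[of n] by (simp add: unit_dot)
 qed (use w in \<open>auto simp: pos_def\<close>)
qed

lemma pos_add: "pos v ==> pos w ==> pos (\<lambda>x. v x + w x)"
 by (simp add: pos_def distrib_left sum.distrib)

lemma pos_cmult: "0 <= e ==> pos w ==> pos (\<lambda>x. e * w x)"
 by (simp add: pos_def mult.left_commute[of _ e] sum_distrib_left[symmetric])

lemma pos_const: "0 <= e ==> pos (\<lambda>_. e)"
 using cone_sum_nonneg by (simp add: pos_def sum_distrib_right[symmetric])

lemma pos_cong: "pos v ==> (!!x. x \<in> idx ==> v x = w x) ==> pos w"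
proof -
 assume v: "pos v" and eq: "!!x. x \<in> idx ==> v x = w x"
 have "(\<Sum>n\<in>I. a n * v (k, i, n)) = (\<Sum>n\<in>I. a n * w (k, i, n))" if "k \<in> levels" for k i a
  by (intro sum.cong refl) (simp only: eq[OF idx_inner[OF that]])
 then show ?thesis using v eq idx_bottom idx_top by (simp add: pos_def)
qed

lemma nxt_idx: "k \<in> levels ==> (nxt k i, i, 1) \<in> idx"
proof -
 assume k: "k \<in> levels"
 consider "nxt k i = 0" "c i < 0" | "nxt k i = K + 1" "0 < c i" | "nxt k i \<in> levels"
  using k c_cases[of i] by (auto simp: nxt_def split: if_splits) fastforce+
 then show ?thesis by cases (use idx_bottom idx_top idx_inner q_pos in auto)
qed

lemma bottom_idx: "(if c j < 0 then 0 else 1, j, 1) \<in> idx"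
 and top_idx: "(if c j < 0 then K else K + 1, j, 1) \<in> idx"
 using idx_bottom[of j] idx_top[of j] c_cases[of j] idx_inner[of 1 1 j] idx_inner[of K 1 j] K q_pos by auto

lemma s_dot: "(\<Sum>n\<in>I. a n * s n) = rho a 0"
 unfolding rho_def by (intro sum.cong refl) (simp add: r_0)

lemma s_dot_nonneg: "cone a ==> 0 <= (\<Sum>n\<in>I. a n * s n)"
 by (simp add: s_dot cone_def)

lemma pos_D: "pos w ==> k \<in> levels ==> cone a ==> 0 <= (\<Sum>n\<in>I. a n * (\<Sum>m\<in>I. D n m * w (k, j, m)))"
 unfolding vec_mat_dot[symmetric] by (rule pos_inner[OF _ _ cone_D])

definition dval :: "nat => 's => (nat => real) => (nat \<times> 's \<times> nat => real) => 's => real" where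
 "dval k i a w j = (if sgn (c i) = sgn (c j) then (\<Sum>n\<in>I. a n * w (k, j, n))
   else (\<Sum>n\<in>I. a n * (\<Sum>m\<in>I. D n m * w (k, j, m))))"

lemma dval_nonneg: "pos w ==> k \<in> levels ==> cone a ==> 0 <= dval k i a w j"
 using pos_inner[of w k a j] pos_D[of w k a j] by (auto simp: dval_def)

lemma dirsum_dot: "(\<Sum>n\<in>I. a n * dirsum k i n w) = (\<Sum>j\<in>UNIV. T i j * dval k i a w j)"
proof -
 have "(\<Sum>n\<in>I. a n * dirsum k i n w) = (\<Sum>n\<in>I. \<Sum>j\<in>UNIV. T i j * (a n *
   (if sgn (c i) = sgn (c j) then w (k, j, n) else (\<Sum>m\<in>I. D n m * w (k, j, m)))))"
  by (simp add: dirsum_def sum_distrib_left mult.left_commute)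
 also have "\<dots> = (\<Sum>j\<in>UNIV. T i j * (\<Sum>n\<in>I. a n *
   (if sgn (c i) = sgn (c j) then w (k, j, n) else (\<Sum>m\<in>I. D n m * w (k, j, m)))))"
  by (subst sum.swap) (simp add: sum_distrib_left)
 also have "\<dots> = (\<Sum>j\<in>UNIV. T i j * dval k i a w j)"
  by (intro sum.cong refl) (simp add: dval_def)
 finally show ?thesis .
qed

lemma dval_diag: "dval k i a w i = (\<Sum>n\<in>I. a n * w (k, i, n))"
 by (simp add: dval_def)

lemma R_inner:
 assumes k: "k \<in> levels" and n: "n \<in> I"
 shows "mat_vec idx (R h) w (k, i, n) = (\<Sum>m\<in>I. E (\<bar>c i\<bar> * h) n m *
  (w (k, i, m) + h * (\<bar>c i\<bar> * s m * w (nxt k i, i, 1) + dirsum k i m w)))"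
 unfolding R_eq Ed_inner[OF k] by (intro sum.cong refl) (simp add: J_inner[OF k])

text \<open>A step size below which \<open>1 + h * T i j\<close> is nonnegative and the drifted time
  \<open>\<bar>c i\<bar> * h\<close> is at most 1, as the Taylor bounds require.\<close>

definition h0 :: real where
 "h0 = 1 / (1 + (\<Sum>i\<in>UNIV. \<bar>c i\<bar>) + (\<Sum>i\<in>UNIV. \<Sum>j\<in>UNIV. \<bar>T i j\<bar>))"

definition cm :: real where "cm = (\<Sum>i\<in>UNIV. \<bar>c i\<bar>)"
definition tm :: real where "tm = (\<Sum>i\<in>UNIV. \<Sum>j\<in>UNIV. \<bar>T i j\<bar>)"

lemma cm: "0 <= cm" "\<bar>c i\<bar> <= cm" and tm: "0 <= tm" "(\<Sum>j\<in>UNIV. \<bar>T i j\<bar>) <= tm" "\<bar>T i j\<bar> <= tm"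
proof -
 show "0 <= cm" "0 <= tm" by (auto simp: cm_def tm_def intro!: sum_nonneg)
 show "\<bar>c i\<bar> <= cm" unfolding cm_def by (rule member_le_sum[of i UNIV "\<lambda>i. \<bar>c i\<bar>"]) auto
 show 1: "(\<Sum>j\<in>UNIV. \<bar>T i j\<bar>) <= tm"
  unfolding tm_def by (rule member_le_sum[of i UNIV "\<lambda>i. \<Sum>j\<in>UNIV. \<bar>T i j\<bar>"]) (auto intro: sum_nonneg)
 have "\<bar>T i j\<bar> <= (\<Sum>j\<in>UNIV. \<bar>T i j\<bar>)"
  by (rule member_le_sum[of j UNIV "\<lambda>j. \<bar>T i j\<bar>"]) auto
 then show "\<bar>T i j\<bar> <= tm" using 1 by simp
qed

lemma h0: "0 < h0" "h0 <= 1" "0 <= h ==> h <= h0 ==> \<bar>c i\<bar> * h <= 1" "0 <= h ==> h <= h0 ==> 0 <= 1 + h * T i j"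
proof -
 have h0: "h0 = 1 / (1 + cm + tm)" by (simp add: h0_def cm_def tm_def)
 show "0 < h0" "h0 <= 1" using cm tm by (auto simp: h0)
 assume h: "0 <= h" "h <= h0"
 then have *: "h * (1 + cm + tm) <= 1" using cm tm by (simp add: h0 field_simps)
 have "\<bar>c i\<bar> * h <= (1 + cm + tm) * h" "\<bar>T i j\<bar> * h <= (1 + cm + tm) * h"
  using cm(1) cm(2)[of i] tm(1) tm(3)[of i j] h by (auto intro!: mult_right_mono)
 moreover have "- (h * T i j) <= \<bar>T i j\<bar> * h" using h by (metis abs_ge_minus_self abs_mult abs_of_nonneg mult.commute)
 ultimately show "\<bar>c i\<bar> * h <= 1" "0 <= 1 + h * T i j" using * by (simp_all add: mult.commute)
qed

lemma pos_sum_T: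
 assumes h: "0 <= h" "h <= h0" and g: "!!j. 0 <= g j"
 shows "0 <= g i + h * (\<Sum>j\<in>UNIV. T i j * g j)"
proof -
 have "g i + h * (\<Sum>j\<in>UNIV. T i j * g j) = (1 + h * T i i) * g i + h * (\<Sum>j\<in>UNIV - {i}. T i j * g j)"
  by (simp add: sum.remove[of UNIV i] distrib_left distrib_right mult.assoc)
 also have "0 <= \<dots>"
  by (intro add_nonneg_nonneg mult_nonneg_nonneg sum_nonneg h0(4) h g T_off) auto
 finally show ?thesis .
qed

text \<open>Drift moves the orbit within the cone. From the drifted orbit, changes of level have
  nonnegative intensity, changes of phase lead to orbits in the cone, and for \<open>h <= h0\<close>
  the diagonal of \<open>T\<close> is outweighed by the identity.\<close>

lemma R_pos:
 assumes h: "0 <= h" "h <= h0" and w: "pos w"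
 shows "pos (mat_vec idx (R h) w)"
 unfolding pos_def
proof (intro conjI allI ballI impI)
 fix i assume "c i < 0"
 then have "mat_vec idx (R h) w (0, i, 1) = w (if c i < 0 then 0 else 1, i, 1) + h * (\<Sum>j\<in>UNIV. T i j * w (if c j < 0 then 0 else 1, j, 1))"
  by (subst R_eq) (simp add: Ed_outer idx_bottom J_bottom)
 also have "0 <= \<dots>" by (rule pos_sum_T[OF h]) (rule pos_entry[OF w bottom_idx])
 finally show "0 <= mat_vec idx (R h) w (0, i, 1)" .
next
 fix i assume "0 < c i"
 then have "mat_vec idx (R h) w (K + 1, i, 1) = w (if c i < 0 then K else K + 1, i, 1) + h * (\<Sum>j\<in>UNIV. T i j * w (if c j < 0 then K else K + 1, j, 1))"
  by (subst R_eq) (simp add: Ed_outer[OF idx_top] J_top)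
 also have "0 <= \<dots>" by (rule pos_sum_T[OF h]) (rule pos_entry[OF w top_idx])
 finally show "0 <= mat_vec idx (R h) w (K + 1, i, 1)" .
next
 fix k i a assume k: "k \<in> levels" and a: "cone a"
 let ?a = "vec_mat I a (E (\<bar>c i\<bar> * h))"
 have a': "cone ?a" using a h by (intro cone_drift) auto
 have "(\<Sum>n\<in>I. a n * mat_vec idx (R h) w (k, i, n))
   = (\<Sum>m\<in>I. ?a m * (w (k, i, m) + h * (\<bar>c i\<bar> * s m * w (nxt k i, i, 1) + dirsum k i m w)))"
  unfolding vec_mat_dot by (intro sum.cong refl) (simp add: R_inner[OF k])
 also have "\<dots> = (\<Sum>m\<in>I. ?a m * w (k, i, m)) + (\<Sum>m\<in>I. h * \<bar>c i\<bar> * w (nxt k i, i, 1) * (?a m * s m)) + (\<Sum>m\<in>I. h * (?a m * dirsum k i m w))"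
  by (simp add: distrib_left sum.distrib mult_ac)
 also have "\<dots> = h * \<bar>c i\<bar> * w (nxt k i, i, 1) * (\<Sum>m\<in>I. ?a m * s m)
   + ((\<Sum>m\<in>I. ?a m * w (k, i, m)) + h * (\<Sum>m\<in>I. ?a m * dirsum k i m w))"
  by (simp add: sum_distrib_left)
 also have "(\<Sum>m\<in>I. ?a m * w (k, i, m)) + h * (\<Sum>m\<in>I. ?a m * dirsum k i m w)
   = dval k i ?a w i + h * (\<Sum>j\<in>UNIV. T i j * dval k i ?a w j)"
  by (simp add: dirsum_dot dval_diag)
 also have "0 <= h * \<bar>c i\<bar> * w (nxt k i, i, 1) * (\<Sum>m\<in>I. ?a m * s m) + \<dots>"
  by (intro add_nonneg_nonneg mult_nonneg_nonneg pos_sum_T[OF h] dval_nonneg w k a' s_dot_nonneg pos_entry[OF w nxt_idx[OF k]])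
    (use h in auto)
 finally show "0 <= (\<Sum>n\<in>I. a n * mat_vec idx (R h) w (k, i, n))" .
qed

section \<open>Expansion of the one-step operators\<close>

lemma Ed_taylor:
 obtains C where "0 <= C" "!!h x y. [|0 <= h; h <= h0; x \<in> idx; y \<in> idx|] ==> \<bar>Ed h x y - mat_one x y - h * F x y\<bar> <= C * h\<^sup>2"
proof -
 obtain C where C: "0 <= C" "!!h i j. [|\<bar>h\<bar> <= 1; i \<in> I; j \<in> I|] ==> \<bar>E h i j - mat_one i j - h * S i j\<bar> <= C * h\<^sup>2"
  using mat_exp_taylor[of I S] by blast
 show ?thesis
 proof (rule that[of "C * cm\<^sup>2"])
  show "0 <= C * cm\<^sup>2" using C by simp
  fix h x y assume h: "0 <= h" "h <= h0" and x: "x \<in> idx" and y: "y \<in> idx"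
  obtain k i n where xe: "x = (k, i, n)" by (cases x)
  obtain l j m where ye: "y = (l, j, m)" by (cases y)
  show "\<bar>Ed h x y - mat_one x y - h * F x y\<bar> <= C * cm\<^sup>2 * h\<^sup>2"
  proof (cases "l = k \<and> j = i \<and> k \<in> levels")
   case True
   then have "n \<in> I" "m \<in> I" using x y xe ye by (auto simp: qbd_index_def)
   then have "\<bar>E (\<bar>c i\<bar> * h) n m - mat_one n m - (\<bar>c i\<bar> * h) * S n m\<bar> <= C * (\<bar>c i\<bar> * h)\<^sup>2"
    using C(2)[of "\<bar>c i\<bar> * h"] h0(3)[OF h] h by auto
   also have "\<dots> <= C * (cm * h)\<^sup>2"
    by (intro mult_left_mono power_mono mult_right_mono cm C) (use h in auto)
   finally show ?thesis using True by (simp add: xe ye Ed_def F_def mat_one_def power_mult_distrib mult_ac)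
  next
   case False
   then have "Ed h x y - mat_one x y - h * F x y = 0" using x y
    by (auto simp: xe ye Ed_def F_def mat_one_def qbd_index_def)
   then show ?thesis using C by simp
  qed
 qed
qed

lemma Ed_small:
 obtains C where "0 <= C" "!!h x y. [|0 <= h; h <= h0; x \<in> idx; y \<in> idx|] ==> \<bar>Ed h x y - mat_one x y\<bar> <= C * h"
proof -
 obtain C where C: "0 <= C" "!!h x y. [|0 <= h; h <= h0; x \<in> idx; y \<in> idx|] ==> \<bar>Ed h x y - mat_one x y - h * F x y\<bar> <= C * h\<^sup>2"
  using Ed_taylor by blast
 show ?thesis
 proof (rule that[of "C + mat_norm idx F"])
  show "0 <= C + mat_norm idx F" using C mat_norm_nonneg[of idx F] by simp
  fix h x y assume h: "0 <= h" "h <= h0" and x: "x \<in> idx" and y: "y \<in> idx"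
  have "\<bar>F x y\<bar> <= (\<Sum>k\<in>idx. \<bar>F k y\<bar>)"
   by (rule member_le_sum[of x idx "\<lambda>k. \<bar>F k y\<bar>"]) (use x finite_idx in auto)
  also have "\<dots> <= mat_norm idx F" by (rule column_le_mat_norm[OF finite_idx y])
  finally have f: "\<bar>F x y\<bar> <= mat_norm idx F" .
  have "\<bar>Ed h x y - mat_one x y\<bar> <= C * h\<^sup>2 + h * \<bar>F x y\<bar>"
  proof -
   have "\<bar>h * F x y\<bar> = h * \<bar>F x y\<bar>" using h by (simp add: abs_mult)
   then show ?thesis using C(2)[OF h x y] by linarith
  qed
  also have "\<dots> <= C * h + h * mat_norm idx F"
   using h h0(2) C f by (intro add_mono mult_left_mono) (auto simp: power2_eq_square mult_left_le)
  finally show "\<bar>Ed h x y - mat_one x y\<bar> <= (C + mat_norm idx F) * h" by (simp add: algebra_simps)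
 qed
qed

lemma R_taylor:
 obtains C where "0 <= C" "!!h x y. [|0 <= h; h <= h0; x \<in> idx; y \<in> idx|] ==> \<bar>R h x y - mat_one x y - h * B x y\<bar> <= C * h\<^sup>2"
proof -
 obtain C where C: "0 <= C" "!!h x y. [|0 <= h; h <= h0; x \<in> idx; y \<in> idx|] ==> \<bar>Ed h x y - mat_one x y - h * F x y\<bar> <= C * h\<^sup>2"
  using Ed_taylor by blast
 obtain C' where C': "0 <= C'" "!!h x y. [|0 <= h; h <= h0; x \<in> idx; y \<in> idx|] ==> \<bar>Ed h x y - mat_one x y\<bar> <= C' * h"
  using Ed_small by blast
 show ?thesis
 proof (rule that[of "C + C' * mat_norm idx J"])
  show "0 <= C + C' * mat_norm idx J" using C C' mat_norm_nonneg[of idx J] by simp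
  fix h x y assume h: "0 <= h" "h <= h0" and x: "x \<in> idx" and y: "y \<in> idx"
  have "R h x y = (\<Sum>z\<in>idx. Ed h x z * mat_one z y) + h * (\<Sum>z\<in>idx. Ed h x z * J z y)"
   by (simp add: R_def mat_mul_def distrib_left sum.distrib sum_distrib_left mult_ac)
  also have "(\<Sum>z\<in>idx. Ed h x z * mat_one z y) = Ed h x y"
   by (rule sum_mat_one_right[OF finite_idx y])
  also have "(\<Sum>z\<in>idx. Ed h x z * J z y) = J x y + (\<Sum>z\<in>idx. (Ed h x z - mat_one x z) * J z y)"
   using sum_mat_one_left[OF finite_idx x, of "\<lambda>z. J z y"] by (simp add: left_diff_distrib sum_subtractf)
  finally have eq: "R h x y - mat_one x y - h * B x y = (Ed h x y - mat_one x y - h * F x y) + h * (\<Sum>z\<in>idx. (Ed h x z - mat_one x z) * J z y)"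
   by (simp add: J_def algebra_simps)
  have "\<bar>\<Sum>z\<in>idx. (Ed h x z - mat_one x z) * J z y\<bar> <= (\<Sum>z\<in>idx. (C' * h) * \<bar>J z y\<bar>)"
   by (rule order_trans[OF sum_abs]) (auto simp: abs_mult intro!: sum_mono mult_right_mono C'(2)[OF h x])
  also have "\<dots> = C' * h * (\<Sum>z\<in>idx. \<bar>J z y\<bar>)" by (simp add: sum_distrib_left)
  also have "\<dots> <= C' * h * mat_norm idx J"
   by (intro mult_left_mono column_le_mat_norm[OF finite_idx y]) (use C' h in auto)
  finally have "\<bar>h * (\<Sum>z\<in>idx. (Ed h x z - mat_one x z) * J z y)\<bar> <= h * (C' * h * mat_norm idx J)"
   using h by (simp add: abs_mult mult_left_mono)
  then show "\<bar>R h x y - mat_one x y - h * B x y\<bar> <= (C + C' * mat_norm idx J) * h\<^sup>2"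
   unfolding eq using C(2)[OF h x y] by (simp add: power2_eq_square algebra_simps)
 qed
qed

text \<open>To first order drift and jumps can be evaluated separately; their interaction is of
  second order, with a constant independent of the column except through its bound
  \<open>W\<close>.\<close>

lemma R_expand:
 obtains C where "0 <= C" "!!h w W x. [|0 <= h; h <= h0; x \<in> idx; !!y. y \<in> idx ==> \<bar>w y\<bar> <= W|] ==>
   \<bar>mat_vec idx (R h) w x - (mat_vec idx (Ed h) w x + h * mat_vec idx J w x)\<bar> <= C * W * h\<^sup>2"
proof -
 obtain C' where C': "0 <= C'" "!!h x y. [|0 <= h; h <= h0; x \<in> idx; y \<in> idx|] ==> \<bar>Ed h x y - mat_one x y\<bar> <= C' * h"
  using Ed_small by blast
 show ?thesis
 proof (rule that[of "C' * mat_norm idx J"])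
  show "0 <= C' * mat_norm idx J" using C' mat_norm_nonneg[of idx J] by simp
  fix h W :: real and w :: "nat \<times> 's \<times> nat => real" and x assume h: "0 <= h" "h <= h0" and x: "x \<in> idx" and w: "!!y. y \<in> idx ==> \<bar>w y\<bar> <= W"
  let ?v = "mat_vec idx J w"
  have "mat_vec idx (R h) w x = mat_vec idx (Ed h) w x + h * mat_vec idx (Ed h) ?v x"
   unfolding R_eq by (simp add: mat_vec_def distrib_left sum.distrib sum_distrib_left mult_ac)
  moreover have "mat_vec idx (Ed h) ?v x = ?v x + (\<Sum>y\<in>idx. (Ed h x y - mat_one x y) * ?v y)"
   using sum_mat_one_left[OF finite_idx x, of ?v] by (simp add: left_diff_distrib sum_subtractf mat_vec_def[of _ "Ed h"])
  ultimately have eq: "mat_vec idx (R h) w x - (mat_vec idx (Ed h) w x + h * ?v x) = h * (\<Sum>y\<in>idx. (Ed h x y - mat_one x y) * ?v y)"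
   by (simp add: algebra_simps)
  have "\<bar>\<Sum>y\<in>idx. (Ed h x y - mat_one x y) * ?v y\<bar> <= (\<Sum>y\<in>idx. (C' * h) * \<bar>?v y\<bar>)"
   by (rule order_trans[OF sum_abs]) (auto simp: abs_mult intro!: sum_mono mult_right_mono C'(2)[OF h x])
  also have "\<dots> = C' * h * (\<Sum>y\<in>idx. \<bar>?v y\<bar>)" by (simp add: sum_distrib_left)
  also have "(\<Sum>y\<in>idx. \<bar>?v y\<bar>) <= (\<Sum>z\<in>idx. (\<Sum>y\<in>idx. \<bar>J y z\<bar>) * \<bar>w z\<bar>)"
   by (rule sum_abs_mat_vec_le) simp
  also have "\<dots> <= (\<Sum>z\<in>idx. (\<Sum>y\<in>idx. \<bar>J y z\<bar>) * W)"
   by (intro sum_mono mult_left_mono w sum_nonneg) auto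
  also have "\<dots> = mat_norm idx J * W"
   by (subst sum_distrib_right[symmetric], subst sum.swap) (simp add: mat_norm_def)
  finally have "\<bar>\<Sum>y\<in>idx. (Ed h x y - mat_one x y) * ?v y\<bar> <= C' * h * (mat_norm idx J * W)"
   using C' h by (simp add: mult_left_mono)
  then have "h * \<bar>\<Sum>y\<in>idx. (Ed h x y - mat_one x y) * ?v y\<bar> <= h * (C' * h * (mat_norm idx J * W))"
   using h by (intro mult_left_mono) auto
  then show "\<bar>mat_vec idx (R h) w x - (mat_vec idx (Ed h) w x + h * ?v x)\<bar> <= C' * mat_norm idx J * W * h\<^sup>2"
   unfolding eq using h by (simp add: abs_mult power2_eq_square mult_ac)
 qed
qed

text \<open>Through \<open>cone_bounded\<close> an entrywise error is dominated by a constant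
  column. The factor depends on the scheme, so this serves only errors of second order in
  \<open>h\<close>.\<close>

lemma pos_small:
 obtains C where "0 <= C" "!!w e. (!!x. x \<in> idx ==> \<bar>w x\<bar> <= e) ==> pos (\<lambda>x. C * e + w x)"
proof -
 obtain C where C: "0 <= C" "!!a n. cone a ==> n \<in> I ==> \<bar>a n\<bar> <= C * (\<Sum>n\<in>I. a n)"
  using cone_bounded by blast
 \<comment> \<open>The summand 1 serves the boundary levels, \<open>q\<close> times \<open>C\<close>
   the \<open>q\<close> entries of an inner orbit.\<close>
 define C' where "C' = 1 + real q * C"
 have C': "1 <= C'" using C by (simp add: C'_def)
 show ?thesis
 proof (rule that[of C'])
  fix w e assume w: "!!x. x \<in> idx ==> \<bar>w x\<bar> <= (e::real)"
  have e: "0 <= e" using w[OF bottom_idx] by (auto intro: order_trans[OF abs_ge_zero])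
  have ce: "e <= C' * e" using C' e mult_right_mono[of 1 C' e] by simp
  have "0 <= C' * e + w x" if "x \<in> idx" for x using w[OF that] ce by linarith
  moreover have "0 <= (\<Sum>n\<in>I. a n * (C' * e + w (k, i, n)))" if k: "k \<in> levels" and a: "cone a" for k i a
  proof -
   have sa: "0 <= (\<Sum>n\<in>I. a n)" by (rule cone_sum_nonneg[OF a])
   have "\<bar>\<Sum>n\<in>I. a n * w (k, i, n)\<bar> <= (\<Sum>n\<in>I. (C * (\<Sum>n\<in>I. a n)) * e)"
   proof (rule order_trans[OF sum_abs], rule sum_mono)
    fix n assume n: "n \<in> I"
    show "\<bar>a n * w (k, i, n)\<bar> <= (C * (\<Sum>n\<in>I. a n)) * e"
     unfolding abs_mult using C(2)[OF a n] w[OF idx_inner[OF k n, of i]] C(1) sa by (intro mult_mono) auto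
   qed
   also have "\<dots> <= C' * e * (\<Sum>n\<in>I. a n)"
    using e sa by (simp add: C'_def algebra_simps)
   finally show ?thesis by (simp add: distrib_left sum.distrib sum_distrib_right[symmetric] mult.commute[of "sum a I"])
  qed
  ultimately show "pos (\<lambda>x. C' * e + w x)" unfolding pos_def using idx_bottom idx_top by blast
 qed (use C' in simp)
qed

section \<open>Columns that dominate the one-step errors\<close>

definition hz :: "nat \<times> 's \<times> nat => real" where
 "hz = (\<lambda>(k, i, n). if k \<in> levels then \<bar>c i\<bar> * s n else 0)"

definition Hc :: "nat \<times> 's \<times> nat => real" where
 "Hc = (\<lambda>(k, i, n). if k \<in> levels then IG excess n else 0)"

text \<open>The value is 1 when the residual time is used up and 1/2 at \<open>\<Delta>\<close>,
  close to which it stands on entering a cell: a change of level therefore loses about 1/2, while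
  drift raises the value at bounded speed.\<close>

definition ramp :: "real => real" where "ramp z = max 0 (1 - z / (2 * \<Delta>))"

text \<open>A Lyapunov function: it drops by a fixed amount at each change of level.\<close>

definition Th :: "nat \<times> 's \<times> nat => real" where
 "Th = (\<lambda>(k, i, n). if k \<in> levels then IG ramp n else 0)"

text \<open>\<open>e1\<close> is the error of \<open>orb_IG_approx\<close> for Lipschitz constant 1.
  \<open>c1\<close> bounds the growth of \<open>Th\<close>: slope of \<open>ramp\<close> times
  speed, plus phase changes of a column between 0 and 1. \<open>\<kappa>\<close> is the drop 1/2
  less the error of \<open>IG ramp 1\<close>. \<open>\<eta>2\<close> bounds the errors created at
  changes of phase.\<close>

definition e1 :: real where "e1 = \<epsilon> / (1 - \<epsilon>)"
definition c1 :: real where "c1 = cm / (2 * \<Delta>) + tm"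
definition \<kappa> :: real where "\<kappa> = 1 / 2 - \<epsilon> / (2 * \<Delta>)"
definition \<eta>2 :: real where "\<eta>2 = tm * (e1 + \<epsilon>)"

lemma e1: "0 <= e1" "\<epsilon> <= e1" and c1: "0 <= c1" and \<eta>2: "0 <= \<eta>2" "tm * e1 <= \<eta>2" "tm * \<epsilon> <= \<eta>2"
proof -
 show "\<epsilon> <= e1" using eps_bounds by (simp add: e1_def field_simps)
 then show "0 <= e1" using eps_bounds by simp
 then show "0 <= \<eta>2" "tm * e1 <= \<eta>2" "tm * \<epsilon> <= \<eta>2" using tm eps_bounds by (auto simp: \<eta>2_def distrib_left)
 show "0 <= c1" using cm tm \<Delta>_pos by (simp add: c1_def)
qed

lemma ramp_lipschitz: "\<bar>ramp x - ramp y\<bar> <= 1 / (2 * \<Delta>) * \<bar>x - y\<bar>"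
proof -
 have "\<bar>(1 - x / (2 * \<Delta>)) - (1 - y / (2 * \<Delta>))\<bar> = 1 / (2 * \<Delta>) * \<bar>x - y\<bar>"
  using \<Delta>_pos by (simp add: diff_divide_distrib[symmetric] abs_divide abs_minus_commute)
 then show ?thesis unfolding ramp_def by linarith
qed

lemma adm_ramp: "adm ramp" by (rule adm_lipschitz) (rule ramp_lipschitz)

lemma ramp_bounds: "0 <= ramp z" "0 <= z ==> ramp z <= 1"
 using \<Delta>_pos by (auto simp: ramp_def)

lemma pos_hz: "pos hz"
 using s_dot_nonneg unfolding pos_def hz_def
 by (auto simp: mult.left_commute[of _ "\<bar>c _\<bar>"] sum_distrib_left[symmetric])

lemma pos_Hc: "pos Hc"
 unfolding pos_def Hc_def using IG_nonneg[OF adm_excess] by (simp add: excess_nonneg)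

lemma pos_Th: "pos Th"
 unfolding pos_def Th_def using IG_nonneg[OF adm_ramp] by (simp add: ramp_bounds)

lemma pos_1_Th: "pos (\<lambda>x. 1 - Th x)"
proof -
 have "0 <= (\<Sum>n\<in>I. a n * (1 - IG ramp n))" if "cone a" for a
 proof -
  have "(\<Sum>n\<in>I. a n * IG ramp n) <= (\<Sum>n\<in>I. a n * IG (\<lambda>_. 1) n)"
   by (rule IG_mono[OF adm_ramp adm_const that]) (rule ramp_bounds)
  then show ?thesis unfolding IG_const_dot by (simp add: right_diff_distrib sum_subtractf)
 qed
 then show ?thesis by (simp add: pos_def Th_def)
qed

lemma Th_entry: "x \<in> idx ==> 0 <= Th x" "x \<in> idx ==> Th x <= 1"
 using pos_entry[OF pos_Th] pos_entry[OF pos_1_Th] by (cases x; force)+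

lemma Hc_entry: "x \<in> idx ==> 0 <= Hc x" "x \<in> idx ==> Hc x <= e1"
 using pos_entry[OF pos_Hc] apply (cases x; force)
 using IG_excess e1 by (auto simp: Hc_def e1_def qbd_index_def)

lemma dval_diff: "dval k i a (\<lambda>x. v x - w x) j = dval k i a v j - dval k i a w j"
 by (simp add: dval_def right_diff_distrib sum_subtractf)

lemma dval_const: "dval k i a (\<lambda>_. W) j = W * (\<Sum>n\<in>I. a n)"
proof -
 have "(\<Sum>n\<in>I. a n * (\<Sum>m\<in>I. D n m * W)) = (\<Sum>n\<in>I. a n * W)"
  by (intro sum.cong refl) (simp only: sum_distrib_right[symmetric] D_row_sum mult_1_left)
 then show ?thesis by (simp add: dval_def sum_distrib_left mult.commute)
qed

lemma T_dval_bound: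
 assumes "pos w" "pos (\<lambda>x. W - w x)" "k \<in> levels" "cone a"
 shows "(\<Sum>j\<in>UNIV. T i j * dval k i a w j) <= tm * W * (\<Sum>n\<in>I. a n)"
proof -
 have d: "0 <= dval k i a w j" "dval k i a w j <= W * (\<Sum>n\<in>I. a n)" for j
  using dval_nonneg[OF assms(1,3,4)] dval_nonneg[OF assms(2,3,4), of i j] by (auto simp: dval_diff dval_const)
 have W: "0 <= W * (\<Sum>n\<in>I. a n)" using d(1)[of i] d(2)[of i] by linarith
 have "(\<Sum>j\<in>UNIV. T i j * dval k i a w j) <= (\<Sum>j\<in>UNIV. \<bar>T i j\<bar> * (W * (\<Sum>n\<in>I. a n)))"
  by (intro sum_mono mult_mono d) auto
 also have "\<dots> = (\<Sum>j\<in>UNIV. \<bar>T i j\<bar>) * (W * (\<Sum>n\<in>I. a n))" by (simp only: sum_distrib_right)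
 also have "\<dots> <= tm * (W * (\<Sum>n\<in>I. a n))" by (intro mult_right_mono tm W)
 finally show ?thesis by (simp add: mult.assoc)
qed

text \<open>The common pattern of the next estimates: \<open>V\<close> is drift plus jumps up to
  second order, and only the comparison of \<open>V\<close> with \<open>U\<close> has to be made on
  the cone. The remainder enters as a constant column through \<open>pos_small\<close>.\<close>

lemma R_upper:
 obtains C where "0 <= C" "!!h w U V W e. [|0 <= h; h <= h0; !!y. y \<in> idx ==> \<bar>w y\<bar> <= W;
   !!x. x \<in> idx ==> \<bar>V x - (mat_vec idx (Ed h) w x + h * mat_vec idx J w x)\<bar> <= e * h\<^sup>2;
   pos (\<lambda>x. U x - V x)|] ==> pos (\<lambda>x. U x + C * (W + e) * h\<^sup>2 - mat_vec idx (R h) w x)"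
proof -
 obtain C where C: "0 <= C" "!!h w W x. [|0 <= h; h <= h0; x \<in> idx; !!y. y \<in> idx ==> \<bar>w y\<bar> <= W|] ==>
   \<bar>mat_vec idx (R h) w x - (mat_vec idx (Ed h) w x + h * mat_vec idx J w x)\<bar> <= C * W * h\<^sup>2"
  using R_expand by blast
 obtain C' where C': "0 <= C'" "!!w e. (!!x. x \<in> idx ==> \<bar>w x\<bar> <= e) ==> pos (\<lambda>x. C' * e + w x)"
  using pos_small by blast
 show ?thesis
 proof (rule that[of "C' * (C + 1)"])
  show "0 <= C' * (C + 1)" using C C' by simp
  fix h :: real and w U V :: "nat \<times> 's \<times> nat => real" and W e :: real
  assume h: "0 <= h" "h <= h0" and w: "!!y. y \<in> idx ==> \<bar>w y\<bar> <= W"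
   and V: "!!x. x \<in> idx ==> \<bar>V x - (mat_vec idx (Ed h) w x + h * mat_vec idx J w x)\<bar> <= e * h\<^sup>2"
   and U: "pos (\<lambda>x. U x - V x)"
  have W0: "0 <= W" using w[OF bottom_idx] by (auto intro: order_trans[OF abs_ge_zero])
  have e0: "0 <= e * h\<^sup>2" using V[OF bottom_idx] by (auto intro: order_trans[OF abs_ge_zero])
  have "\<bar>V x - mat_vec idx (R h) w x\<bar> <= (C + 1) * (W * h\<^sup>2 + e * h\<^sup>2)" if "x \<in> idx" for x
  proof -
   have "\<bar>V x - mat_vec idx (R h) w x\<bar> <= C * W * h\<^sup>2 + e * h\<^sup>2"
   proof -
    have "\<bar>mat_vec idx (R h) w x - (mat_vec idx (Ed h) w x + h * mat_vec idx J w x)\<bar> <= C * W * h\<^sup>2"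
     by (rule C(2)[OF h that]) (rule w)
    then show ?thesis using V[OF that] by linarith
   qed
   also have "\<dots> <= (C + 1) * (W * h\<^sup>2 + e * h\<^sup>2)"
    using C(1) W0 e0 by (simp add: algebra_simps)
   finally show ?thesis .
  qed
  from C'(2)[OF this] have "pos (\<lambda>x. C' * ((C + 1) * (W * h\<^sup>2 + e * h\<^sup>2)) + (V x - mat_vec idx (R h) w x))" .
  from pos_add[OF U this] show "pos (\<lambda>x. U x + C' * (C + 1) * (W + e) * h\<^sup>2 - mat_vec idx (R h) w x)"
   by (rule pos_cong) (simp add: algebra_simps)
 qed
qed

text \<open>Rows of \<open>D\<close> sum to 1 and rows of \<open>T\<close> to 0, so \<open>B\<close>
  annihilates constants, and \<open>J\<close> returns the mass that the drift \<open>F\<close> loses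
  at rate \<open>s\<close>.\<close>

lemma J_const: "x \<in> idx ==> mat_vec idx J (\<lambda>_. W) x = W * hz x"
proof -
 assume x: "x \<in> idx"
 have dir: "dirsum k i n (\<lambda>_. W) = 0" if "n \<in> I" for k i n
 proof -
  have "(\<Sum>m\<in>I. D n m * W) = W"
   using D_row_sum[OF that] by (simp add: sum_distrib_right[symmetric])
  then have "(if sgn (c i) = sgn (c j) then W else (\<Sum>m\<in>I. D n m * W)) = W" for j by simp
  then have "dirsum k i n (\<lambda>_. W) = (\<Sum>j\<in>UNIV. T i j) * W" by (simp only: dirsum_def sum_distrib_right)
  then show ?thesis by (simp add: T_sum)
 qed
 have t0: "(\<Sum>j\<in>UNIV. T i j * W) = 0" for i using T_sum[of i] by (simp add: sum_distrib_right[symmetric])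
 from x show ?thesis
  by (cases rule: idx_cases) (auto simp: J_inner J_bottom J_top[simplified] dir hz_def t0)
qed

text \<open>The mass lost by drift and the mass returned by jumps cancel to first order, so
  constants grow only by a term of second order per step.\<close>

lemma R_one:
 obtains C where "0 <= C" "!!h. [|0 <= h; h <= h0|] ==> pos (\<lambda>x. 1 + C * h\<^sup>2 - mat_vec idx (R h) (\<lambda>_. 1) x)"
proof -
 obtain C where C: "0 <= C" "!!h w U V W e. [|0 <= h; h <= h0; !!y. y \<in> idx ==> \<bar>w y\<bar> <= W;
   !!x. x \<in> idx ==> \<bar>V x - (mat_vec idx (Ed h) w x + h * mat_vec idx J w x)\<bar> <= e * h\<^sup>2;
   pos (\<lambda>x. U x - V x)|] ==> pos (\<lambda>x. U x + C * (W + e) * h\<^sup>2 - mat_vec idx (R h) w x)"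
  using R_upper by blast
 obtain C' where C': "0 <= C'" "!!h n. [|0 <= h; h <= 1; n \<in> I|] ==> \<bar>1 - G n h - h * s n\<bar> <= C' * h\<^sup>2"
  using G_taylor by blast
 show ?thesis
 proof (rule that[of "C * (1 + C' * cm\<^sup>2)"])
  show "0 <= C * (1 + C' * cm\<^sup>2)" using C C' by simp
  fix h assume h: "0 <= h" "h <= h0"
  show "pos (\<lambda>x. 1 + C * (1 + C' * cm\<^sup>2) * h\<^sup>2 - mat_vec idx (R h) (\<lambda>_. 1) x)"
  proof (rule C(2)[OF h, of _ _ "\<lambda>_. 1"])
   fix x assume x: "x \<in> idx"
   then show "\<bar>1 - (mat_vec idx (Ed h) (\<lambda>_. 1) x + h * mat_vec idx J (\<lambda>_. 1) x)\<bar> <= C' * cm\<^sup>2 * h\<^sup>2"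
   proof (cases rule: idx_cases)
    case (inner k i n)
    have "\<bar>1 - G n (\<bar>c i\<bar> * h) - (\<bar>c i\<bar> * h) * s n\<bar> <= C' * (\<bar>c i\<bar> * h)\<^sup>2"
     by (rule C'(2)) (use h h0(3)[OF h] inner in auto)
    also have "\<dots> <= C' * (cm * h)\<^sup>2"
     by (intro mult_left_mono power_mono mult_right_mono cm C') (use h in auto)
    finally show ?thesis unfolding inner(1) Ed_inner[OF inner(2)] J_const[OF x[unfolded inner(1)]] using inner
     by (simp add: hz_def G_def power_mult_distrib algebra_simps)
   next
    case (bottom i)
    show ?thesis unfolding bottom(1) J_const[OF x[unfolded bottom(1)]] Ed_outer[OF idx_bottom[OF bottom(2)], simplified]
     using C' by (simp add: hz_def)
   next
    case (top i)
    have "K + 1 \<notin> levels" by simp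
    then show ?thesis unfolding top(1) J_const[OF x[unfolded top(1)]] Ed_outer[OF idx_top[OF top(2)] \<open>K + 1 \<notin> levels\<close>]
     using C' by (simp add: hz_def)
   qed
  qed (use pos_const in auto)
 qed
qed

lemma IG_bounded:
 assumes "adm g" "n \<in> I" "!!z. 0 <= z ==> \<bar>g z\<bar> <= Fb"
 shows "\<bar>IG g n\<bar> <= Fb"
 using IG_abs_le[OF assms(1) adm_const cone_unit[OF assms(2)], of Fb] assms(2,3) by (simp add: unit_dot IG_const)

lemma IG_ramp_1: "IG ramp 1 <= 1 / 2 + \<epsilon> / (2 * \<Delta>)"
 using IG_1_approx[of ramp "1 / (2 * \<Delta>)", OF ramp_lipschitz] \<Delta>_pos by (simp add: ramp_def)

lemma Th_nxt: "k \<in> levels ==> Th (nxt k i, i, 1) <= 1 - \<kappa>"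
 using IG_ramp_1 eps_bounds \<Delta>_pos by (auto simp: Th_def \<kappa>_def)

lemma Hc_nxt: "Hc (k, i, 1) <= \<epsilon>"
 using IG_excess_1 eps_bounds by (auto simp: Hc_def)

text \<open>Mass leaves a cell where \<open>ramp\<close> is 1 and reappears with value at most
  \<open>1 - \<kappa>\<close>; the difference gives the term with \<open>hz\<close>. Everything else
  raises \<open>Th\<close> at rate at most \<open>c1\<close>.\<close>

lemma R_Th:
 obtains C where "0 <= C" "!!h. [|0 <= h; h <= h0|] ==>
   pos (\<lambda>x. Th x + h * (c1 - \<kappa> * hz x) + C * h\<^sup>2 - mat_vec idx (R h) Th x)"
proof -
 obtain C where C: "0 <= C" "!!h w U V W e. [|0 <= h; h <= h0; !!y. y \<in> idx ==> \<bar>w y\<bar> <= W;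
   !!x. x \<in> idx ==> \<bar>V x - (mat_vec idx (Ed h) w x + h * mat_vec idx J w x)\<bar> <= e * h\<^sup>2;
   pos (\<lambda>x. U x - V x)|] ==> pos (\<lambda>x. U x + C * (W + e) * h\<^sup>2 - mat_vec idx (R h) w x)"
  using R_upper by blast
 obtain C' where C': "0 <= C'"
  "!!g h g0 Fb L n. [|0 <= h; h <= 1; n \<in> I; adm g; !!z. 0 <= z ==> z < h ==> \<bar>g z - g0\<bar> <= L * h; \<bar>g0\<bar> <= Fb; 0 <= L|]
    ==> \<bar>IG (\<lambda>z. indicator {..<h} z * g z) n - h * s n * g0\<bar> <= C' * (Fb + L) * h\<^sup>2"
  using short_time by blast
 let ?e = "C' * (1 + 1 / (2 * \<Delta>)) * cm\<^sup>2"
 show ?thesis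
 proof (rule that[of "C * (1 + ?e)"])
  show "0 <= C * (1 + ?e)" using C C' \<Delta>_pos by simp
  fix h assume h: "0 <= h" "h <= h0"
  \<comment> \<open>The mass leaving within the step, against its first order value with
    \<open>ramp 0 = 1\<close>. Adding it to \<open>V\<close> exchanges the signed entry
    \<open>s n\<close> for an integral that can be compared on the cone.\<close>
  define X where "X = (\<lambda>i n. IG (\<lambda>z. indicator {..<\<bar>c i\<bar> * h} z * ramp z) n - \<bar>c i\<bar> * h * s n * 1)"
  define V where "V = (\<lambda>x. mat_vec idx (Ed h) Th x + h * mat_vec idx J Th x
    + (case x of (k, i, n) => if k \<in> levels then X i n else 0))"
  show "pos (\<lambda>x. Th x + h * (c1 - \<kappa> * hz x) + C * (1 + ?e) * h\<^sup>2 - mat_vec idx (R h) Th x)"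
  proof (rule C(2)[OF h, of Th 1 V])
   show "\<bar>Th y\<bar> <= 1" if "y \<in> idx" for y using Th_entry[OF that] by simp
   fix x assume x: "x \<in> idx"
   then show "\<bar>V x - (mat_vec idx (Ed h) Th x + h * mat_vec idx J Th x)\<bar> <= ?e * h\<^sup>2"
   proof (cases rule: idx_cases)
    case (inner k i n)
    have "\<bar>X i n\<bar> <= C' * (1 + 1 / (2 * \<Delta>)) * (\<bar>c i\<bar> * h)\<^sup>2"
     unfolding X_def
    proof (rule C'(2))
     show "0 <= \<bar>c i\<bar> * h" "\<bar>c i\<bar> * h <= 1" using h h0(3)[OF h] by auto
     fix z assume z: "0 <= z" "z < \<bar>c i\<bar> * h"
     have "\<bar>ramp z - ramp 0\<bar> <= 1 / (2 * \<Delta>) * \<bar>z - 0\<bar>" by (rule ramp_lipschitz)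
     also have "\<dots> <= 1 / (2 * \<Delta>) * (\<bar>c i\<bar> * h)"
      using z \<Delta>_pos by (intro mult_left_mono) auto
     finally show "\<bar>ramp z - 1\<bar> <= 1 / (2 * \<Delta>) * (\<bar>c i\<bar> * h)" by (simp add: ramp_def)
    qed (use inner adm_ramp \<Delta>_pos in auto)
    also have "\<dots> <= C' * (1 + 1 / (2 * \<Delta>)) * (cm * h)\<^sup>2"
     by (intro mult_left_mono power_mono mult_right_mono cm) (use h C' \<Delta>_pos in auto)
    finally show ?thesis using inner by (simp add: V_def power_mult_distrib mult.assoc)
   qed (use C' \<Delta>_pos in \<open>auto simp: V_def\<close>)
  next
   show "pos (\<lambda>x. Th x + h * (c1 - \<kappa> * hz x) - V x)"
    unfolding pos_def
   proof (intro conjI allI ballI impI)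
    fix i assume ci: "c i < 0"
    have "(\<Sum>j\<in>UNIV. T i j * Th (if c j < 0 then 0 else 1, j, 1)) <= (\<Sum>j\<in>UNIV. \<bar>T i j\<bar> * 1)"
     by (intro sum_mono mult_mono Th_entry bottom_idx) auto
    also have "\<dots> <= c1" using tm(2)[of i] cm \<Delta>_pos by (simp add: c1_def add_increasing)
    finally show "0 <= Th (0, i, 1) + h * (c1 - \<kappa> * hz (0, i, 1)) - V (0, i, 1)"
     using h ci by (simp add: V_def Ed_outer idx_bottom J_bottom Th_def[of ] hz_def mult_left_mono)
   next
    fix i assume ci: "0 < c i"
    have "(\<Sum>j\<in>UNIV. T i j * Th (if c j < 0 then K else K + 1, j, 1)) <= (\<Sum>j\<in>UNIV. \<bar>T i j\<bar> * 1)"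
     by (intro sum_mono mult_mono Th_entry top_idx) auto
    also have "\<dots> <= c1" using tm(2)[of i] cm \<Delta>_pos by (simp add: c1_def add_increasing)
    finally have "h * mat_vec idx J Th (K + 1, i, 1) <= h * c1"
     unfolding J_top[OF ci] by (rule mult_left_mono[OF _ h(1)])
    then show "0 <= Th (K + 1, i, 1) + h * (c1 - \<kappa> * hz (K + 1, i, 1)) - V (K + 1, i, 1)"
     by (simp add: V_def Ed_outer[OF idx_top[OF ci]] hz_def)
   next
    fix k i a assume k: "k \<in> levels" and a: "cone a"
    let ?\<delta> = "\<bar>c i\<bar> * h"
    let ?s = "\<Sum>n\<in>I. a n * s n" and ?a = "\<Sum>n\<in>I. a n"
    have d0: "0 <= ?\<delta>" using h by simp
    \<comment> \<open>\<open>sh\<close> is the part of the residual time that survives the drift,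
      \<open>lo\<close> the part that leaves the cell during it.\<close>
    define sh where "sh = (\<lambda>z. indicator {?\<delta>..} z * ramp (z - ?\<delta>))"
    define lo where "lo = (\<lambda>z. indicator {..<?\<delta>} z * ramp z)"
    have adm: "adm sh" "adm lo" unfolding sh_def lo_def
     using adm_shift_back[OF adm_ramp d0] adm_borel[OF adm_ramp] ramp_bounds
     by (auto intro!: adm_bounded[of _ 1] simp: indicator_def)
    have V_eq: "V (k, i, n) = IG sh n + IG lo n - ?\<delta> * s n + h * (\<bar>c i\<bar> * s n * Th (nxt k i, i, 1) + dirsum k i n Th)"
     if "n \<in> I" for n
    proof -
     have "mat_vec idx (Ed h) Th (k, i, n) = (\<Sum>m\<in>I. E ?\<delta> n m * IG ramp m)"
      unfolding Ed_inner[OF k] using k by (simp add: Th_def)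
     also have "\<dots> = IG sh n" unfolding sh_def by (rule drift_IG[OF adm_ramp d0 that])
     finally show ?thesis using k that by (simp add: V_def X_def lo_def J_inner)
    qed
    have "(\<Sum>n\<in>I. a n * V (k, i, n)) = (\<Sum>n\<in>I. a n * (IG sh n + IG lo n - ?\<delta> * s n + h * (\<bar>c i\<bar> * s n * Th (nxt k i, i, 1) + dirsum k i n Th)))"
     by (intro sum.cong refl) (simp only: V_eq)
    also have "\<dots> = (\<Sum>n\<in>I. a n * IG sh n) + (\<Sum>n\<in>I. a n * IG lo n) - ?\<delta> * ?s + ?\<delta> * ?s * Th (nxt k i, i, 1)
      + h * (\<Sum>n\<in>I. a n * dirsum k i n Th)"
     by (simp add: distrib_left right_diff_distrib sum.distrib sum_subtractf sum_distrib_left sum_distrib_right mult_ac)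
    also have "(\<Sum>n\<in>I. a n * IG sh n) + (\<Sum>n\<in>I. a n * IG lo n) = (\<Sum>n\<in>I. a n * IG (\<lambda>z. sh z + lo z) n)"
     unfolding sum.distrib[symmetric] by (intro sum.cong refl) (simp only: IG_add[OF adm] distrib_left)
    also have "(\<Sum>n\<in>I. a n * IG (\<lambda>z. sh z + lo z) n) <= (\<Sum>n\<in>I. a n * IG (\<lambda>z. ramp z + ?\<delta> / (2 * \<Delta>)) n)"
    proof (rule IG_mono[OF adm_add[OF adm] adm_add[OF adm_ramp adm_const] a])
     fix z :: real assume "0 <= z"
     have "ramp (z - ?\<delta>) <= ramp z + ?\<delta> / (2 * \<Delta>)"
      using ramp_lipschitz[of "z - ?\<delta>" z] d0 by simp
     moreover have "0 <= ?\<delta> / (2 * \<Delta>)" using d0 \<Delta>_pos by simp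
     ultimately show "sh z + lo z <= ramp z + ?\<delta> / (2 * \<Delta>)" by (auto simp: sh_def lo_def indicator_def)
    qed
    also have "(\<Sum>n\<in>I. a n * IG (\<lambda>z. ramp z + ?\<delta> / (2 * \<Delta>)) n) = (\<Sum>n\<in>I. a n * (IG ramp n + IG (\<lambda>_. ?\<delta> / (2 * \<Delta>)) n))"
     by (intro sum.cong refl) (simp only: IG_add[OF adm_ramp adm_const])
    also have "\<dots> = (\<Sum>n\<in>I. a n * IG ramp n) + ?\<delta> / (2 * \<Delta>) * ?a"
     by (simp only: distrib_left sum.distrib IG_const_dot)
    finally have 1: "(\<Sum>n\<in>I. a n * V (k, i, n)) <= (\<Sum>n\<in>I. a n * IG ramp n) + ?\<delta> / (2 * \<Delta>) * ?a
      - ?\<delta> * ?s + ?\<delta> * ?s * Th (nxt k i, i, 1) + h * (\<Sum>n\<in>I. a n * dirsum k i n Th)" by simp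
    have sa: "0 <= ?a" by (rule cone_sum_nonneg[OF a])
    have "?\<delta> * ?s * Th (nxt k i, i, 1) <= ?\<delta> * ?s * (1 - \<kappa>)"
     by (intro mult_left_mono Th_nxt k mult_nonneg_nonneg d0 s_dot_nonneg a)
    moreover have "h * (\<Sum>n\<in>I. a n * dirsum k i n Th) <= h * (tm * 1 * ?a)"
     unfolding dirsum_dot by (intro mult_left_mono T_dval_bound pos_Th pos_1_Th k a h)
    moreover have "?\<delta> / (2 * \<Delta>) * ?a <= cm * h / (2 * \<Delta>) * ?a"
     using cm(2)[of i] h sa \<Delta>_pos by (intro mult_right_mono divide_right_mono) auto
    moreover have "(\<Sum>n\<in>I. a n * (Th (k, i, n) + h * (c1 - \<kappa> * hz (k, i, n)) - V (k, i, n)))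
      = (\<Sum>n\<in>I. a n * IG ramp n) + h * c1 * ?a - \<kappa> * (?\<delta> * ?s) - (\<Sum>n\<in>I. a n * V (k, i, n))"
     using k by (simp add: Th_def hz_def distrib_left right_diff_distrib sum.distrib sum_subtractf sum_distrib_left sum_distrib_right mult_ac)
    moreover have "h * c1 * ?a = cm * h / (2 * \<Delta>) * ?a + h * (tm * 1 * ?a)"
     by (simp add: c1_def algebra_simps)
    ultimately show "0 <= (\<Sum>n\<in>I. a n * (Th (k, i, n) + h * (c1 - \<kappa> * hz (k, i, n)) - V (k, i, n)))"
     using 1 by (simp add: algebra_simps)
   qed
  qed
 qed
qed

text \<open>The remaining entries of the row are off the diagonal, hence nonnegative, and the whole
  row sums to 0. Changes of phase without reversal thus never increase the excess.\<close>

lemma T_same_nonpos: "(\<Sum>j\<in>UNIV. if sgn (c i) = sgn (c j) then T i j else 0) <= 0"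
proof -
 have "(\<Sum>j\<in>UNIV. if sgn (c i) = sgn (c j) then T i j else 0) = (\<Sum>j\<in>UNIV. T i j) - (\<Sum>j\<in>UNIV. if sgn (c i) = sgn (c j) then 0 else T i j)"
  unfolding sum_subtractf[symmetric] by (intro sum.cong) auto
 moreover have "0 <= (\<Sum>j\<in>UNIV. if sgn (c i) = sgn (c j) then 0 else T i j)"
  by (intro sum_nonneg) (auto intro: T_off)
 ultimately show ?thesis by (simp add: T_sum)
qed

text \<open>Drift decreases the excess, a change of level creates at most \<open>\<epsilon>\<close>,
  a reversal replaces it by at most \<open>e1\<close>, and the coefficient of the present excess is
  nonpositive. There is no feedback, hence no exponential growth.\<close>

lemma R_Hc:
 obtains C where "0 <= C" "!!h. [|0 <= h; h <= h0|] ==>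
   pos (\<lambda>x. Hc x + h * (\<epsilon> * hz x + \<eta>2) + C * h\<^sup>2 - mat_vec idx (R h) Hc x)"
proof -
 obtain C where C: "0 <= C" "!!h w U V W e. [|0 <= h; h <= h0; !!y. y \<in> idx ==> \<bar>w y\<bar> <= W;
   !!x. x \<in> idx ==> \<bar>V x - (mat_vec idx (Ed h) w x + h * mat_vec idx J w x)\<bar> <= e * h\<^sup>2;
   pos (\<lambda>x. U x - V x)|] ==> pos (\<lambda>x. U x + C * (W + e) * h\<^sup>2 - mat_vec idx (R h) w x)"
  using R_upper by blast
 show ?thesis
 proof (rule that[of "C * (e1 + 0)"])
  show "0 <= C * (e1 + 0)" using C e1 by simp
  fix h assume h: "0 <= h" "h <= h0"
  let ?V = "\<lambda>x. mat_vec idx (Ed h) Hc x + h * mat_vec idx J Hc x"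
  show "pos (\<lambda>x. Hc x + h * (\<epsilon> * hz x + \<eta>2) + C * (e1 + 0) * h\<^sup>2 - mat_vec idx (R h) Hc x)"
  proof (rule C(2)[OF h, of Hc e1 ?V])
   show "\<bar>Hc y\<bar> <= e1" if "y \<in> idx" for y using Hc_entry[OF that] by simp
   show "\<bar>?V x - ?V x\<bar> <= 0 * h\<^sup>2" for x by simp
   show "pos (\<lambda>x. Hc x + h * (\<epsilon> * hz x + \<eta>2) - ?V x)"
    unfolding pos_def
   proof (intro conjI allI ballI impI)
    have bnd: "(\<Sum>j\<in>UNIV. T i j * Hc (g j, j, 1)) <= \<eta>2" if "!!j. (g j, j, 1) \<in> idx" for g :: "'s => nat" and i
    proof -
     have "(\<Sum>j\<in>UNIV. T i j * Hc (g j, j, 1)) <= (\<Sum>j\<in>UNIV. \<bar>T i j\<bar> * \<epsilon>)"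
      by (intro sum_mono mult_mono Hc_nxt Hc_entry that) auto
     also have "\<dots> = (\<Sum>j\<in>UNIV. \<bar>T i j\<bar>) * \<epsilon>" by (simp only: sum_distrib_right)
     also have "\<dots> <= tm * \<epsilon>" using eps_bounds by (intro mult_right_mono tm) auto
     finally show ?thesis using \<eta>2 by simp
    qed
    fix i
    { assume ci: "c i < 0"
     have "h * mat_vec idx J Hc (0, i, 1) <= h * \<eta>2"
      unfolding J_bottom[OF ci] using h by (intro mult_left_mono bnd bottom_idx) auto
     then show "0 <= Hc (0, i, 1) + h * (\<epsilon> * hz (0, i, 1) + \<eta>2) - ?V (0, i, 1)"
      by (simp add: Ed_outer[OF idx_bottom[OF ci]] hz_def) }
    { assume ci: "0 < c i"
     have "h * mat_vec idx J Hc (K + 1, i, 1) <= h * \<eta>2"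
      unfolding J_top[OF ci] using h by (intro mult_left_mono bnd top_idx) auto
     then show "0 <= Hc (K + 1, i, 1) + h * (\<epsilon> * hz (K + 1, i, 1) + \<eta>2) - ?V (K + 1, i, 1)"
      by (simp add: Ed_outer[OF idx_top[OF ci]] hz_def) }
    fix k a assume k: "k \<in> levels" and a: "cone a"
    let ?\<delta> = "\<bar>c i\<bar> * h"
    let ?s = "\<Sum>n\<in>I. a n * s n" and ?a = "\<Sum>n\<in>I. a n" and ?H = "\<Sum>n\<in>I. a n * IG excess n"
    have d0: "0 <= ?\<delta>" using h by simp
    have sa: "0 <= ?a" by (rule cone_sum_nonneg[OF a])
    have H0: "0 <= ?H" by (rule IG_nonneg[OF adm_excess a excess_nonneg])
    define sh where "sh = (\<lambda>z. indicator {?\<delta>..} z * excess (z - ?\<delta>))"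
    have adm: "adm sh" unfolding sh_def by (rule adm_shift_back[OF adm_excess d0])
    have V_eq: "?V (k, i, n) = IG sh n + h * (\<bar>c i\<bar> * s n * Hc (nxt k i, i, 1) + dirsum k i n Hc)"
     if "n \<in> I" for n
    proof -
     have "mat_vec idx (Ed h) Hc (k, i, n) = (\<Sum>m\<in>I. E ?\<delta> n m * IG excess m)"
      unfolding Ed_inner[OF k] using k by (simp add: Hc_def)
     also have "\<dots> = IG sh n" unfolding sh_def by (rule drift_IG[OF adm_excess d0 that])
     finally show ?thesis using k that by (simp add: J_inner)
    qed
    have "(\<Sum>n\<in>I. a n * ?V (k, i, n)) = (\<Sum>n\<in>I. a n * (IG sh n + h * (\<bar>c i\<bar> * s n * Hc (nxt k i, i, 1) + dirsum k i n Hc)))"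
     by (intro sum.cong refl) (simp only: V_eq)
    also have "\<dots> = (\<Sum>n\<in>I. a n * IG sh n) + ?\<delta> * ?s * Hc (nxt k i, i, 1) + h * (\<Sum>n\<in>I. a n * dirsum k i n Hc)"
     by (simp add: distrib_left sum.distrib sum_distrib_left sum_distrib_right mult_ac)
    finally have 0: "(\<Sum>n\<in>I. a n * ?V (k, i, n)) = (\<Sum>n\<in>I. a n * IG sh n) + ?\<delta> * ?s * Hc (nxt k i, i, 1) + h * (\<Sum>n\<in>I. a n * dirsum k i n Hc)" .
    have 1: "(\<Sum>n\<in>I. a n * IG sh n) <= ?H"
     by (rule IG_mono[OF adm adm_excess a]) (use d0 in \<open>auto simp: sh_def excess_def indicator_def\<close>)
    have 2: "?\<delta> * ?s * Hc (nxt k i, i, 1) <= ?\<delta> * ?s * \<epsilon>"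
     by (intro mult_left_mono Hc_nxt mult_nonneg_nonneg d0 s_dot_nonneg a)
    have "(\<Sum>j\<in>UNIV. T i j * dval k i a Hc j) <= (\<Sum>j\<in>UNIV. (if sgn (c i) = sgn (c j) then T i j else 0) * ?H + \<bar>T i j\<bar> * (e1 * ?a))"
    proof (rule sum_mono)
     fix j
     show "T i j * dval k i a Hc j <= (if sgn (c i) = sgn (c j) then T i j else 0) * ?H + \<bar>T i j\<bar> * (e1 * ?a)"
     proof (cases "sgn (c i) = sgn (c j)")
      case True
      then show ?thesis using k e1 sa by (simp add: dval_def Hc_def)
     next
      case False
      have "dval k i a Hc j <= e1 * ?a"
       using False k D_excess[OF a] by (simp add: dval_def Hc_def e1_def)
      then have "T i j * dval k i a Hc j <= \<bar>T i j\<bar> * (e1 * ?a)"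
       using dval_nonneg[OF pos_Hc k a, of i j] by (intro mult_mono) auto
      then show ?thesis using False by simp
     qed
    qed
    also have "\<dots> = (\<Sum>j\<in>UNIV. if sgn (c i) = sgn (c j) then T i j else 0) * ?H + (\<Sum>j\<in>UNIV. \<bar>T i j\<bar>) * (e1 * ?a)"
     by (simp only: sum.distrib sum_distrib_right)
    also have "\<dots> <= 0 * ?H + tm * (e1 * ?a)"
     by (intro add_mono mult_right_mono T_same_nonpos H0 tm mult_nonneg_nonneg e1 sa)
    also have "\<dots> <= \<eta>2 * ?a" using mult_right_mono[OF \<eta>2(2) sa] by (simp add: mult.assoc)
    finally have 3: "h * (\<Sum>n\<in>I. a n * dirsum k i n Hc) <= h * (\<eta>2 * ?a)"
     unfolding dirsum_dot using h by (intro mult_left_mono) auto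
    have "(\<Sum>n\<in>I. a n * (Hc (k, i, n) + h * (\<epsilon> * hz (k, i, n) + \<eta>2) - ?V (k, i, n)))
     = (\<Sum>n\<in>I. a n * (Hc (k, i, n) + h * (\<epsilon> * hz (k, i, n) + \<eta>2))) - (\<Sum>n\<in>I. a n * ?V (k, i, n))"
     by (simp only: right_diff_distrib sum_subtractf)
    also have "(\<Sum>n\<in>I. a n * (Hc (k, i, n) + h * (\<epsilon> * hz (k, i, n) + \<eta>2))) = ?H + ?\<delta> * ?s * \<epsilon> + h * (\<eta>2 * ?a)"
     using k by (simp add: Hc_def hz_def distrib_left sum.distrib sum_distrib_left sum_distrib_right mult_ac)
    finally show "0 <= (\<Sum>n\<in>I. a n * (Hc (k, i, n) + h * (\<epsilon> * hz (k, i, n) + \<eta>2) - ?V (k, i, n)))"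
     using 0 1 2 3 by linarith
   qed
  qed
 qed
qed

section \<open>Positions on the grid\<close>

text \<open>The end of cell \<open>k\<close> towards which phase \<open>i\<close> moves. Orbits run
  at speed \<open>\<bar>c i\<bar>\<close>, so the residual time is a distance from this end.\<close>

definition edge :: "nat => 's => real" where
 "edge k i = gridpt b K (if 0 < c i then k + 1 else k)"

text \<open>The level of the fluid queue when the residual time in the cell is \<open>z\<close>.\<close>

definition posn :: "nat => 's => real => real" where
 "posn k i z = edge k i - sgn (c i) * z"

definition flow :: "'s => real => real => real" where
 "flow i h x = (if 0 < c i then min (x + c i * h) b else max (x + c i * h) 0)"

lemma gridpt_eq: "gridpt b K k = (real k - 1) * \<Delta>"
 by (simp add: gridpt_def \<Delta>_eq)

lemma K_\<Delta>: "real K * \<Delta> = b"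
 using K by (simp add: \<Delta>_eq)

lemma gridpt_Suc: "gridpt b K (k + 1) = gridpt b K k + \<Delta>"
 and gridpt_1: "gridpt b K 1 = 0" and gridpt_top: "gridpt b K (K + 1) = b"
 using K_\<Delta> by (simp_all add: gridpt_eq algebra_simps)

lemma edge_bounds: "k \<in> levels ==> 0 <= edge k i" "k \<in> levels ==> edge k i <= b"
proof -
 assume k: "k \<in> levels"
 have "0 <= (real k - 1) * \<Delta>" using k \<Delta>_pos by (intro mult_nonneg_nonneg) auto
 moreover have "(real k - 1) * \<Delta> + \<Delta> <= b"
 proof -
  have "real k * \<Delta> <= real K * \<Delta>" using k \<Delta>_pos by (intro mult_right_mono) auto
  then show ?thesis by (simp add: K_\<Delta> left_diff_distrib)
 qed
 ultimately show "0 <= edge k i" "edge k i <= b" using \<Delta>_pos gridpt_Suc[of k]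
  by (auto simp: edge_def gridpt_eq)
qed

lemma sgn_c: "sgn (c i) = (if 0 < c i then 1 else - 1)"
 using c_cases[of i] by (auto simp: sgn_if)

lemma posn_lip: "\<bar>posn k i x - posn k i y\<bar> = \<bar>x - y\<bar>"
 by (auto simp: posn_def sgn_c)

lemma posn_same: "sgn (c i) = sgn (c j) ==> posn k i = posn k j"
 by (auto simp: posn_def edge_def sgn_c fun_eq_iff split: if_splits)

lemma posn_opposite: "sgn (c i) \<noteq> sgn (c j) ==> posn k j (\<Delta> - z) = posn k i z"
 using gridpt_Suc[of k] by (auto simp: posn_def edge_def sgn_c split: if_splits)

lemma posn_nxt: "k \<in> levels ==> posn (nxt k i) i \<Delta> = edge k i"
 by (auto simp: posn_def edge_def nxt_def sgn_c gridpt_eq algebra_simps of_nat_diff)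

lemma flow_lip: "\<bar>flow i h x - flow i h y\<bar> <= \<bar>x - y\<bar>"
 by (auto simp: flow_def)

lemma flow_posn:
 assumes k: "k \<in> levels" and h: "0 <= h"
 shows "\<bar>c i\<bar> * h <= z ==> flow i h (posn k i z) = posn k i (z - \<bar>c i\<bar> * h)"
  and "0 <= z ==> z < \<bar>c i\<bar> * h ==> \<bar>flow i h (posn k i z) - edge k i\<bar> <= \<bar>c i\<bar> * h"
  and "0 <= z ==> \<bar>flow i h (posn k i z) - posn k i z\<bar> <= \<bar>c i\<bar> * h"
proof -
 have ch: "0 <= \<bar>c i\<bar> * h" using h by simp
 have f: "flow i h (posn k i z) = (if 0 < c i then min (edge k i - z + \<bar>c i\<bar> * h) b else max (edge k i + z - \<bar>c i\<bar> * h) 0)" for z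
  by (simp add: flow_def posn_def sgn_c abs_if)
 have p: "posn k i z = (if 0 < c i then edge k i - z else edge k i + z)" for z
  by (simp add: posn_def sgn_c)
 note e = edge_bounds[OF k, of i]
 show "\<bar>c i\<bar> * h <= z ==> flow i h (posn k i z) = posn k i (z - \<bar>c i\<bar> * h)"
  unfolding f unfolding p using e by auto
 show "0 <= z ==> z < \<bar>c i\<bar> * h ==> \<bar>flow i h (posn k i z) - edge k i\<bar> <= \<bar>c i\<bar> * h"
  unfolding f using e ch by (auto simp: min_def max_def)
 show "0 <= z ==> \<bar>flow i h (posn k i z) - posn k i z\<bar> <= \<bar>c i\<bar> * h"
  unfolding f unfolding p using e ch by (cases "0 < c i") (auto simp: min_def max_def)
qed

section \<open>The transition matrix of the phase process\<close>

abbreviation "PT h \<equiv> mat_exp UNIV T h"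

text \<open>The powers of \<open>mat_one + (h / m) T\<close> are nonnegative once the step is below
  \<open>h0\<close>, and \<open>product_formula\<close>, with zero remainder, has the exponential as
  their limit.\<close>

lemma PT_nonneg: "0 <= h ==> 0 <= PT h i j"
proof -
 assume h: "0 <= h"
 let ?R = "\<lambda>h i j. mat_one i j + h * T i j"
 let ?u = "\<lambda>k. mat_one k j :: real"
 have lim: "(\<lambda>m. (mat_vec UNIV (?R (h / real m)) ^^ m) ?u i) \<longlonglongrightarrow> mat_vec UNIV (PT h) ?u i"
  by (rule product_formula[of UNIV h0 0]) (use h0 h in auto)
 have "(\<lambda>m. h / real m) \<longlonglongrightarrow> 0" by (rule lim_const_over_n)
 then have "eventually (\<lambda>m. h / real m < h0) sequentially" by (rule order_tendstoD) (rule h0)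
 then have "eventually (\<lambda>m. 0 <= (mat_vec UNIV (?R (h / real m)) ^^ m) ?u i) sequentially"
 proof eventually_elim
  case (elim m)
  have "0 <= (mat_vec UNIV (?R (h / real m)) ^^ l) ?u k" for l k
  proof (induction l arbitrary: k)
   case (Suc l)
   let ?w = "(mat_vec UNIV (?R (h / real m)) ^^ l) ?u"
   have "0 <= ?w k + h / real m * (\<Sum>j\<in>UNIV. T k j * ?w j)"
    by (rule pos_sum_T) (use elim h Suc in auto)
   also have "\<dots> = mat_vec UNIV (?R (h / real m)) ?w k"
    using sum_mat_one_left[of UNIV k ?w]
    by (simp add: mat_vec_def distrib_right sum.distrib sum_distrib_left mult.assoc)
   finally show ?case by simp
  qed (simp add: mat_one_def)
  then show ?case .
 qed
 then have "0 <= mat_vec UNIV (PT h) ?u i"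
  by (intro tendsto_lowerbound[OF lim]) auto
 also have "mat_vec UNIV (PT h) ?u i = PT h i j"
  unfolding mat_vec_def by (rule sum_mat_one_right) auto
 finally show ?thesis .
qed

lemma PT_sum: "(\<Sum>j\<in>UNIV. PT h i j) = 1"
proof -
 have "((\<lambda>h. \<Sum>j\<in>UNIV. PT h i j) has_real_derivative 0) (at x)" for x
 proof -
  have "((\<lambda>h. \<Sum>j\<in>UNIV. PT h i j) has_real_derivative (\<Sum>j\<in>UNIV. \<Sum>k\<in>UNIV. PT x i k * T k j)) (at x)"
   by (intro DERIV_sum mat_exp_deriv_right) auto
  also have "(\<Sum>j\<in>UNIV. \<Sum>k\<in>UNIV. PT x i k * T k j) = 0"
   by (subst sum.swap) (simp add: sum_distrib_left[symmetric] T_sum)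
  finally show ?thesis .
 qed
 then have "(\<Sum>j\<in>UNIV. PT h i j) = (\<Sum>j\<in>UNIV. PT 0 i j)"
  using DERIV_isconst_all[of "\<lambda>h. \<Sum>j\<in>UNIV. PT h i j"] by blast
 then show ?thesis using sum_mat_one_left[of UNIV i "\<lambda>_. 1"] by (simp add: mat_exp_0)
qed

section \<open>One-step error\<close>

definition lipb :: "real => real => (real => 's => real) => bool" where
 "lipb L Fb g \<longleftrightarrow> (\<forall>x y i. \<bar>g x i - g y i\<bar> <= L * \<bar>x - y\<bar>) \<and> (\<forall>x i. \<bar>g x i\<bar> <= Fb)"

text \<open>The comparison column of \<open>g\<close>: its mean over the level that the residual
  time encodes through \<open>posn\<close>.\<close>

definition Wop :: "(real => 's => real) => nat \<times> 's \<times> nat => real" where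
 "Wop g = (\<lambda>(k, i, n). if k = 0 then g 0 i else if k = K + 1 then g b i else IG (\<lambda>z. g (posn k i z) i) n)"

text \<open>One Euler step of the fluid queue: flow under the present phase for time
  \<open>h\<close>, then draw the phase from its transition matrix.\<close>

definition Qop :: "real => (real => 's => real) => real => 's => real" where
 "Qop h g x i = (\<Sum>j\<in>UNIV. PT h i j * g (flow i h x) j)"

lemma lipbD: "lipb L Fb g ==> \<bar>g x i - g y i\<bar> <= L * \<bar>x - y\<bar>" "lipb L Fb g ==> \<bar>g x i\<bar> <= Fb"
 "lipb L Fb g ==> 0 <= L" "lipb L Fb g ==> 0 <= Fb"
proof -
 assume g: "lipb L Fb g"
 then show 1: "\<bar>g x i - g y i\<bar> <= L * \<bar>x - y\<bar>" "\<bar>g x i\<bar> <= Fb" for x y i by (auto simp: lipb_def)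
 from 1(1)[of 1 _ 0] show "0 <= L" by (auto intro: order_trans[OF abs_ge_zero])
 from 1(2) show "0 <= Fb" by (auto intro: order_trans[OF abs_ge_zero])
qed

text \<open>The flow is nonexpansive and the transition matrix is stochastic, so neither constant
  deteriorates and the same \<open>L\<close> and \<open>Fb\<close> serve all iterates.\<close>

lemma lipb_Qop: "lipb L Fb g ==> 0 <= h ==> lipb L Fb (Qop h g)"
 unfolding lipb_def[of _ _ "Qop h g"]
proof (intro conjI allI)
 assume g: "lipb L Fb g" and h: "0 <= h"
 fix x y i
 have "\<bar>Qop h g x i - Qop h g y i\<bar> = \<bar>\<Sum>j\<in>UNIV. PT h i j * (g (flow i h x) j - g (flow i h y) j)\<bar>"
  by (simp add: Qop_def right_diff_distrib sum_subtractf)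
 also have "\<dots> <= (\<Sum>j\<in>UNIV. PT h i j * (L * \<bar>x - y\<bar>))"
 proof (rule order_trans[OF sum_abs], rule sum_mono)
  fix j
  have "\<bar>g (flow i h x) j - g (flow i h y) j\<bar> <= L * \<bar>x - y\<bar>"
   by (rule order_trans[OF lipbD(1)[OF g] mult_left_mono[OF flow_lip lipbD(3)[OF g]]])
  then show "\<bar>PT h i j * (g (flow i h x) j - g (flow i h y) j)\<bar> <= PT h i j * (L * \<bar>x - y\<bar>)"
   using PT_nonneg[OF h, of i j] by (simp add: abs_mult mult_left_mono)
 qed
 also have "\<dots> = L * \<bar>x - y\<bar>" by (simp add: sum_distrib_right[symmetric] PT_sum)
 finally show "\<bar>Qop h g x i - Qop h g y i\<bar> <= L * \<bar>x - y\<bar>" .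
 have "\<bar>Qop h g x i\<bar> <= (\<Sum>j\<in>UNIV. PT h i j * Fb)"
  unfolding Qop_def
 proof (rule order_trans[OF sum_abs], rule sum_mono)
  fix j show "\<bar>PT h i j * g (flow i h x) j\<bar> <= PT h i j * Fb"
   using PT_nonneg[OF h, of i j] lipbD(2)[OF g] by (simp add: abs_mult mult_left_mono)
 qed
 also have "\<dots> = Fb" by (simp add: sum_distrib_right[symmetric] PT_sum)
 finally show "\<bar>Qop h g x i\<bar> <= Fb" .
qed

lemma lipb_Qop_pow: "lipb L Fb g ==> 0 <= h ==> lipb L Fb ((Qop h ^^ m) g)"
 by (induction m) (auto intro: lipb_Qop)

lemma lip_posn: "lipb L Fb g ==> \<bar>g (posn k i x) j - g (posn k i y) j\<bar> <= L * \<bar>x - y\<bar>"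
 using lipbD(1)[of L Fb g "posn k i x" j "posn k i y"] by (simp add: posn_lip)

lemma adm_posn: "lipb L Fb g ==> adm (\<lambda>z. g (posn k i z) j)"
 by (rule adm_lipschitz) (rule lip_posn)

lemma Wop_inner: "k \<in> levels ==> Wop g (k, i, n) = IG (\<lambda>z. g (posn k i z) i) n"
 by (auto simp: Wop_def)

lemma Wop_bottom: "Wop g (0, i, n) = g 0 i" and Wop_top: "Wop g (K + 1, i, n) = g b i"
 by (simp_all add: Wop_def)

lemma Wop_bounded: "lipb L Fb g ==> x \<in> idx ==> \<bar>Wop g x\<bar> <= Fb"
proof -
 assume g: "lipb L Fb g" and x: "x \<in> idx"
 from x show ?thesis
 proof (cases rule: idx_cases)
  case (inner k i n)
  then show ?thesis using IG_bounded[OF adm_posn[OF g] inner(3) lipbD(2)[OF g]] by (simp add: Wop_inner)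
 qed (use lipbD(2)[OF g] in \<open>auto simp: Wop_bottom Wop_top simp del: One_nat_def add_Suc_right\<close>)
qed

lemma Wop_enter: "lipb L Fb g ==> k \<in> levels ==> \<bar>Wop g (k, i, 1) - g (posn k i \<Delta>) i\<bar> <= L * \<epsilon>"
 unfolding Wop_inner by (rule IG_1_approx[of "\<lambda>z. g (posn k i z) i"]) (rule lip_posn)

lemma Wop_nxt:
 assumes g: "lipb L Fb g" and k: "k \<in> levels"
 shows "\<bar>Wop g (nxt k i, i, 1) - g (edge k i) i\<bar> <= L * \<epsilon>"
proof -
 have L: "0 <= L * \<epsilon>" using lipbD(3)[OF g] eps_bounds by simp
 consider "nxt k i = 0" "k = 1" "c i < 0" | "nxt k i = K + 1" "k = K" "0 < c i" | "nxt k i \<in> levels"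
  using k c_cases[of i] by (auto simp: nxt_def split: if_splits) fastforce+
 then show ?thesis
 proof cases
  case 1
  then show ?thesis using L by (simp add: Wop_bottom edge_def gridpt_1)
 next
  case 2
  then show ?thesis using L by (simp add: Wop_top edge_def gridpt_top)
 next
  case 3
  then show ?thesis using Wop_enter[OF g 3, of i] posn_nxt[OF k, of i] by simp
 qed
qed

lemma posn_bottom: "0 < c j ==> posn 1 j \<Delta> = 0" and posn_top: "c j < 0 ==> posn K j \<Delta> = b"
 using gridpt_Suc[of 1] gridpt_1 gridpt_Suc[of K] gridpt_top by (auto simp: posn_def edge_def sgn_c)

lemma Wop_from_bottom: "lipb L Fb g ==> \<bar>Wop g (if c j < 0 then 0 else 1, j, 1) - g 0 j\<bar> <= L * \<epsilon>"
 and Wop_from_top: "lipb L Fb g ==> \<bar>Wop g (if c j < 0 then K else K + 1, j, 1) - g b j\<bar> <= L * \<epsilon>"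
proof -
 assume g: "lipb L Fb g"
 have L: "0 <= L * \<epsilon>" using lipbD(3)[OF g] eps_bounds by simp
 have "1 \<in> levels" "K \<in> levels" using K by auto
 then show "\<bar>Wop g (if c j < 0 then 0 else 1, j, 1) - g 0 j\<bar> <= L * \<epsilon>"
  "\<bar>Wop g (if c j < 0 then K else K + 1, j, 1) - g b j\<bar> <= L * \<epsilon>"
  using Wop_enter[OF g, of 1 j] Wop_enter[OF g, of K j] c_cases[of j] L
  by (auto simp: Wop_bottom Wop_top posn_bottom posn_top)
qed

text \<open>The defects that survive division by \<open>h\<close>: a level is entered with residual
  time only close to \<open>\<Delta>\<close>, a reversal turns \<open>z\<close> only roughly into
  \<open>\<Delta> - z\<close>, and leaving a boundary enters a cell only near its end.\<close>

definition main :: "(real => 's => real) => nat \<times> 's \<times> nat => real" where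
 "main g = (\<lambda>(k, i, n). if k \<in> levels then
   \<bar>c i\<bar> * s n * (Wop g (nxt k i, i, 1) - g (edge k i) i)
   + (\<Sum>j\<in>UNIV. T i j * (if sgn (c i) = sgn (c j) then 0
     else (\<Sum>m\<in>I. D n m * Wop g (k, j, m)) - IG (\<lambda>z. g (posn k i z) j) n))
  else if k = 0 then (\<Sum>j\<in>UNIV. T i j * (Wop g (if c j < 0 then 0 else 1, j, 1) - g 0 j))
  else (\<Sum>j\<in>UNIV. T i j * (Wop g (if c j < 0 then K else K + 1, j, 1) - g b j)))"

lemma sum_T_le:
 assumes "!!j. \<bar>f j\<bar> <= e" shows "(\<Sum>j\<in>UNIV. T i j * f j) <= tm * e"
proof -
 have e: "0 <= e" using assms by (auto intro: order_trans[OF abs_ge_zero])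
 have "(\<Sum>j\<in>UNIV. T i j * f j) <= (\<Sum>j\<in>UNIV. \<bar>T i j\<bar> * e)"
 proof (rule sum_mono)
  fix j
  have "T i j * f j <= \<bar>T i j\<bar> * \<bar>f j\<bar>" by (metis abs_ge_self abs_mult)
  also have "\<dots> <= \<bar>T i j\<bar> * e" by (intro mult_left_mono assms) auto
  finally show "T i j * f j <= \<bar>T i j\<bar> * e" .
 qed
 also have "\<dots> = (\<Sum>j\<in>UNIV. \<bar>T i j\<bar>) * e" by (simp only: sum_distrib_right)
 also have "\<dots> <= tm * e" by (intro mult_right_mono tm e)
 finally show ?thesis .
qed

text \<open>An entry error is at most \<open>L * \<epsilon>\<close>: multiplied by the intensity it
  gives the term with \<open>hz\<close>, at a boundary it goes into \<open>\<eta>2\<close>.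
  Reversals contribute through \<open>D_approx\<close>, whose excess term is the one with
  \<open>Hc\<close>.\<close>

lemma main_pos:
 assumes g: "lipb L Fb g"
 shows "pos (\<lambda>x. L * (\<epsilon> * hz x + \<eta>2 + tm * Hc x) - main g x)"
 unfolding pos_def
proof (intro conjI allI ballI impI)
 note L = lipbD(3)[OF g]
 have bd: "tm * (L * \<epsilon>) <= L * \<eta>2"
  using mult_left_mono[OF \<eta>2(3) L] by (simp add: mult_ac)
 fix i
 { have "main g (0, i, 1) <= tm * (L * \<epsilon>)"
   using sum_T_le[of "\<lambda>j. Wop g (if c j < 0 then 0 else 1, j, 1) - g 0 j", OF Wop_from_bottom[OF g]]
   by (simp add: main_def)
  then show "0 <= L * (\<epsilon> * hz (0, i, 1) + \<eta>2 + tm * Hc (0, i, 1)) - main g (0, i, 1)"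
   using bd by (simp add: hz_def Hc_def) }
 { have "main g (K + 1, i, 1) <= tm * (L * \<epsilon>)"
   using sum_T_le[of "\<lambda>j. Wop g (if c j < 0 then K else K + 1, j, 1) - g b j", OF Wop_from_top[OF g]]
   by (simp add: main_def)
  then show "0 <= L * (\<epsilon> * hz (K + 1, i, 1) + \<eta>2 + tm * Hc (K + 1, i, 1)) - main g (K + 1, i, 1)"
   using bd by (simp add: hz_def Hc_def) }
 fix k a assume k: "k \<in> levels" and a: "cone a"
 let ?s = "\<Sum>n\<in>I. a n * s n" and ?a = "\<Sum>n\<in>I. a n" and ?H = "\<Sum>n\<in>I. a n * IG excess n"
 define d where "d = Wop g (nxt k i, i, 1) - g (edge k i) i"
 define e where "e = (\<lambda>n j. if sgn (c i) = sgn (c j) then 0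
     else (\<Sum>m\<in>I. D n m * Wop g (k, j, m)) - IG (\<lambda>z. g (posn k i z) j) n)"
 have sa: "0 <= ?a" by (rule cone_sum_nonneg[OF a])
 have H0: "0 <= ?H" by (rule IG_nonneg[OF adm_excess a excess_nonneg])
 have sum_swap: "(\<Sum>n\<in>I. a n * (\<Sum>j\<in>UNIV. T i j * e n j)) = (\<Sum>j\<in>UNIV. T i j * (\<Sum>n\<in>I. a n * e n j))"
  unfolding sum_distrib_left by (subst sum.swap) (simp add: mult.left_commute)
 have "(\<Sum>n\<in>I. a n * main g (k, i, n)) = (\<Sum>n\<in>I. a n * (\<bar>c i\<bar> * s n * d + (\<Sum>j\<in>UNIV. T i j * e n j)))"
  using k by (simp add: main_def d_def e_def)
 also have "\<dots> = \<bar>c i\<bar> * ?s * d + (\<Sum>n\<in>I. a n * (\<Sum>j\<in>UNIV. T i j * e n j))"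
  by (simp add: distrib_left sum.distrib sum_distrib_left sum_distrib_right mult_ac)
 finally have eq: "(\<Sum>n\<in>I. a n * main g (k, i, n)) = \<bar>c i\<bar> * ?s * d + (\<Sum>j\<in>UNIV. T i j * (\<Sum>n\<in>I. a n * e n j))"
  unfolding sum_swap .
 have "\<bar>c i\<bar> * ?s * d <= \<bar>c i\<bar> * ?s * (L * \<epsilon>)"
  using Wop_nxt[OF g k, of i] s_dot_nonneg[OF a] by (intro mult_left_mono mult_nonneg_nonneg) (auto simp: d_def)
 moreover have "(\<Sum>j\<in>UNIV. T i j * (\<Sum>n\<in>I. a n * e n j)) <= tm * (L * (e1 + \<epsilon>) * ?a + L * ?H)"
 proof (rule sum_T_le)
  fix j
  show "\<bar>\<Sum>n\<in>I. a n * e n j\<bar> <= L * (e1 + \<epsilon>) * ?a + L * ?H"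
  proof (cases "sgn (c i) = sgn (c j)")
   case True
   then show ?thesis using L e1 eps_bounds sa H0 by (simp add: e_def)
  next
   case False
   then have "(\<Sum>n\<in>I. a n * e n j) = (\<Sum>n\<in>I. a n * ((\<Sum>m\<in>I. D n m * IG (\<lambda>z. g (posn k j z) j) m) - IG (\<lambda>z. g (posn k j (\<Delta> - z)) j) n))"
    using k by (simp add: e_def Wop_inner posn_opposite)
   then show ?thesis using D_approx[OF lip_posn[OF g, of k j _ j] a] by (simp add: e1_def)
  qed
 qed
 moreover have "(\<Sum>n\<in>I. a n * (L * (\<epsilon> * hz (k, i, n) + \<eta>2 + tm * Hc (k, i, n)) - main g (k, i, n)))
   = L * (\<epsilon> * (\<bar>c i\<bar> * ?s) + \<eta>2 * ?a + tm * ?H) - (\<Sum>n\<in>I. a n * main g (k, i, n))"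
  using k by (simp add: hz_def Hc_def right_diff_distrib distrib_left sum.distrib sum_subtractf sum_distrib_left mult_ac)
 ultimately show "0 <= (\<Sum>n\<in>I. a n * (L * (\<epsilon> * hz (k, i, n) + \<eta>2 + tm * Hc (k, i, n)) - main g (k, i, n)))"
  unfolding eq by (simp add: \<eta>2_def algebra_simps)
qed

text \<open>The phase transition is expanded to first order, and the flow over one step is split
  into paths that stay in the cell and paths that reach its end. Both limits match drift and jumps
  of the scheme up to \<open>main\<close>; the rest is of second order, uniformly in
  \<open>g\<close> through \<open>Fb + L\<close>.\<close>

lemma main_error:
 obtains C where "0 <= C" "!!h L Fb g x. [|0 <= h; h <= h0; lipb L Fb g; x \<in> idx|] ==>
  \<bar>Wop (Qop h g) x + h * main g x - (mat_vec idx (Ed h) (Wop g) x + h * mat_vec idx J (Wop g) x)\<bar> <= C * (Fb + L) * h\<^sup>2"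
proof -
 obtain C' where C': "0 <= C'"
  "!!g h g0 Fb L n. [|0 <= h; h <= 1; n \<in> I; adm g; !!z. 0 <= z ==> z < h ==> \<bar>g z - g0\<bar> <= L * h; \<bar>g0\<bar> <= Fb; 0 <= L|]
    ==> \<bar>IG (\<lambda>z. indicator {..<h} z * g z) n - h * s n * g0\<bar> <= C' * (Fb + L) * h\<^sup>2"
  using short_time by blast
 obtain CT where CT: "0 <= CT" "!!h i j. \<bar>h\<bar> <= 1 ==> \<bar>PT h i j - mat_one i j - h * T i j\<bar> <= CT * h\<^sup>2"
  using mat_exp_taylor[of "UNIV :: 's set" T] by auto
 define N where "N = real (card (UNIV :: 's set))"
 have expand: "\<bar>(\<Sum>j\<in>UNIV. PT h i j * a j) - (a i + h * (\<Sum>j\<in>UNIV. T i j * a j))\<bar> <= CT * N * Fb * h\<^sup>2"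
  if "!!j. \<bar>a j\<bar> <= Fb" "0 <= h" "h <= h0" for a Fb h i
 proof -
  have "(\<Sum>j\<in>UNIV. PT h i j * a j) - (a i + h * (\<Sum>j\<in>UNIV. T i j * a j)) = (\<Sum>j\<in>UNIV. (PT h i j - mat_one i j - h * T i j) * a j)"
   using sum_mat_one_left[of UNIV i a] by (simp add: left_diff_distrib sum_subtractf sum_distrib_left mult.assoc)
  moreover have "\<bar>\<Sum>j\<in>UNIV. (PT h i j - mat_one i j - h * T i j) * a j\<bar> <= (\<Sum>j\<in>(UNIV::'s set). CT * h\<^sup>2 * Fb)"
  proof (rule order_trans[OF sum_abs], rule sum_mono)
   fix j
   have "\<bar>h\<bar> <= 1" using that h0(2) by simp
   then show "\<bar>(PT h i j - mat_one i j - h * T i j) * a j\<bar> <= CT * h\<^sup>2 * Fb"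
    unfolding abs_mult using CT that by (intro mult_mono) auto
  qed
  ultimately show ?thesis by (simp add: N_def mult_ac)
 qed
 have N: "0 <= N" by (simp add: N_def)
 define C where "C = C' * cm\<^sup>2 + tm * cm + CT * N"
 have C0: "0 <= C" using C' CT N tm cm by (simp add: C_def)
 show ?thesis
 proof (rule that[OF C0])
  fix h L Fb g x assume h: "0 <= h" "h <= h0" and g: "lipb L Fb g" and x: "x \<in> idx"
  note L = lipbD(3)[OF g] and Fb = lipbD(4)[OF g]
  have le: "CT * N * Fb * h\<^sup>2 <= C * (Fb + L) * h\<^sup>2"
  proof (rule mult_right_mono)
   have "CT * N * Fb <= C * Fb" unfolding C_def
    using C' tm cm Fb by (intro mult_right_mono) auto
   also have "\<dots> <= C * (Fb + L)" using C0 L by (intro mult_left_mono) auto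
   finally show "CT * N * Fb <= C * (Fb + L)" .
  qed simp
  from x show "\<bar>Wop (Qop h g) x + h * main g x - (mat_vec idx (Ed h) (Wop g) x + h * mat_vec idx J (Wop g) x)\<bar> <= C * (Fb + L) * h\<^sup>2"
  proof (cases rule: idx_cases)
   case (bottom i)
   have "flow i h 0 = 0" using bottom h b_pos by (simp add: flow_def mult_nonpos_nonneg)
   then have "Wop (Qop h g) x + h * main g x - (mat_vec idx (Ed h) (Wop g) x + h * mat_vec idx J (Wop g) x)
    = (\<Sum>j\<in>UNIV. PT h i j * g 0 j) - (g 0 i + h * (\<Sum>j\<in>UNIV. T i j * g 0 j))"
    using bottom by (simp add: Wop_bottom Qop_def main_def Ed_outer[OF idx_bottom] J_bottom right_diff_distrib sum_subtractf)
   then show ?thesis using expand[of "g 0" Fb h i] lipbD(2)[OF g] h le by simp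
  next
   case (top i)
   have fl: "flow i h b = b" using top h by (simp add: flow_def)
   have "Wop (Qop h g) x = (\<Sum>j\<in>UNIV. PT h i j * g b j)"
    unfolding top(1) Wop_top Qop_def fl ..
   moreover have "main g x = (\<Sum>j\<in>UNIV. T i j * Wop g (if c j < 0 then K else K + 1, j, 1)) - (\<Sum>j\<in>UNIV. T i j * g b j)"
    unfolding top(1) main_def by (simp add: right_diff_distrib sum_subtractf)
   moreover have "mat_vec idx (Ed h) (Wop g) x = g b i"
    unfolding top(1) by (subst Ed_outer[OF idx_top[OF top(2)]]) (auto simp: Wop_top)
   moreover have "mat_vec idx J (Wop g) x = (\<Sum>j\<in>UNIV. T i j * Wop g (if c j < 0 then K else K + 1, j, 1))"
    unfolding top(1) by (rule J_top[OF top(2)])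
   ultimately have "Wop (Qop h g) x + h * main g x - (mat_vec idx (Ed h) (Wop g) x + h * mat_vec idx J (Wop g) x)
    = (\<Sum>j\<in>UNIV. PT h i j * g b j) - (g b i + h * (\<Sum>j\<in>UNIV. T i j * g b j))"
    by (simp add: right_diff_distrib)
   then show ?thesis using expand[of "g b" Fb h i] lipbD(2)[OF g] h le by simp
  next
   case (inner k i n)
   note k = inner(2) and n = inner(3)
   let ?\<delta> = "\<bar>c i\<bar> * h"
   have d0: "0 <= ?\<delta>" "?\<delta> <= 1" using h h0(3)[OF h] by auto
   define \<gamma> where "\<gamma> = (\<lambda>j z. g (flow i h (posn k i z)) j)"
   define sh where "sh = (\<lambda>z. indicator {?\<delta>..} z * g (posn k i (z - ?\<delta>)) i)"
   define lo where "lo = (\<lambda>z. indicator {..<?\<delta>} z * \<gamma> i z)"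
   define bb where "bb = (\<lambda>j. IG (\<lambda>z. g (posn k i z) j) n)"
   have lip\<gamma>: "\<bar>\<gamma> j x - \<gamma> j y\<bar> <= L * \<bar>x - y\<bar>" for j x y
    unfolding \<gamma>_def
    by (rule order_trans[OF lipbD(1)[OF g] mult_left_mono[OF _ L]])
      (use flow_lip[of i h "posn k i x" "posn k i y"] in \<open>simp add: posn_lip\<close>)
   have adm\<gamma>: "adm (\<gamma> j)" for j by (rule adm_lipschitz[OF lip\<gamma>])
   have adm_sh: "adm sh" unfolding sh_def
    by (rule adm_shift_back[OF adm_posn[OF g, of k i i] d0(1)])
   have adm_lo: "adm lo" unfolding lo_def
    using adm_borel[OF adm\<gamma>[of i]] lipbD(2)[OF g] Fb
    by (intro adm_bounded[of _ Fb]) (auto simp: indicator_def \<gamma>_def)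
   have E1: "mat_vec idx (Ed h) (Wop g) x = IG sh n"
    unfolding inner(1) Ed_inner[OF k] Wop_inner[OF k] sh_def
    by (rule drift_IG[OF adm_posn[OF g] d0(1) n])
   have E2: "Wop (Qop h g) x = (\<Sum>j\<in>UNIV. PT h i j * IG (\<gamma> j) n)"
   proof -
    have "Wop (Qop h g) x = IG (\<lambda>z. \<Sum>j\<in>UNIV. PT h i j * \<gamma> j z) n"
     unfolding inner(1) Wop_inner[OF k] Qop_def \<gamma>_def ..
    also have "\<dots> = (\<Sum>j\<in>UNIV. IG (\<lambda>z. PT h i j * \<gamma> j z) n)"
     by (rule IG_sum) (use n adm\<gamma> in \<open>auto intro: adm_cmult\<close>)
    finally show ?thesis by (simp add: IG_cmult)
   qed
   \<comment> \<open>Where the residual time survives the step, the flow stays in the cell and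
     equals the shift that the drift produces, so \<open>sh\<close> is exact and all the error sits
     in \<open>lo\<close>.\<close>
   have E3: "IG (\<gamma> i) n = IG sh n + IG lo n"
   proof -
    have "IG (\<gamma> i) n = IG (\<lambda>z. sh z + lo z) n"
     by (rule IG_cong) (use flow_posn(1)[OF k h(1), of i] in \<open>auto simp: sh_def lo_def \<gamma>_def indicator_def\<close>)
    then show ?thesis using IG_add[OF adm_sh adm_lo n] by simp
   qed
   have E4: "\<bar>IG lo n - ?\<delta> * s n * g (edge k i) i\<bar> <= C' * (Fb + L) * ?\<delta>\<^sup>2"
    unfolding lo_def
   proof (rule C'(2)[OF d0 n adm\<gamma> _ lipbD(2)[OF g] L])
    fix z assume "0 <= z" "z < ?\<delta>"
    then show "\<bar>\<gamma> i z - g (edge k i) i\<bar> <= L * ?\<delta>"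
     unfolding \<gamma>_def
     by (intro order_trans[OF lipbD(1)[OF g] mult_left_mono[OF flow_posn(2)[OF k h(1)] L]])
   qed
   have E5: "\<bar>IG (\<gamma> j) n - bb j\<bar> <= L * ?\<delta>" for j
   proof -
    have "IG (\<gamma> j) n - bb j = IG (\<lambda>z. \<gamma> j z - g (posn k i z) j) n"
     unfolding bb_def by (rule IG_diff[OF adm\<gamma> adm_posn[OF g] n, symmetric])
    also have "\<bar>\<dots>\<bar> <= L * ?\<delta>"
    proof (rule IG_bounded[OF adm_diff[OF adm\<gamma> adm_posn[OF g]] n])
     fix z :: real assume "0 <= z"
     then show "\<bar>\<gamma> j z - g (posn k i z) j\<bar> <= L * ?\<delta>"
      unfolding \<gamma>_def
      by (intro order_trans[OF lipbD(1)[OF g] mult_left_mono[OF flow_posn(3)[OF k h(1)] L]])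
    qed
    finally show ?thesis .
   qed
   \<comment> \<open>The values after jumps of the scheme cancel; left are the values of
     \<open>g\<close> at the end of the cell and at the present level, to be met by
     \<open>E4\<close> and \<open>E8\<close>.\<close>
   have E6: "main g x - mat_vec idx J (Wop g) x = - (\<bar>c i\<bar> * s n * g (edge k i) i) - (\<Sum>j\<in>UNIV. T i j * bb j)"
   proof -
    define DD where "DD = (\<lambda>j. \<Sum>m\<in>I. D n m * Wop g (k, j, m))"
    have "dirsum k i n (Wop g) = (\<Sum>j\<in>UNIV. T i j * (if sgn (c i) = sgn (c j) then bb j else DD j))"
     unfolding dirsum_def DD_def bb_def using posn_same[of i _ k] k
     by (intro sum.cong refl) (auto simp: Wop_inner)
    moreover have "main g x = \<bar>c i\<bar> * s n * (Wop g (nxt k i, i, 1) - g (edge k i) i)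
      + (\<Sum>j\<in>UNIV. T i j * (if sgn (c i) = sgn (c j) then 0 else DD j - bb j))"
     unfolding inner(1) main_def DD_def bb_def prod.case by (simp only: k if_True)
    moreover have "(\<Sum>j\<in>UNIV. T i j * (if sgn (c i) = sgn (c j) then 0 else DD j - bb j))
      - (\<Sum>j\<in>UNIV. T i j * (if sgn (c i) = sgn (c j) then bb j else DD j)) = - (\<Sum>j\<in>UNIV. T i j * bb j)"
     unfolding sum_subtractf[symmetric] sum_negf[symmetric] by (intro sum.cong refl) (simp add: algebra_simps)
    ultimately show ?thesis
     using k n by (simp add: inner(1) J_inner algebra_simps)
   qed
   have "\<bar>IG (\<gamma> j) n\<bar> <= Fb" for j
    by (rule IG_bounded[OF adm\<gamma> n]) (use lipbD(2)[OF g] in \<open>auto simp: \<gamma>_def\<close>)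
   from expand[of "\<lambda>j. IG (\<gamma> j) n", OF this h, of i]
   have E7: "\<bar>Wop (Qop h g) x - (IG (\<gamma> i) n + h * (\<Sum>j\<in>UNIV. T i j * IG (\<gamma> j) n))\<bar> <= CT * N * Fb * h\<^sup>2"
    unfolding E2 .
   have E8: "\<bar>(\<Sum>j\<in>UNIV. T i j * IG (\<gamma> j) n) - (\<Sum>j\<in>UNIV. T i j * bb j)\<bar> <= tm * (L * ?\<delta>)"
   proof -
    have "(\<Sum>j\<in>UNIV. T i j * (IG (\<gamma> j) n - bb j)) <= tm * (L * ?\<delta>)"
     by (rule sum_T_le) (rule E5)
    moreover have "(\<Sum>j\<in>UNIV. T i j * (bb j - IG (\<gamma> j) n)) <= tm * (L * ?\<delta>)"
     by (rule sum_T_le) (use E5 in \<open>simp add: abs_minus_commute\<close>)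
    ultimately show ?thesis by (simp add: right_diff_distrib sum_subtractf abs_le_iff)
   qed
   have E9: "\<bar>h * (\<Sum>j\<in>UNIV. T i j * IG (\<gamma> j) n) - h * (\<Sum>j\<in>UNIV. T i j * bb j)\<bar> <= h * (tm * (L * ?\<delta>))"
    using mult_left_mono[OF E8 h(1)] h(1) by (simp add: abs_mult right_diff_distrib[symmetric])
   have "h * main g x - h * mat_vec idx J (Wop g) x = - (?\<delta> * s n * g (edge k i) i) - h * (\<Sum>j\<in>UNIV. T i j * bb j)"
    unfolding right_diff_distrib[symmetric] E6 by (simp add: algebra_simps)
   then have "\<bar>Wop (Qop h g) x + h * main g x - (mat_vec idx (Ed h) (Wop g) x + h * mat_vec idx J (Wop g) x)\<bar>
     <= CT * N * Fb * h\<^sup>2 + C' * (Fb + L) * ?\<delta>\<^sup>2 + h * (tm * (L * ?\<delta>))"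
    using E7 E4 E9 E3 unfolding E1 by linarith
   also have "\<dots> <= CT * N * (Fb + L) * h\<^sup>2 + C' * (Fb + L) * (cm * h)\<^sup>2 + h * (tm * ((Fb + L) * (cm * h)))"
    using CT(1) C'(1) N L Fb h cm(2)[of i] tm(1) cm(1)
    by (intro add_mono mult_left_mono mult_right_mono power_mono mult_mono) auto
   also have "\<dots> = C * (Fb + L) * h\<^sup>2"
    by (simp add: C_def power2_eq_square algebra_simps)
   finally show ?thesis .
  qed
 qed
qed

lemma pos_mono: "pos (\<lambda>x. U x - w x) ==> (!!x. x \<in> idx ==> U' x = U x + d) ==> 0 <= d ==> pos (\<lambda>x. U' x - w x)"
 by (rule pos_cong[OF pos_add[OF _ pos_const[of d]]]) auto

text \<open>The Euler step plus \<open>h * main g\<close> plays the part of \<open>V\<close> in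
  \<open>R_upper\<close>, and \<open>main_pos\<close> supplies the comparison.\<close>

lemma R_Wop:
 obtains C where "0 <= C" "!!h L Fb g. [|0 <= h; h <= h0; lipb L Fb g|] ==>
  pos (\<lambda>x. h * (L * \<epsilon> * hz x + L * \<eta>2 + L * tm * Hc x) + C * (Fb + L) * h\<^sup>2 - (mat_vec idx (R h) (Wop g) x - Wop (Qop h g) x))"
proof -
 obtain C where C: "0 <= C" "!!h w U V W e. [|0 <= h; h <= h0; !!y. y \<in> idx ==> \<bar>w y\<bar> <= W;
   !!x. x \<in> idx ==> \<bar>V x - (mat_vec idx (Ed h) w x + h * mat_vec idx J w x)\<bar> <= e * h\<^sup>2;
   pos (\<lambda>x. U x - V x)|] ==> pos (\<lambda>x. U x + C * (W + e) * h\<^sup>2 - mat_vec idx (R h) w x)"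
  using R_upper by blast
 obtain C' where C': "0 <= C'" "!!h L Fb g x. [|0 <= h; h <= h0; lipb L Fb g; x \<in> idx|] ==>
  \<bar>Wop (Qop h g) x + h * main g x - (mat_vec idx (Ed h) (Wop g) x + h * mat_vec idx J (Wop g) x)\<bar> <= C' * (Fb + L) * h\<^sup>2"
  using main_error by blast
 show ?thesis
 proof (rule that[of "C * (1 + C')"])
  show "0 <= C * (1 + C')" using C C' by simp
  fix h L Fb g assume h: "0 <= h" "h <= h0" and g: "lipb L Fb g"
  let ?u = "\<lambda>x. h * (L * \<epsilon> * hz x + L * \<eta>2 + L * tm * Hc x)"
  have "pos (\<lambda>x. (Wop (Qop h g) x + ?u x) - (Wop (Qop h g) x + h * main g x))"
   using pos_cmult[OF h(1) main_pos[OF g]] by (rule pos_cong) (simp add: algebra_simps)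
  from C(2)[OF h Wop_bounded[OF g] C'(2)[OF h g] this]
  have "pos (\<lambda>x. (Wop (Qop h g) x + ?u x) + C * (Fb + C' * (Fb + L)) * h\<^sup>2 - mat_vec idx (R h) (Wop g) x)" .
  then have "pos (\<lambda>x. (?u x + C * (Fb + C' * (Fb + L)) * h\<^sup>2) - (mat_vec idx (R h) (Wop g) x - Wop (Qop h g) x))"
   by (rule pos_cong) simp
  then show "pos (\<lambda>x. ?u x + C * (1 + C') * (Fb + L) * h\<^sup>2 - (mat_vec idx (R h) (Wop g) x - Wop (Qop h g) x))"
   by (rule pos_mono[where d = "C * L * h\<^sup>2"]) (use C lipbD(3)[OF g] in \<open>auto simp: algebra_simps\<close>)
 qed
qed

section \<open>Accumulated error\<close>

lemma mat_vec_add: "mat_vec X A (\<lambda>j. v j + w j) i = mat_vec X A v i + mat_vec X A w i"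
 by (simp add: mat_vec_def distrib_left sum.distrib)

lemma mat_vec_cmult: "mat_vec X A (\<lambda>j. e * v j) i = e * mat_vec X A v i"
 by (simp add: mat_vec_def sum_distrib_left mult_ac)

text \<open>The columns \<open>X 1 + \<beta> Th + Y Hc\<close> dominate the accumulated errors: the drop of \<open>Th\<close> at
 changes of level compensates the terms with \<open>hz\<close>.\<close>

lemma supersolution:
 assumes \<kappa>: "0 < \<kappa>"
 obtains C where "0 <= C"
  "!!h t m d x0 y0 l1 l2 l3 l4. [|0 <= h; h <= h0; real m * h <= t;
    0 <= x0; 0 <= y0; 0 <= l1; 0 <= l2; 0 <= l3; 0 <= l4;
    pos (\<lambda>x. x0 + y0 * Hc x - d 0 x);
    !!j. pos (\<lambda>x. h * (l1 * hz x + l2 + l3 * Hc x) + l4 * h\<^sup>2 - (d (Suc j) x - mat_vec idx (R h) (d j) x))|]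
   ==> pos (\<lambda>x. (1 + C * h\<^sup>2) ^ m * (x0 + real m * (h * ((l1 + (y0 + t * l3) * \<epsilon>) / \<kappa> * c1 + (y0 + t * l3) * \<eta>2 + l2)
       + h\<^sup>2 * (C * ((l1 + (y0 + t * l3) * \<epsilon>) / \<kappa> + (y0 + t * l3)) + l4)))
     + (l1 + (y0 + t * l3) * \<epsilon>) / \<kappa> * Th x + (y0 + real m * h * l3) * Hc x - d m x)"
proof -
 obtain C1 where C1: "0 <= C1" "!!h. [|0 <= h; h <= h0|] ==> pos (\<lambda>x. 1 + C1 * h\<^sup>2 - mat_vec idx (R h) (\<lambda>_. 1) x)"
  using R_one by blast
 obtain C2 where C2: "0 <= C2" "!!h. [|0 <= h; h <= h0|] ==>
   pos (\<lambda>x. Th x + h * (c1 - \<kappa> * hz x) + C2 * h\<^sup>2 - mat_vec idx (R h) Th x)"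
  using R_Th by blast
 obtain C3 where C3: "0 <= C3" "!!h. [|0 <= h; h <= h0|] ==>
   pos (\<lambda>x. Hc x + h * (\<epsilon> * hz x + \<eta>2) + C3 * h\<^sup>2 - mat_vec idx (R h) Hc x)"
  using R_Hc by blast
 define C where "C = C1 + C2 + C3"
 have C: "C1 <= C" "C2 <= C" "C3 <= C" "0 <= C" using C1 C2 C3 by (auto simp: C_def)
 show ?thesis
 proof (rule that[OF C(4)])
  fix h t x0 y0 l1 l2 l3 l4 :: real and m :: nat and d :: "nat => nat \<times> 's \<times> nat => real"
  assume h: "0 <= h" "h <= h0" and mt: "real m * h <= t"
   and nn: "0 <= x0" "0 <= y0" "0 <= l1" "0 <= l2" "0 <= l3" "0 <= l4"
   and d0: "pos (\<lambda>x. x0 + y0 * Hc x - d 0 x)"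
   and d: "!!j. pos (\<lambda>x. h * (l1 * hz x + l2 + l3 * Hc x) + l4 * h\<^sup>2 - (d (Suc j) x - mat_vec idx (R h) (d j) x))"
  have "0 <= real m * h" using h by simp
  then have t: "0 <= t" using mt by linarith
  \<comment> \<open>A bound, valid for all steps, on the coefficient of \<open>Hc\<close>, which
    grows by \<open>h * l3\<close> per step.\<close>
  define Y where "Y = y0 + t * l3"
  \<comment> \<open>Chosen so that the drop \<open>\<beta> * \<kappa>\<close> pays both for the
    given term \<open>l1\<close> and for the excess \<open>Y * \<epsilon>\<close> created at changes
    of level.\<close>
  define \<beta> where "\<beta> = (l1 + Y * \<epsilon>) / \<kappa>"
  define a where "a = \<beta> * c1 + Y * \<eta>2 + l2"
  define a' where "a' = C * (\<beta> + Y) + l4"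
  have Y: "0 <= Y" using nn t by (simp add: Y_def)
  have \<beta>: "0 <= \<beta>" "\<beta> * \<kappa> = l1 + Y * \<epsilon>" using nn Y eps_bounds \<kappa> by (auto simp: \<beta>_def)
  have a: "0 <= a" "0 <= a'" using \<beta> Y nn c1 \<eta>2 C by (auto simp: a_def a'_def)
  define X where "X = (\<lambda>m. (1 + C * h\<^sup>2) ^ m * (x0 + real m * (h * a + h\<^sup>2 * a')))"
  define y where "y = (\<lambda>m. y0 + real m * h * l3)"
  have X0: "0 <= X m" for m
   unfolding X_def using C nn a h by (intro mult_nonneg_nonneg add_nonneg_nonneg zero_le_power) auto
  have "pos (\<lambda>x. X m + \<beta> * Th x + y m * Hc x - d m x)"
   using mt
  proof (induction m)
   case 0
   show ?case using pos_add[OF d0 pos_cmult[OF \<beta>(1) pos_Th]]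
    by (rule pos_cong) (simp add: X_def y_def)
  next
   case (Suc m)
   have mt: "real m * h <= t" using Suc.prems h by (simp add: algebra_simps)
   have ym: "0 <= y m" "y m <= Y" unfolding y_def Y_def
    using nn h mult_right_mono[OF mt nn(5)] by auto
   \<comment> \<open>The slack in the constant column; \<open>gap2\<close> is the slack in the
     coefficient of \<open>hz\<close>.\<close>
   define gap where "gap = X (Suc m) - (X m * (1 + C1 * h\<^sup>2) + h * (\<beta> * c1 + y m * \<eta>2 + l2) + h\<^sup>2 * (\<beta> * C2 + y m * C3 + l4))"
   have gap: "0 <= gap"
   proof -
    have "(1 + C * h\<^sup>2) * X m + 1 * (h * a + h\<^sup>2 * a') <= (1 + C * h\<^sup>2) * X m + (1 + C * h\<^sup>2) ^ Suc m * (h * a + h\<^sup>2 * a')"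
     using C a h by (intro add_left_mono mult_right_mono one_le_power) auto
    also have "\<dots> = X (Suc m)" by (simp add: X_def algebra_simps)
    finally have "(1 + C * h\<^sup>2) * X m + (h * a + h\<^sup>2 * a') <= X (Suc m)" by simp
    moreover have "X m * (1 + C1 * h\<^sup>2) <= (1 + C * h\<^sup>2) * X m"
     unfolding mult.commute[of "X m"] using C X0 by (intro mult_right_mono add_left_mono) auto
    moreover have "h * (\<beta> * c1 + y m * \<eta>2 + l2) <= h * a"
     unfolding a_def using h mult_right_mono[OF ym(2) \<eta>2(1)] by (intro mult_left_mono) auto
    moreover have "h\<^sup>2 * (\<beta> * C2 + y m * C3 + l4) <= h\<^sup>2 * a'"
    proof (rule mult_left_mono)
     have "\<beta> * C2 + y m * C3 <= \<beta> * C + Y * C"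
      using \<beta> ym C C2 C3 Y by (intro add_mono mult_mono) auto
     then show "\<beta> * C2 + y m * C3 + l4 <= a'" by (simp add: a'_def algebra_simps)
    qed simp
    ultimately show ?thesis unfolding gap_def by linarith
   qed
   have gap2: "0 <= h * (\<beta> * \<kappa> - y m * \<epsilon> - l1)"
    unfolding \<beta> using h ym eps_bounds by (intro mult_nonneg_nonneg) (auto simp: mult_right_mono)
   have lin: "mat_vec idx (R h) (\<lambda>x. X m + \<beta> * Th x + y m * Hc x - d m x) x
     = X m * mat_vec idx (R h) (\<lambda>_. 1) x + \<beta> * mat_vec idx (R h) Th x + y m * mat_vec idx (R h) Hc x - mat_vec idx (R h) (d m) x" for x
    using mat_vec_cmult[of idx "R h" "X m" "\<lambda>_. 1" x]
    by (simp add: mat_vec_diff mat_vec_add mat_vec_cmult)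
   have "pos (mat_vec idx (R h) (\<lambda>x. X m + \<beta> * Th x + y m * Hc x - d m x))"
    by (rule R_pos[OF h Suc.IH[OF mt]])
   \<comment> \<open>The image of the old bound, the growth of the three columns with their
     coefficients, the given defect and the two slacks add up to the bound for
     \<open>Suc m\<close>.\<close>
   from pos_add[OF pos_add[OF pos_add[OF pos_add[OF pos_add[OF pos_add[OF this pos_cmult[OF X0[of m] C1(2)[OF h]]] pos_cmult[OF \<beta>(1) C2(2)[OF h]]]
     pos_cmult[OF ym(1) C3(2)[OF h]]] d[of m]] pos_const[OF gap]] pos_cmult[OF gap2 pos_hz]]
   show ?case
    by (rule pos_cong) (unfold lin, simp add: gap_def y_def algebra_simps)
  qed
  then show "pos (\<lambda>x. (1 + C * h\<^sup>2) ^ m * (x0 + real m * (h * ((l1 + (y0 + t * l3) * \<epsilon>) / \<kappa> * c1 + (y0 + t * l3) * \<eta>2 + l2)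
       + h\<^sup>2 * (C * ((l1 + (y0 + t * l3) * \<epsilon>) / \<kappa> + (y0 + t * l3)) + l4)))
     + (l1 + (y0 + t * l3) * \<epsilon>) / \<kappa> * Th x + (y0 + real m * h * l3) * Hc x - d m x)"
   unfolding X_def y_def a_def a'_def \<beta>_def Y_def .
 qed
qed

text \<open>With \<open>h = t / m\<close>, a second order term summed over \<open>m\<close> steps is
  of size \<open>t\<^sup>2 / m\<close> and vanishes, together with every constant of the scheme in
  it. What remains involves only \<open>\<epsilon>\<close> and the given coefficients.\<close>

lemma limit_bound:
 assumes \<kappa>: "0 < \<kappa>" and t: "0 <= t" and x: "x \<in> idx"
  and nn: "0 <= x0" "0 <= y0" "0 <= l1" "0 <= l2" "0 <= l3" "0 <= l4"
  and d0: "!!m. pos (\<lambda>x. x0 + y0 * Hc x - d m 0 x)"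
  and d: "!!m j h. 0 <= h ==> h <= h0 ==> h = t / real m ==>
    pos (\<lambda>x. h * (l1 * hz x + l2 + l3 * Hc x) + l4 * h\<^sup>2 - (d m (Suc j) x - mat_vec idx (R h) (d m j) x))"
  and v: "!!m. v m <= d m m x" "v \<longlonglongrightarrow> z"
 shows "z <= x0 + t * ((l1 + (y0 + t * l3) * \<epsilon>) / \<kappa> * c1 + (y0 + t * l3) * \<eta>2 + l2)
   + (l1 + (y0 + t * l3) * \<epsilon>) / \<kappa> + (y0 + t * l3) * e1"
proof -
 obtain C where C: "0 <= C"
  "!!h t m d x0 y0 l1 l2 l3 l4. [|0 <= h; h <= h0; real m * h <= t;
    0 <= x0; 0 <= y0; 0 <= l1; 0 <= l2; 0 <= l3; 0 <= l4;
    pos (\<lambda>x. x0 + y0 * Hc x - d 0 x);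
    !!j. pos (\<lambda>x. h * (l1 * hz x + l2 + l3 * Hc x) + l4 * h\<^sup>2 - (d (Suc j) x - mat_vec idx (R h) (d j) x))|]
   ==> pos (\<lambda>x. (1 + C * h\<^sup>2) ^ m * (x0 + real m * (h * ((l1 + (y0 + t * l3) * \<epsilon>) / \<kappa> * c1 + (y0 + t * l3) * \<eta>2 + l2)
       + h\<^sup>2 * (C * ((l1 + (y0 + t * l3) * \<epsilon>) / \<kappa> + (y0 + t * l3)) + l4)))
     + (l1 + (y0 + t * l3) * \<epsilon>) / \<kappa> * Th x + (y0 + real m * h * l3) * Hc x - d m x)"
  using supersolution[OF \<kappa>] by blast
 define Y where "Y = y0 + t * l3"
 define \<beta> where "\<beta> = (l1 + Y * \<epsilon>) / \<kappa>"
 define a where "a = \<beta> * c1 + Y * \<eta>2 + l2"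
 define a' where "a' = C * (\<beta> + Y) + l4"
 have Y: "0 <= Y" using nn t by (simp add: Y_def)
 have \<beta>: "0 <= \<beta>" using nn Y eps_bounds \<kappa> by (auto simp: \<beta>_def)
 have a: "0 <= a" "0 <= a'" using \<beta> Y nn c1 \<eta>2 C(1) by (auto simp: a_def a'_def)
 define bd where "bd = (\<lambda>m. exp (C * t\<^sup>2 / real m) * (x0 + t * a + t\<^sup>2 * a' / real m) + \<beta> + Y * e1)"
 have "bd \<longlonglongrightarrow> exp 0 * (x0 + t * a + 0) + \<beta> + Y * e1"
  unfolding bd_def by (intro tendsto_intros lim_const_over_n)
 moreover have "(\<lambda>m. t / real m) \<longlonglongrightarrow> 0" by (rule lim_const_over_n)
 then have "eventually (\<lambda>m. t / real m < h0) sequentially" by (rule order_tendstoD) (rule h0)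
 then have "eventually (\<lambda>m. v m <= bd m) sequentially"
  using eventually_gt_at_top[of "0::nat"]
 proof eventually_elim
  case (elim m)
  let ?h = "t / real m"
  have h: "0 <= ?h" "?h <= h0" "real m * ?h = t" using elim t by auto
  have h2: "real m * (?h * a + ?h\<^sup>2 * a') = t * a + t\<^sup>2 * a' / real m"
   using elim by (simp add: power2_eq_square field_simps)
  have h3: "real m * ?h <= t" using h by simp
  have "pos (\<lambda>x. (1 + C * ?h\<^sup>2) ^ m * (x0 + real m * (?h * a + ?h\<^sup>2 * a')) + \<beta> * Th x + (y0 + real m * ?h * l3) * Hc x - d m m x)"
   using C(2)[OF h(1,2) h3 nn, of "d m", OF d0 d[OF h(1,2) refl]]
   unfolding a_def a'_def \<beta>_def Y_def .
  then have "pos (\<lambda>x. (1 + C * ?h\<^sup>2) ^ m * (x0 + (t * a + t\<^sup>2 * a' / real m)) + \<beta> * Th x + Y * Hc x - d m m x)"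
   unfolding h2 h(3) Y_def .
  from pos_entry[OF this] x
  have "d m m x <= (1 + C * ?h\<^sup>2) ^ m * (x0 + (t * a + t\<^sup>2 * a' / real m)) + \<beta> * Th x + Y * Hc x"
   by (cases x) auto
  also have "\<dots> <= exp (C * t\<^sup>2 / real m) * (x0 + (t * a + t\<^sup>2 * a' / real m)) + \<beta> * 1 + Y * e1"
  proof (intro add_mono mult_left_mono mult_right_mono)
   have "(1 + C * ?h\<^sup>2) ^ m <= exp (C * ?h\<^sup>2) ^ m"
    by (intro power_mono exp_ge_add_one_self) (use C(1) in auto)
   also have "\<dots> = exp (real m * (C * ?h\<^sup>2))" by (simp add: exp_of_nat_mult)
   also have "real m * (C * ?h\<^sup>2) = C * t\<^sup>2 / real m" using elim by (simp add: power2_eq_square field_simps)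
   finally show "(1 + C * ?h\<^sup>2) ^ m <= exp (C * t\<^sup>2 / real m)" .
  qed (use x Th_entry Hc_entry \<beta> Y nn a t in auto)
  finally show ?case using v(1)[of m] by (simp add: bd_def add.assoc)
 qed
 ultimately have "z <= exp 0 * (x0 + t * a + 0) + \<beta> + Y * e1"
  using v(2) by (intro tendsto_le[OF sequentially_bot]) auto
 then show ?thesis unfolding a_def \<beta>_def Y_def by simp
qed

lemma R_pow_tendsto:
 assumes "0 <= t" "x \<in> idx"
 shows "(\<lambda>m. (mat_vec idx (R (t / real m)) ^^ m) w x) \<longlonglongrightarrow> mat_vec idx (mat_exp idx B t) w x"
proof -
 obtain C where C: "0 <= C" "!!h x y. [|0 <= h; h <= h0; x \<in> idx; y \<in> idx|] ==> \<bar>R h x y - mat_one x y - h * B x y\<bar> <= C * h\<^sup>2"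
  using R_taylor by blast
 show ?thesis by (rule product_formula[OF finite_idx h0(1) C(1) C(2) assms])
qed

lemma lipb_uminus: "lipb L Fb f ==> lipb L Fb (\<lambda>x i. - f x i)"
 by (auto simp: lipb_def abs_minus_commute)

lemma Qop_uminus: "Qop h (\<lambda>x i. - g x i) = (\<lambda>x i. - Qop h g x i)"
 by (simp add: Qop_def fun_eq_iff sum_negf)

lemma Qop_pow_uminus: "(Qop h ^^ m) (\<lambda>x i. - f x i) = (\<lambda>x i. - (Qop h ^^ m) f x i)"
 by (induction m) (simp_all add: Qop_uminus)

lemma IG_uminus: "IG (\<lambda>z. - g z) n = - IG g n"
 using IG_cmult[of "-1" g n] by simp

lemma Wop_uminus: "Wop (\<lambda>x i. - f x i) x = - Wop f x"
 by (cases x) (simp add: Wop_def IG_uminus)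

lemma mat_vec_uminus: "mat_vec X A (\<lambda>x. - w x) i = - mat_vec X A w i"
 by (simp add: mat_vec_def sum_negf)

definition bound :: "real => real => real => real => real => real" where
 "bound t l1 l2 l3 y0 = t * ((l1 + (y0 + t * l3) * \<epsilon>) / \<kappa> * c1 + (y0 + t * l3) * \<eta>2 + l2)
   + (l1 + (y0 + t * l3) * \<epsilon>) / \<kappa> + (y0 + t * l3) * e1"

lemma initial_in_idx: "initial_index c b K q \<tau> y i k n ==> (k, i, n) \<in> idx"
 using c_cases[of i] by (auto simp: initial_index_def qbd_index_def split: if_splits)

text \<open>The unit vector \<open>n\<close> is the orbit of age \<open>\<tau> n\<close>, so its
  residual time is close to \<open>\<Delta> - \<tau> n\<close>; the starting point lies within one
  gap of the points \<open>\<tau>\<close> from the corresponding level.\<close>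

lemma initial_value:
 assumes ini: "initial_index c b K q \<tau> y i k n" and g: "lipb L Fb g"
  and d: "!!n. n \<in> I ==> \<tau> (n + 1) - \<tau> n <= d"
 shows "\<bar>Wop g (k, i, n) - g y i\<bar> <= L * (e1 + d)"
proof -
 have L: "0 <= L" by (rule lipbD(3)[OF g])
 have d0: "0 <= d" using d[OF q_pos] tau_Suc[OF q_pos] by simp
 have nn: "0 <= L * (e1 + d)" using L d0 e1 by simp
 consider "y = 0" "c i < 0" "k = 0" | "y = b" "0 < c i" "k = K + 1"
  | "k \<in> levels" "n \<in> I" "0 < c i" "gridpt b K k + \<tau> n <= y" "y < gridpt b K k + \<tau> (n + 1)"
  | "k \<in> levels" "n \<in> I" "c i < 0" "gridpt b K (k + 1) - \<tau> (n + 1) < y" "y <= gridpt b K (k + 1) - \<tau> n"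
  using ini c_cases[of i] unfolding initial_index_def by (auto split: if_splits)
 then show ?thesis
 proof cases
  case 1
  then show ?thesis using nn by (simp add: Wop_bottom)
 next
  case 2
  then show ?thesis using nn by (simp add: Wop_top)
 next
  case 3
  have "\<bar>Wop g (k, i, n) - g (posn k i (\<Delta> - \<tau> n)) i\<bar> <= L * \<epsilon> / (1 - \<epsilon>)"
   unfolding Wop_inner[OF 3(1)] by (rule IG_unit_approx[OF lip_posn[OF g] 3(2)])
  moreover have "\<bar>g (posn k i (\<Delta> - \<tau> n)) i - g y i\<bar> <= L * d"
  proof (rule order_trans[OF lipbD(1)[OF g] mult_left_mono[OF _ L]])
   show "\<bar>posn k i (\<Delta> - \<tau> n) - y\<bar> <= d"
    using 3 d[OF 3(2)] gridpt_Suc[of k] by (auto simp: posn_def edge_def sgn_c)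
  qed
  ultimately show ?thesis by (simp add: e1_def distrib_left)
 next
  case 4
  have "\<bar>Wop g (k, i, n) - g (posn k i (\<Delta> - \<tau> n)) i\<bar> <= L * \<epsilon> / (1 - \<epsilon>)"
   unfolding Wop_inner[OF 4(1)] by (rule IG_unit_approx[OF lip_posn[OF g] 4(2)])
  moreover have "\<bar>g (posn k i (\<Delta> - \<tau> n)) i - g y i\<bar> <= L * d"
  proof (rule order_trans[OF lipbD(1)[OF g] mult_left_mono[OF _ L]])
   show "\<bar>posn k i (\<Delta> - \<tau> n) - y\<bar> <= d"
    using 4 d[OF 4(2)] gridpt_Suc[of k] by (auto simp: posn_def edge_def sgn_c)
  qed
  ultimately show ?thesis by (simp add: e1_def distrib_left)
 qed
qed

text \<open>The difference of \<open>j\<close> steps of the scheme and the column of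
  \<open>j\<close> Euler steps starts at 0 and satisfies the recursion of \<open>limit_bound\<close>
  by \<open>R_Wop\<close>; the initial point adds \<open>L * (e1 + d)\<close>.\<close>

lemma Wop_converges_upper:
 assumes \<kappa>: "0 < \<kappa>" and t: "0 <= t" and ini: "initial_index c b K q \<tau> y i k n" and f: "lipb L Fb f"
  and d: "!!n. n \<in> I ==> \<tau> (n + 1) - \<tau> n <= d"
  and lim: "(\<lambda>m. (Qop (t / real m) ^^ m) f y i) \<longlonglongrightarrow> evl"
 shows "mat_vec idx (mat_exp idx B t) (Wop f) (k, i, n) - evl - L * (e1 + d) <= bound t (L * \<epsilon>) (L * \<eta>2) (L * tm) 0"
proof -
 let ?x = "(k, i, n)"
 have x: "?x \<in> idx" by (rule initial_in_idx[OF ini])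
 obtain C where C: "0 <= C" "!!h L Fb g. [|0 <= h; h <= h0; lipb L Fb g|] ==>
  pos (\<lambda>x. h * (L * \<epsilon> * hz x + L * \<eta>2 + L * tm * Hc x) + C * (Fb + L) * h\<^sup>2 - (mat_vec idx (R h) (Wop g) x - Wop (Qop h g) x))"
  using R_Wop by blast
 define dd where "dd = (\<lambda>m j x. (mat_vec idx (R (t / real m)) ^^ j) (Wop f) x - Wop ((Qop (t / real m) ^^ j) f) x)"
 have h: "0 <= t / real m" for m using t by simp
 have "mat_vec idx (mat_exp idx B t) (Wop f) (k, i, n) - evl - L * (e1 + d) <= 0 + t * ((L * \<epsilon> + (0 + t * (L * tm)) * \<epsilon>) / \<kappa> * c1 + (0 + t * (L * tm)) * \<eta>2 + L * \<eta>2)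
   + (L * \<epsilon> + (0 + t * (L * tm)) * \<epsilon>) / \<kappa> + (0 + t * (L * tm)) * e1"
 proof (rule limit_bound[OF \<kappa> t x, where ?l4.0 = "C * (Fb + L)" and d = dd])
  show "0 <= L * \<epsilon>" "0 <= L * \<eta>2" "0 <= L * tm" "0 <= C * (Fb + L)"
   using lipbD(3,4)[OF f] eps_bounds \<eta>2 tm C by auto
  show "pos (\<lambda>x. 0 + 0 * Hc x - dd m 0 x)" for m
   using pos_const[of 0] by (simp add: dd_def)
  show "(\<lambda>m. (mat_vec idx (R (t / real m)) ^^ m) (Wop f) ?x - (Qop (t / real m) ^^ m) f y i - L * (e1 + d))
    \<longlonglongrightarrow> mat_vec idx (mat_exp idx B t) (Wop f) ?x - evl - L * (e1 + d)"
   by (intro tendsto_intros R_pow_tendsto t x lim)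
  show "(mat_vec idx (R (t / real m)) ^^ m) (Wop f) ?x - (Qop (t / real m) ^^ m) f y i - L * (e1 + d) <= dd m m ?x" for m
   using initial_value[OF ini lipb_Qop_pow[OF f h] d, of m m] unfolding dd_def by simp
 next
  fix m j h assume hh: "0 <= h" "h <= h0" "h = t / real m"
  let ?g = "(Qop h ^^ j) f"
  from C(2)[OF hh(1,2) lipb_Qop_pow[OF f hh(1), of j]]
  show "pos (\<lambda>x. h * (L * \<epsilon> * hz x + L * \<eta>2 + L * tm * Hc x) + C * (Fb + L) * h\<^sup>2 - (dd m (Suc j) x - mat_vec idx (R h) (dd m j) x))"
   by (rule pos_cong) (simp add: dd_def hh(3)[symmetric] mat_vec_diff)
 qed auto
 then show ?thesis by (simp add: bound_def)
qed

text \<open>Positivity yields upper bounds only; the lower bound is the upper bound for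
  \<open>-f\<close>, since both schemes are linear.\<close>

lemma Wop_converges:
 assumes \<kappa>: "0 < \<kappa>" and t: "0 <= t" and ini: "initial_index c b K q \<tau> y i k n" and f: "lipb L Fb f"
  and d: "!!n. n \<in> I ==> \<tau> (n + 1) - \<tau> n <= d"
  and lim: "(\<lambda>m. (Qop (t / real m) ^^ m) f y i) \<longlonglongrightarrow> evl"
 shows "\<bar>mat_vec idx (mat_exp idx B t) (Wop f) (k, i, n) - evl\<bar> <= L * (e1 + d) + bound t (L * \<epsilon>) (L * \<eta>2) (L * tm) 0"
proof -
 have lim': "(\<lambda>m. (Qop (t / real m) ^^ m) (\<lambda>x i. - f x i) y i) \<longlonglongrightarrow> - evl"
  unfolding Qop_pow_uminus by (rule tendsto_minus[OF lim])
 have neg: "mat_vec idx (mat_exp idx B t) (Wop (\<lambda>x i. - f x i)) (k, i, n) = - mat_vec idx (mat_exp idx B t) (Wop f) (k, i, n)"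
  unfolding Wop_uminus[abs_def] by (rule mat_vec_uminus)
 show ?thesis
  using Wop_converges_upper[OF \<kappa> t ini f d lim] Wop_converges_upper[OF \<kappa> t ini lipb_uminus[OF f] d lim']
  unfolding neg by linarith
qed

section \<open>The closing operator\<close>

abbreviation "Vop f \<equiv> closing_op c b K q S f"

lemma gridpt_range:
 assumes k: "k \<in> levels" shows "0 <= gridpt b K k" "gridpt b K (k + 1) <= b"
proof -
 show "0 <= gridpt b K k" using k \<Delta>_pos by (auto simp: gridpt_eq)
 have "real k * \<Delta> <= real K * \<Delta>" using k \<Delta>_pos by (intro mult_right_mono) auto
 then show "gridpt b K (k + 1) <= b" by (simp add: gridpt_eq K_\<Delta>)
qed

text \<open>Substituting \<open>posn k i z\<close> for the level maps the cell to
  \<open>(0, \<Delta>]\<close> in either direction and reduces the integral to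
  \<open>closing_integral\<close>; the missing endpoint is a null set.\<close>

lemma Vop_inner:
 assumes k: "k \<in> levels" and n: "n \<in> I" and cont: "continuous_on {0..b} (\<lambda>x. f x i)"
 shows "Vop f (k, i, n) = IG (\<lambda>z. f (posn k i (reflect z)) i) n"
proof -
 have rng: "posn k i z \<in> {0..b}" if "z \<in> {0..\<Delta>}" for z
  using that gridpt_Suc[of k] gridpt_range[OF k] by (auto simp: posn_def edge_def sgn_c)
 have contp: "continuous_on {0..\<Delta>} (\<lambda>z. f (posn k i z) i)"
 proof (rule continuous_on_compose2[OF cont])
  show "continuous_on {0..\<Delta>} (posn k i)" unfolding posn_def by (intro continuous_intros)
  show "posn k i ` {0..\<Delta>} \<subseteq> {0..b}" using rng by auto
 qed
 define g where "g = (\<lambda>x. closing_vec \<Delta> q S (if 0 < c i then gridpt b K (k + 1) - x else x - gridpt b K k) n * f x i)"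
 let ?\<sigma> = "- sgn (c i)"
 have \<sigma>: "?\<sigma> \<noteq> 0" "\<bar>?\<sigma>\<bar> = 1" using c_nz[of i] by (auto simp: sgn_c)
 have pos: "edge k i + ?\<sigma> * z = posn k i z" for z by (simp add: posn_def)
 have z: "(if 0 < c i then gridpt b K (k + 1) - posn k i z else posn k i z - gridpt b K k) = z" for z
  by (simp add: posn_def edge_def sgn_c)
 have ind: "indicator (cell c b K k i) (posn k i z) = (indicator {0<..\<Delta>} z :: real)" for z
  using gridpt_Suc[of k] by (auto simp: cell_def posn_def edge_def sgn_c indicator_def)
 have "Vop f (k, i, n) = (\<integral>x. indicator (cell c b K k i) x *\<^sub>R g x \<partial>lborel)"
  using k by (simp add: closing_op_def set_lebesgue_integral_def g_def \<Delta>_eq)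
 also have "\<dots> = (\<integral>z. indicator (cell c b K k i) (posn k i z) *\<^sub>R g (posn k i z) \<partial>lborel)"
  using lborel_integral_real_affine[OF \<sigma>(1), of "\<lambda>x. indicator (cell c b K k i) x *\<^sub>R g x" "edge k i"]
  unfolding \<sigma>(2) pos by simp
 also have "\<dots> = (LINT z:{0<..\<Delta>}|lborel. closing_vec \<Delta> q S z n * f (posn k i z) i)"
  unfolding ind g_def z set_lebesgue_integral_def ..
 also have "\<dots> = (LINT z:{0..\<Delta>}|lborel. closing_vec \<Delta> q S z n * f (posn k i z) i)"
  unfolding set_lebesgue_integral_def
 proof (rule integral_cong_AE)
  let ?c = "\<lambda>z. closing_vec \<Delta> q S z n * f (posn k i z) i"
  have "continuous_on {0..\<Delta>} ?c"
   unfolding closing_vec_def mat_vec_def[of I "\<lambda>n m. E _ n m + E _ n m"] using n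
   by (intro continuous_intros contp continuous_on_compose2[OF mat_exp_continuous[of I _ _ UNIV S]]) auto
  then have m [measurable]: "(\<lambda>z. indicator {0..\<Delta>} z *\<^sub>R ?c z) \<in> borel_measurable borel"
   by (intro borel_measurable_continuous_on_indicator) auto
  then show "(\<lambda>z. indicator {0..\<Delta>} z *\<^sub>R ?c z) \<in> borel_measurable lborel" by simp
  have eq: "indicator {0<..\<Delta>} z *\<^sub>R ?c z = indicator {0<..} z * (indicator {0..\<Delta>} z *\<^sub>R ?c z)" for z
   by (auto simp: indicator_def)
  show "(\<lambda>z. indicator {0<..\<Delta>} z *\<^sub>R ?c z) \<in> borel_measurable lborel"
   unfolding eq by measurable
  show "AE z in lborel. indicator {0<..\<Delta>} z *\<^sub>R ?c z = indicator {0..\<Delta>} z *\<^sub>R ?c z"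
   using AE_lborel_singleton[of 0] by eventually_elim (auto simp: indicator_def)
 qed
 also have "\<dots> = IG (\<lambda>z. f (posn k i (reflect z)) i) n"
  by (rule closing_integral[OF contp n])
 finally show ?thesis .
qed

lemma Vop_bottom: "Vop f (0, i, n) = f 0 i" and Vop_top: "Vop f (K + 1, i, n) = f b i"
 by (simp_all add: closing_op_def)

lemma adm_reflect:
 assumes k: "k \<in> levels" and cont: "continuous_on UNIV (\<lambda>x. f x i)"
 shows "adm (\<lambda>z. f (posn k i (reflect z)) i)"
proof -
 have c: "continuous_on X (\<lambda>z. f (posn k i z) i)" for X
  by (rule continuous_on_compose2[OF cont]) (auto simp: posn_def intro!: continuous_intros)
 have c2: "continuous_on UNIV (\<lambda>z. f (posn k i (reflect z)) i)"
  by (rule continuous_on_compose2[OF c[of UNIV] reflect_cont]) auto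
 have "bounded ((\<lambda>z. f (posn k i z) i) ` {0..\<Delta>})"
  by (intro compact_imp_bounded compact_continuous_image c) auto
 then obtain C where "\<forall>z\<in>{0..\<Delta>}. \<bar>f (posn k i z) i\<bar> <= C" by (auto simp: bounded_iff)
 then show ?thesis
  by (intro adm_bounded[of _ C] borel_measurable_continuous_onI c2) (use reflect_bounds in auto)
qed

lemma Vop_bounded_pos:
 assumes cont: "!!i. continuous_on UNIV (\<lambda>x. f x i)" and bd: "!!x i. \<bar>f x i\<bar> <= Fb"
 shows "pos (\<lambda>x. Fb - Vop f x)"
 unfolding pos_def
proof (intro conjI allI ballI impI)
 fix i
 show "0 <= Fb - Vop f (0, i, 1)" using bd[of 0 i] by (simp add: Vop_bottom)
 show "0 <= Fb - Vop f (K + 1, i, 1)" using bd[of b i] unfolding Vop_top by simp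
 fix k a assume k: "k \<in> levels" and a: "cone a"
 have cont': "continuous_on {0..b} (\<lambda>x. f x i)" by (rule continuous_on_subset[OF cont]) simp
 have "(\<Sum>n\<in>I. a n * (Fb - Vop f (k, i, n))) = (\<Sum>n\<in>I. a n * IG (\<lambda>z. Fb - f (posn k i (reflect z)) i) n)"
  by (intro sum.cong refl) (simp add: Vop_inner[where f = f, OF k _ cont'] IG_diff[OF adm_const adm_reflect[where f = f and i = i, OF k cont]] IG_const)
 also have "0 <= \<dots>"
  by (rule IG_nonneg[OF adm_diff[OF adm_const adm_reflect[OF k cont]] a]) (use bd in \<open>simp add: abs_le_iff\<close>)
 finally show "0 <= (\<Sum>n\<in>I. a n * (Fb - Vop f (k, i, n)))" .
qed

lemma lipb_cont: "lipb L Fb f ==> continuous_on X (\<lambda>x. f x i)"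
proof -
 assume f: "lipb L Fb f"
 have "L-lipschitz_on X (\<lambda>x. f x i)"
  using lipbD(1,3)[OF f] by (intro lipschitz_onI) (auto simp: dist_real_def)
 then show ?thesis by (rule lipschitz_on_continuous_on)
qed

text \<open>The closing operator reads the folded residual time, \<open>Wop\<close> the unfolded
  one; \<open>reflect_dev\<close> bounds the difference by twice the excess, which is small in mean
  along the scheme although not pointwise.\<close>

lemma Vop_Wop_pos:
 assumes f: "lipb L Fb f"
 shows "pos (\<lambda>x. 0 + (2 * L) * Hc x - (Vop f x - Wop f x))"
 unfolding pos_def
proof (intro conjI allI ballI impI)
 note L = lipbD(3)[OF f]
 fix i
 show "0 <= 0 + (2 * L) * Hc (0, i, 1) - (Vop f (0, i, 1) - Wop f (0, i, 1))"
  by (simp add: Vop_bottom Wop_bottom Hc_def)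
 show "0 <= 0 + (2 * L) * Hc (K + 1, i, 1) - (Vop f (K + 1, i, 1) - Wop f (K + 1, i, 1))"
  unfolding Vop_top Wop_top by (simp add: Hc_def)
 fix k a assume k: "k \<in> levels" and a: "cone a"
 let ?g = "\<lambda>z. 2 * L * excess z - (f (posn k i (reflect z)) i - f (posn k i z) i)"
 note ad = adm_reflect[where f = f and i = i, OF k lipb_cont[OF f]] adm_posn[OF f, of k i i] adm_cmult[OF adm_excess, of "2 * L"]
 have "(\<Sum>n\<in>I. a n * (0 + (2 * L) * Hc (k, i, n) - (Vop f (k, i, n) - Wop f (k, i, n)))) = (\<Sum>n\<in>I. a n * IG ?g n)"
 proof (intro sum.cong refl)
  fix n assume n: "n \<in> I"
  have "IG ?g n = (2 * L) * Hc (k, i, n) - (Vop f (k, i, n) - Wop f (k, i, n))"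
   unfolding IG_diff[OF ad(3) adm_diff[OF ad(1,2)] n] IG_diff[OF ad(1,2) n] IG_cmult Vop_inner[where f = f, OF k n lipb_cont[OF f]]
   using k by (simp add: Hc_def Wop_inner)
  then show "a n * (0 + (2 * L) * Hc (k, i, n) - (Vop f (k, i, n) - Wop f (k, i, n))) = a n * IG ?g n" by simp
 qed
 also have "0 <= \<dots>"
 proof (rule IG_nonneg[OF adm_diff[OF ad(3) adm_diff[OF ad(1,2)]] a])
  fix z :: real assume z: "0 <= z"
  have "f (posn k i (reflect z)) i - f (posn k i z) i <= L * \<bar>reflect z - z\<bar>"
   using lip_posn[OF f, of k i "reflect z" i z] by simp
  also have "\<dots> <= L * (2 * excess z)" by (intro mult_left_mono reflect_dev z L)
  finally show "0 <= ?g z" by simp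
 qed
 finally show "0 <= (\<Sum>n\<in>I. a n * (0 + (2 * L) * Hc (k, i, n) - (Vop f (k, i, n) - Wop f (k, i, n))))" .
qed

lemma Vop_uminus: "Vop (\<lambda>x i. - f x i) x = - Vop f x"
 by (cases x) (simp add: closing_op_def set_lebesgue_integral_def)

lemma semigroup_upper:
 assumes \<kappa>: "0 < \<kappa>" and t: "0 <= t" and x: "x \<in> idx" and nn: "0 <= x0" "0 <= y0"
  and w: "pos (\<lambda>x. x0 + y0 * Hc x - w x)"
 shows "mat_vec idx (mat_exp idx B t) w x <= x0 + bound t 0 0 0 y0"
proof -
 have "mat_vec idx (mat_exp idx B t) w x <= x0 + t * ((0 + (y0 + t * 0) * \<epsilon>) / \<kappa> * c1 + (y0 + t * 0) * \<eta>2 + 0)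
   + (0 + (y0 + t * 0) * \<epsilon>) / \<kappa> + (y0 + t * 0) * e1"
 proof (rule limit_bound[OF \<kappa> t x, where ?l4.0 = 0 and d = "\<lambda>m j. (mat_vec idx (R (t / real m)) ^^ j) w"])
  show "(\<lambda>m. (mat_vec idx (R (t / real m)) ^^ m) w x) \<longlonglongrightarrow> mat_vec idx (mat_exp idx B t) w x"
   by (rule R_pow_tendsto[OF t x])
 qed (use nn w pos_const[of 0] in auto)
 then show ?thesis by (simp add: bound_def)
qed

text \<open>On constant columns the semigroup bound has no loss, since all coefficients in
  \<open>bound\<close> are 0. This carries a uniform approximation of the test function through the
  scheme with factor 1.\<close>

lemma Vop_contraction:
 assumes \<kappa>: "0 < \<kappa>" and t: "0 <= t" and x: "x \<in> idx"
  and cont: "!!i. continuous_on UNIV (\<lambda>x. f x i)" and bd: "!!x i. \<bar>f x i\<bar> <= Fb"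
 shows "\<bar>mat_vec idx (mat_exp idx B t) (Vop f) x\<bar> <= Fb"
proof -
 have Fb: "0 <= Fb" using bd by (auto intro: order_trans[OF abs_ge_zero])
 have 1: "mat_vec idx (mat_exp idx B t) (Vop f) x <= Fb"
  using semigroup_upper[OF \<kappa> t x Fb order_refl, of "Vop f"] Vop_bounded_pos[OF cont bd]
  by (simp add: bound_def)
 have "pos (\<lambda>x. Fb - Vop (\<lambda>x i. - f x i) x)"
  by (rule Vop_bounded_pos) (use cont bd in \<open>auto intro: continuous_on_minus\<close>)
 then have "mat_vec idx (mat_exp idx B t) (Vop (\<lambda>x i. - f x i)) x <= Fb"
  using semigroup_upper[OF \<kappa> t x Fb order_refl, of "Vop (\<lambda>x i. - f x i)"] by (simp add: bound_def)
 then show ?thesis using 1 unfolding Vop_uminus[abs_def] mat_vec_uminus by (simp add: abs_le_iff)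
qed

lemma Vop_Wop_close:
 assumes \<kappa>: "0 < \<kappa>" and t: "0 <= t" and x: "x \<in> idx" and f: "lipb L Fb f"
 shows "\<bar>mat_vec idx (mat_exp idx B t) (Vop f) x - mat_vec idx (mat_exp idx B t) (Wop f) x\<bar> <= bound t 0 0 0 (2 * L)"
proof -
 have L: "0 <= 2 * L" using lipbD(3)[OF f] by simp
 have 1: "mat_vec idx (mat_exp idx B t) (\<lambda>x. Vop f x - Wop f x) x <= 0 + bound t 0 0 0 (2 * L)"
  by (rule semigroup_upper[OF \<kappa> t x order_refl L Vop_Wop_pos[OF f]])
 have 2: "mat_vec idx (mat_exp idx B t) (\<lambda>x. Vop (\<lambda>x i. - f x i) x - Wop (\<lambda>x i. - f x i) x) x <= 0 + bound t 0 0 0 (2 * L)"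
  by (rule semigroup_upper[OF \<kappa> t x order_refl L Vop_Wop_pos[OF lipb_uminus[OF f]]])
 show ?thesis
  using 1 2 unfolding Vop_uminus Wop_uminus mat_vec_diff mat_vec_uminus by (simp add: abs_le_iff)
qed

text \<open>Three comparisons: \<open>g\<close> with the Lipschitz function \<open>f\<close> by
  contraction, the closing operator with \<open>Wop\<close> by the excess, and the semigroup on
  \<open>Wop f\<close> with the Euler limit.\<close>

theorem scheme_error:
 assumes \<kappa>: "0 < \<kappa>" and t: "0 <= t" and ini: "initial_index c b K q \<tau> y i k n" and f: "lipb L Fb f"
  and d: "!!n. n \<in> I ==> \<tau> (n + 1) - \<tau> n <= d"
  and lim: "(\<lambda>m. (Qop (t / real m) ^^ m) f y i) \<longlonglongrightarrow> evl"
  and cont: "!!i. continuous_on UNIV (\<lambda>x. g x i)" and gf: "!!x i. \<bar>g x i - f x i\<bar> <= e"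
 shows "\<bar>mat_vec idx (mat_exp idx B t) (Vop g) (k, i, n) - evl\<bar>
  <= e + L * (e1 + d) + bound t (L * \<epsilon>) (L * \<eta>2) (L * tm) 0 + bound t 0 0 0 (2 * L)"
proof -
 let ?x = "(k, i, n)" and ?P = "mat_exp idx B t"
 have x: "?x \<in> idx" by (rule initial_in_idx[OF ini])
 have "\<bar>mat_vec idx ?P (Vop (\<lambda>x i. g x i - f x i)) ?x\<bar> <= e"
  by (rule Vop_contraction[OF \<kappa> t x]) (use gf cont lipb_cont[OF f] in \<open>auto intro: continuous_on_diff\<close>)
 moreover have "mat_vec idx ?P (Vop (\<lambda>x i. g x i - f x i)) ?x = mat_vec idx ?P (Vop g) ?x - mat_vec idx ?P (Vop f) ?x"
 proof -
  have "Vop (\<lambda>x i. g x i - f x i) y = Vop g y - Vop f y" if "y \<in> idx" for y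
   using that
  proof (cases rule: idx_cases)
   case (top i)
   then show ?thesis unfolding top(1) Vop_top by simp
  next
   case (inner k i n)
   have "continuous_on {0..b} (\<lambda>x. g x i)" by (rule continuous_on_subset[OF cont]) simp
   moreover have "continuous_on {0..b} (\<lambda>x. f x i)" by (rule lipb_cont[OF f])
   ultimately show ?thesis using inner
    by (simp add: Vop_inner continuous_on_diff IG_diff[OF adm_reflect adm_reflect] cont lipb_cont[OF f])
  qed (simp add: Vop_bottom)
  then have "mat_vec idx ?P (Vop (\<lambda>x i. g x i - f x i)) = mat_vec idx ?P (\<lambda>y. Vop g y - Vop f y)"
   by (rule mat_vec_cong)
  then show ?thesis by (simp add: mat_vec_diff)
 qed
 ultimately show ?thesis
  using Wop_converges[OF \<kappa> t ini f d lim] Vop_Wop_close[OF \<kappa> t x f] by linarith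
qed

section \<open>The fluid queue as a limit of Euler schemes\<close>

text \<open>For positive rate the path stays below the line of slope \<open>c j\<close> and is
  nondecreasing. If it ends below \<open>b\<close> it never touched \<open>b\<close> and follows the
  line; if it ends at \<open>b\<close>, the line ends there or above. Negative rate is
  symmetric.\<close>

lemma level_rate_flow:
 assumes uv: "u <= v" and cont: "continuous_on {u..v} X"
  and X: "!!y. u <= y ==> y <= v ==> X y \<in> {0..b}"
  and D: "!!y. u <= y ==> y < v ==> (X has_real_derivative level_rate c b (X y) j) (at y within {y..})"
 shows "X v = flow j (v - u) (X u)"
proof (cases "0 < c j")
 case True
 have rate: "level_rate c b x j = (if x = b then 0 else c j)" if "x \<in> {0..b}" for x
  using that True b_pos by (auto simp: level_rate_def)
 have sub: "continuous_on {x..v} X" if "u <= x" for x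
  by (rule continuous_on_subset[OF cont]) (use that in auto)
 have up: "X v <= X u + c j * (v - u)"
 proof -
  have "X v - c j * v <= X u - c j * u"
  proof (rule right_deriv_nonpos_imp_le[OF uv])
   show "continuous_on {u..v} (\<lambda>y. X y - c j * y)" by (intro continuous_intros cont)
   fix x assume x: "u <= x" "x < v"
   have "((\<lambda>y. X y - c j * y) has_real_derivative (level_rate c b (X x) j - c j)) (at x within {x..})"
    using D[OF x] by (auto intro!: derivative_eq_intros)
   moreover have "level_rate c b (X x) j - c j <= 0" using rate[of "X x"] X[of x] x True by auto
   ultimately show "\<exists>d\<le>0. ((\<lambda>y. X y - c j * y) has_real_derivative d) (at x within {x..})" by blast
  qed
  then show ?thesis by (simp add: algebra_simps)
 qed
 have mono: "X y <= X v" if "u <= y" "y <= v" for y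
 proof -
  have "- X v <= - X y"
  proof (rule right_deriv_nonpos_imp_le[OF that(2)])
   show "continuous_on {y..v} (\<lambda>y. - X y)" by (intro continuous_intros sub that)
   fix x assume x: "y <= x" "x < v"
   have "((\<lambda>y. - X y) has_real_derivative (- level_rate c b (X x) j)) (at x within {x..})"
    using D[of x] x that by (auto intro!: derivative_eq_intros)
   moreover have "- level_rate c b (X x) j <= 0" using rate[of "X x"] X[of x] x that True by auto
   ultimately show "\<exists>d\<le>0. ((\<lambda>y. - X y) has_real_derivative d) (at x within {x..})" by blast
  qed
  then show ?thesis by simp
 qed
 show ?thesis
 proof (cases "X v = b")
  case Xb: True
  then show ?thesis using up True by (simp add: flow_def)
 next
  case False
  then have Xv: "X v < b" using X[of v] uv by auto
  have "X v - c j * v = X u - c j * u"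
  proof (rule right_deriv_zero_imp_const[OF uv])
   show "continuous_on {u..v} (\<lambda>y. X y - c j * y)" by (intro continuous_intros cont)
   fix x assume x: "u <= x" "x < v"
   have "level_rate c b (X x) j = c j" using rate[of "X x"] X[of x] x mono[of x] Xv by auto
   then show "((\<lambda>y. X y - c j * y) has_real_derivative 0) (at x within {x..})"
    using D[OF x] by (auto intro!: derivative_eq_intros)
  qed
  then have "X u + c j * (v - u) = X v" by (simp add: algebra_simps)
  then show ?thesis using True Xv by (simp add: flow_def)
 qed
next
 case False
 then have neg: "c j < 0" using c_cases[of j] by auto
 have rate: "level_rate c b x j = (if x = 0 then 0 else c j)" if "x \<in> {0..b}" for x
  using that neg b_pos by (auto simp: level_rate_def)
 have sub: "continuous_on {x..v} X" if "u <= x" for x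
  by (rule continuous_on_subset[OF cont]) (use that in auto)
 have low: "X u + c j * (v - u) <= X v"
 proof -
  have "c j * v - X v <= c j * u - X u"
  proof (rule right_deriv_nonpos_imp_le[OF uv])
   show "continuous_on {u..v} (\<lambda>y. c j * y - X y)" by (intro continuous_intros cont)
   fix x assume x: "u <= x" "x < v"
   have "((\<lambda>y. c j * y - X y) has_real_derivative (c j - level_rate c b (X x) j)) (at x within {x..})"
    using D[OF x] by (auto intro!: derivative_eq_intros)
   moreover have "c j - level_rate c b (X x) j <= 0" using rate[of "X x"] X[of x] x neg by auto
   ultimately show "\<exists>d\<le>0. ((\<lambda>y. c j * y - X y) has_real_derivative d) (at x within {x..})" by blast
  qed
  then show ?thesis by (simp add: algebra_simps)
 qed
 have mono: "X v <= X y" if "u <= y" "y <= v" for y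
 proof (rule right_deriv_nonpos_imp_le[OF that(2) sub[OF that(1)]])
  fix x assume x: "y <= x" "x < v"
  have "level_rate c b (X x) j <= 0" using rate[of "X x"] X[of x] x that neg by auto
  then show "\<exists>d\<le>0. (X has_real_derivative d) (at x within {x..})" using D[of x] x that by auto
 qed
 show ?thesis
 proof (cases "X v = 0")
  case X0: True
  then show ?thesis using low False by (simp add: flow_def)
 next
  case X0: False
  then have Xv: "0 < X v" using X[of v] uv by auto
  have "X v - c j * v = X u - c j * u"
  proof (rule right_deriv_zero_imp_const[OF uv])
   show "continuous_on {u..v} (\<lambda>y. X y - c j * y)" by (intro continuous_intros cont)
   fix x assume x: "u <= x" "x < v"
   have "level_rate c b (X x) j = c j" using rate[of "X x"] X[of x] x mono[of x] Xv by auto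
   then show "((\<lambda>y. X y - c j * y) has_real_derivative 0) (at x within {x..})"
    using D[OF x] by (auto intro!: derivative_eq_intros)
  qed
  then have "X u + c j * (v - u) = X v" by (simp add: algebra_simps)
  then show ?thesis using False Xv by (simp add: flow_def)
 qed
qed

lemma level_lipschitz:
 assumes uv: "u <= v" and cont: "continuous_on {u..v} X"
  and D: "!!y. u <= y ==> y < v ==> (X has_real_derivative level_rate c b (X y) (\<phi> y)) (at y within {y..})"
 shows "\<bar>X v - X u\<bar> <= cm * (v - u)"
proof -
 have rate: "\<bar>level_rate c b x j\<bar> <= cm" for x j
  using cm(2)[of j] cm(1) by (auto simp: level_rate_def max_def min_def)
 have "X v - cm * v <= X u - cm * u"
 proof (rule right_deriv_nonpos_imp_le[OF uv])
  show "continuous_on {u..v} (\<lambda>y. X y - cm * y)" by (intro continuous_intros cont)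
  fix x assume x: "u <= x" "x < v"
  have "((\<lambda>y. X y - cm * y) has_real_derivative (level_rate c b (X x) (\<phi> x) - cm)) (at x within {x..})"
   using D[OF x] by (auto intro!: derivative_eq_intros)
  moreover have "level_rate c b (X x) (\<phi> x) - cm <= 0" using rate[of "X x" "\<phi> x"] by auto
  ultimately show "\<exists>d\<le>0. ((\<lambda>y. X y - cm * y) has_real_derivative d) (at x within {x..})" by blast
 qed
 moreover have "- X v - cm * v <= - X u - cm * u"
 proof (rule right_deriv_nonpos_imp_le[OF uv])
  show "continuous_on {u..v} (\<lambda>y. - X y - cm * y)" by (intro continuous_intros cont)
  fix x assume x: "u <= x" "x < v"
  have "((\<lambda>y. - X y - cm * y) has_real_derivative (- level_rate c b (X x) (\<phi> x) - cm)) (at x within {x..})"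
   using D[OF x] by (auto intro!: derivative_eq_intros)
  moreover have "- level_rate c b (X x) (\<phi> x) - cm <= 0" using rate[of "X x" "\<phi> x"] by auto
  ultimately show "\<exists>d\<le>0. ((\<lambda>y. - X y - cm * y) has_real_derivative d) (at x within {x..})" by blast
 qed
 ultimately show ?thesis by (simp add: abs_le_iff algebra_simps)
qed

section \<open>Euler paths and their expectations\<close>

primrec euler :: "real => (nat => 's) => real => nat => real" where
 "euler h \<sigma> x 0 = x"
| "euler h \<sigma> x (Suc k) = flow (\<sigma> k) h (euler h \<sigma> x k)"

lemma flow_dev: "x \<in> {0..b} ==> 0 <= h ==> \<bar>flow j h x - x\<bar> <= cm * h"
proof -
 assume x: "x \<in> {0..b}" and h: "0 <= h"
 have "\<bar>flow j h x - x\<bar> <= \<bar>c j * h\<bar>" using x h c_cases[of j]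
  by (auto simp: flow_def min_def max_def mult_nonneg_nonneg mult_nonpos_nonneg)
 also have "\<dots> <= cm * h" using cm(2)[of j] h by (simp add: abs_mult mult_right_mono)
 finally show ?thesis .
qed

definition jumps :: "(real => 'x) => real => real set" where
 "jumps g t = {y\<in>{0<..t}. \<not> (\<exists>h>0. \<forall>r\<in>{y - h<..<y}. g r = g y)}"

text \<open>A step without a jump in its interior is exact, any other costs at most
  \<open>2 * cm * h\<close>, one \<open>cm * h\<close> for the path and one for the flow. The flow
  is nonexpansive, so old errors are not amplified.\<close>

lemma euler_error:
 assumes h: "0 <= h" and kt: "real k * h <= t" and g: "cadlag_step g"
  and cont: "continuous_on {0..} X" and X: "!!y. 0 <= y ==> X y \<in> {0..b}"
  and D: "!!y. 0 <= y ==> (X has_real_derivative level_rate c b (X y) (g y)) (at y within {y..})"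
 shows "\<bar>X (real k * h) - euler h (\<lambda>k. g (real k * h)) (X 0) k\<bar> <= 2 * cm * h * card (jumps g t \<inter> {..<real k * h})"
 using kt
proof (induction k)
 case 0
 then show ?case using h cm(1) by simp
next
 case (Suc k)
 let ?u = "real k * h" and ?v = "real (Suc k) * h"
 let ?e = "euler h (\<lambda>k. g (real k * h)) (X 0) k"
 have uv: "0 <= ?u" "?u <= ?v" "?v - ?u = h" using h by (auto simp: algebra_simps)
 have IH: "\<bar>X ?u - ?e\<bar> <= 2 * cm * h * card (jumps g t \<inter> {..<?u})"
  using Suc.prems uv by (intro Suc.IH) linarith
 have fin: "finite (jumps g t)" unfolding jumps_def by (rule cadlag_step_finite_jumps[OF g])
 have contuv: "continuous_on {?u..?v} X" by (rule continuous_on_subset[OF cont]) (use uv in auto)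
 \<comment> \<open>Only the open interval matters: a jump at \<open>?u\<close> is already seen by
   the right continuous \<open>g\<close>, one at \<open>?v\<close> acts after the step.\<close>
 show ?case
 proof (cases "jumps g t \<inter> {?u<..<?v} = {}")
  case True
  have const: "g y = g ?u" if "?u <= y" "y < ?v" for y
  proof (rule cadlag_step_const[OF g uv(1)])
   fix z assume z: "?u < z" "z < ?v"
   then have "z \<notin> jumps g t" using True by auto
   then show "\<exists>h>0. \<forall>r\<in>{z - h<..<z}. g r = g z" using z uv Suc.prems by (auto simp: jumps_def)
  qed (use that in auto)
  have "X ?v = flow (g ?u) (?v - ?u) (X ?u)"
  proof (rule level_rate_flow[OF uv(2) contuv])
   show "X y \<in> {0..b}" if "?u <= y" "y <= ?v" for y
    by (rule X) (use uv(1) that(1) in linarith)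
   fix y assume y: "?u <= y" "y < ?v"
   then show "(X has_real_derivative level_rate c b (X y) (g ?u)) (at y within {y..})"
    using D[of y] uv(1) const[OF y] by simp
  qed
  then have "\<bar>X ?v - euler h (\<lambda>k. g (real k * h)) (X 0) (Suc k)\<bar> <= \<bar>X ?u - ?e\<bar>"
   using flow_lip[of "g ?u" h "X ?u" ?e] uv(3) by simp
  also note IH
  also have "2 * cm * h * card (jumps g t \<inter> {..<?u}) <= 2 * cm * h * card (jumps g t \<inter> {..<?v})"
   using cm h uv fin by (intro mult_left_mono) (auto intro!: card_mono)
  finally show ?thesis .
 next
  case False
  then obtain z where z: "z \<in> jumps g t" "?u < z" "z < ?v" by auto
  have "insert z (jumps g t \<inter> {..<?u}) \<subseteq> jumps g t \<inter> {..<?v}" using z uv by auto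
  then have "card (insert z (jumps g t \<inter> {..<?u})) <= card (jumps g t \<inter> {..<?v})"
   using fin by (intro card_mono) auto
  then have cd: "real (card (jumps g t \<inter> {..<?u})) + 1 <= real (card (jumps g t \<inter> {..<?v}))"
   using fin z by simp
  have "\<bar>X ?v - X ?u\<bar> <= cm * (?v - ?u)"
   by (rule level_lipschitz[OF uv(2) contuv, of g]) (rule D, use uv(1) in linarith)
  moreover have "\<bar>flow (g ?u) h (X ?u) - X ?u\<bar> <= cm * h" by (rule flow_dev[OF X[OF uv(1)] h])
  moreover have "\<bar>flow (g ?u) h (X ?u) - flow (g ?u) h ?e\<bar> <= \<bar>X ?u - ?e\<bar>" by (rule flow_lip)
  ultimately have "\<bar>X ?v - euler h (\<lambda>k. g (real k * h)) (X 0) (Suc k)\<bar> <= \<bar>X ?u - ?e\<bar> + 2 * cm * h"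
   unfolding uv(3) by simp
  also have "\<dots> <= 2 * cm * h * (real (card (jumps g t \<inter> {..<?u})) + 1)"
   using IH by (simp add: algebra_simps)
  also have "\<dots> <= 2 * cm * h * card (jumps g t \<inter> {..<?v})"
   using cm h cd by (intro mult_left_mono) auto
  finally show ?thesis .
 qed
qed

lemma euler_cong: "(!!l. l < k ==> \<sigma> l = \<sigma>' l) ==> euler h \<sigma> x k = euler h \<sigma>' x k"
 by (induction k) auto

lemma sum_PiE_Suc:
 fixes H :: "(nat => 's) => real"
 shows "(\<Sum>\<sigma>\<in>PiE {..Suc m} (\<lambda>_. UNIV). H \<sigma>) = (\<Sum>\<sigma>\<in>PiE {..m} (\<lambda>_. UNIV). \<Sum>j\<in>UNIV. H (\<sigma>(Suc m := j)))"
proof -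
 have "PiE {..Suc m} (\<lambda>_. UNIV :: 's set) = (\<lambda>(y, g). g(Suc m := y)) ` (UNIV \<times> PiE {..m} (\<lambda>_. UNIV))"
  using PiE_insert_eq[of "Suc m" "{..m}" "\<lambda>_. UNIV :: 's set"] by (simp add: atMost_Suc)
 moreover have "inj_on (\<lambda>(y, g). g(Suc m := y)) (UNIV \<times> PiE {..m} (\<lambda>_. UNIV :: 's set))"
  using inj_combinator[of "Suc m" "{..m}" "\<lambda>_. UNIV :: 's set"] by simp
 ultimately have "(\<Sum>\<sigma>\<in>PiE {..Suc m} (\<lambda>_. UNIV). H \<sigma>) = (\<Sum>(y, g)\<in>UNIV \<times> PiE {..m} (\<lambda>_. UNIV). H (g(Suc m := y)))"
  by (simp add: sum.reindex split_def)
 also have "\<dots> = (\<Sum>y\<in>UNIV. \<Sum>g\<in>PiE {..m} (\<lambda>_. UNIV). H (g(Suc m := y)))"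
  by (rule sum.cartesian_product[symmetric])
 also have "\<dots> = (\<Sum>g\<in>PiE {..m} (\<lambda>_. UNIV). \<Sum>y\<in>UNIV. H (g(Suc m := y)))"
  by (rule sum.swap)
 finally show ?thesis .
qed

text \<open>The law of the phase process is given by cylinder probabilities only. A functional of
  finitely many phases is a finite combination of indicators of such cylinders; extensional
  functions name each cylinder once.\<close>

lemma path_functional:
 fixes \<phi> :: "real => 'w => 's" and H :: "(nat => 's) => real"
 assumes M: "ctmc M T \<phi>" and h: "0 <= h"
  and dep: "!!\<sigma> \<sigma>'. (!!l. l <= m ==> \<sigma> l = \<sigma>' l) ==> H \<sigma> = H \<sigma>'"
 shows "integrable M (\<lambda>om. H (\<lambda>k. \<phi> (real k * h) om))"
  and "(\<integral>om. H (\<lambda>k. \<phi> (real k * h) om) \<partial>M)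
   = (\<Sum>\<sigma>\<in>PiE {..m} (\<lambda>_. UNIV). H \<sigma> * measure M {om\<in>space M. \<forall>k\<le>m. \<phi> (real k * h) om = \<sigma> k})"
proof -
 let ?A = "\<lambda>\<sigma>. {om\<in>space M. \<forall>k\<le>m. \<phi> (real k * h) om = \<sigma> k}"
 interpret M: prob_space M using M by (simp add: ctmc_def)
 have meas: "\<phi> (real k * h) \<in> measurable M (count_space UNIV)" for k
  using M h by (auto simp: ctmc_def)
 have A: "?A \<sigma> \<in> sets M" for \<sigma>
 proof -
  have "{om\<in>space M. \<phi> (real k * h) om = \<sigma> k} \<in> sets M" for k
  proof -
   have "\<phi> (real k * h) -` {\<sigma> k} \<inter> space M \<in> sets M" using meas by (rule measurable_sets) auto
   then show ?thesis by (simp add: vimage_def Int_def conj_commute)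
  qed
  then show ?thesis by (intro sets.sets_Collect_countable_All sets.sets_Collect_finite_All) auto
 qed
 have fin: "finite (PiE {..m} (\<lambda>_. UNIV :: 's set))" by (intro finite_PiE) auto
 have pt: "H (\<lambda>k. \<phi> (real k * h) om) = (\<Sum>\<sigma>\<in>PiE {..m} (\<lambda>_. UNIV). H \<sigma> * indicator (?A \<sigma>) om)" if om: "om \<in> space M" for om
 proof -
  let ?\<sigma> = "restrict (\<lambda>k. \<phi> (real k * h) om) {..m}"
  have "(\<Sum>\<sigma>\<in>PiE {..m} (\<lambda>_. UNIV). H \<sigma> * indicator (?A \<sigma>) om) = (\<Sum>\<sigma>\<in>PiE {..m} (\<lambda>_. UNIV). if \<sigma> = ?\<sigma> then H ?\<sigma> else 0)"
  proof (intro sum.cong refl)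
   fix \<sigma> assume \<sigma>: "\<sigma> \<in> PiE {..m} (\<lambda>_. UNIV :: 's set)"
   have "om \<in> ?A \<sigma> \<longleftrightarrow> \<sigma> = ?\<sigma>"
   proof
    assume "om \<in> ?A \<sigma>"
    then show "\<sigma> = ?\<sigma>" using \<sigma> by (intro PiE_ext[OF \<sigma>]) auto
   qed (use om in auto)
   then show "H \<sigma> * indicator (?A \<sigma>) om = (if \<sigma> = ?\<sigma> then H ?\<sigma> else 0)"
    by (simp add: indicator_def)
  qed
  also have "\<dots> = H ?\<sigma>" using fin by (simp add: sum.delta)
  also have "\<dots> = H (\<lambda>k. \<phi> (real k * h) om)" by (rule dep) simp
  finally show ?thesis by simp
 qed
 have int: "integrable M (\<lambda>om. H \<sigma> * indicator (?A \<sigma>) om)" for \<sigma>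
  by (rule integrable_mult_right, rule integrable_real_indicator[OF A]) (simp add: M.emeasure_eq_measure)
 show "integrable M (\<lambda>om. H (\<lambda>k. \<phi> (real k * h) om))"
  by (subst Bochner_Integration.integrable_cong[OF refl pt], assumption) (intro Bochner_Integration.integrable_sum int)
 have "(\<integral>om. H (\<lambda>k. \<phi> (real k * h) om) \<partial>M) = (\<integral>om. (\<Sum>\<sigma>\<in>PiE {..m} (\<lambda>_. UNIV). H \<sigma> * indicator (?A \<sigma>) om) \<partial>M)"
  by (rule Bochner_Integration.integral_cong[OF refl pt])
 also have "\<dots> = (\<Sum>\<sigma>\<in>PiE {..m} (\<lambda>_. UNIV). \<integral>om. H \<sigma> * indicator (?A \<sigma>) om \<partial>M)"
  by (rule Bochner_Integration.integral_sum[OF int])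
 also have "\<dots> = (\<Sum>\<sigma>\<in>PiE {..m} (\<lambda>_. UNIV). H \<sigma> * measure M (?A \<sigma>))"
 proof (intro sum.cong refl)
  fix \<sigma>
  have "(\<integral>om. indicator (?A \<sigma>) om \<partial>M) = measure M (?A \<sigma> \<inter> space M)"
   by (rule Bochner_Integration.integral_indicator)
  also have "?A \<sigma> \<inter> space M = ?A \<sigma>" by blast
  finally show "(\<integral>om. H \<sigma> * indicator (?A \<sigma>) om \<partial>M) = H \<sigma> * measure M (?A \<sigma>)"
   by (simp only: integral_mult_right_zero)
 qed
 finally show "(\<integral>om. H (\<lambda>k. \<phi> (real k * h) om) \<partial>M) = (\<Sum>\<sigma>\<in>PiE {..m} (\<lambda>_. UNIV). H \<sigma> * measure M (?A \<sigma>))" .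
qed

text \<open>The Markov property integrates out the last phase, which replaces \<open>g\<close> by
  \<open>Qop h g\<close>; the induction therefore varies \<open>g\<close> and peels steps off at the
  end.\<close>

lemma euler_expectation:
 fixes \<phi> :: "real => 'w => 's"
 assumes M: "ctmc M T \<phi>" and h: "0 <= h" and i: "!!om. om \<in> space M ==> \<phi> 0 om = i"
 shows "(\<integral>om. g (euler h (\<lambda>k. \<phi> (real k * h) om) x m) (\<phi> (real m * h) om) \<partial>M) = (Qop h ^^ m) g x i"
proof (induction m arbitrary: g)
 case 0
 interpret M: prob_space M using M by (simp add: ctmc_def)
 have "(\<integral>om. g (euler h (\<lambda>k. \<phi> (real k * h) om) x 0) (\<phi> (real 0 * h) om) \<partial>M) = (\<integral>om. g x i \<partial>M)"
  by (rule Bochner_Integration.integral_cong) (auto simp: i)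
 then show ?case by (simp add: M.prob_space)
next
 case (Suc m)
 let ?P = "\<lambda>m \<sigma>. measure M {om\<in>space M. \<forall>k\<le>m. \<phi> (real k * h) om = \<sigma> k}"
 let ?X = "PiE {..m} (\<lambda>_. UNIV :: 's set)"
 have step: "?P (Suc m) \<sigma> = ?P m \<sigma> * PT h (\<sigma> m) (\<sigma> (Suc m))" for \<sigma>
 proof -
  have markov: "0 <= \<tau> 0 \<and> (\<forall>k\<le>m. \<tau> k <= \<tau> (Suc k)) \<longrightarrow>
    measure M {om\<in>space M. \<forall>k\<le>Suc m. \<phi> (\<tau> k) om = \<sigma> k} =
    measure M {om\<in>space M. \<forall>k\<le>m. \<phi> (\<tau> k) om = \<sigma> k} * mat_exp UNIV T (\<tau> (Suc m) - \<tau> m) (\<sigma> m) (\<sigma> (Suc m))" for \<tau> :: "nat => real"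
   using M unfolding ctmc_def by blast
  have "real (Suc m) * h - real m * h = h" by (simp add: algebra_simps)
  then show ?thesis using markov[of "\<lambda>k. real k * h"] h by (auto simp: algebra_simps)
 qed
 have "(\<integral>om. g (euler h (\<lambda>k. \<phi> (real k * h) om) x (Suc m)) (\<phi> (real (Suc m) * h) om) \<partial>M)
   = (\<Sum>\<sigma>\<in>PiE {..Suc m} (\<lambda>_. UNIV). g (euler h \<sigma> x (Suc m)) (\<sigma> (Suc m)) * ?P (Suc m) \<sigma>)"
 proof (rule path_functional(2)[OF M h, of "Suc m" "\<lambda>\<sigma>. g (euler h \<sigma> x (Suc m)) (\<sigma> (Suc m))"])
  fix \<sigma> \<sigma>' :: "nat => 's" assume "!!l. l <= Suc m ==> \<sigma> l = \<sigma>' l"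
  then show "g (euler h \<sigma> x (Suc m)) (\<sigma> (Suc m)) = g (euler h \<sigma>' x (Suc m)) (\<sigma>' (Suc m))"
   using euler_cong[of "Suc m" \<sigma> \<sigma>' h x] by simp
 qed
 also have "\<dots> = (\<Sum>\<sigma>\<in>?X. \<Sum>j\<in>UNIV. g (euler h (\<sigma>(Suc m := j)) x (Suc m)) j * ?P (Suc m) (\<sigma>(Suc m := j)))"
  unfolding sum_PiE_Suc by simp
 also have "\<dots> = (\<Sum>\<sigma>\<in>?X. Qop h g (euler h \<sigma> x m) (\<sigma> m) * ?P m \<sigma>)"
 proof (intro sum.cong refl)
  fix \<sigma>
  have 1: "euler h (\<sigma>(Suc m := j)) x (Suc m) = flow (\<sigma> m) h (euler h \<sigma> x m)" for j
   using euler_cong[of m "\<sigma>(Suc m := j)" \<sigma> h x] by simp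
  have "{om\<in>space M. \<forall>k\<le>m. \<phi> (real k * h) om = (\<sigma>(Suc m := j)) k} = {om\<in>space M. \<forall>k\<le>m. \<phi> (real k * h) om = \<sigma> k}" for j
   by auto
  then have 2: "?P (Suc m) (\<sigma>(Suc m := j)) = ?P m \<sigma> * PT h (\<sigma> m) j" for j
   unfolding step by simp
  show "(\<Sum>j\<in>UNIV. g (euler h (\<sigma>(Suc m := j)) x (Suc m)) j * ?P (Suc m) (\<sigma>(Suc m := j))) = Qop h g (euler h \<sigma> x m) (\<sigma> m) * ?P m \<sigma>"
   unfolding 1 2 by (simp add: Qop_def sum_distrib_right sum_distrib_left mult_ac)
 qed
 also have "\<dots> = (\<integral>om. Qop h g (euler h (\<lambda>k. \<phi> (real k * h) om) x m) (\<phi> (real m * h) om) \<partial>M)"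
 proof (rule path_functional(2)[OF M h, of m "\<lambda>\<sigma>. Qop h g (euler h \<sigma> x m) (\<sigma> m)", symmetric])
  fix \<sigma> \<sigma>' :: "nat => 's" assume "!!l. l <= m ==> \<sigma> l = \<sigma>' l"
  then show "Qop h g (euler h \<sigma> x m) (\<sigma> m) = Qop h g (euler h \<sigma>' x m) (\<sigma>' m)"
   using euler_cong[of m \<sigma> \<sigma>' h x] by simp
 qed
 also have "\<dots> = (Qop h ^^ m) (Qop h g) x i" by (rule Suc.IH)
 finally show ?case by (simp add: funpow_swap1)
qed

text \<open>On each path the error is of order \<open>1 / m\<close> times its own finite number of
  jumps. That number has no common bound, but \<open>f\<close> is bounded, so dominated convergence
  applies.\<close>

theorem fluid_queue_limit:
 fixes \<phi> :: "real => 'w => 's"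
 assumes fq: "fluid_queue M T c b x0 i X \<phi>" and t: "0 <= t" and f: "lipb L Fb f"
 shows "(\<lambda>m. (Qop (t / real m) ^^ m) f x0 i) \<longlonglongrightarrow> (\<integral>om. f (X t om) (\<phi> t om) \<partial>M)"
  and "(\<lambda>om. f (X t om) (\<phi> t om)) \<in> borel_measurable M"
proof -
 have M: "ctmc M T \<phi>" using fq by (simp add: fluid_queue_def)
 interpret M: prob_space M using M by (simp add: ctmc_def)
 have path: "X 0 om = x0" "\<phi> 0 om = i" "!!y. 0 <= y ==> X y om \<in> {0..b}" "continuous_on {0..} (\<lambda>y. X y om)"
  "!!y. 0 <= y ==> ((\<lambda>u. X u om) has_real_derivative level_rate c b (X y om) (\<phi> y om)) (at y within {y..})"
  "cadlag_step (\<lambda>y. \<phi> y om)" if "om \<in> space M" for om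
  using fq M that unfolding fluid_queue_def ctmc_def by auto
 \<comment> \<open>Indexing by \<open>Suc m\<close> keeps the step size from dividing by 0.\<close>
 let ?h = "\<lambda>m. t / real (Suc m)"
 define F where "F = (\<lambda>m om. f (euler (?h m) (\<lambda>k. \<phi> (real k * ?h m) om) x0 (Suc m)) (\<phi> (real (Suc m) * ?h m) om))"
 have h: "0 <= ?h m" "real (Suc m) * ?h m = t" for m using t by auto
 have lim: "(\<lambda>m. F m om) \<longlonglongrightarrow> f (X t om) (\<phi> t om)" if om: "om \<in> space M" for om
 proof -
  let ?N = "card (jumps (\<lambda>y. \<phi> y om) t)"
  have fin: "finite (jumps (\<lambda>y. \<phi> y om) t)" unfolding jumps_def by (rule cadlag_step_finite_jumps[OF path(6)[OF om]])
  have bd: "norm (F m om - f (X t om) (\<phi> t om)) <= L * (2 * cm * ?N * t) / real (Suc m)" for m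
  proof -
   let ?e = "euler (?h m) (\<lambda>k. \<phi> (real k * ?h m) om) x0 (Suc m)"
   have "\<bar>X (real (Suc m) * ?h m) om - ?e\<bar> <= 2 * cm * ?h m * card (jumps (\<lambda>y. \<phi> y om) t \<inter> {..<real (Suc m) * ?h m})"
    using euler_error[of "?h m" "Suc m" t "\<lambda>y. \<phi> y om" "\<lambda>y. X y om"] path[OF om] h[of m] by simp
   also have "\<dots> <= 2 * cm * ?h m * ?N"
    using cm t fin by (intro mult_left_mono) (auto intro: card_mono)
   finally have "\<bar>?e - X t om\<bar> <= 2 * cm * ?h m * ?N" unfolding h(2) by (simp add: abs_minus_commute)
   from mult_left_mono[OF this lipbD(3)[OF f]] lipbD(1)[OF f, of ?e "\<phi> t om" "X t om"]
   have "\<bar>f ?e (\<phi> t om) - f (X t om) (\<phi> t om)\<bar> <= L * (2 * cm * ?h m * ?N)" by linarith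
   then show ?thesis unfolding F_def h(2) by (simp add: mult_ac)
  qed
  have "(\<lambda>m. L * (2 * cm * ?N * t) / real (Suc m)) \<longlonglongrightarrow> 0"
   by (rule LIMSEQ_Suc[OF lim_const_over_n])
  from Lim_null_comparison[OF always_eventually[OF allI[OF bd]] this]
  have "(\<lambda>m. F m om - f (X t om) (\<phi> t om)) \<longlonglongrightarrow> 0" .
  then show ?thesis by (simp add: LIM_zero_iff)
 qed
 have Fint: "integrable M (F m)" for m
  unfolding F_def
 proof (rule path_functional(1)[OF M h(1), of "Suc m" "\<lambda>\<sigma>. f (euler (?h m) \<sigma> x0 (Suc m)) (\<sigma> (Suc m))"])
  fix \<sigma> \<sigma>' :: "nat => 's" assume "!!l. l <= Suc m ==> \<sigma> l = \<sigma>' l"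
  then show "f (euler (?h m) \<sigma> x0 (Suc m)) (\<sigma> (Suc m)) = f (euler (?h m) \<sigma>' x0 (Suc m)) (\<sigma>' (Suc m))"
   using euler_cong[of "Suc m" \<sigma> \<sigma>' "?h m" x0] by simp
 qed
 show meas: "(\<lambda>om. f (X t om) (\<phi> t om)) \<in> borel_measurable M"
  by (rule borel_measurable_LIMSEQ_real[OF lim borel_measurable_integrable[OF Fint]])
 have "(\<lambda>m. \<integral>om. F m om \<partial>M) \<longlonglongrightarrow> (\<integral>om. f (X t om) (\<phi> t om) \<partial>M)"
 proof (rule integral_dominated_convergence[where w = "\<lambda>_. Fb"])
  show "AE om in M. (\<lambda>m. F m om) \<longlonglongrightarrow> f (X t om) (\<phi> t om)" using lim by auto
  show "AE om in M. norm (F m om) <= Fb" for m using lipbD(2)[OF f] by (auto simp: F_def)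
 qed (use meas Fint in auto)
 moreover have "(\<integral>om. F m om \<partial>M) = (Qop (?h m) ^^ Suc m) f x0 i" for m
  unfolding F_def by (rule euler_expectation[OF M h(1) path(2)])
 ultimately have "(\<lambda>m. (Qop (t / real (Suc m)) ^^ Suc m) f x0 i) \<longlonglongrightarrow> (\<integral>om. f (X t om) (\<phi> t om) \<partial>M)" by simp
 then show "(\<lambda>m. (Qop (t / real m) ^^ m) f x0 i) \<longlonglongrightarrow> (\<integral>om. f (X t om) (\<phi> t om) \<partial>M)"
  by (rule LIMSEQ_imp_Suc)
qed

section \<open>States and columns of the QBD-RAP\<close>

text \<open>The value of a column at a state: pairing with the orbit in inner levels, the single
  entry at a boundary.\<close>

definition hat :: "(nat \<times> 's \<times> nat => real) => 's qstate => real" where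
 "hat w = (\<lambda>(k, i, a). if k \<in> levels then (\<Sum>n\<in>I. a n * w (k, i, n)) else w (k, i, 1))"

text \<open>The invariant of the paths: normalised orbit with nonnegative residual density. It makes
  intensities nonnegative and lets \<open>hat\<close> reproduce constants.\<close>

definition good :: "'s qstate => bool" where
 "good = (\<lambda>(k, i, a). valid_state c K q (k, i, a) \<and> (k \<in> levels \<longrightarrow> cone a \<and> (\<Sum>n\<in>I. a n) = 1))"

text \<open>On good states, the value of a column after an event and the intensity of an event are
 values of columns before the event.\<close>

definition tw :: "'s option => (nat \<times> 's \<times> nat => real) => nat \<times> 's \<times> nat => real" where
 "tw e w = (\<lambda>(k, i, n). case e of None => w (nxt k i, i, 1)
  | Some j => if k = 0 then w (if c j < 0 then 0 else 1, j, 1)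
    else if k = K + 1 then w (if c j < 0 then K else K + 1, j, 1)
    else if sgn (c i) = sgn (c j) then w (k, j, n) else (\<Sum>m\<in>I. D n m * w (k, j, m)))"

definition lam :: "'s option => nat \<times> 's \<times> nat => real" where
 "lam e = (\<lambda>(k, i, n). case e of None => hz (k, i, n) | Some j => if j \<noteq> i then T i j else 0)"

lemma hat_inner: "k \<in> levels ==> hat w (k, i, a) = (\<Sum>n\<in>I. a n * w (k, i, n))"
 and hat_outer: "k \<notin> levels ==> hat w (k, i, a) = w (k, i, 1)"
 unfolding hat_def prod.case by (simp_all only: if_True if_False)

lemma good_cases:
 assumes "good y"
 obtains (bottom) i where "y = (0, i, unit_vec 1)" "c i < 0"
 | (top) i where "y = (K + 1, i, unit_vec 1)" "0 < c i"
 | (inner) k i a where "y = (k, i, a)" "k \<in> levels" "cone a" "(\<Sum>n\<in>I. a n) = 1" "a = restrict_row q a"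
proof -
 obtain k i a where y: "y = (k, i, a)" by (cases y)
 consider "k = 0" | "k = K + 1" | "k \<in> levels"
  using assms by (fastforce simp: y good_def valid_state_def)
 then show ?thesis
  using assms that y by cases (auto simp: good_def valid_state_def)
qed

lemma hat_const: "good y ==> hat (\<lambda>_. e) y = e"
 by (erule good_cases) (auto simp: hat_def sum_distrib_right[symmetric])

lemma hat_diff: "hat (\<lambda>x. v x - w x) y = hat v y - hat w y"
 by (cases y) (simp add: hat_def right_diff_distrib sum_subtractf)

lemma restrict_dot: "(\<Sum>n\<in>I. restrict_row q a n * w n) = (\<Sum>n\<in>I. a n * w n)"
 by (intro sum.cong refl) (simp add: restrict_row_def)

lemma hat_reset: "hat w (l, j, reset_orbit K q \<alpha> l) = w (l, j, 1)"
 by (simp add: hat_def reset_orbit_def restrict_dot alpha_dot)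

lemma alpha_unit: "n \<in> I ==> \<alpha> n = unit_vec 1 n"
 using construction by (simp add: me_construction_def)

lemma rho_cong: "(!!n. n \<in> I ==> a n = a' n) ==> rho a z = rho a' z"
 unfolding rho_def by (intro sum.cong) auto

lemma cone_cong: "(!!n. n \<in> I ==> a n = a' n) ==> cone a = cone a'"
 unfolding cone_def using rho_cong[of a a'] by simp

lemma good_reset:
 assumes "l <= K + 1" "l = 0 ==> c j < 0" "l = K + 1 ==> 0 < c j"
 shows "good (l, j, reset_orbit K q \<alpha> l)"
proof -
 have "cone (restrict_row q \<alpha>)"
  using cone_cong[of "restrict_row q \<alpha>" "unit_vec 1"] cone_unit[OF q_pos] by (simp add: restrict_row_def alpha_unit)
 moreover have "(\<Sum>n\<in>I. restrict_row q \<alpha> n) = 1"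
  using restrict_dot[of \<alpha> "\<lambda>_. 1"] alpha_dot[of "\<lambda>_. 1"] by simp
 moreover have "restrict_row q (restrict_row q \<alpha>) = restrict_row q \<alpha>"
  by (simp add: restrict_row_def fun_eq_iff)
 ultimately show ?thesis using assms by (simp add: good_def valid_state_def reset_orbit_def)
qed

lemma nxt_bounds: "k \<in> levels ==> nxt k i <= K + 1" "k \<in> levels ==> nxt k i = 0 ==> c i < 0"
 "k \<in> levels ==> nxt k i = K + 1 ==> 0 < c i" "k \<in> levels ==> nxt k i \<noteq> k"
 using c_cases[of i] by (auto simp: nxt_def split: if_splits)

lemma target_None: "target c K q \<alpha> D (k, i, a) None = (nxt k i, i, reset_orbit K q \<alpha> (nxt k i))"
 by (simp add: target_def nxt_def Let_def)

lemma target_bottom: "target c K q \<alpha> D (0, i, a) (Some j) =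
  ((if c j < 0 then 0 else 1), j, reset_orbit K q \<alpha> (if c j < 0 then 0 else 1))"
 using c_cases[of j] by (auto simp: target_def Let_def)

lemma target_top: "target c K q \<alpha> D (K + 1, i, a) (Some j) =
  ((if c j < 0 then K else K + 1), j, reset_orbit K q \<alpha> (if c j < 0 then K else K + 1))"
 by (simp add: target_def Let_def)

lemma target_inner: "k \<in> levels ==> target c K q \<alpha> D (k, i, a) (Some j) =
  (k, j, if sgn (c i) \<noteq> sgn (c j) then restrict_row q (vec_mat I a D) else a)"
 by (auto simp: target_def)

lemma enabled_None: "enabled K (k, i, a) None \<longleftrightarrow> k \<in> levels"
 and enabled_Some: "enabled K (k, i, a) (Some j) \<longleftrightarrow> j \<noteq> i"
 by (simp_all add: enabled_def)

lemma hat_target: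
 assumes y: "good y" and e: "enabled K y e"
 shows "hat w (target c K q \<alpha> D y e) = hat (tw e w) y"
 using y
proof (cases rule: good_cases)
 case (bottom i)
 then obtain j where "e = Some j" using e by (cases e) (auto simp: enabled_None)
 then show ?thesis by (simp add: bottom target_bottom hat_reset hat_outer tw_def del: if_split)
next
 case (top i)
 then obtain j where "e = Some j" using e by (cases e) (auto simp: enabled_None)
 then show ?thesis unfolding top(1) by (simp only: target_top hat_reset) (simp add: hat_outer tw_def)
next
 case (inner k i a)
 show ?thesis
 proof (cases e)
  case None
  have "hat (tw None w) (k, i, a) = (\<Sum>n\<in>I. a n) * w (nxt k i, i, 1)"
   by (simp add: hat_inner[OF inner(2)] tw_def sum_distrib_right)
  then show ?thesis by (simp add: None inner(1,4) target_None hat_reset)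
 next
  case (Some j)
  have k: "k \<noteq> 0" "k \<noteq> K + 1" using inner(2) by auto
  show ?thesis
  proof (cases "sgn (c i) = sgn (c j)")
   case True
   then show ?thesis using k by (simp add: Some inner(1) target_inner[OF inner(2)] hat_inner[OF inner(2)] tw_def)
  next
   case False
   then show ?thesis using k
    by (simp add: Some inner(1) target_inner[OF inner(2)] hat_inner[OF inner(2)] tw_def restrict_dot vec_mat_dot)
  qed
 qed
qed

lemma good_target:
 assumes y: "good y" and e: "enabled K y e"
 shows "good (target c K q \<alpha> D y e)"
 using y
proof (cases rule: good_cases)
 case (bottom i)
 then obtain j where "e = Some j" using e by (cases e) (auto simp: enabled_None)
 then show ?thesis using K by (simp only: bottom target_bottom) (rule good_reset, use c_cases[of j] in \<open>auto split: if_splits\<close>)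
next
 case (top i)
 then obtain j where "e = Some j" using e by (cases e) (auto simp: enabled_None)
 then show ?thesis using K by (simp only: top target_top) (rule good_reset, use c_cases[of j] in \<open>auto split: if_splits\<close>)
next
 case (inner k i a)
 show ?thesis
 proof (cases e)
  case None
  then show ?thesis by (simp only: inner(1) target_None) (rule good_reset, use nxt_bounds inner in auto)
 next
  case (Some j)
  have k: "k \<noteq> 0" "k \<noteq> K + 1" "k <= K + 1" using inner(2) by auto
  have v: "valid_state c K q (k, j, restrict_row q a')" for a'
   using inner(2) by (auto simp: valid_state_def restrict_row_def fun_eq_iff)
  show ?thesis
  proof (cases "sgn (c i) = sgn (c j)")
   case True
   then show ?thesis using v[of a] inner(3,4,5) by (simp add: Some inner(1) target_inner[OF inner(2)] good_def)
  next
   case False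
   have "cone (restrict_row q (vec_mat I a D))"
    using cone_cong[of "restrict_row q (vec_mat I a D)" "vec_mat I a D"] cone_D[OF inner(3)] by (simp add: restrict_row_def)
   moreover have "(\<Sum>n\<in>I. restrict_row q (vec_mat I a D) n) = 1"
   proof -
    have "(\<Sum>n\<in>I. restrict_row q (vec_mat I a D) n) = (\<Sum>n\<in>I. a n * (\<Sum>m\<in>I. D n m * 1))"
     using restrict_dot[of "vec_mat I a D" "\<lambda>_. 1"] vec_mat_dot[of a D "\<lambda>_. 1"] by simp
    also have "\<dots> = (\<Sum>n\<in>I. a n)" by (intro sum.cong refl) (simp only: mult_1_right D_row_sum)
    finally show ?thesis using inner(4) by simp
   qed
   ultimately show ?thesis using False v by (simp add: Some inner(1) target_inner[OF inner(2)] good_def)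
  qed
 qed
qed

lemma target_changes:
 assumes "enabled K (k, i, a) e" "target c K q \<alpha> D (k, i, a) e = (k', i', a')"
 shows "(k', i') \<noteq> (k, i)"
proof (cases e)
 case None
 then show ?thesis using assms nxt_bounds(4)[of k i] by (auto simp: enabled_None target_None)
next
 case (Some j)
 then have "j \<noteq> i" using assms by (simp add: enabled_Some)
 moreover have "i' = j" using assms(2) by (auto simp: Some target_def Let_def split: if_splits)
 ultimately show ?thesis by simp
qed

text \<open>The phase after the event tells it: \<open>Some j\<close> ends in \<open>j\<close>,
  different from the old phase, and \<open>None\<close> keeps the phase. A jump time thus belongs to
  one counting process.\<close>

lemma target_event_unique:
 assumes "enabled K y e" "enabled K y e'" "target c K q \<alpha> D y e = target c K q \<alpha> D y e'"
 shows "e = e'"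
proof -
 obtain k i a where y: "y = (k, i, a)" by (cases y)
 have ph: "fst (snd (target c K q \<alpha> D (k, i, a) (Some j))) = j" for j
  by (simp add: target_def Let_def)
 have ph0: "fst (snd (target c K q \<alpha> D (k, i, a) None)) = i" by (simp add: target_None)
 show ?thesis using assms ph ph0 unfolding y by (cases e; cases e') (metis enabled_Some)+
qed

lemma intensity_hat: "good y ==> intensity T c K q S y e = hat (lam e) y"
proof -
 assume y: "good y"
 show ?thesis
 proof (cases e)
  case (Some j)
  obtain k i a where ye: "y = (k, i, a)" by (cases y)
  have "hat (lam e) y = hat (\<lambda>_. if j \<noteq> i then T i j else 0) y"
   unfolding ye hat_def Some by (simp add: lam_def)
  then show ?thesis using hat_const[OF y] by (simp add: Some ye intensity_def enabled_def)
 next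
  case None
  from y show ?thesis
  proof (cases rule: good_cases)
   case (inner k i a)
   have "(\<Sum>n\<in>I. a n * lam None (k, i, n)) = \<bar>c i\<bar> * (\<Sum>n\<in>I. a n * s n)"
    using inner(2) by (simp add: lam_def hz_def sum_distrib_left mult_ac)
   then show ?thesis by (simp add: None inner(1) intensity_def enabled_None hat_inner[OF inner(2)] inner(2)[simplified] dot_def)
  qed (auto simp: None intensity_def enabled_def hat_outer lam_def hz_def)
 qed
qed

lemma lam_nonneg: "good y ==> 0 <= hat (lam e) y"
proof -
 assume y: "good y"
 show ?thesis
 proof (cases e)
  case (Some j)
  obtain k i a where ye: "y = (k, i, a)" by (cases y)
  have "hat (lam e) y = hat (\<lambda>_. if j \<noteq> i then T i j else 0) y"
   unfolding ye hat_def Some by (simp add: lam_def)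
  then show ?thesis using hat_const[OF y] T_off by simp
 next
  case None
  from y show ?thesis
  proof (cases rule: good_cases)
   case (inner k i a)
   then show ?thesis using pos_inner[OF pos_hz inner(2,3)] by (simp add: None hat_inner[OF inner(2)] lam_def)
  qed (auto simp: None hat_outer lam_def hz_def)
 qed
qed

definition drift :: "(nat \<times> 's \<times> nat => real) => 's qstate => real" where
 "drift w = (\<lambda>(k, i, a). \<Sum>n\<in>I. orbit_drift c K q S (k, i, a) n * w (k, i, n))"

lemma exit_dot: "dot I (vec_mat I a S) ones = - (\<Sum>n\<in>I. a n * s n)"
proof -
 have "dot I (vec_mat I a S) ones = (\<Sum>n\<in>I. \<Sum>m\<in>I. a m * S m n)" by (simp add: dot_def vec_mat_def ones_def)
 also have "\<dots> = (\<Sum>m\<in>I. a m * (\<Sum>n\<in>I. S m n))" by (subst sum.swap) (simp add: sum_distrib_left)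
 finally show ?thesis by (simp add: exit_vec_def mat_vec_def ones_def sum_negf)
qed

text \<open>Since the row sums to 0, subtracting a constant changes nothing, and the diagonal entry
  then meets a zero factor.\<close>

lemma sum_T_diff:
 assumes "V i = v"
 shows "(\<Sum>j\<in>UNIV. (if j \<noteq> i then T i j else 0) * (V j - v)) = (\<Sum>j\<in>UNIV. T i j * V j)"
proof -
 have "(\<Sum>j\<in>UNIV. (if j \<noteq> i then T i j else 0) * (V j - v)) = (\<Sum>j\<in>UNIV. T i j * (V j - v))"
  using assms by (intro sum.cong) auto
 then show ?thesis by (simp add: right_diff_distrib sum_subtractf sum_distrib_right[symmetric] T_sum)
qed

text \<open>The jumps compensate the nonlinear term of the drift, which leaves the linear generator.\<close>

lemma generator_identity:
 assumes y: "good y"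
 shows "hat (mat_vec idx B w) y = drift w y + (\<Sum>e\<in>UNIV. hat (lam e) y * hat (\<lambda>x. tw e w x - w x) y)"
proof -
 have opt: "(\<Sum>e\<in>UNIV. g e) = g None + (\<Sum>j\<in>UNIV. g (Some j))" for g :: "'s option => real"
  unfolding UNIV_option_conv by (simp add: sum.reindex)
 have lamS: "hat (lam (Some j)) (k, i, a) = (if j \<noteq> i then T i j else 0)" if "y = (k, i, a)" for k i a j
 proof -
  have "hat (lam (Some j)) y = hat (\<lambda>_. if j \<noteq> i then T i j else 0) y"
   unfolding that hat_def by (simp add: lam_def)
  then show ?thesis using hat_const[OF y] that by simp
 qed
 from y show ?thesis
 proof (cases rule: good_cases)
  case (bottom i)
  have "hat (mat_vec idx B w) y = (\<Sum>j\<in>UNIV. T i j * w (if c j < 0 then 0 else 1, j, 1))"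
   using bottom by (simp add: hat_outer B_bottom)
  also have "\<dots> = (\<Sum>j\<in>UNIV. (if j \<noteq> i then T i j else 0) * (w (if c j < 0 then 0 else 1, j, 1) - w (0, i, 1)))"
   by (rule sum_T_diff[symmetric]) (use bottom in simp)
  also have "\<dots> = (\<Sum>j\<in>UNIV. hat (lam (Some j)) y * hat (\<lambda>x. tw (Some j) w x - w x) y)"
   unfolding bottom(1) lamS[OF bottom(1)] by (intro sum.cong refl) (simp add: hat_outer tw_def)
  finally have "hat (mat_vec idx B w) y = (\<Sum>j\<in>UNIV. hat (lam (Some j)) y * hat (\<lambda>x. tw (Some j) w x - w x) y)" .
  moreover have "hat (lam None) (0, i, unit_vec 1) = 0" by (simp add: hat_outer lam_def hz_def)
  ultimately show ?thesis unfolding opt by (simp add: bottom drift_def orbit_drift_def)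
 next
  case (top i)
  have out: "K + 1 \<notin> levels" by simp
  have "hat (mat_vec idx B w) y = (\<Sum>j\<in>UNIV. T i j * w (if c j < 0 then K else K + 1, j, 1))"
   unfolding top(1) hat_outer[OF out] by (rule B_top[OF top(2)])
  also have "\<dots> = (\<Sum>j\<in>UNIV. (if j \<noteq> i then T i j else 0) * (w (if c j < 0 then K else K + 1, j, 1) - w (K + 1, i, 1)))"
   by (rule sum_T_diff[symmetric]) (use top in simp)
  also have "\<dots> = (\<Sum>j\<in>UNIV. hat (lam (Some j)) y * hat (\<lambda>x. tw (Some j) w x - w x) y)"
   unfolding top(1) hat_outer[OF out] by (intro sum.cong refl) (simp add: tw_def lam_def)
  finally show ?thesis unfolding opt top(1) hat_outer[OF out]
   by (simp add: drift_def orbit_drift_def lam_def hz_def)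
 next
  case (inner k i a)
  note k = inner(2)
  have k': "k \<noteq> 0" "k \<noteq> K + 1" using k by auto
  let ?s = "\<Sum>n\<in>I. a n * s n"
  let ?w = "\<Sum>n\<in>I. a n * w (k, i, n)"
  define V where "V = (\<lambda>j. \<Sum>n\<in>I. a n * (if sgn (c i) = sgn (c j) then w (k, j, n) else (\<Sum>m\<in>I. D n m * w (k, j, m))))"
  have hw: "hat w y = ?w" unfolding inner(1) by (rule hat_inner[OF k])
  have twN: "hat (tw None w) y = w (nxt k i, i, 1)"
   unfolding inner(1) hat_inner[OF k] using inner(4) by (simp add: tw_def sum_distrib_right[symmetric])
  have twS: "hat (tw (Some j) w) y = V j" for j
   unfolding inner(1) hat_inner[OF k] V_def using k' by (simp add: tw_def)
  have lamN: "hat (lam None) y = \<bar>c i\<bar> * ?s"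
   unfolding inner(1) hat_inner[OF k] using k by (simp add: lam_def hz_def sum_distrib_left mult_ac)
  have Vi: "V i = ?w" by (simp add: V_def)
  have "drift w y = (\<Sum>n\<in>I. \<bar>c i\<bar> * (vec_mat I a S n + ?s * a n) * w (k, i, n))"
   using k unfolding drift_def inner(1) prod.case by (intro sum.cong refl) (simp add: orbit_drift_def exit_dot)
  also have "\<dots> = \<bar>c i\<bar> * (\<Sum>n\<in>I. vec_mat I a S n * w (k, i, n)) + \<bar>c i\<bar> * ?s * ?w"
  proof -
   have "(\<Sum>n\<in>I. \<bar>c i\<bar> * (X n + z * a n) * w (k, i, n)) = \<bar>c i\<bar> * (\<Sum>n\<in>I. X n * w (k, i, n)) + \<bar>c i\<bar> * z * ?w" for X z
    by (simp add: distrib_left distrib_right sum.distrib sum_distrib_left mult_ac)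
   then show ?thesis .
  qed
  finally have dr: "drift w y = \<bar>c i\<bar> * (\<Sum>n\<in>I. a n * (\<Sum>m\<in>I. S n m * w (k, i, m))) + \<bar>c i\<bar> * ?s * ?w"
   unfolding vec_mat_dot .
  have dir: "(\<Sum>n\<in>I. a n * dirsum k i n w) = (\<Sum>j\<in>UNIV. T i j * V j)"
   unfolding dirsum_dot by (intro sum.cong refl) (simp add: V_def dval_def)
  have "hat (mat_vec idx B w) y = (\<Sum>n\<in>I. a n * (\<bar>c i\<bar> * (\<Sum>m\<in>I. S n m * w (k, i, m)) + \<bar>c i\<bar> * s n * w (nxt k i, i, 1) + dirsum k i n w))"
   unfolding inner(1) hat_inner[OF k] by (intro sum.cong refl) (simp only: B_inner[OF k])
  also have "\<dots> = \<bar>c i\<bar> * (\<Sum>n\<in>I. a n * (\<Sum>m\<in>I. S n m * w (k, i, m))) + \<bar>c i\<bar> * ?s * w (nxt k i, i, 1) + (\<Sum>n\<in>I. a n * dirsum k i n w)"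
  proof -
   have "(\<Sum>n\<in>I. a n * (\<bar>c i\<bar> * X n + \<bar>c i\<bar> * s n * z + Y n)) = \<bar>c i\<bar> * (\<Sum>n\<in>I. a n * X n) + \<bar>c i\<bar> * ?s * z + (\<Sum>n\<in>I. a n * Y n)" for X Y z
    by (simp add: distrib_left sum.distrib sum_distrib_left sum_distrib_right mult_ac)
   then show ?thesis .
  qed
  also have "(\<Sum>n\<in>I. a n * dirsum k i n w) = (\<Sum>j\<in>UNIV. (if j \<noteq> i then T i j else 0) * (V j - ?w))"
   unfolding dir by (rule sum_T_diff[where V = V, OF Vi, symmetric])
  also have "\<dots> = (\<Sum>j\<in>UNIV. hat (lam (Some j)) y * hat (\<lambda>x. tw (Some j) w x - w x) y)"
   unfolding hat_diff twS hw using lamS[OF inner(1)] inner(1) by (intro sum.cong refl) simp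
  finally show ?thesis unfolding opt hat_diff twN lamN hw dr by (simp add: algebra_simps)
 qed
qed

lemma hat_bounded:
 obtains C where "0 <= C" "!!w W y. good y ==> (!!x. x \<in> idx ==> \<bar>w x\<bar> <= W) ==> \<bar>hat w y\<bar> <= C * W"
proof -
 obtain C where C: "0 <= C" "!!w e. (!!x. x \<in> idx ==> \<bar>w x\<bar> <= e) ==> pos (\<lambda>x. C * e + w x)"
  using pos_small by blast
 show ?thesis
 proof (rule that[OF C(1)])
  fix w W y assume y: "good y" and w: "!!x. x \<in> idx ==> \<bar>w x\<bar> <= (W::real)"
  have hp: "0 <= hat v y" if "pos v" for v
   using y
  proof (cases rule: good_cases)
   case (top i)
   then show ?thesis using that unfolding top(1) by (subst hat_outer) (auto simp: pos_def)
  next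
   case (inner k i a)
   then show ?thesis using pos_inner[OF that inner(2,3)] by (simp add: hat_inner[OF inner(2)])
  qed (use that in \<open>auto simp: hat_outer pos_def\<close>)
  have "0 <= hat (\<lambda>x. C * W - w x) y" using hp[OF C(2)[of "\<lambda>x. - w x" W]] w by simp
  moreover have "0 <= hat (\<lambda>x. C * W - (- w x)) y" using hp[OF C(2)[of w W]] w by simp
  moreover have "hat (\<lambda>x. - w x) y = - hat w y" using hat_diff[of "\<lambda>_. 0" w y] hat_const[OF y, of 0] by simp
  ultimately show "\<bar>hat w y\<bar> <= C * W" unfolding hat_diff hat_const[OF y] by simp
 qed
qed

text \<open>Orbits vanish outside their valid positions and a boundary orbit is the scalar 1, so the
  sum over all indices has only the terms of the present level and phase.\<close>

lemma hat_idx_sum: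
 assumes "good (l, j, a)"
 shows "(\<Sum>(l', j', n)\<in>idx. a n * of_bool (l = l' \<and> j = j') * w (l', j', n)) = hat w (l, j, a)"
 using assms
proof (cases rule: good_cases)
 case (bottom i)
 have "(\<Sum>(l', j', n)\<in>idx. a n * of_bool (l = l' \<and> j = j') * w (l', j', n))
  = (\<Sum>x\<in>idx. mat_one (0, j, 1) x * w x)"
  using bottom by (intro sum.cong refl) (auto simp: unit_vec_def mat_one_def qbd_index_def)
 then show ?thesis using bottom sum_mat_one_left[OF finite_idx idx_bottom[of j]] by (simp add: hat_outer)
next
 case (top i)
 have "(\<Sum>(l', j', n)\<in>idx. a n * of_bool (l = l' \<and> j = j') * w (l', j', n))
  = (\<Sum>x\<in>idx. mat_one (K + 1, j, 1) x * w x)"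
  using top by (intro sum.cong refl) (auto simp: unit_vec_def mat_one_def qbd_index_def)
 then show ?thesis using top sum_mat_one_left[OF finite_idx idx_top[of j], of w] by (simp add: hat_def)
next
 case (inner k i a')
 have "(\<Sum>(l', j', n)\<in>idx. a n * of_bool (l = l' \<and> j = j') * w (l', j', n))
  = (\<Sum>x\<in>idx. (case x of (l', j', n) => if l' = l \<and> j' = j then a n * w (l, j, n) else 0))"
  by (intro sum.cong refl) auto
 also have "\<dots> = (\<Sum>n\<in>I. a n * w (l, j, n))"
  by (rule block_inner) (use inner in auto)
 finally show ?thesis using inner by (simp add: hat_inner)
qed

end

section \<open>Step approximations of left limits\<close>

text \<open>Each interval, open on the left and closed on the right, carries the value at its left
  end. Such integrands are known at the start of the interval, and under refinement they converge to
  left limits.\<close>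

definition step_at :: "real => real => nat => (real => real) => real => real" where
 "step_at u h m f r = (\<Sum>l<m. f (u + real l * h) * indicator {u + real l * h<..u + real (Suc l) * h} r)"

abbreviation part :: "real => real => nat => nat => real" where
 "part u t m l \<equiv> u + real l * ((t - u) / real m)"

lemma step_at_eq:
 assumes h: "0 < h" and r: "u < r" "r <= u + real m * h"
 obtains l where "l < m" "u + real l * h < r" "r <= u + real (Suc l) * h" "step_at u h m f r = f (u + real l * h)"
proof -
 define l where "l = nat (\<lceil>(r - u) / h\<rceil> - 1)"
 have pos: "0 < (r - u) / h" using h r by simp
 then have "1 <= \<lceil>(r - u) / h\<rceil>" by (simp add: one_le_ceiling)
 then have l: "real l = of_int \<lceil>(r - u) / h\<rceil> - 1" by (simp add: l_def)
 have "real l < (r - u) / h" "(r - u) / h <= real l + 1"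
  unfolding l using ceiling_correct[of "(r - u) / h"] by linarith+
 then have lr: "u + real l * h < r" "r <= u + real (Suc l) * h"
  using h by (simp_all add: field_simps)
 have "real l * h < real m * h" using lr r by linarith
 then have lm: "l < m" using h by simp
 have uniq: "k = l" if "u + real k * h < r" "r <= u + real (Suc k) * h" for k
 proof -
  have "real k * h < real (Suc l) * h" "real l * h < real (Suc k) * h" using that lr by linarith+
  then have "real k < real (Suc l)" "real l < real (Suc k)"
   using h by (metis mult_less_cancel_right_pos)+
  then show ?thesis by simp
 qed
 have "step_at u h m f r = (\<Sum>k<m. if k = l then f (u + real l * h) else 0)"
  unfolding step_at_def
 proof (intro sum.cong refl)
  fix k
  show "f (u + real k * h) * indicator {u + real k * h<..u + real (Suc k) * h} r = (if k = l then f (u + real l * h) else 0)"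
  proof (cases "k = l")
   case True
   have "r \<in> {u + real l * h<..u + real (Suc l) * h}" using lr by (simp only: greaterThanAtMost_iff)
   then show ?thesis unfolding True by (simp only: indicator_simps if_True refl mult_1_right)
  next
   case False
   then have "r \<notin> {u + real k * h<..u + real (Suc k) * h}" using uniq by (simp only: greaterThanAtMost_iff) blast
   then show ?thesis using False by (simp only: indicator_simps not_False_eq_True if_False mult_zero_right)
  qed
 qed
 also have "\<dots> = f (u + real l * h)" using lm by (simp add: sum.delta)
 finally show ?thesis using that[OF lm lr] by simp
qed

text \<open>The left end of the interval containing \<open>r\<close> is strictly below
  \<open>r\<close> and tends to \<open>r\<close>, which is why the left limit appears, also at a
  jump.\<close>

lemma step_at_tendsto:
 assumes t: "u < t" and r: "u < r" "r <= t" and f: "(f \<longlongrightarrow> y) (at_left r)"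
 shows "(\<lambda>m. step_at u ((t - u) / real m) m f r) \<longlonglongrightarrow> y"
proof (rule tendstoI)
 fix e :: real assume "0 < e"
 with f have "eventually (\<lambda>x. dist (f x) y < e) (at_left r)" by (rule tendstoD)
 then obtain d where d: "d < r" "!!x. d < x ==> x < r ==> dist (f x) y < e"
  unfolding eventually_at_left_field by auto
 have "(\<lambda>m. (t - u) / real m) \<longlonglongrightarrow> 0" by (rule lim_const_over_n)
 then have "eventually (\<lambda>m. (t - u) / real m < r - d) sequentially" by (rule order_tendstoD) (use d in simp)
 then show "eventually (\<lambda>m. dist (step_at u ((t - u) / real m) m f r) y < e) sequentially"
  using eventually_gt_at_top[of "0::nat"]
 proof eventually_elim
  case (elim m)
  let ?h = "(t - u) / real m"
  have h: "0 < ?h" "real m * ?h = t - u" using t elim by auto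
  then have "r <= u + real m * ?h" using r by simp
  from step_at_eq[OF h(1) r(1) this, of f] obtain l where l: "l < m" "u + real l * ?h < r" "r <= u + real (Suc l) * ?h"
   "step_at u ?h m f r = f (u + real l * ?h)" .
  have "u + real (Suc l) * ?h = u + real l * ?h + ?h" by (simp only: of_nat_Suc distrib_right mult_1_left add_ac)
  then have "d < u + real l * ?h" using l(3) elim by linarith
  then show ?case using d(2) l(2,4) by simp
 qed
qed

lemma step_at_bounded:
 assumes h: "0 < h" and r: "u < r" "r <= u + real m * h"
  and f: "!!x. u <= x ==> x <= u + real m * h ==> \<bar>f x\<bar> <= C"
 shows "\<bar>step_at u h m f r\<bar> <= C"
proof -
 from step_at_eq[OF h r, of f] obtain l where l: "l < m" "u + real l * h < r" "step_at u h m f r = f (u + real l * h)" by metis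
 then show ?thesis using f[of "u + real l * h"] h r by simp
qed

lemma step_at_borel [measurable]: "step_at u h m f \<in> borel_measurable borel"
 unfolding step_at_def[abs_def] by measurable

text \<open>Values of columns along a path are bounded and continuous off the finitely many events.
  Both integrals are provided: the Lebesgue integral for expectations, the gauge integral for
  differentiation in the upper end.\<close>

lemma regular_integrable:
 fixes f :: "real => real"
 assumes C: "!!r. u <= r ==> r <= t ==> \<bar>f r\<bar> <= C" and X: "finite X"
  and cont: "!!r. u < r ==> r < t ==> r \<notin> X ==> isCont f r"
 shows "set_integrable lborel {u<..t} f"
  and "f integrable_on {u..t}" "integral {u..t} f = (LINT r:{u<..t}|lborel. f r)"
  and "set_borel_measurable lborel {u<..t} f"
proof -
 let ?g = "\<lambda>r. indicator {u<..<t} r * f r"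
 have "continuous_on (- (X \<union> {u, t})) ?g"
 proof (rule continuous_at_imp_continuous_on, intro ballI)
  fix r assume r: "r \<in> - (X \<union> {u, t})"
  show "isCont ?g r"
  proof (cases "u < r \<and> r < t")
   case True
   then have "eventually (\<lambda>x. x \<in> {u<..<t}) (nhds r)" by (intro eventually_nhds_in_open) auto
   then have "eventually (\<lambda>x. ?g x = f x) (nhds r)" by eventually_elim simp
   then have "isCont ?g r = isCont f r" by (rule isCont_cong)
   then show ?thesis using cont[of r] True r by simp
  next
   case False
   then have "r \<in> - {u..t}" using r by auto
   then have "eventually (\<lambda>x. x \<in> - {u..t}) (nhds r)" by (intro eventually_nhds_in_open) auto
   then have "eventually (\<lambda>x. ?g x = 0) (nhds r)" by eventually_elim (auto simp: indicator_def)
   then have "isCont ?g r = isCont (\<lambda>_. 0 :: real) r" by (rule isCont_cong)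
   then show ?thesis by simp
  qed
 qed
 then have [measurable]: "?g \<in> borel_measurable borel"
  by (rule borel_measurable_continuous_countable_exceptions[rotated]) (use X in \<open>simp add: countable_finite\<close>)
 have eq: "indicator {u<..t} r *\<^sub>R f r = ?g r + indicator {u<..t} r * (indicator {t} r * f t)" for r
  by (auto simp: indicator_def)
 show meas: "set_borel_measurable lborel {u<..t} f"
  unfolding set_borel_measurable_def eq by measurable
 have bd: "\<bar>indicator {u<..t} r *\<^sub>R f r\<bar> <= indicator {u..t} r * \<bar>C\<bar>" for r
  using C[of r] by (auto simp: indicator_def)
 have i1: "integrable lborel (\<lambda>r. indicator {u..t} r * \<bar>C\<bar>)"
  by (intro integrable_mult_left integrable_real_indicator) (auto simp: emeasure_lborel_Icc_eq)
 show int: "set_integrable lborel {u<..t} f"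
  unfolding set_integrable_def
  by (rule Bochner_Integration.integrable_bound[OF i1]) (use meas bd in \<open>auto simp: set_borel_measurable_def\<close>)
 have "(f has_integral (LINT r:{u<..t}|lborel. f r)) {u<..t}"
  unfolding has_integral_iff using set_borel_integral_eq_integral[OF int] by simp
 then have "(f has_integral (LINT r:{u<..t}|lborel. f r)) {u..t}"
 proof (rule has_integral_spike_set_eq[THEN iffD1, rotated 2])
  show "negligible {x \<in> {u<..t} - {u..t}. f x \<noteq> 0}" "negligible {x \<in> {u..t} - {u<..t}. f x \<noteq> 0}"
   by (rule negligible_subset[of "{u}"]; auto)+
 qed
 then show "f integrable_on {u..t}" "integral {u..t} f = (LINT r:{u<..t}|lborel. f r)"
  by (auto simp: has_integral_integrable integral_unique)
qed

lemma step_at_integral_sum: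
 fixes f g :: "real => real"
 assumes t: "u < t" and m: "0 < m" and g: "set_integrable lborel {u<..t} g"
 shows "(LINT r:{u<..t}|lborel. step_at u ((t - u) / real m) m f r * g r)
  = (\<Sum>l<m. f (part u t m l) *
   (LINT r:{part u t m l<..part u t m (Suc l)}|lborel. g r))"
proof -
 let ?h = "(t - u) / real m"
 have h: "0 < ?h" "u + real m * ?h = t" using t m by auto
 have sub: "{u + real l * ?h<..u + real (Suc l) * ?h} \<subseteq> {u<..t}" if "l < m" for l
 proof -
  have "real (Suc l) * ?h <= real m * ?h" using that h by (intro mult_right_mono) auto
  moreover have "0 <= real l * ?h" by (rule mult_nonneg_nonneg[OF of_nat_0_le_iff less_imp_le[OF h(1)]])
  ultimately show ?thesis using h(2) by auto
 qed
 have int: "set_integrable lborel {u + real l * ?h<..u + real (Suc l) * ?h} g" if "l < m" for l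
  by (rule set_integrable_subset[OF g _ sub[OF that]]) simp
 have "(LINT r:{u<..t}|lborel. step_at u (?h) m f r * g r)
  = (\<integral>r. (\<Sum>l<m. f (u + real l * ?h) * (indicator {u + real l * ?h<..u + real (Suc l) * ?h} r *\<^sub>R g r)) \<partial>lborel)"
  unfolding set_lebesgue_integral_def
 proof (rule Bochner_Integration.integral_cong[OF refl])
  fix r
  have "indicator {u<..t} r * (f (u + real l * ?h) * indicator {u + real l * ?h<..u + real (Suc l) * ?h} r * g r)
   = f (u + real l * ?h) * (indicator {u + real l * ?h<..u + real (Suc l) * ?h} r * g r)" if "l \<in> {..<m}" for l
   using sub[of l] that by (auto simp: indicator_def)
  then show "indicator {u<..t} r *\<^sub>R (step_at u ?h m f r * g r)
   = (\<Sum>l<m. f (u + real l * ?h) * (indicator {u + real l * ?h<..u + real (Suc l) * ?h} r *\<^sub>R g r))"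
   unfolding step_at_def real_scaleR_def sum_distrib_right sum_distrib_left by (intro sum.cong refl)
 qed
 also have "\<dots> = (\<Sum>l<m. \<integral>r. f (u + real l * ?h) * (indicator {u + real l * ?h<..u + real (Suc l) * ?h} r *\<^sub>R g r) \<partial>lborel)"
  by (rule Bochner_Integration.integral_sum) (use int in \<open>auto simp: set_integrable_def\<close>)
 finally show ?thesis by (simp add: set_lebesgue_integral_def)
qed

lemma step_at_integral:
 fixes f g :: "real => real"
 assumes t: "u < t" and X: "finite X"
  and f: "!!r. u <= r ==> r <= t ==> \<bar>f r\<bar> <= C" "!!r. u < r ==> r < t ==> r \<notin> X ==> isCont f r"
  and g: "!!r. u <= r ==> r <= t ==> \<bar>g r\<bar> <= C'" "!!r. u < r ==> r < t ==> r \<notin> X ==> isCont g r"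
 shows "(\<lambda>m. \<Sum>l<m. f (part u t m l) *
   (LINT r:{part u t m l<..part u t m (Suc l)}|lborel. g r))
  \<longlonglongrightarrow> (LINT r:{u<..t}|lborel. f r * g r)"
proof -
 let ?h = "\<lambda>m. (t - u) / real m"
 note g_int = regular_integrable(1,4)[OF g(1) X g(2)]
 have fg_meas: "set_borel_measurable lborel {u<..t} (\<lambda>r. f r * g r)"
 proof (rule regular_integrable(4)[OF _ X])
  show "\<bar>f r * g r\<bar> <= C * C'" if "u <= r" "r <= t" for r
   unfolding abs_mult using f(1)[OF that] g(1)[OF that] by (intro mult_mono) auto
  show "isCont (\<lambda>r. f r * g r) r" if "u < r" "r < t" "r \<notin> X" for r
   using f(2) g(2) that by (intro isCont_mult) auto
 qed
 have C: "0 <= C" using f(1)[of u] t by (auto intro: order_trans[OF abs_ge_zero])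
 have "(\<lambda>m. LINT r:{u<..t}|lborel. step_at u (?h m) m f r * g r) \<longlonglongrightarrow> (LINT r:{u<..t}|lborel. f r * g r)"
  unfolding set_lebesgue_integral_def
 proof (rule integral_dominated_convergence[where w = "\<lambda>r. C * (indicator {u<..t} r * \<bar>g r\<bar>)"])
  show "(\<lambda>r. indicator {u<..t} r *\<^sub>R (f r * g r)) \<in> borel_measurable lborel"
   using fg_meas by (simp add: set_borel_measurable_def)
  show "(\<lambda>r. indicator {u<..t} r *\<^sub>R (step_at u (?h m) m f r * g r)) \<in> borel_measurable lborel" for m
  proof -
   have "(\<lambda>r. step_at u (?h m) m f r * (indicator {u<..t} r *\<^sub>R g r)) \<in> borel_measurable lborel"
    using g_int(2) by (intro borel_measurable_times) (auto simp: set_borel_measurable_def)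
   then show ?thesis by (simp add: mult_ac)
  qed
  show "integrable lborel (\<lambda>r. C * (indicator {u<..t} r * \<bar>g r\<bar>))"
   using set_integrable_abs[OF g_int(1)] by (simp add: set_integrable_def)
  show "AE r in lborel. (\<lambda>m. indicator {u<..t} r *\<^sub>R (step_at u (?h m) m f r * g r)) \<longlonglongrightarrow> indicator {u<..t} r *\<^sub>R (f r * g r)"
  proof -
   have "AE r in lborel. r \<notin> insert t X"
    by (rule AE_not_in[OF finite_imp_null_set_lborel]) (use X in simp)
   then show ?thesis
   proof eventually_elim
    case (elim r)
    show ?case
    proof (cases "u < r \<and> r < t")
     case True
     then have "(f \<longlongrightarrow> f r) (at_left r)" using f(2)[of r] elim
      by (auto simp: isCont_def filterlim_at_split)
     then show ?thesis using True t by (intro tendsto_intros step_at_tendsto) auto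
    qed (use elim in \<open>auto simp: indicator_def\<close>)
   qed
  qed
  show "AE r in lborel. norm (indicator {u<..t} r *\<^sub>R (step_at u (?h m) m f r * g r)) <= C * (indicator {u<..t} r * \<bar>g r\<bar>)" for m
  proof (rule AE_I2)
   fix r
   show "norm (indicator {u<..t} r *\<^sub>R (step_at u (?h m) m f r * g r)) <= C * (indicator {u<..t} r * \<bar>g r\<bar>)"
   proof (cases "m = 0")
    case True
    then show ?thesis using C by (simp add: step_at_def)
   next
    case False
    then have h: "0 < ?h m" "u + real m * ?h m = t" using t by auto
    show ?thesis
    proof (cases "u < r \<and> r <= t")
     case True
     have "\<bar>step_at u (?h m) m f r\<bar> <= C"
     proof (rule step_at_bounded[OF h(1)])
      show "u < r" "r <= u + real m * ?h m" using True unfolding h(2) by simp_all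
      show "\<bar>f x\<bar> <= C" if "u <= x" "x <= u + real m * ?h m" for x
       using that unfolding h(2) by (rule f(1))
     qed
     then show ?thesis using True by (simp add: abs_mult mult_right_mono)
    qed (auto simp: indicator_def)
   qed
  qed
 qed
 moreover have "(LINT r:{u<..t}|lborel. step_at u (?h m) m f r * g r)
  = (\<Sum>l<m. f (u + real l * ?h m) * (LINT r:{u + real l * ?h m<..u + real (Suc l) * ?h m}|lborel. g r))" for m
 proof (cases "m = 0")
  case True
  then show ?thesis by (simp add: step_at_def set_lebesgue_integral_def)
 next
  case False
  then show ?thesis by (intro step_at_integral_sum[OF t _ g_int(1)]) simp
 qed
 ultimately show ?thesis by simp
qed

lemma right_deriv_integral:
 fixes f :: "real => real"
 assumes f: "f integrable_on {u..t}" and r: "u <= r" "r < t" and cont: "(f \<longlongrightarrow> f r) (at_right r)"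
 shows "((\<lambda>x. integral {u..x} f) has_real_derivative f r) (at r within {r..})"
proof -
 have fr: "f integrable_on {r..t}" by (rule integrable_on_subinterval[OF f]) (use r in auto)
 have "((\<lambda>x. integral {r..x} f) has_vector_derivative f r) (at r within ({r..t} - {}))"
  by (rule integral_has_vector_derivative_continuous_at[OF fr])
    (use r cont in \<open>auto simp: continuous_within at_within_Icc_at_right\<close>)
 then have "((\<lambda>x. integral {r..x} f) has_real_derivative f r) (at_right r)"
  using r by (simp add: at_within_Icc_at_right has_real_derivative_iff_has_vector_derivative)
 then have "((\<lambda>x. integral {u..r} f + integral {r..x} f) has_real_derivative f r) (at_right r)"
  by (auto intro!: derivative_eq_intros)
 moreover have "eventually (\<lambda>x. integral {u..r} f + integral {r..x} f = integral {u..x} f) (at_right r)"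
  using eventually_at_right_real[OF r(2)]
 proof eventually_elim
  case (elim x)
  show ?case by (rule Henstock_Kurzweil_Integration.integral_combine) (use elim r in \<open>auto intro: integrable_on_subinterval[OF f]\<close>)
 qed
 ultimately have "((\<lambda>x. integral {u..x} f) has_real_derivative f r) (at_right r)"
  by (subst (asm) has_field_derivative_cong_eventually) auto
 then show ?thesis by (simp add: at_within_Ici_at_right)
qed

lemma cadlag_stepD:
 assumes "cadlag_step f"
 shows "0 <= t ==> \<exists>h>0. \<forall>u\<in>{t..<t + h}. f u = f t"
  and "0 < t ==> \<exists>h>0. \<exists>a. \<forall>u\<in>{t - h<..<t}. f u = a"
 using assms by (simp_all add: cadlag_step_def)

lemma cadlag_step_Pair:
 assumes "cadlag_step f" "cadlag_step g" shows "cadlag_step (\<lambda>t. (f t, g t))"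
 unfolding cadlag_step_def
proof (intro conjI allI impI)
 fix t :: real
 { assume t: "0 <= t"
  obtain h where h: "h > 0" "\<forall>u\<in>{t..<t + h}. f u = f t" using cadlag_stepD(1)[OF assms(1) t] by blast
  obtain h' where h': "h' > 0" "\<forall>u\<in>{t..<t + h'}. g u = g t" using cadlag_stepD(1)[OF assms(2) t] by blast
  have "(f u, g u) = (f t, g t)" if "u \<in> {t..<t + min h h'}" for u
  proof -
   have "u \<in> {t..<t + h}" "u \<in> {t..<t + h'}" using that by (auto simp: min_def split: if_splits)
   then show ?thesis using h(2) h'(2) by blast
  qed
  moreover have "0 < min h h'" using h h' by simp
  ultimately show "\<exists>h>0. \<forall>u\<in>{t..<t + h}. (f u, g u) = (f t, g t)" by blast }
 { assume t: "0 < t"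
  obtain h x where h: "h > 0" "\<forall>u\<in>{t - h<..<t}. f u = x" using cadlag_stepD(2)[OF assms(1) t] by blast
  obtain h' y where h': "h' > 0" "\<forall>u\<in>{t - h'<..<t}. g u = y" using cadlag_stepD(2)[OF assms(2) t] by blast
  have "(f u, g u) = (x, y)" if "u \<in> {t - min h h'<..<t}" for u
  proof -
   have "u \<in> {t - h<..<t}" "u \<in> {t - h'<..<t}" using that by (auto simp: min_def split: if_splits)
   then show ?thesis using h(2) h'(2) by blast
  qed
  moreover have "0 < min h h'" using h h' by simp
  ultimately show "\<exists>h>0. \<exists>a. \<forall>u\<in>{t - h<..<t}. (f u, g u) = a" by blast }
qed

section \<open>Paths of the QBD-RAP\<close>

locale scheme_path = qbd_scheme Q Z \<Delta> \<epsilon> q \<alpha> S \<tau> T c b K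
 for Q :: "'z measure" and Z \<Delta> \<epsilon> q \<alpha> S \<tau> and T :: "'s::finite => 's => real" and c b K +
 fixes Y :: "real => 's qstate"
 assumes path: "qbd_path c K q \<alpha> S D Y" and good_0: "good (Y 0)"
begin

abbreviation "lv u \<equiv> fst (Y u)"
abbreviation "ph u \<equiv> fst (snd (Y u))"
abbreviation "ob u \<equiv> snd (snd (Y u))"
abbreviation "occ \<equiv> occurs c K q \<alpha> D Y"
abbreviation "gp \<equiv> (\<lambda>u. (lv u, ph u))"
abbreviation "tgt \<equiv> target c K q \<alpha> D"

definition evs :: "real => real set" where "evs t = {u\<in>{0<..t}. \<exists>e. occ e u}"

lemma valid: "0 <= u ==> valid_state c K q (Y u)"
 and cadlag_gp: "cadlag_step gp"
 and ob_deriv: "0 <= u ==> ((\<lambda>u. ob u n) has_real_derivative orbit_drift c K q S (Y u) n) (at u within {u..})"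
 and left_or_occ: "0 < u ==> left_state Y u (Y u) \<or> (\<exists>e. occ e u)"
 using path unfolding qbd_path_def by (auto intro: cadlag_step_Pair)

lemma left_state_lim: "left_state Y u (k, i, a) ==> ((\<lambda>u. ob u n) \<longlongrightarrow> a n) (at_left u)"
 by (simp add: left_state_def)

lemma left_state_near: "left_state Y u (k, i, a) ==> eventually (\<lambda>x. lv x = k \<and> ph x = i) (at_left u)"
proof -
 assume "left_state Y u (k, i, a)"
 then obtain h where "h > 0" "\<forall>x\<in>{u - h<..<u}. lv x = k \<and> ph x = i" by (auto simp: left_state_def)
 then show ?thesis unfolding eventually_at_left_field by (intro exI[of _ "u - h"]) auto
qed

lemma left_state_unique:
 assumes "left_state Y u y" "left_state Y u y'" shows "y = y'"
proof -
 obtain k i a where y: "y = (k, i, a)" by (cases y)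
 obtain k' i' a' where y': "y' = (k', i', a')" by (cases y')
 have "eventually (\<lambda>x. k = k' \<and> i = i') (at_left u)"
  using left_state_near[OF assms(1)[unfolded y]] left_state_near[OF assms(2)[unfolded y']] by eventually_elim auto
 then have "k = k' \<and> i = i'" by simp
 moreover have "a = a'"
 proof
  fix n show "a n = a' n"
   using tendsto_unique[OF _ left_state_lim[OF assms(1)[unfolded y]] left_state_lim[OF assms(2)[unfolded y']]] by simp
 qed
 ultimately show ?thesis by (simp add: y y')
qed

lemma left_exists: "0 < u ==> \<exists>y. left_state Y u y"
 using left_or_occ[of u] unfolding occurs_def by blast

text \<open>Every enabled event changes the pair of level and phase, so an event time is a jump of a
  step path; finiteness follows.\<close>

lemma occ_jump: "u \<in> evs t ==> u \<in> jumps gp t"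
proof -
 assume u: "u \<in> evs t"
 then obtain e y where y: "left_state Y u y" "enabled K y e" "Y u = tgt y e" and u0: "0 < u" "u <= t"
  by (auto simp: evs_def occurs_def)
 obtain k i a where ye: "y = (k, i, a)" by (cases y)
 have "(lv u, ph u) \<noteq> (k, i)"
  using target_changes[of k i a e "lv u" "ph u" "ob u"] y by (simp add: ye)
 moreover have "(lv u, ph u) = (k, i)" if "h > 0" "\<forall>r\<in>{u - h<..<u}. gp r = gp u" for h
 proof -
  have "eventually (\<lambda>x. gp x = gp u) (at_left u)"
   unfolding eventually_at_left_field using that by (intro exI[of _ "u - h"]) auto
  then have "eventually (\<lambda>x. (lv u, ph u) = (k, i)) (at_left u)"
   using left_state_near[OF y(1)[unfolded ye]] by eventually_elim auto
  then show ?thesis by simp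
 qed
 ultimately have "\<not> (\<exists>h>0. \<forall>r\<in>{u - h<..<u}. gp r = gp u)" by metis
 then show ?thesis using u0 by (simp add: jumps_def)
qed

lemma finite_evs: "finite (evs t)"
 using cadlag_step_finite_jumps[OF cadlag_gp, of t] occ_jump
 by (auto intro!: finite_subset[of "evs t" "jumps gp t"] simp: jumps_def)

lemma occ_left_state: "0 < u ==> \<not> (\<exists>e. occ e u) ==> left_state Y u (Y u)"
 using left_or_occ by blast

lemma gp_const:
 assumes "0 <= u" "!!x. u < x ==> x < v ==> \<not> (\<exists>e. occ e x)" "x \<in> {u..<v}"
 shows "gp x = gp u"
proof (rule cadlag_step_const[OF cadlag_gp assms(1) _ assms(3)])
 fix z assume z: "u < z" "z < v"
 then have "left_state Y z (Y z)" using assms by (intro occ_left_state) auto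
 then show "\<exists>h>0. \<forall>r\<in>{z - h<..<z}. gp r = gp z"
  by (cases "Y z") (auto simp: left_state_def)
qed

lemma ob_right: "0 <= u ==> ((\<lambda>x. ob x n) \<longlongrightarrow> ob u n) (at_right u)"
 using DERIV_continuous[OF ob_deriv[of u n]] by (simp add: continuous_within at_within_Ici_at_right)

lemma ob_cont:
 assumes "0 <= u" "u <= x" "!!z. u < z ==> z <= x ==> \<not> (\<exists>e. occ e z)"
 shows "continuous_on {u..x} (\<lambda>z. ob z n)"
proof (cases "u < x")
 case True
 have left: "((\<lambda>x. ob x n) \<longlongrightarrow> ob z n) (at_left z)" if "u < z" "z <= x" for z
 proof -
  have "left_state Y z (Y z)" by (rule occ_left_state) (use assms(1) assms(3)[OF that] that(1) in simp_all)
  then show ?thesis using left_state_lim[of z "lv z" "ph z" "ob z" n] by simp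
 qed
 show ?thesis
 proof (rule continuous_on_IccI[OF _ _ _ True])
  show "((\<lambda>x. ob x n) \<longlongrightarrow> ob u n) (at_right u)" by (rule ob_right[OF assms(1)])
  show "((\<lambda>x. ob x n) \<longlongrightarrow> ob x n) (at_left x)" by (rule left[OF True order_refl])
  show "(\<lambda>x. ob x n) \<midarrow>z\<rightarrow> ob z n" if "u < z" "z < x" for z
   using left[of z] ob_right[of z n] that assms(1) by (simp add: filterlim_at_split)
 qed
next
 case False
 then have "x = u" using assms(2) by simp
 then show ?thesis by (simp only: atLeastAtMost_singleton continuous_on_sing)
qed

text \<open>Between events the orbit is proportional to the solution of a linear equation, so it stays
 in the cone.\<close>

lemma good_regime:
 assumes u: "0 <= u" "u <= x" and no: "!!z. u < z ==> z <= x ==> \<not> (\<exists>e. occ e z)"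
  and g: "good (Y u)"
 shows "good (Y x)"
proof (cases "u = x")
 case True
 then show ?thesis using g by simp
next
 case False
 then have ux: "u < x" using u by simp
 have gpc: "gp z = gp u" if "z \<in> {u..x}" for z
 proof (cases "z = x")
  case False
  then show ?thesis using gp_const[of u x z] no u that by auto
 next
  case True
  have "left_state Y x (Y x)" using no[of x] ux u by (intro occ_left_state) auto
  then have "eventually (\<lambda>z. lv z = lv x \<and> ph z = ph x) (at_left x)"
   using left_state_near[of x "lv x" "ph x" "ob x"] by simp
  moreover have "eventually (\<lambda>z. z \<in> {u<..<x}) (at_left x)" by (rule eventually_at_left_real[OF ux])
  ultimately have "eventually (\<lambda>z. gp x = gp u) (at_left x)"
  proof eventually_elim
   case (elim z)
   then show ?case using gp_const[of u x z] no u by auto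
  qed
  then show ?thesis using True by simp
 qed
 obtain k i a where yu: "Y u = (k, i, a)" by (cases "Y u")
 have Yz: "Y z = (k, i, ob z)" if "z \<in> {u..x}" for z
  using gpc[OF that] yu by (cases "Y z") simp
 have Yx: "(k, i, ob x) = Y x" by (rule Yz[symmetric]) (use u in simp)
 have valx: "valid_state c K q (k, i, ob x)" unfolding Yx by (rule valid) (use u in simp)
 show ?thesis
 proof (cases "k \<in> levels")
  case False
  then have "good (k, i, ob x)" using valx by (auto simp: good_def)
  then show ?thesis unfolding Yx .
 next
  case k: True
  let ?c = "\<bar>c i\<bar>"
  \<comment> \<open>The factor of the nonlinear term of the drift; \<open>\<mu>\<close> below is its
    integrating factor.\<close>
  define ll where "ll = (\<lambda>z. ?c * dot I (vec_mat I (ob z) S) ones)"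
  have contob: "continuous_on {u..x} (\<lambda>z. ob z n)" for n by (rule ob_cont[OF u no])
  have contll: "continuous_on {u..x} ll"
   unfolding ll_def dot_def vec_mat_def by (intro continuous_intros contob)
  have llint: "ll integrable_on {u..x}" by (rule integrable_continuous_interval[OF contll])
  define \<mu> where "\<mu> = (\<lambda>z. exp (integral {u..z} ll))"
  have cont\<mu>: "continuous_on {u..x} \<mu>"
   unfolding \<mu>_def by (intro continuous_on_exp indefinite_integral_continuous_1 llint)
  have dint: "((\<lambda>z. integral {u..z} ll) has_real_derivative ll z) (at z within {z..})" if "u <= z" "z < x" for z
  proof (rule right_deriv_integral[OF llint that])
   have "continuous_on {z..x} ll" by (rule continuous_on_subset[OF contll]) (use that in auto)
   then show "(ll \<longlongrightarrow> ll z) (at_right z)" using that(2)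
    by (simp add: continuous_on_Icc_at_rightD)
  qed
  have d\<mu>: "(\<mu> has_real_derivative \<mu> z * ll z) (at z within {z..})" if "u <= z" "z < x" for z
   unfolding \<mu>_def by (rule DERIV_chain2[OF DERIV_exp dint[OF that]])
  have dob: "((\<lambda>z. ob z n) has_real_derivative ?c * vec_mat I (ob z) S n - ll z * ob z n) (at z within {z..})"
   if "u <= z" "z < x" "n \<in> I" for z n
  proof -
   have Yzz: "(k, i, ob z) = Y z" by (rule Yz[symmetric]) (use that in simp)
   have "orbit_drift c K q S (k, i, ob z) n = ?c * vec_mat I (ob z) S n - ll z * ob z n"
    using that(3) k by (simp add: orbit_drift_def ll_def algebra_simps)
   then have "orbit_drift c K q S (Y z) n = ?c * vec_mat I (ob z) S n - ll z * ob z n" unfolding Yzz .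
   moreover have "0 <= z" using u that by linarith
   ultimately show ?thesis using ob_deriv[of z n] by (simp only:)
  qed
  define \<sigma> where "\<sigma> = (\<lambda>z. \<Sum>n\<in>I. ob z n)"
  have d\<sigma>: "(\<sigma> has_real_derivative ll z - ll z * \<sigma> z) (at z within {z..})" if "u <= z" "z < x" for z
  proof -
   have "(\<sigma> has_real_derivative (\<Sum>n\<in>I. ?c * vec_mat I (ob z) S n - ll z * ob z n)) (at z within {z..})"
    unfolding \<sigma>_def by (intro DERIV_sum dob that)
   then show ?thesis by (simp add: sum_subtractf ll_def dot_def ones_def \<sigma>_def sum_distrib_left)
  qed
  \<comment> \<open>The deviation of the total mass from 1 solves a homogeneous linear equation, so
    mass 1 persists.\<close>
  have "(\<sigma> x - 1) * \<mu> x = (\<sigma> u - 1) * \<mu> u"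
  proof (rule right_deriv_zero_imp_const[OF u(2)])
   show "continuous_on {u..x} (\<lambda>z. (\<sigma> z - 1) * \<mu> z)"
    unfolding \<sigma>_def by (intro continuous_intros contob cont\<mu>)
   fix z assume z: "u <= z" "z < x"
   have "((\<lambda>z. (\<sigma> z - 1) * \<mu> z) has_real_derivative (ll z - ll z * \<sigma> z) * \<mu> z + \<mu> z * ll z * (\<sigma> z - 1)) (at z within {z..})"
    by (rule DERIV_mult) (use d\<sigma>[OF z] d\<mu>[OF z] in \<open>auto intro!: derivative_eq_intros\<close>)
   then show "((\<lambda>z. (\<sigma> z - 1) * \<mu> z) has_real_derivative 0) (at z within {z..})"
    by (simp add: algebra_simps)
  qed
  moreover have "\<sigma> u = 1" using g k yu by (simp add: good_def \<sigma>_def)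
  ultimately have \<sigma>x: "\<sigma> x = 1" by (simp add: \<mu>_def)
  have sol: "\<mu> x * ob x n = vec_mat I (ob u) (E (?c * (x - u))) n" if n: "n \<in> I" for n
  proof -
   \<comment> \<open>The rescaled orbit carried on to time \<open>x\<close> by the linear flow;
     constancy of this quantity says that \<open>\<mu>\<close> times the orbit solves the linear
     equation.\<close>
   define \<Phi> where "\<Phi> = (\<lambda>z. \<mu> z * (\<Sum>m\<in>I. ob z m * E (?c * (x - z)) m n))"
   have contE: "continuous_on {u..x} (\<lambda>z. E (?c * (x - z)) m n)" if "m \<in> I" for m
    by (rule continuous_on_compose2[OF mat_exp_continuous[of I m n UNIV]]) (use that n in \<open>auto intro!: continuous_intros\<close>)
   have "\<Phi> x = \<Phi> u"
   proof (rule right_deriv_zero_imp_const[OF u(2)])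
    show "continuous_on {u..x} \<Phi>"
     unfolding \<Phi>_def by (intro continuous_intros contob cont\<mu> contE)
    fix z assume z: "u <= z" "z < x"
    let ?E = "\<lambda>m. E (?c * (x - z)) m n"
    have dE: "((\<lambda>z. E (?c * (x - z)) m n) has_real_derivative (\<Sum>l\<in>I. S m l * ?E l) * (- ?c)) (at z within {z..})" if "m \<in> I" for m
     by (rule DERIV_chain2[OF mat_exp_deriv_left]) (use that n in \<open>auto intro!: derivative_eq_intros\<close>)
    have "(\<Phi> has_real_derivative \<mu> z * ll z * (\<Sum>m\<in>I. ob z m * ?E m) + (\<Sum>m\<in>I. (?c * vec_mat I (ob z) S m - ll z * ob z m) * ?E m
      + (\<Sum>l\<in>I. S m l * ?E l) * (- ?c) * ob z m) * \<mu> z) (at z within {z..})"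
     unfolding \<Phi>_def by (intro DERIV_mult DERIV_sum d\<mu>[OF z] dob[OF z] dE)
    moreover have "(\<Sum>m\<in>I. (?c * vec_mat I (ob z) S m - ll z * ob z m) * ?E m + (\<Sum>l\<in>I. S m l * ?E l) * (- ?c) * ob z m)
      = - ll z * (\<Sum>m\<in>I. ob z m * ?E m)"
    proof -
     have "(\<Sum>m\<in>I. ?c * vec_mat I (ob z) S m * ?E m) = (\<Sum>m\<in>I. (\<Sum>l\<in>I. S m l * ?E l) * ?c * ob z m)"
      using vec_mat_dot[of "ob z" S ?E] by (simp add: sum_distrib_left[symmetric] mult_ac)
     moreover have "(\<Sum>m\<in>I. (?c * vec_mat I (ob z) S m - ll z * ob z m) * ?E m + (\<Sum>l\<in>I. S m l * ?E l) * (- ?c) * ob z m)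
      = (\<Sum>m\<in>I. ?c * vec_mat I (ob z) S m * ?E m) - (\<Sum>m\<in>I. ll z * (ob z m * ?E m)) - (\<Sum>m\<in>I. (\<Sum>l\<in>I. S m l * ?E l) * ?c * ob z m)"
      unfolding sum_subtractf[symmetric] by (intro sum.cong refl) (simp add: algebra_simps)
     ultimately show ?thesis by (simp add: sum_distrib_left[symmetric])
    qed
    ultimately show "(\<Phi> has_real_derivative 0) (at z within {z..})" by (simp add: mult_ac)
   qed
   moreover have "\<Phi> x = \<mu> x * ob x n"
    using n by (simp add: \<Phi>_def mat_exp_0 sum_mat_one_right)
   moreover have "\<Phi> u = vec_mat I (ob u) (E (?c * (x - u))) n"
    by (simp add: \<Phi>_def \<mu>_def vec_mat_def)
   ultimately show ?thesis by simp
  qed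
  have "cone (ob u)" using g k yu by (simp add: good_def)
  then have "cone (vec_mat I (ob u) (E (?c * (x - u))))" using u by (intro cone_drift) auto
  then have "cone (\<lambda>n. \<mu> x * ob x n)" using cone_cong[of "\<lambda>n. \<mu> x * ob x n" "vec_mat I (ob u) (E (?c * (x - u)))"] sol by simp
  moreover have "rho (\<lambda>n. \<mu> x * ob x n) z = \<mu> x * rho (ob x) z" for z
   by (simp add: rho_def sum_distrib_left mult.assoc)
  moreover have "0 < \<mu> x" by (simp add: \<mu>_def)
  ultimately have "cone (ob x)" by (simp add: cone_def zero_le_mult_iff)
  then have "good (k, i, ob x)" using valx \<sigma>x by (simp add: good_def \<sigma>_def)
  then show ?thesis unfolding Yx .
 qed
qed

text \<open>Level and phase are eventually constant from the left, and the conditions on the orbit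
  are closed, so they pass to the limit.\<close>

lemma good_left:
 assumes u: "0 < u" and g: "!!x. 0 <= x ==> x < u ==> good (Y x)" and y: "left_state Y u y"
 shows "good y"
proof -
 obtain k i a where ye: "y = (k, i, a)" by (cases y)
 note near = left_state_near[OF y[unfolded ye]] and lim = left_state_lim[OF y[unfolded ye]]
 have nt: "at_left u \<noteq> bot" by simp
 have ev: "eventually (\<lambda>x. good (k, i, ob x)) (at_left u)"
  using near eventually_at_left_real[OF u]
 proof eventually_elim
  case (elim x)
  then show ?case using g[of x] by (cases "Y x") simp
 qed
 show ?thesis
 proof (cases "k \<in> levels")
  case k: True
  have 1: "eventually (\<lambda>x. ob x n = restrict_row q (ob x) n) (at_left u)" for n
   using ev by eventually_elim (use k in \<open>auto simp: good_def valid_state_def\<close>)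
  have a: "a n = restrict_row q a n" for n
  proof (cases "n \<in> I")
   case False
   have "eventually (\<lambda>x. ob x n = 0) (at_left u)"
    using 1[of n]
   proof eventually_elim
    case (elim x)
    have "restrict_row q (ob x) n = 0" using False by (auto simp: restrict_row_def)
    then show ?case by (rule trans[OF elim])
   qed
   then have "((\<lambda>x. ob x n) \<longlongrightarrow> 0) (at_left u)" by (rule tendsto_eventually)
   then have "a n = 0" using tendsto_unique[OF nt lim] by simp
   then show ?thesis using False by (simp add: restrict_row_def)
  qed (simp add: restrict_row_def)
  have "((\<lambda>x. \<Sum>n\<in>I. ob x n) \<longlongrightarrow> (\<Sum>n\<in>I. a n)) (at_left u)" by (intro tendsto_sum lim)
  moreover have "eventually (\<lambda>x. (\<Sum>n\<in>I. ob x n) = 1) (at_left u)"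
   using ev by eventually_elim (use k in \<open>auto simp: good_def\<close>)
  then have "((\<lambda>x. \<Sum>n\<in>I. ob x n) \<longlongrightarrow> 1) (at_left u)" by (rule tendsto_eventually)
  ultimately have s1: "(\<Sum>n\<in>I. a n) = 1" using tendsto_unique[OF nt] by blast
  have "0 <= rho a z" if "0 <= z" for z
  proof (rule tendsto_lowerbound)
   show "((\<lambda>x. rho (ob x) z) \<longlongrightarrow> rho a z) (at_left u)"
    unfolding rho_def by (intro tendsto_sum tendsto_mult lim tendsto_const)
   show "eventually (\<lambda>x. 0 <= rho (ob x) z) (at_left u)"
    using ev by eventually_elim (use k that in \<open>auto simp: good_def cone_def\<close>)
  qed (rule nt)
  then have "cone a" by (simp add: cone_def)
  moreover have "valid_state c K q (k, i, a)" using k a by (auto simp: valid_state_def fun_eq_iff)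
  ultimately show ?thesis using s1 by (simp add: ye good_def)
 next
  case k: False
  have 1: "eventually (\<lambda>x. valid_state c K q (k, i, ob x) \<and> ob x = unit_vec 1) (at_left u)"
   using ev by eventually_elim (use k in \<open>auto simp: good_def valid_state_def\<close>)
  have "a n = unit_vec 1 n" for n
  proof -
   have "eventually (\<lambda>x. ob x n = unit_vec 1 n) (at_left u)" using 1 by eventually_elim simp
   then have "((\<lambda>x. ob x n) \<longlongrightarrow> unit_vec 1 n) (at_left u)" by (rule tendsto_eventually)
   then show ?thesis using tendsto_unique[OF nt lim] by simp
  qed
  then have "a = unit_vec 1" by (rule ext)
  moreover have "eventually (\<lambda>x. valid_state c K q (k, i, unit_vec 1)) (at_left u)"
   using 1 by eventually_elim metis
  then have "valid_state c K q (k, i, unit_vec 1)" by simp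
  ultimately show ?thesis using k by (auto simp: ye good_def)
 qed
qed

lemma evs_mono: "x <= y ==> evs x \<subseteq> evs y"
 by (auto simp: evs_def)

text \<open>Induction on the number of events up to \<open>u\<close>, which replaces an enumeration
  of the jump times.\<close>

lemma good_path: "0 <= u ==> good (Y u)"
proof (induction "card (evs u)" arbitrary: u rule: less_induct)
 case less
 show ?case
 proof (cases "evs u = {}")
  case True
  then show ?thesis
   by (intro good_regime[OF order_refl less.prems _ good_0]) (auto simp: evs_def)
 next
  case False
  \<comment> \<open>The last event: times before it have fewer events, so its left limit is good;
    then \<open>good_target\<close> applies at \<open>v\<close> and \<open>good_regime\<close> after
    it.\<close>
  define v where "v = Max (evs u)"
  have v: "v \<in> evs u" "!!x. x \<in> evs u ==> x <= v"
   unfolding v_def using False finite_evs by (auto intro: Max_in)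
  then have v0: "0 < v" "v <= u" and vo: "\<exists>e. occ e v" by (auto simp: evs_def)
  then obtain e y where y: "left_state Y v y" "enabled K y e" "Y v = tgt y e" by (auto simp: occurs_def)
  have "good y"
  proof (rule good_left[OF v0(1) _ y(1)])
   fix x assume x: "0 <= x" "x < v"
   have "evs x \<subset> evs u"
   proof
    show "evs x \<subseteq> evs u" by (rule evs_mono) (use x v0 in auto)
    have "v \<notin> evs x" using x by (simp add: evs_def)
    then show "evs x \<noteq> evs u" using v(1) by blast
   qed
   then have "card (evs x) < card (evs u)" by (rule psubset_card_mono[OF finite_evs])
   then show "good (Y x)" using less.hyps x by blast
  qed
  then have "good (Y v)" unfolding y(3) by (rule good_target) (rule y(2))
  then show ?thesis
  proof (rule good_regime[rotated 3])
   fix z assume "v < z" "z <= u"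
   then show "\<not> (\<exists>e. occ e z)" using v(2)[of z] v0 by (auto simp: evs_def)
  qed (use v0 in auto)
 qed
qed

section \<open>Left limits and derivatives of columns along a path\<close>

definition lft :: "real => 's qstate" where "lft u = (SOME y. left_state Y u y)"

lemma lft: "0 < u ==> left_state Y u (lft u)"
 unfolding lft_def using left_exists by (rule someI_ex)

lemma good_lft: "0 < u ==> good (lft u)"
 by (rule good_left[OF _ _ lft]) (auto intro: good_path)

lemma lft_eq: "0 < u ==> \<not> (\<exists>e. occ e u) ==> lft u = Y u"
 by (rule left_state_unique[OF lft occ_left_state])

lemma outer_idx: "good (k, i, a) ==> k \<notin> levels ==> (k, i, 1) \<in> idx"
 by (erule good_cases) (auto intro: idx_bottom idx_top[simplified])

lemma hat_tendsto:
 assumes near: "eventually (\<lambda>x. lv x = k \<and> ph x = i) \<F>" and lim: "!!n. ((\<lambda>x. ob x n) \<longlongrightarrow> a n) \<F>"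
  and v: "!!x. x \<in> idx ==> ((\<lambda>z. v z x) \<longlongrightarrow> v' x) \<F>" and g: "good (k, i, a)"
 shows "((\<lambda>x. hat (v x) (Y x)) \<longlongrightarrow> hat v' (k, i, a)) \<F>"
proof (cases "k \<in> levels")
 case True
 have "((\<lambda>x. \<Sum>n\<in>I. ob x n * v x (k, i, n)) \<longlongrightarrow> (\<Sum>n\<in>I. a n * v' (k, i, n))) \<F>"
  by (intro tendsto_sum tendsto_mult lim v idx_inner True)
 moreover have "eventually (\<lambda>x. (\<Sum>n\<in>I. ob x n * v x (k, i, n)) = hat (v x) (Y x)) \<F>"
  using near
 proof eventually_elim
  case (elim x)
  then show ?case using True by (cases "Y x") (simp add: hat_inner)
 qed
 ultimately show ?thesis unfolding hat_inner[OF True] by (rule Lim_transform_eventually)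
next
 case False
 have "((\<lambda>x. v x (k, i, 1)) \<longlongrightarrow> v' (k, i, 1)) \<F>"
  by (rule v[OF outer_idx[OF g False]])
 moreover have "eventually (\<lambda>x. v x (k, i, 1) = hat (v x) (Y x)) \<F>"
  using near
 proof eventually_elim
  case (elim x)
  then have "Y x = (k, i, ob x)" by (cases "Y x") simp
  then show ?case using hat_outer[OF False] by metis
 qed
 ultimately show ?thesis unfolding hat_outer[OF False] by (rule Lim_transform_eventually)
qed

lemma hat_left:
 assumes "0 < u" "!!x. x \<in> idx ==> isCont (\<lambda>z. v z x) u"
 shows "((\<lambda>x. hat (v x) (Y x)) \<longlongrightarrow> hat (v u) (lft u)) (at_left u)"
proof -
 obtain k i a where l: "lft u = (k, i, a)" by (cases "lft u")
 show ?thesis unfolding l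
 proof (rule hat_tendsto)
  show "eventually (\<lambda>x. lv x = k \<and> ph x = i) (at_left u)" "!!n. ((\<lambda>x. ob x n) \<longlongrightarrow> a n) (at_left u)"
   using left_state_near left_state_lim lft[OF assms(1)] unfolding l by blast+
  show "((\<lambda>z. v z x) \<longlongrightarrow> v u x) (at_left u)" if "x \<in> idx" for x
   using assms(2)[OF that] by (simp add: isCont_def filterlim_at_split)
  show "good (k, i, a)" using good_lft[OF assms(1)] l by simp
 qed
qed

lemma right_near: "0 <= u ==> eventually (\<lambda>x. lv x = lv u \<and> ph x = ph u) (at_right u)"
proof -
 assume u: "0 <= u"
 obtain h where h: "h > 0" "\<forall>x\<in>{u..<u + h}. gp x = gp u" using cadlag_stepD(1)[OF cadlag_gp u] by blast
 have "eventually (\<lambda>x. x \<in> {u<..<u + h}) (at_right u)" by (rule eventually_at_right_real) (use h in simp)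
 then show ?thesis
 proof eventually_elim
  case (elim x)
  then have "x \<in> {u..<u + h}" by simp
  then have "gp x = gp u" using h(2) by blast
  then show ?case by simp
 qed
qed

lemma hat_right:
 assumes "0 <= u" "!!x. x \<in> idx ==> isCont (\<lambda>z. v z x) u"
 shows "((\<lambda>x. hat (v x) (Y x)) \<longlongrightarrow> hat (v u) (Y u)) (at_right u)"
proof -
 have "((\<lambda>x. hat (v x) (Y x)) \<longlongrightarrow> hat (v u) (lv u, ph u, ob u)) (at_right u)"
 proof (rule hat_tendsto[OF right_near[OF assms(1)]])
  show "((\<lambda>x. ob x n) \<longlongrightarrow> ob u n) (at_right u)" for n by (rule ob_right[OF assms(1)])
  show "((\<lambda>z. v z x) \<longlongrightarrow> v u x) (at_right u)" if "x \<in> idx" for x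
   using assms(2)[OF that] by (simp add: isCont_def filterlim_at_split)
  show "good (lv u, ph u, ob u)" using good_path[OF assms(1)] by simp
 qed
 then show ?thesis by simp
qed

lemma hat_isCont:
 assumes "0 < u" "\<not> (\<exists>e. occ e u)" "!!x. x \<in> idx ==> isCont (\<lambda>z. v z x) u"
 shows "isCont (\<lambda>x. hat (v x) (Y x)) u"
 using hat_left[of u v] hat_right[of u v] lft_eq[of u] assms by (simp add: isCont_def filterlim_at_split)

lemma hat_deriv:
 assumes u: "0 <= u" and v: "!!x. x \<in> idx ==> ((\<lambda>z. v z x) has_real_derivative v' x) (at u)"
 shows "((\<lambda>x. hat (v x) (Y x)) has_real_derivative drift (v u) (Y u) + hat v' (Y u)) (at u within {u..})"
proof -
 obtain k i a where yu: "Y u = (k, i, a)" by (cases "Y u")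
 have near: "eventually (\<lambda>x. Y x = (k, i, ob x)) (at u within {u..})"
  unfolding at_within_Ici_at_right using right_near[OF u]
 proof eventually_elim
  case (elim x)
  then show ?case by (cases "Y x") (simp add: yu)
 qed
 have v': "((\<lambda>z. v z x) has_real_derivative v' x) (at u within {u..})" if "x \<in> idx" for x
  by (rule has_field_derivative_at_within[OF v[OF that]])
 show ?thesis
 proof (cases "k \<in> levels")
  case True
  have eq: "eventually (\<lambda>x. hat (v x) (Y x) = (\<Sum>n\<in>I. ob x n * v x (k, i, n))) (at u within {u..})"
   using near
  proof eventually_elim
   case (elim x)
   have "hat (v x) (k, i, ob x) = (\<Sum>n\<in>I. ob x n * v x (k, i, n))" by (rule hat_inner[OF True])
   then show ?case unfolding elim[symmetric] .
  qed
  have "((\<lambda>x. \<Sum>n\<in>I. ob x n * v x (k, i, n)) has_real_derivative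
    (\<Sum>n\<in>I. orbit_drift c K q S (Y u) n * v u (k, i, n) + v' (k, i, n) * ob u n)) (at u within {u..})"
   by (intro DERIV_sum DERIV_mult ob_deriv u v' idx_inner True)
  moreover have "(\<Sum>n\<in>I. orbit_drift c K q S (Y u) n * v u (k, i, n) + v' (k, i, n) * ob u n) = drift (v u) (Y u) + hat v' (Y u)"
   by (simp add: yu drift_def hat_inner[OF True] sum.distrib mult.commute[of "v' _"])
  ultimately have "((\<lambda>x. \<Sum>n\<in>I. ob x n * v x (k, i, n)) has_real_derivative drift (v u) (Y u) + hat v' (Y u)) (at u within {u..})" by simp
  then show ?thesis
   by (subst has_field_derivative_cong_eventually[OF eq]) (simp_all add: yu hat_inner[OF True])
 next
  case False
  have eq: "eventually (\<lambda>x. hat (v x) (Y x) = v x (k, i, 1)) (at u within {u..})"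
   using near
  proof eventually_elim
   case (elim x)
   have "hat (v x) (k, i, ob x) = v x (k, i, 1)" by (rule hat_outer[OF False])
   then show ?case unfolding elim[symmetric] .
  qed
  have "(k, i, 1) \<in> idx" using outer_idx good_path[OF u] yu False by metis
  then have "((\<lambda>x. v x (k, i, 1)) has_real_derivative v' (k, i, 1)) (at u within {u..})" by (rule v')
  moreover have "drift (v u) (Y u) + hat v' (Y u) = v' (k, i, 1)"
  proof -
   have "orbit_drift c K q S (k, i, a) n = 0" for n
    unfolding orbit_drift_def prod.case using False by (simp only: simp_thms if_False)
   then show ?thesis by (simp add: yu drift_def hat_outer[OF False])
  qed
  ultimately show ?thesis
   by (subst has_field_derivative_cong_eventually[OF eq]) (simp_all add: yu hat_outer[OF False])
 qed
qed

end

context qbd_scheme begin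

section \<open>The compensated sum of jumps\<close>

text \<open>The backward solution with terminal column \<open>w0\<close> at time \<open>t\<close>.
  The value 0 off \<open>idx\<close> makes continuity in \<open>u\<close> hold for every
  argument.\<close>

definition wv :: "real => (nat \<times> 's \<times> nat => real) => real => nat \<times> 's \<times> nat => real" where
 "wv t w0 u x = (if x \<in> idx then mat_vec idx (mat_exp idx B (t - u)) w0 x else 0)"

definition jv :: "real => (nat \<times> 's \<times> nat => real) => 's option => real => nat \<times> 's \<times> nat => real" where
 "jv t w0 e u x = tw e (wv t w0 u) x - wv t w0 u x"

lemma hat_uminus: "hat (\<lambda>x. - v x) y = - hat v y"
 by (cases y) (simp add: hat_def sum_negf)

lemma hat_cong: "good y ==> (!!x. x \<in> idx ==> v x = w x) ==> hat v y = hat w y"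
proof (erule good_cases)
 fix i assume v: "!!x. x \<in> idx ==> v x = w x"
 { assume "y = (0, i, unit_vec 1)" "c i < 0"
  then show ?thesis using v[OF idx_bottom[of i]] by (simp add: hat_outer) }
 { assume "y = (K + 1, i, unit_vec 1)" "0 < c i"
  then show ?thesis using v[OF idx_top[of i]] by (simp add: hat_def) }
 fix k a assume "y = (k, i, a)" "k \<in> levels"
 then show ?thesis using v[OF idx_inner[of k]] by (auto simp only: hat_inner intro!: sum.cong)
qed

lemma wv_deriv:
 assumes x: "x \<in> idx"
 shows "((\<lambda>u. wv t w0 u x) has_real_derivative - mat_vec idx B (wv t w0 u) x) (at u)"
proof -
 have d: "((\<lambda>u. mat_exp idx B (t - u) x y) has_real_derivative (\<Sum>z\<in>idx. B x z * mat_exp idx B (t - u) z y) * (-1)) (at u)"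
  if "y \<in> idx" for y
  by (rule DERIV_chain2[OF mat_exp_deriv_left[OF finite_idx x that]]) (auto intro!: derivative_eq_intros)
 have "((\<lambda>u. \<Sum>y\<in>idx. mat_exp idx B (t - u) x y * w0 y) has_real_derivative
   (\<Sum>y\<in>idx. ((\<Sum>z\<in>idx. B x z * mat_exp idx B (t - u) z y) * (-1)) * w0 y)) (at u)"
  by (intro DERIV_sum DERIV_cmult_right d)
 moreover have "(\<Sum>y\<in>idx. ((\<Sum>z\<in>idx. B x z * mat_exp idx B (t - u) z y) * (-1)) * w0 y) = - mat_vec idx B (wv t w0 u) x"
 proof -
  have "mat_vec idx B (wv t w0 u) x = (\<Sum>z\<in>idx. B x z * (\<Sum>y\<in>idx. mat_exp idx B (t - u) z y * w0 y))"
   unfolding mat_vec_def[of idx B] by (intro sum.cong refl) (simp add: wv_def mat_vec_def)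
  also have "\<dots> = (\<Sum>z\<in>idx. \<Sum>y\<in>idx. B x z * mat_exp idx B (t - u) z y * w0 y)"
   by (simp add: sum_distrib_left mult.assoc)
  also have "\<dots> = (\<Sum>y\<in>idx. \<Sum>z\<in>idx. B x z * mat_exp idx B (t - u) z y * w0 y)" by (rule sum.swap)
  finally show ?thesis by (simp add: sum_distrib_right sum_negf)
 qed
 moreover have "(\<lambda>u. wv t w0 u x) = (\<lambda>u. \<Sum>y\<in>idx. mat_exp idx B (t - u) x y * w0 y)"
  using x by (simp add: wv_def mat_vec_def fun_eq_iff)
 ultimately show ?thesis by simp
qed

lemma wv_isCont: "isCont (\<lambda>u. wv t w0 u x) u"
proof (cases "x \<in> idx")
 case True
 then show ?thesis by (intro DERIV_isCont[OF wv_deriv])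
next
 case False
 then show ?thesis by (simp add: wv_def)
qed

lemma jv_isCont: "isCont (\<lambda>u. jv t w0 e u x) u"
proof -
 obtain k i n where x: "x = (k, i, n)" by (cases x)
 have "isCont (\<lambda>u. tw e (wv t w0 u) x) u"
 proof (cases e)
  case None
  then show ?thesis by (simp add: x tw_def wv_isCont)
 next
  case (Some j)
  consider "k = 0" | "k \<noteq> 0" "k = K + 1" | "k \<noteq> 0" "k \<noteq> K + 1" "sgn (c i) = sgn (c j)"
   | "k \<noteq> 0" "k \<noteq> K + 1" "sgn (c i) \<noteq> sgn (c j)" by blast
  then show ?thesis
  proof cases
   case 4
   then have "(\<lambda>u. tw e (wv t w0 u) x) = (\<lambda>u. \<Sum>m\<in>I. D n m * wv t w0 u (k, j, m))"
    by (simp add: Some x tw_def)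
   then show ?thesis by (simp only:) (intro continuous_intros wv_isCont)
  qed (simp_all add: Some x tw_def wv_isCont)
 qed
 then show ?thesis unfolding jv_def by (intro continuous_intros wv_isCont)
qed

text \<open>On good states \<open>hat\<close> is controlled by the entries, which are continuous on
  a compact interval. The bound is uniform over states, so it dominates whole paths; its dependence
  on the scheme does no harm, as one scheme is fixed here.\<close>

lemma hat_family_bounded:
 fixes v :: "real => nat \<times> 's \<times> nat => real"
 assumes v: "!!x u. x \<in> idx ==> isCont (\<lambda>u. v u x) u"
 obtains W where "0 <= W" "!!u y. u \<in> {0..t} ==> good y ==> \<bar>hat (v u) y\<bar> <= W"
proof -
 obtain C where C: "0 <= C" "!!w W y. good y ==> (!!x. x \<in> idx ==> \<bar>w x\<bar> <= W) ==> \<bar>hat w y\<bar> <= C * W"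
  using hat_bounded by blast
 have "\<exists>W. \<forall>u\<in>{0..t}. \<bar>v u x\<bar> <= W" if "x \<in> idx" for x
 proof -
  have "continuous_on {0..t} (\<lambda>u. v u x)" by (intro continuous_at_imp_continuous_on ballI v that)
  then have "bounded ((\<lambda>u. v u x) ` {0..t})" by (intro compact_imp_bounded compact_continuous_image compact_Icc)
  then show ?thesis by (auto simp: bounded_iff)
 qed
 then obtain W where W: "\<forall>x\<in>idx. \<forall>u\<in>{0..t}. \<bar>v u x\<bar> <= W x" by metis
 show ?thesis
 proof (rule that[of "C * (\<Sum>x\<in>idx. \<bar>W x\<bar>)"])
  show "0 <= C * (\<Sum>x\<in>idx. \<bar>W x\<bar>)" using C(1) by (intro mult_nonneg_nonneg sum_nonneg) auto
  fix u y assume u: "u \<in> {0..t}" and y: "good y"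
  show "\<bar>hat (v u) y\<bar> <= C * (\<Sum>x\<in>idx. \<bar>W x\<bar>)"
  proof (rule C(2)[OF y])
   fix x assume x: "x \<in> idx"
   have "\<bar>v u x\<bar> <= W x" using W x u by blast
   also have "W x <= \<bar>W x\<bar>" by simp
   also have "\<bar>W x\<bar> <= (\<Sum>x\<in>idx. \<bar>W x\<bar>)" by (rule member_le_sum[OF x _ finite_idx]) simp
   finally show "\<bar>v u x\<bar> <= (\<Sum>x\<in>idx. \<bar>W x\<bar>)" .
  qed
 qed
qed

end

context scheme_path begin

abbreviation "le e u \<equiv> hat (lam e) (Y u)"

lemma occ_lft:
 assumes "0 < u" "occ e u" shows "enabled K (lft u) e" "Y u = tgt (lft u) e"
proof -
 obtain y where y: "left_state Y u y" "enabled K y e" "Y u = tgt y e" using assms(2) by (auto simp: occurs_def)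
 have "y = lft u" by (rule left_state_unique[OF y(1) lft[OF assms(1)]])
 then show "enabled K (lft u) e" "Y u = tgt (lft u) e" using y by auto
qed

lemma occ_unique: "0 < u ==> occ e u ==> occ e' u ==> e = e'"
 using occ_lft target_event_unique by metis

lemma evs_right:
 shows "eventually (\<lambda>x. evs x = evs u) (at_right u)"
proof -
 let ?F = "evs (u + 1) - {..u}"
 have "eventually (\<lambda>x. \<forall>r\<in>?F. x < r) (at_right u)"
  using finite_evs by (intro eventually_ball_finite ballI order_tendstoD(2)[OF tendsto_ident_at]) auto
 moreover have "eventually (\<lambda>x. x \<in> {u<..<u + 1}) (at_right u)" by (rule eventually_at_right_real) simp
 ultimately show ?thesis
 proof eventually_elim
  case (elim x)
  show ?case
  proof
   show "evs x \<subseteq> evs u"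
   proof
    fix r assume r: "r \<in> evs x"
    show "r \<in> evs u"
    proof (rule ccontr)
     assume "r \<notin> evs u"
     then have "r \<in> ?F" using r elim(2) by (auto simp: evs_def)
     then have "x < r" using elim(1) by blast
     then show False using r by (simp add: evs_def)
    qed
   qed
   show "evs u \<subseteq> evs x" by (rule evs_mono) (use elim(2) in auto)
  qed
 qed
qed

lemma evs_left:
 assumes "0 < u" shows "eventually (\<lambda>x. evs x = evs u - {u}) (at_left u)"
proof -
 let ?F = "evs u - {u}"
 have "r < u" if "r \<in> ?F" for r using that by (auto simp: evs_def)
 then have "eventually (\<lambda>x. \<forall>r\<in>?F. r < x) (at_left u)"
  using finite_evs by (intro eventually_ball_finite ballI order_tendstoD(1)[OF tendsto_ident_at]) auto
 moreover have "eventually (\<lambda>x. x \<in> {0<..<u}) (at_left u)" by (rule eventually_at_left_real[OF assms])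
 ultimately show ?thesis
 proof eventually_elim
  case (elim x)
  show ?case
  proof
   show "evs x \<subseteq> ?F" using elim(2) by (auto simp: evs_def)
   show "?F \<subseteq> evs x"
   proof
    fix r assume r: "r \<in> ?F"
    then have "r < x" using elim(1) by blast
    then show "r \<in> evs x" using r by (auto simp: evs_def)
   qed
  qed
 qed
qed

section \<open>Compensated sums for a fixed horizon and terminal column\<close>

context
 fixes t :: real and w0 :: "nat \<times> 's \<times> nat => real"
 assumes t: "0 < t"
begin

text \<open>\<open>je\<close> takes the present state, \<open>jl\<close> its left limit; they agree
  off the events. Sums of \<open>je\<close> over left ends have \<open>jl\<close> as their limit at
  an event.\<close>

abbreviation "je e u \<equiv> hat (jv t w0 e u) (Y u)"
abbreviation "jl e u \<equiv> hat (jv t w0 e u) (lft u)"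

lemma jump_eq:
 assumes u: "0 < u"
 shows "hat (wv t w0 u) (Y u) - hat (wv t w0 u) (lft u) = (\<Sum>e\<in>UNIV. if occ e u then jl e u else 0)"
proof (cases "\<exists>e. occ e u")
 case True
 then obtain e where e: "occ e u" by blast
 have "(\<Sum>e\<in>UNIV. if occ e u then jl e u else 0) = (\<Sum>e'\<in>UNIV. if e' = e then jl e u else 0)"
 proof (intro sum.cong refl)
  fix e'
  show "(if occ e' u then jl e' u else 0) = (if e' = e then jl e u else 0)"
  proof (cases "e' = e")
   case False
   then have "\<not> occ e' u" using occ_unique[OF u e] by blast
   then show ?thesis using False by simp
  qed (simp add: e)
 qed
 also have "\<dots> = jl e u" by simp
 also have "\<dots> = hat (tw e (wv t w0 u)) (lft u) - hat (wv t w0 u) (lft u)"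
  unfolding jv_def[abs_def] by (rule hat_diff)
 also have "hat (tw e (wv t w0 u)) (lft u) = hat (wv t w0 u) (Y u)"
  using hat_target[OF good_lft[OF u] occ_lft(1)[OF u e]] occ_lft(2)[OF u e] by simp
 finally show ?thesis by simp
next
 case False
 then show ?thesis using lft_eq[OF u] by simp
qed

lemma je_le_bounded:
 obtains W where "!!e u. u \<in> {0..t} ==> \<bar>je e u\<bar> <= W e" "!!e u. u \<in> {0..t} ==> \<bar>le e u\<bar> <= W e"
  "!!e u. u \<in> {0..t} ==> \<bar>je e u * le e u\<bar> <= W e * W e"
proof -
 have "\<exists>W. \<forall>u\<in>{0..t}. \<bar>je e u\<bar> <= W \<and> \<bar>le e u\<bar> <= W" for e
 proof -
  obtain W where W: "0 <= W" "!!u y. u \<in> {0..t} ==> good y ==> \<bar>hat (jv t w0 e u) y\<bar> <= W"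
   using hat_family_bounded[of "jv t w0 e" t] jv_isCont by blast
  obtain W' where W': "0 <= W'" "!!u y. u \<in> {0..t} ==> good y ==> \<bar>hat (lam e) y\<bar> <= W'"
   using hat_family_bounded[of "\<lambda>_. lam e" t] by auto
  have "\<bar>je e u\<bar> <= W + W' \<and> \<bar>le e u\<bar> <= W + W'" if "u \<in> {0..t}" for u
  proof -
   have "0 <= u" using that by simp
   from W(2)[OF that good_path[OF this]] W'(2)[OF that good_path[OF this]] show ?thesis
    using W(1) W'(1) by linarith
  qed
  then show ?thesis by blast
 qed
 then obtain W where W: "!!e u. u \<in> {0..t} ==> \<bar>je e u\<bar> <= W e \<and> \<bar>le e u\<bar> <= W e" by metis
 show ?thesis
 proof (rule that[of W])
  show "\<bar>je e u * le e u\<bar> <= W e * W e" if "u \<in> {0..t}" for e u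
   unfolding abs_mult using W[OF that, of e] by (intro mult_mono) auto
 qed (use W in auto)
qed

lemma je_le_isCont:
 assumes "0 < u" "u < t" "u \<notin> evs t"
 shows "isCont (je e) u" "isCont (le e) u"
proof -
 have no: "\<not> (\<exists>e. occ e u)" using assms by (auto simp: evs_def)
 show "isCont (je e) u" by (rule hat_isCont[OF assms(1) no jv_isCont])
 show "isCont (le e) u" by (rule hat_isCont[OF assms(1) no]) simp
qed

text \<open>A Dynkin formula on a single path. The time derivative of the backward solution cancels
  the linear generator, so by \<open>generator_identity\<close> only the compensator of the jumps is
  left between events.\<close>

lemma path_identity:
 "hat (wv t w0 t) (Y t) - hat (wv t w0 0) (Y 0)
  = (\<Sum>e\<in>UNIV. \<Sum>r\<in>{r\<in>evs t. occ e r}. jl e r) - (\<Sum>e\<in>UNIV. LINT r:{0<..t}|lborel. je e r * le e r)"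
proof -
 define Jp where "Jp = (\<lambda>r. \<Sum>e\<in>UNIV. if occ e r then jl e r else 0)"
 define gd where "gd = (\<lambda>u. - (\<Sum>e\<in>UNIV. je e u * le e u))"
 define G0 where "G0 = (\<lambda>u. hat (wv t w0 u) (Y u))"
 \<comment> \<open>With its jumps removed the value is continuous and has the right derivative
   \<open>gd\<close> everywhere, events included.\<close>
 define G1 where "G1 = (\<lambda>u. G0 u - (\<Sum>r\<in>evs u. Jp r))"
 obtain W where W: "!!e u. u \<in> {0..t} ==> \<bar>je e u\<bar> <= W e" "!!e u. u \<in> {0..t} ==> \<bar>le e u\<bar> <= W e"
  "!!e u. u \<in> {0..t} ==> \<bar>je e u * le e u\<bar> <= W e * W e"
  using je_le_bounded by blast
 have dG: "(G0 has_real_derivative gd u) (at u within {u..})" if u: "0 <= u" for u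
 proof -
  have "(G0 has_real_derivative drift (wv t w0 u) (Y u) + hat (\<lambda>x. - mat_vec idx B (wv t w0 u) x) (Y u)) (at u within {u..})"
   unfolding G0_def by (rule hat_deriv[OF u wv_deriv])
  moreover have "drift (wv t w0 u) (Y u) + hat (\<lambda>x. - mat_vec idx B (wv t w0 u) x) (Y u) = gd u"
   unfolding hat_uminus generator_identity[OF good_path[OF u], of "wv t w0 u"] gd_def
   by (simp add: jv_def[abs_def] mult.commute)
  ultimately show ?thesis by simp
 qed
 have dG1: "(G1 has_real_derivative gd u) (at u within {u..})" if u: "0 <= u" for u
 proof -
  have eq: "eventually (\<lambda>x. G1 x = G0 x - (\<Sum>r\<in>evs u. Jp r)) (at u within {u..})"
   unfolding at_within_Ici_at_right using evs_right by eventually_elim (simp add: G1_def)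
  have "((\<lambda>x. G0 x - (\<Sum>r\<in>evs u. Jp r)) has_real_derivative gd u - 0) (at u within {u..})"
   by (intro DERIV_diff dG u DERIV_const)
  then show ?thesis
   by (subst has_field_derivative_cong_eventually[OF eq]) (simp_all add: G1_def)
 qed
 have rG1: "(G1 \<longlongrightarrow> G1 u) (at_right u)" if u: "0 <= u" for u
  using DERIV_continuous[OF dG1[OF u]] by (simp add: continuous_within at_within_Ici_at_right)
 have lG1: "(G1 \<longlongrightarrow> G1 u) (at_left u)" if u: "0 < u" for u
 proof -
  have "((\<lambda>x. G0 x - (\<Sum>r\<in>evs u - {u}. Jp r)) \<longlongrightarrow> hat (wv t w0 u) (lft u) - (\<Sum>r\<in>evs u - {u}. Jp r)) (at_left u)"
   unfolding G0_def by (intro tendsto_intros hat_left u wv_isCont)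
  moreover have "eventually (\<lambda>x. G0 x - (\<Sum>r\<in>evs u - {u}. Jp r) = G1 x) (at_left u)"
   using evs_left[OF u] by eventually_elim (simp add: G1_def)
  moreover have "hat (wv t w0 u) (lft u) - (\<Sum>r\<in>evs u - {u}. Jp r) = G1 u"
  proof -
   have "(\<Sum>r\<in>evs u. Jp r) = Jp u + (\<Sum>r\<in>evs u - {u}. Jp r)"
   proof (cases "u \<in> evs u")
    case True
    then show ?thesis by (rule sum.remove[OF finite_evs])
   next
    case False
    then have "Jp u = 0" using u by (simp add: Jp_def evs_def)
    then show ?thesis using False by simp
   qed
   then show ?thesis using jump_eq[OF u] unfolding G1_def G0_def Jp_def by simp
  qed
  ultimately show ?thesis using Lim_transform_eventually by fastforce
 qed
 have contG1: "continuous_on {0..t} G1"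
 proof (rule continuous_on_IccI[OF _ _ _ t])
  show "G1 \<midarrow>u\<rightarrow> G1 u" if "0 < u" "u < t" for u
   using lG1[of u] rG1[of u] that by (simp add: filterlim_at_split)
 qed (use lG1 rG1 t in auto)
 have reg: "f integrable_on {0..t}" "integral {0..t} f = (LINT r:{0<..t}|lborel. f r)" "set_integrable lborel {0<..t} f"
  if "!!r. 0 <= r ==> r <= t ==> \<bar>f r\<bar> <= C" "!!r. 0 < r ==> r < t ==> r \<notin> evs t ==> isCont f r" for f :: "real => real" and C
  using regular_integrable[OF that(1) finite_evs that(2)] by auto
 have contgd: "isCont gd r" if "0 < r" "r < t" "r \<notin> evs t" for r
  unfolding gd_def by (intro continuous_intros je_le_isCont that)
 have bdgd: "\<bar>gd r\<bar> <= (\<Sum>e\<in>UNIV. W e * W e)" if "0 <= r" "r <= t" for r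
  unfolding gd_def abs_minus_cancel using W(3) that by (intro order_trans[OF sum_abs] sum_mono) auto
 note gdint = reg[OF bdgd contgd]
 \<comment> \<open>The fundamental theorem of calculus for right derivatives: the integrand
   \<open>gd\<close> is only right continuous at events.\<close>
 have "G1 t - integral {0..t} gd = G1 0 - integral {0..0} gd"
 proof (rule right_deriv_zero_imp_const[of 0 t "\<lambda>u. G1 u - integral {0..u} gd"])
  show "continuous_on {0..t} (\<lambda>u. G1 u - integral {0..u} gd)"
   by (intro continuous_intros contG1 indefinite_integral_continuous_1 gdint)
  fix u assume u: "0 <= u" "u < t"
  have "(gd \<longlongrightarrow> gd u) (at_right u)"
   unfolding gd_def by (intro tendsto_intros hat_right u(1) jv_isCont continuous_const)
  then have "((\<lambda>u. G1 u - integral {0..u} gd) has_real_derivative gd u - gd u) (at u within {u..})"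
   by (intro DERIV_diff dG1 u(1) right_deriv_integral[OF gdint(1) u])
  then show "((\<lambda>u. G1 u - integral {0..u} gd) has_real_derivative 0) (at u within {u..})" by simp
 qed (use t in simp)
 moreover have "evs 0 = {}" by (auto simp: evs_def)
 ultimately have 1: "G0 t - G0 0 = (\<Sum>r\<in>evs t. Jp r) + integral {0..t} gd" by (simp add: G1_def)
 have "(\<Sum>r\<in>evs t. Jp r) = (\<Sum>e\<in>UNIV. \<Sum>r\<in>evs t. if occ e r then jl e r else 0)"
  unfolding Jp_def by (rule sum.swap)
 also have "\<dots> = (\<Sum>e\<in>UNIV. \<Sum>r\<in>{r\<in>evs t. occ e r}. jl e r)"
  by (intro sum.cong refl sum.inter_filter[symmetric] finite_evs)
 finally have 2: "(\<Sum>r\<in>evs t. Jp r) = \<dots>" .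
 have si: "set_integrable lborel {0<..t} (\<lambda>r. je e r * le e r)" for e
  by (rule reg(3)[of _ "W e * W e"]) (use W(3) je_le_isCont in \<open>auto intro!: continuous_intros\<close>)
 have "integral {0..t} gd = (LINT r:{0<..t}|lborel. gd r)" by (rule gdint(2))
 also have "\<dots> = - (LINT r:{0<..t}|lborel. \<Sum>e\<in>UNIV. je e r * le e r)"
  by (simp add: gd_def set_lebesgue_integral_def)
 also have "(LINT r:{0<..t}|lborel. \<Sum>e\<in>UNIV. je e r * le e r) = (\<Sum>e\<in>UNIV. LINT r:{0<..t}|lborel. je e r * le e r)"
  using si by (intro set_integral_sum) auto
 finally show ?thesis using 1 2 unfolding G0_def by simp
qed

lemma event_sum:
 assumes "0 < m"
 shows "(\<Sum>l<m. f (part 0 t m l) * real (event_count c K q \<alpha> D Y e (part 0 t m l) (part 0 t m (Suc l))))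
  = (\<Sum>r\<in>{r\<in>evs t. occ e r}. step_at 0 ((t - 0) / real m) m f r)"
proof -
 define h where "h = (t - 0) / real m"
 have h: "0 <= h" "real m * h = t" using assms t by (auto simp: h_def)
 let ?X = "{r\<in>evs t. occ e r}"
 have fX: "finite ?X" using finite_evs by simp
 have cnt: "real (event_count c K q \<alpha> D Y e (0 + real l * h) (0 + real (Suc l) * h)) = (\<Sum>r\<in>?X. indicator {0 + real l * h<..0 + real (Suc l) * h} r)"
  if l: "l < m" for l
 proof -
  let ?A = "{0 + real l * h<..0 + real (Suc l) * h}"
  have "real (Suc l) * h <= real m * h" using l h by (intro mult_right_mono) auto
  moreover have "0 <= real l * h" using h by simp
  ultimately have "{r\<in>?A. occ e r} = ?X \<inter> ?A" using h(2) by (auto simp: evs_def)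
  then have "real (event_count c K q \<alpha> D Y e (0 + real l * h) (0 + real (Suc l) * h)) = (\<Sum>r\<in>?X \<inter> ?A. 1)"
   by (simp add: event_count_def)
  also have "\<dots> = (\<Sum>r\<in>?X. if r \<in> ?A then 1 else 0)" by (rule sum.inter_restrict[OF fX])
  also have "\<dots> = (\<Sum>r\<in>?X. indicator ?A r)" by (intro sum.cong refl) (simp add: indicator_def)
  finally show ?thesis .
 qed
 have "(\<Sum>l<m. f (0 + real l * h) * real (event_count c K q \<alpha> D Y e (0 + real l * h) (0 + real (Suc l) * h)))
  = (\<Sum>l<m. \<Sum>r\<in>?X. f (0 + real l * h) * indicator {0 + real l * h<..0 + real (Suc l) * h} r)"
  unfolding sum_distrib_left[symmetric] by (intro sum.cong refl arg_cong2[where f = times] cnt) simp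
 also have "\<dots> = (\<Sum>r\<in>?X. \<Sum>l<m. f (0 + real l * h) * indicator {0 + real l * h<..0 + real (Suc l) * h} r)"
  by (rule sum.swap)
 finally show ?thesis unfolding step_at_def h_def .
qed

abbreviation compensated :: "nat => real" where
 "compensated m \<equiv> (\<Sum>e\<in>UNIV. \<Sum>l<m. je e (part 0 t m l) *
   (real (event_count c K q \<alpha> D Y e (part 0 t m l) (part 0 t m (Suc l)))
   - (LINT r:{part 0 t m l<..part 0 t m (Suc l)}|lborel. le e r)))"

text \<open>At an event the left ends select the left limit \<open>jl\<close>; in the integral the
  finitely many event times do not count. The two limits are the two sums of
  \<open>path_identity\<close>.\<close>

lemma compensated_tendsto:
 "compensated \<longlonglongrightarrow> hat (wv t w0 t) (Y t) - hat (wv t w0 0) (Y 0)"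
proof -
 obtain W where W: "!!e u. u \<in> {0..t} ==> \<bar>je e u\<bar> <= W e" "!!e u. u \<in> {0..t} ==> \<bar>le e u\<bar> <= W e"
  "!!e u. u \<in> {0..t} ==> \<bar>je e u * le e u\<bar> <= W e * W e"
  using je_le_bounded by blast
 have A: "(\<lambda>m. \<Sum>l<m. je e (part 0 t m l) *
   real (event_count c K q \<alpha> D Y e (part 0 t m l) (part 0 t m (Suc l))))
   \<longlonglongrightarrow> (\<Sum>r\<in>{r\<in>evs t. occ e r}. jl e r)" for e
 proof (rule Lim_transform_eventually)
  show "(\<lambda>m. \<Sum>r\<in>{r\<in>evs t. occ e r}. step_at 0 ((t - 0) / real m) m (je e) r) \<longlonglongrightarrow> (\<Sum>r\<in>{r\<in>evs t. occ e r}. jl e r)"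
  proof (rule tendsto_sum)
   fix r assume "r \<in> {r\<in>evs t. occ e r}"
   then have r: "0 < r" "r <= t" by (auto simp: evs_def)
   show "(\<lambda>m. step_at 0 ((t - 0) / real m) m (je e) r) \<longlonglongrightarrow> jl e r"
    by (rule step_at_tendsto[OF t r hat_left[OF r(1) jv_isCont]])
  qed
  show "eventually (\<lambda>m. (\<Sum>r\<in>{r\<in>evs t. occ e r}. step_at 0 ((t - 0) / real m) m (je e) r) =
   (\<Sum>l<m. je e (part 0 t m l) *
   real (event_count c K q \<alpha> D Y e (part 0 t m l) (part 0 t m (Suc l))))) sequentially"
   using eventually_gt_at_top[of 0] by eventually_elim (rule event_sum[symmetric])
 qed
 have A2: "(\<lambda>m. \<Sum>l<m. je e (part 0 t m l) *
   (LINT r:{part 0 t m l<..part 0 t m (Suc l)}|lborel. le e r))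
   \<longlonglongrightarrow> (LINT r:{0<..t}|lborel. je e r * le e r)" for e
  by (rule step_at_integral[where C = "W e" and C' = "W e", OF t finite_evs[of t]]) (use W je_le_isCont in auto)
 have "(\<lambda>m. \<Sum>e\<in>UNIV. (\<Sum>l<m. je e (part 0 t m l) *
   real (event_count c K q \<alpha> D Y e (part 0 t m l) (part 0 t m (Suc l)))) -
   (\<Sum>l<m. je e (part 0 t m l) *
   (LINT r:{part 0 t m l<..part 0 t m (Suc l)}|lborel. le e r)))
   \<longlonglongrightarrow> (\<Sum>e\<in>UNIV. (\<Sum>r\<in>{r\<in>evs t. occ e r}. jl e r) - (LINT r:{0<..t}|lborel. je e r * le e r))"
  by (intro tendsto_sum tendsto_diff A A2)
 then show ?thesis
  unfolding path_identity by (simp only: right_diff_distrib sum_subtractf)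
qed

text \<open>Counts and integrated intensities add up over the intervals, so the bound does not
  depend on the partition and can serve as dominating function.\<close>

lemma compensated_bounded:
 assumes m: "0 < m" and W: "0 <= W" "!!e u. u \<in> {0..t} ==> \<bar>je e u\<bar> <= W"
 shows "\<bar>compensated m\<bar> <= W * (\<Sum>e\<in>UNIV. real (event_count c K q \<alpha> D Y e 0 t) + (LINT r:{0<..t}|lborel. le e r))"
proof -
 define h where "h = (t - 0) / real m"
 have h: "0 < h" "0 + real m * h = t" using m t by (auto simp: h_def)
 have one: "step_at 0 h m (\<lambda>_. 1) r = 1" if "0 < r" "r <= t" for r
  using step_at_eq[OF h(1) that(1), of m "\<lambda>_. 1"] that h(2) by metis
 let ?N = "\<lambda>e l. real (event_count c K q \<alpha> D Y e (0 + real l * h) (0 + real (Suc l) * h))"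
 let ?L = "\<lambda>e l. LINT r:{0 + real l * h<..0 + real (Suc l) * h}|lborel. le e r"
 have sN: "(\<Sum>l<m. ?N e l) = real (event_count c K q \<alpha> D Y e 0 t)" for e
 proof -
  have "(\<Sum>l<m. 1 * ?N e l) = (\<Sum>r\<in>{r\<in>evs t. occ e r}. step_at 0 h m (\<lambda>_. 1) r)"
   unfolding h_def by (rule event_sum[OF m])
  also have "\<dots> = (\<Sum>r\<in>{r\<in>evs t. occ e r}. 1)"
   by (intro sum.cong refl one) (auto simp: evs_def)
  also have "{r\<in>evs t. occ e r} = {r\<in>{0<..t}. occ e r}" by (auto simp: evs_def)
  finally show ?thesis by (simp add: event_count_def)
 qed
 have sL: "(\<Sum>l<m. ?L e l) = (LINT r:{0<..t}|lborel. le e r)" for e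
 proof -
  obtain W where W: "!!e u. u \<in> {0..t} ==> \<bar>je e u\<bar> <= W e" "!!e u. u \<in> {0..t} ==> \<bar>le e u\<bar> <= W e"
   "!!e u. u \<in> {0..t} ==> \<bar>je e u * le e u\<bar> <= W e * W e"
   using je_le_bounded by blast
  have "set_integrable lborel {0<..t} (le e)"
   by (rule regular_integrable(1)[where C = "W e", OF _ finite_evs[of t]]) (use W(2) je_le_isCont in auto)
  then have "(LINT r:{0<..t}|lborel. step_at 0 h m (\<lambda>_. 1) r * le e r) = (\<Sum>l<m. 1 * ?L e l)"
   unfolding h_def by (rule step_at_integral_sum[OF t m])
  moreover have "(LINT r:{0<..t}|lborel. step_at 0 h m (\<lambda>_. 1) r * le e r) = (LINT r:{0<..t}|lborel. le e r)"
   by (rule set_lebesgue_integral_cong) (auto simp: one)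
  ultimately show ?thesis by simp
 qed
 have le0: "0 <= ?L e l" for e l
  unfolding set_lebesgue_integral_def
 proof (rule Bochner_Integration.integral_nonneg)
  fix r
  have "0 <= le e r" if "r \<in> {0 + real l * h<..0 + real (Suc l) * h}"
  proof (rule lam_nonneg[OF good_path])
   have "0 <= real l * h" using h by simp
   then show "0 <= r" using that by simp
  qed
  then show "0 <= indicator {0 + real l * h<..0 + real (Suc l) * h} r *\<^sub>R le e r"
   by (simp add: indicator_def)
 qed
 have "\<bar>compensated m\<bar> <= (\<Sum>e\<in>UNIV. \<Sum>l<m. \<bar>je e (0 + real l * h) * (?N e l - ?L e l)\<bar>)"
  unfolding h_def[symmetric] by (rule order_trans[OF sum_abs]) (intro sum_mono sum_abs)
 also have "\<dots> <= (\<Sum>e\<in>UNIV. \<Sum>l<m. W * (?N e l + ?L e l))"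
 proof (intro sum_mono)
  fix e l assume l: "l \<in> {..<m}"
  have "real l * h <= real m * h" using l h(1) by (intro mult_right_mono) auto
  then have "0 + real l * h \<in> {0..t}" using h by auto
  moreover have "\<bar>?N e l - ?L e l\<bar> <= ?N e l + ?L e l" using le0[of l e] by (simp add: abs_le_iff)
  ultimately show "\<bar>je e (0 + real l * h) * (?N e l - ?L e l)\<bar> <= W * (?N e l + ?L e l)"
   unfolding abs_mult using W by (intro mult_mono) auto
 qed
 also have "\<dots> = W * (\<Sum>e\<in>UNIV. real (event_count c K q \<alpha> D Y e 0 t) + (LINT r:{0<..t}|lborel. le e r))"
  by (simp only: sum_distrib_left[symmetric] sum.distrib sN sL)
 finally show ?thesis .
qed

lemma intensity_set_integrable:
 assumes "0 <= u" "u <= t" shows "set_integrable lborel {u<..t} (le e)"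
proof -
 obtain W where W: "!!e u. u \<in> {0..t} ==> \<bar>je e u\<bar> <= W e" "!!e u. u \<in> {0..t} ==> \<bar>le e u\<bar> <= W e"
  "!!e u. u \<in> {0..t} ==> \<bar>je e u * le e u\<bar> <= W e * W e"
  using je_le_bounded by blast
 show ?thesis
  by (rule regular_integrable(1)[where C = "W e", OF _ finite_evs[of t]]) (use W(2) je_le_isCont assms in auto)
qed

text \<open>Riemann sums use finitely many times only; this is how the integrated intensity becomes
  measurable as a function of the path.\<close>

lemma intensity_riemann:
 assumes u: "0 <= u" "u < t"
 shows "(\<lambda>m. \<Sum>l<m. le e (part u t m l) * ((t - u) / real m)) \<longlonglongrightarrow> (LINT r:{u<..t}|lborel. le e r)"
proof -
 obtain W where W: "!!e u. u \<in> {0..t} ==> \<bar>je e u\<bar> <= W e" "!!e u. u \<in> {0..t} ==> \<bar>le e u\<bar> <= W e"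
  "!!e u. u \<in> {0..t} ==> \<bar>je e u * le e u\<bar> <= W e * W e"
  using je_le_bounded by blast
 have len: "(LINT r:{u + real l * h<..u + real (Suc l) * h}|lborel. 1) = h" if "0 <= h" for l h
  using that by (simp add: set_lebesgue_integral_def algebra_simps)
 have "(\<lambda>m. \<Sum>l<m. le e (part u t m l) *
   (LINT r:{part u t m l<..part u t m (Suc l)}|lborel. 1))
  \<longlonglongrightarrow> (LINT r:{u<..t}|lborel. le e r * 1)"
  by (rule step_at_integral[where C = "W e" and C' = 1, OF u(2) finite_evs[of t]]) (use W je_le_isCont u in auto)
 moreover have "(LINT r:{part u t m l<..part u t m (Suc l)}|lborel. 1) = (t - u) / real m" for l m
  by (rule len) (use u in simp)
 ultimately show ?thesis by simp
qed

lemma intensity_integral: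
 assumes u: "0 <= u" "u <= t"
 shows "(\<integral>\<^sup>+r\<in>{u<..t}. ennreal (intensity T c K q S (Y r) e) \<partial>lborel) = ennreal (LINT r:{u<..t}|lborel. le e r)"
  and "0 <= (LINT r:{u<..t}|lborel. le e r)"
proof -
 have nn: "0 <= indicator {u<..t} r *\<^sub>R le e r" for r
  using lam_nonneg[OF good_path[of r]] u by (auto simp: indicator_def)
 have "(\<integral>\<^sup>+r\<in>{u<..t}. ennreal (intensity T c K q S (Y r) e) \<partial>lborel) = (\<integral>\<^sup>+r. ennreal (indicator {u<..t} r *\<^sub>R le e r) \<partial>lborel)"
  by (intro nn_integral_cong) (use intensity_hat[OF good_path] u in \<open>auto simp: indicator_def\<close>)
 also have "\<dots> = ennreal (LINT r:{u<..t}|lborel. le e r)"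
  unfolding set_lebesgue_integral_def
  by (rule nn_integral_eq_integral) (use intensity_set_integrable[OF u] nn in \<open>auto simp: set_integrable_def\<close>)
 finally show "(\<integral>\<^sup>+r\<in>{u<..t}. ennreal (intensity T c K q S (Y r) e) \<partial>lborel) = ennreal (LINT r:{u<..t}|lborel. le e r)" .
 show "0 <= (LINT r:{u<..t}|lborel. le e r)"
  unfolding set_lebesgue_integral_def by (rule Bochner_Integration.integral_nonneg) (rule nn)
qed

lemma intensity_integral_le:
 assumes u: "0 <= u" "u <= t" and W: "!!r. r \<in> {0..t} ==> le e r <= W"
 shows "(LINT r:{u<..t}|lborel. le e r) <= W * (t - u)"
proof -
 have "(LINT r:{u<..t}|lborel. le e r) <= (LINT r:{u<..t}|lborel. W)"
  by (rule set_integral_mono[OF intensity_set_integrable[OF u]]) (use W u in \<open>auto simp: set_integrable_def\<close>)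
 also have "\<dots> = W * (t - u)" using u by (simp add: set_lebesgue_integral_def)
 finally show ?thesis .
qed

end
end

section \<open>The expectation of the QBD-RAP process\<close>

text \<open>The assumption says that the conditional expectation of \<open>g\<close> given
  \<open>F\<close> vanishes, and the bounded \<open>V\<close> is known given
  \<open>F\<close>.\<close>

lemma integral_mult_subalgebra_eq_0:
 fixes g V :: "'a => real"
 assumes M: "prob_space M" and F: "subalgebra M F" and g: "integrable M g"
  and V: "V \<in> borel_measurable F" "!!om. om \<in> space M ==> \<bar>V om\<bar> <= C"
  and zero: "!!X. X \<in> sets F ==> (\<integral>om\<in>X. g om \<partial>M) = 0"
 shows "integrable M (\<lambda>om. V om * g om)" and "(\<integral>om. V om * g om \<partial>M) = 0"
proof -
 interpret prob_space M by (rule M)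
 interpret finite_measure_subalgebra M F by unfold_locales (rule F)
 have VM: "V \<in> borel_measurable M" by (rule measurable_from_subalg[OF F V(1)])
 show int: "integrable M (\<lambda>om. V om * g om)"
 proof (rule Bochner_Integration.integrable_bound)
  show "integrable M (\<lambda>om. C * \<bar>g om\<bar>)" using g by simp
  show "(\<lambda>om. V om * g om) \<in> borel_measurable M" using VM g by simp
  show "AE om in M. norm (V om * g om) <= norm (C * \<bar>g om\<bar>)"
  proof (rule AE_I2)
   fix om assume "om \<in> space M"
   then have "\<bar>V om\<bar> <= \<bar>C\<bar>" using V(2)[of om] by linarith
   then show "norm (V om * g om) <= norm (C * \<bar>g om\<bar>)" by (simp add: abs_mult mult_right_mono)
  qed
 qed
 have "AE om in M. real_cond_exp M F g om = 0"
  by (rule real_cond_exp_charact) (use zero g in \<open>auto simp: set_lebesgue_integral_def\<close>)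
 then have "AE om in M. V om * real_cond_exp M F g om = 0" by eventually_elim simp
 then have "(\<integral>om. V om * real_cond_exp M F g om \<partial>M) = 0" by (rule integral_eq_zero_AE)
 then show "(\<integral>om. V om * g om \<partial>M) = 0"
  using real_cond_exp_intg(2)[OF int V(1)] g by simp
qed

context qbd_scheme begin

lemma hat_unit: "(k, i, n) \<in> idx ==> hat w (k, i, unit_vec n) = w (k, i, n)"
 and good_unit: "(k, i, n) \<in> idx ==> good (k, i, unit_vec n)"
proof -
 assume x: "(k, i, n) \<in> idx"
 note u = unit_dot
 from x show "hat w (k, i, unit_vec n) = w (k, i, n)"
 proof (cases rule: idx_cases)
  case (inner k' i' n')
  then show ?thesis using u[of n "\<lambda>n. w (k, i, n)"] by (simp add: hat_inner)
 qed (auto simp: hat_def)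
 from x show "good (k, i, unit_vec n)"
 proof (cases rule: idx_cases)
  case (inner k' i' n')
  have "unit_vec n = restrict_row q (unit_vec n)" using inner by (auto simp: restrict_row_def unit_vec_def fun_eq_iff)
  then show ?thesis using inner u[of n "\<lambda>_. 1"] cone_unit[of n] by (simp add: good_def valid_state_def)
 qed (auto simp: good_def valid_state_def)
qed

text \<open>Each summand of the compensated sum is a factor known at the start of its interval times
  the increment of a compensated count, so its mean is 0. Refining the partition under a common
  dominating function gives mean 0 to the change of the backward solution between times 0 and
  \<open>t\<close>.\<close>

theorem qbd_rap_expectation:
 fixes N :: "'v measure"
 assumes rap: "qbd_rap N T c K q \<alpha> S D (k, i, n) L A \<psi>" and x: "(k, i, n) \<in> idx" and t0: "0 <= t"
 shows "(\<integral>om. hat w0 (L t om, \<psi> t om, A t om) \<partial>N) = mat_vec idx (mat_exp idx B t) w0 (k, i, n)"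
  and "om \<in> space N ==> good (L t om, \<psi> t om, A t om)"
proof -
 define Y where "Y = (\<lambda>om t. (L t om, \<psi> t om, A t om))"
 have N: "prob_space N"
  and meas: "!!t. 0 <= t ==> L t \<in> measurable N (count_space UNIV)" "!!t. 0 <= t ==> \<psi> t \<in> measurable N (count_space UNIV)"
   "!!t m. 0 <= t ==> (\<lambda>om. A t om m) \<in> borel_measurable N"
  and Y0: "!!om. om \<in> space N ==> Y om 0 = (k, i, unit_vec n)"
  and pth: "!!om. om \<in> space N ==> qbd_path c K q \<alpha> S D (Y om)"
  and cnt: "!!e u t. 0 <= u ==> u <= t ==> (\<lambda>om. real (event_count c K q \<alpha> D (Y om) e u t)) \<in> borel_measurable N"
  and comp: "!!e u t X. 0 <= u ==> u <= t ==> X \<in> history N L \<psi> A u ==>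
      (\<integral>\<^sup>+om\<in>X. ennreal (real (event_count c K q \<alpha> D (Y om) e u t)) \<partial>N) =
      (\<integral>\<^sup>+om\<in>X. (\<integral>\<^sup>+r\<in>{u<..t}. ennreal (intensity T c K q S (Y om r) e) \<partial>lborel) \<partial>N)"
  using rap unfolding qbd_rap_def prod.case Let_def Y_def by auto
 interpret N: prob_space N by (rule N)
 have path: "scheme_path Q Z \<Delta> \<epsilon> q \<alpha> S \<tau> T c b K (Y om)" if "om \<in> space N" for om
  by (intro scheme_path.intro qbd_scheme_axioms scheme_path_axioms.intro pth[OF that])
    (simp add: Y0[OF that] good_unit[OF x])
 have goodY: "good (Y om u)" if "om \<in> space N" "0 <= u" for om u
  by (rule scheme_path.good_path[OF path[OF that(1)] that(2)])
 show "om \<in> space N ==> good (L t om, \<psi> t om, A t om)"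
  using goodY[OF _ t0, of om] by (simp add: Y_def)
 \<comment> \<open>The generators of the history, so that the history up to \<open>u\<close> becomes
   the measure space \<open>F u\<close> for conditioning.\<close>
 define gens where "gens = (\<lambda>u. {{om\<in>space N. L v om = k \<and> \<psi> v om = i \<and> A v om n <= x} | v k i n x. v \<in> {0..u}})"
 define F where "F = (\<lambda>u. sigma (space N) (gens u))"
 have gens_Pow: "gens u \<subseteq> Pow (space N)" for u by (auto simp: gens_def)
 have space_F: "space (F u) = space N" for u by (simp add: F_def space_measure_of[OF gens_Pow])
 have sets_F: "sets (F u) = history N L \<psi> A u" for u
  unfolding F_def sets_measure_of[OF gens_Pow] history_def by (simp only: gens_def)
 have sub: "subalgebra N (F u)" for u
 proof -
  have "X \<in> sets N" if X: "X \<in> gens u" for X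
  proof -
   obtain v k i n x where X: "X = {om\<in>space N. L v om = k \<and> \<psi> v om = i \<and> A v om n <= x}" and v: "0 <= v"
    using \<open>X \<in> gens u\<close> by (auto simp: gens_def)
   note [measurable] = meas[OF v]
   show ?thesis unfolding X by measurable
  qed
  then have "sigma_sets (space N) (gens u) \<subseteq> sets N" by (intro sets.sigma_sets_subset) auto
  then show ?thesis unfolding subalgebra_def space_F by (simp add: F_def sets_measure_of[OF gens_Pow])
 qed
 have gen_in: "{om\<in>space N. L u om = l \<and> \<psi> u om = j \<and> A u om m <= y} \<in> sets (F u)" if "0 <= u" for u l j m y
 proof -
  have "{om\<in>space N. L u om = l \<and> \<psi> u om = j \<and> A u om m <= y} \<in> gens u"
   unfolding gens_def
   by (intro CollectI exI[of _ u] exI[of _ l] exI[of _ j] exI[of _ m] exI[of _ y] conjI refl) (use that in simp)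
  then show ?thesis by (simp add: F_def sets_measure_of[OF gens_Pow])
 qed
 have hatF: "(\<lambda>om. hat v (Y om u)) \<in> borel_measurable (F u)" if u: "0 <= u" for v u
 proof -
  have 1: "(\<lambda>om. A u om m * of_bool (L u om = l \<and> \<psi> u om = j)) \<in> borel_measurable (F u)" for l j m
   unfolding borel_measurable_iff_le space_F
  proof
   fix y :: real
   let ?E = "\<lambda>y. {om\<in>space N. L u om = l \<and> \<psi> u om = j \<and> A u om m <= y}"
   \<comment> \<open>Generators bound an orbit entry as well; the union over growing bounds frees
     level and phase from it. For \<open>0 <= y\<close> the complement belongs to the set, as the
     product vanishes there.\<close>
   have "(\<Union>z::nat. ?E (real z)) \<in> sets (F u)" by (intro sets.countable_UN) (use gen_in[OF u] in auto)
   also have "(\<Union>z::nat. ?E (real z)) = {om\<in>space N. L u om = l \<and> \<psi> u om = j}"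
    using real_arch_simple by auto
   finally have "space (F u) - {om\<in>space N. L u om = l \<and> \<psi> u om = j} \<in> sets (F u)" by (rule sets.compl_sets)
   then have "?E y \<union> (if 0 <= y then space N - {om\<in>space N. L u om = l \<and> \<psi> u om = j} else {}) \<in> sets (F u)"
    using gen_in[OF u] by (auto simp: space_F)
   also have "?E y \<union> (if 0 <= y then space N - {om\<in>space N. L u om = l \<and> \<psi> u om = j} else {})
    = {om\<in>space N. A u om m * of_bool (L u om = l \<and> \<psi> u om = j) <= y}"
    by (auto simp: of_bool_def)
   finally show "{om\<in>space N. A u om m * of_bool (L u om = l \<and> \<psi> u om = j) <= y} \<in> sets (F u)" .
  qed
  have 2: "hat v (Y om u) = (\<Sum>(l, j, m)\<in>idx. A u om m * of_bool (L u om = l \<and> \<psi> u om = j) * v (l, j, m))"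
   if "om \<in> space N" for om
   using hat_idx_sum[of "L u om" "\<psi> u om" "A u om" v] goodY[OF that u] by (simp add: Y_def)
  have "(\<lambda>om. \<Sum>(l, j, m)\<in>idx. A u om m * of_bool (L u om = l \<and> \<psi> u om = j) * v (l, j, m)) \<in> borel_measurable (F u)"
   unfolding case_prod_beta by (intro borel_measurable_sum borel_measurable_times 1 borel_measurable_const)
  then show ?thesis
   by (rule measurable_cong[THEN iffD1, rotated]) (simp add: 2 space_F)
 qed
 have hatN: "(\<lambda>om. hat v (Y om u)) \<in> borel_measurable N" if u: "0 <= u" for v u
  by (rule measurable_from_subalg[OF sub hatF[OF u]])
 show "(\<integral>om. hat w0 (L t om, \<psi> t om, A t om) \<partial>N) = mat_vec idx (mat_exp idx B t) w0 (k, i, n)"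
 proof (cases "t = 0")
  case True
  have "(\<integral>om. hat w0 (L t om, \<psi> t om, A t om) \<partial>N) = (\<integral>om. w0 (k, i, n) \<partial>N)"
   by (rule Bochner_Integration.integral_cong) (use Y0 True in \<open>auto simp: Y_def hat_unit[OF x]\<close>)
  also have "\<dots> = w0 (k, i, n)" by (simp add: N.prob_space)
  finally show ?thesis
   using sum_mat_one_left[OF finite_idx x, of w0] unfolding True mat_exp_0 mat_vec_def by simp
 next
  case False
  then have t: "0 < t" using t0 by simp
  define La where "La = (\<lambda>e u v om. LINT r:{u<..v}|lborel. hat (lam e) (Y om r))"
  define Nc where "Nc = (\<lambda>e u v om. real (event_count c K q \<alpha> D (Y om) e u v))"
  obtain Wl where Wl: "!!e y. good y ==> \<bar>hat (lam e) y\<bar> <= Wl e"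
  proof -
   have "\<exists>W. \<forall>y. good y \<longrightarrow> \<bar>hat (lam e) y\<bar> <= W" for e
   proof -
    obtain W where W: "0 <= W" "!!u y. u \<in> {0..0::real} ==> good y ==> \<bar>hat (lam e) y\<bar> <= W"
     using hat_family_bounded[of "\<lambda>_. lam e" 0] continuous_const by blast
    show ?thesis by (intro exI[of _ W] allI impI W(2)[of 0]) simp_all
   qed
   then show ?thesis using that by metis
  qed
  have La_nonneg: "0 <= La e u v om" and La_eq: "(\<integral>\<^sup>+r\<in>{u<..v}. ennreal (intensity T c K q S (Y om r) e) \<partial>lborel) = ennreal (La e u v om)"
   and La_le: "La e u v om <= Wl e * (v - u)"
   if "om \<in> space N" "0 <= u" "u < v" for e u v om
  proof -
   have uv: "0 < v" "u <= v" using that by auto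
   note P = path[OF that(1)]
   show "0 <= La e u v om" "(\<integral>\<^sup>+r\<in>{u<..v}. ennreal (intensity T c K q S (Y om r) e) \<partial>lborel) = ennreal (La e u v om)"
    unfolding La_def by (rule scheme_path.intensity_integral[OF P uv(1) that(2) uv(2)])+
   show "La e u v om <= Wl e * (v - u)"
    unfolding La_def
   proof (rule scheme_path.intensity_integral_le[OF P uv(1) that(2) uv(2)])
    fix r assume "r \<in> {0..v}"
    then show "hat (lam e) (Y om r) <= Wl e" using Wl[OF goodY[OF that(1), of r], of e] by auto
   qed
  qed
  have La_meas: "La e u v \<in> borel_measurable N" if "0 <= u" "u < v" for e u v
  proof (rule borel_measurable_LIMSEQ_real)
   have v: "0 < v" using that by simp
   show "(\<lambda>m. \<Sum>l<m. hat (lam e) (Y om (part u v m l)) * ((v - u) / real m)) \<longlonglongrightarrow> La e u v om"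
    if "om \<in> space N" for om
    unfolding La_def by (rule scheme_path.intensity_riemann[OF path[OF that] v \<open>0 <= u\<close> \<open>u < v\<close>])
   show "(\<lambda>om. \<Sum>l<m. hat (lam e) (Y om (part u v m l)) * ((v - u) / real m)) \<in> borel_measurable N" for m
    using that by (intro borel_measurable_sum borel_measurable_times hatN borel_measurable_const) auto
  qed
  have La_int: "integrable N (La e u v)" if "0 <= u" "u < v" for e u v
   by (rule N.integrable_const_bound[where B = "Wl e * (v - u)"])
     (use La_meas[OF that] La_nonneg[OF _ that] La_le[OF _ that] in auto)
  have comp': "(\<integral>\<^sup>+om\<in>X. ennreal (Nc e u v om) \<partial>N) = (\<integral>\<^sup>+om\<in>X. ennreal (La e u v om) \<partial>N)"
   if "0 <= u" "u < v" "X \<in> history N L \<psi> A u" for e u v X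
  proof -
   have "(\<integral>\<^sup>+om\<in>X. ennreal (Nc e u v om) \<partial>N) = (\<integral>\<^sup>+om\<in>X. (\<integral>\<^sup>+r\<in>{u<..v}. ennreal (intensity T c K q S (Y om r) e) \<partial>lborel) \<partial>N)"
    unfolding Nc_def by (rule comp) (use that in auto)
   also have "\<dots> = (\<integral>\<^sup>+om\<in>X. ennreal (La e u v om) \<partial>N)"
    by (rule nn_integral_cong) (simp only: La_eq[OF _ that(1,2)])
   finally show ?thesis .
  qed
  have Nc_meas: "Nc e u v \<in> borel_measurable N" if "0 <= u" "u < v" for e u v
   unfolding Nc_def using cnt[of u v e] that by simp
  have Nc_nonneg: "0 <= Nc e u v om" for e u v om by (simp add: Nc_def)
  \<comment> \<open>Finiteness of the expected count is not assumed: the intensity property on the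
    whole space equates it with the bounded integrated intensity.\<close>
  have Nc_int: "integrable N (Nc e u v)" if uv: "0 <= u" "u < v" for e u v
  proof (rule integrableI_nonneg[OF Nc_meas[OF uv]])
   have s: "(\<integral>\<^sup>+om\<in>space N. ennreal (g om) \<partial>N) = (\<integral>\<^sup>+om. ennreal (g om) \<partial>N)" for g
    by (rule nn_integral_cong) simp
   have "space N \<in> history N L \<psi> A u" unfolding history_def by (rule sigma_sets_top)
   from comp'[OF uv this, of e] have "(\<integral>\<^sup>+om. ennreal (Nc e u v om) \<partial>N) = (\<integral>\<^sup>+om. ennreal (La e u v om) \<partial>N)"
    unfolding s .
   also have "\<dots> = ennreal (\<integral>om. La e u v om \<partial>N)"
    by (rule nn_integral_eq_integral[OF La_int[OF uv]]) (use La_nonneg[OF _ uv] in auto)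
   also have "\<dots> < \<infinity>" by simp
   finally show "(\<integral>\<^sup>+om. ennreal (Nc e u v om) \<partial>N) < \<infinity>" .
  qed (use Nc_nonneg in auto)
  have set_eq: "(\<integral>om\<in>X. Nc e u v om - La e u v om \<partial>N) = 0" if uv: "0 <= u" "u < v" and X: "X \<in> sets (F u)" for e u v X
  proof -
   have XN: "X \<in> sets N" using X sub[of u] by (auto simp: subalgebra_def)
   have nn: "(\<integral>om\<in>X. g om \<partial>N) = enn2real (\<integral>\<^sup>+om\<in>X. ennreal (g om) \<partial>N)"
    if "g \<in> borel_measurable N" "!!om. om \<in> space N ==> 0 <= g om" for g
   proof -
    have "(\<integral>om\<in>X. g om \<partial>N) = enn2real (\<integral>\<^sup>+om. ennreal (indicator X om *\<^sub>R g om) \<partial>N)"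
     unfolding set_lebesgue_integral_def
     by (rule integral_eq_nn_integral) (use that XN in \<open>auto simp: indicator_def\<close>)
    also have "(\<integral>\<^sup>+om. ennreal (indicator X om *\<^sub>R g om) \<partial>N) = (\<integral>\<^sup>+om\<in>X. ennreal (g om) \<partial>N)"
     by (rule nn_integral_cong) (simp add: indicator_def)
    finally show ?thesis .
   qed
   have "(\<integral>om\<in>X. Nc e u v om - La e u v om \<partial>N) = (\<integral>om\<in>X. Nc e u v om \<partial>N) - (\<integral>om\<in>X. La e u v om \<partial>N)"
    by (rule set_integral_diff(2); unfold set_integrable_def; intro integrable_mult_indicator XN Nc_int[OF uv] La_int[OF uv])
   also have "(\<integral>om\<in>X. Nc e u v om \<partial>N) = (\<integral>om\<in>X. La e u v om \<partial>N)"
    using nn[OF Nc_meas[OF uv] Nc_nonneg, of e] nn[OF La_meas[OF uv] La_nonneg[OF _ uv], of e] comp'[OF uv X[unfolded sets_F], of e] by simp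
   finally show ?thesis by simp
  qed
  obtain W where W: "!!e u y. u \<in> {0..t} ==> good y ==> \<bar>hat (jv t w0 e u) y\<bar> <= W" "0 <= W"
  proof -
   have "\<exists>W. \<forall>u\<in>{0..t}. \<forall>y. good y \<longrightarrow> \<bar>hat (jv t w0 e u) y\<bar> <= W" for e
   proof -
    obtain W where "0 <= W" "!!u y. u \<in> {0..t} ==> good y ==> \<bar>hat (jv t w0 e u) y\<bar> <= W"
     using hat_family_bounded[of "jv t w0 e" t] jv_isCont by blast
    then show ?thesis by blast
   qed
   then obtain V where V: "!!e u y. u \<in> {0..t} ==> good y ==> \<bar>hat (jv t w0 e u) y\<bar> <= V e" by metis
   show ?thesis
   proof (rule that[of "\<Sum>e\<in>UNIV. \<bar>V e\<bar>"])
    fix e u y assume "u \<in> {0..t}" "good y"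
    then have "\<bar>hat (jv t w0 e u) y\<bar> <= \<bar>V e\<bar>" using V[of u y e] by linarith
    also have "\<bar>V e\<bar> <= (\<Sum>e\<in>UNIV. \<bar>V e\<bar>)" by (rule member_le_sum) auto
    finally show "\<bar>hat (jv t w0 e u) y\<bar> <= (\<Sum>e\<in>UNIV. \<bar>V e\<bar>)" .
   qed (simp add: sum_nonneg)
  qed
  have summand: "integrable N (\<lambda>om. hat (jv t w0 e u) (Y om u) * (Nc e u v om - La e u v om))"
    "(\<integral>om. hat (jv t w0 e u) (Y om u) * (Nc e u v om - La e u v om) \<partial>N) = 0"
   if uv: "0 <= u" "u < v" "u <= t" for e u v
  proof -
   have g: "integrable N (\<lambda>om. Nc e u v om - La e u v om)"
    by (intro Bochner_Integration.integrable_diff Nc_int La_int uv)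
   have bd: "\<bar>hat (jv t w0 e u) (Y om u)\<bar> <= W" if "om \<in> space N" for om
    by (rule W(1)[OF _ goodY[OF that uv(1)]]) (use uv in simp)
   note z = integral_mult_subalgebra_eq_0[OF N sub[of u] g hatF[OF uv(1)] bd set_eq[OF uv(1,2)]]
   show "integrable N (\<lambda>om. hat (jv t w0 e u) (Y om u) * (Nc e u v om - La e u v om))"
    "(\<integral>om. hat (jv t w0 e u) (Y om u) * (Nc e u v om - La e u v om) \<partial>N) = 0"
    using z by simp_all
  qed
  define H where "H = (\<lambda>m e l om. hat (jv t w0 e (part 0 t m l)) (Y om (part 0 t m l)) *
    (Nc e (part 0 t m l) (part 0 t m (Suc l)) om
    - La e (part 0 t m l) (part 0 t m (Suc l)) om))"
  define Cm where "Cm = (\<lambda>m om. \<Sum>e\<in>UNIV. \<Sum>l<m. H m e l om)"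
  have times: "0 <= part 0 t m l" "part 0 t m l < part 0 t m (Suc l)"
   "part 0 t m l <= t" if "l < m" for l m
  proof -
   have h: "0 < (t - 0) / real m" "real m * ((t - 0) / real m) = t" using t that by auto
   show "0 <= part 0 t m l"
    unfolding add_0 by (rule mult_nonneg_nonneg[OF of_nat_0_le_iff less_imp_le[OF h(1)]])
   show "part 0 t m l < part 0 t m (Suc l)"
    unfolding add_0 by (rule mult_strict_right_mono[OF _ h(1)]) simp
   have "real l * ((t - 0) / real m) <= real m * ((t - 0) / real m)" using that h by (intro mult_right_mono) auto
   then show "part 0 t m l <= t" using h by simp
  qed
  have H_int: "integrable N (H m e l)" and H_0: "(\<integral>om. H m e l om \<partial>N) = 0" if "l < m" for m e l
   unfolding H_def by (rule summand[OF times[OF that]])+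
  have Cm_int: "integrable N (Cm m)" for m
   unfolding Cm_def by (intro Bochner_Integration.integrable_sum H_int) simp
  have Cm_0: "(\<integral>om. Cm m om \<partial>N) = 0" for m
  proof -
   have "(\<integral>om. Cm m om \<partial>N) = (\<Sum>e\<in>UNIV. \<integral>om. (\<Sum>l<m. H m e l om) \<partial>N)"
    unfolding Cm_def by (rule Bochner_Integration.integral_sum) (intro Bochner_Integration.integrable_sum H_int, simp)
   also have "\<dots> = (\<Sum>e\<in>UNIV. \<Sum>l<m. \<integral>om. H m e l om \<partial>N)"
    by (intro sum.cong refl Bochner_Integration.integral_sum H_int) simp
   also have "\<dots> = 0" by (intro sum.neutral ballI H_0) simp
   finally show ?thesis .
  qed
  let ?l = "\<lambda>om. hat w0 (Y om t) - mat_vec idx (mat_exp idx B t) w0 (k, i, n)"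
  have lim: "(\<lambda>m. Cm m om) \<longlonglongrightarrow> ?l om" if om: "om \<in> space N" for om
  proof -
   have "hat (wv t w0 t) (Y om t) = hat w0 (Y om t)"
   proof (rule hat_cong[OF goodY[OF om t0]])
    fix y assume "y \<in> idx"
    then show "wv t w0 t y = w0 y"
     using sum_mat_one_left[OF finite_idx, of y w0] by (simp add: wv_def mat_exp_0 mat_vec_def)
   qed
   moreover have "hat (wv t w0 0) (Y om 0) = mat_vec idx (mat_exp idx B t) w0 (k, i, n)"
    using x by (simp add: Y0[OF om] hat_unit[OF x] wv_def)
   ultimately show ?thesis
    using scheme_path.compensated_tendsto[OF path[OF om] t, of w0] unfolding Cm_def H_def Nc_def La_def by simp
  qed
  let ?w = "\<lambda>om. W * (\<Sum>e\<in>UNIV. Nc e 0 t om + La e 0 t om)"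
  \<comment> \<open>A partition into at least one interval is needed for the dominating bound, hence
    \<open>Suc m\<close>.\<close>
  have "(\<lambda>m. \<integral>om. Cm (Suc m) om \<partial>N) \<longlonglongrightarrow> (\<integral>om. ?l om \<partial>N)"
  proof (rule integral_dominated_convergence[where w = ?w])
   show "integrable N ?w"
    by (intro integrable_mult_right Bochner_Integration.integrable_sum Bochner_Integration.integrable_add Nc_int La_int order_refl t)
   show "?l \<in> borel_measurable N" using hatN[OF t0] by simp
   show "AE om in N. (\<lambda>m. Cm (Suc m) om) \<longlonglongrightarrow> ?l om" using lim by (auto intro!: LIMSEQ_Suc)
   show "AE om in N. norm (Cm (Suc m) om) <= ?w om" for m
   proof (rule AE_I2)
    fix om assume om: "om \<in> space N"
    have "\<bar>Cm (Suc m) om\<bar> <= ?w om"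
     unfolding Cm_def H_def Nc_def La_def
     by (rule scheme_path.compensated_bounded[OF path[OF om] t _ W(2)])
       (use W(1) goodY[OF om] in auto)
    then show "norm (Cm (Suc m) om) <= ?w om" by simp
   qed
  qed (use Cm_int in auto)
  then have "(\<integral>om. ?l om \<partial>N) = 0" unfolding Cm_0 by (simp add: LIMSEQ_const_iff)
  moreover have "integrable N (\<lambda>om. hat w0 (Y om t))"
  proof -
   obtain V where V: "0 <= V" "!!u y. u \<in> {0..t} ==> good y ==> \<bar>hat w0 y\<bar> <= V"
    using hat_family_bounded[of "\<lambda>_. w0" t] continuous_const by blast
   show ?thesis
    by (rule N.integrable_const_bound[where B = V]) (use V(2)[of t] t0 hatN[OF t0] goodY[OF _ t0] in auto)
  qed
  ultimately show ?thesis by (simp add: Y_def N.prob_space)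
 qed
qed

lemma qbd_matrix_value_eq:
 assumes x: "y \<in> idx"
 shows "qbd_matrix_value T c b K q \<alpha> S D y t f = mat_vec idx (mat_exp idx B t) (Vop f) y"
proof -
 have "vec_mat idx (unit_vec y) (mat_exp idx B t) z = mat_exp idx B t y z" for z
 proof -
  have "unit_vec y = mat_one y" by (auto simp: unit_vec_def mat_one_def fun_eq_iff)
  then show ?thesis using sum_mat_one_left[OF finite_idx x, of "\<lambda>x. mat_exp idx B t x z"] by (simp add: vec_mat_def)
 qed
 then show ?thesis by (simp add: qbd_matrix_value_def dot_def mat_vec_def)
qed

lemma qbd_expectation_eq:
 fixes N :: "'v measure"
 assumes rap: "qbd_rap N T c K q \<alpha> S D (k, i, n) L A \<psi>" and x: "(k, i, n) \<in> idx" and t: "0 <= t"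
 shows "qbd_expectation N c b K q S L A \<psi> t f = qbd_matrix_value T c b K q \<alpha> S D (k, i, n) t f"
proof -
 have "qbd_expectation N c b K q S L A \<psi> t f = (\<integral>om. hat (Vop f) (L t om, \<psi> t om, A t om) \<partial>N)"
  unfolding qbd_expectation_def
  by (intro Bochner_Integration.integral_cong refl) (rule hat_idx_sum[OF qbd_rap_expectation(2)[OF rap x t]])
 then show ?thesis by (simp only: qbd_rap_expectation(1)[OF rap x t] qbd_matrix_value_eq[OF x])
qed

end

section \<open>Passage to the limit\<close>

text \<open>The test function is given on \<open>[0, b]\<close>, while \<open>lipb\<close> and the
  comparison columns use the whole line; composing with this projection extends it without changing
  bounds or continuity.\<close>

definition clampb :: "real => real => real" where
 "clampb b x = max 0 (min b x)"

lemma clampb: "0 < b ==> clampb b x \<in> {0..b}" "x \<in> {0..b} ==> clampb b x = x"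
 "\<bar>clampb b x - clampb b y\<bar> <= \<bar>x - y\<bar>" "continuous_on X (clampb b)"
 by (auto simp: clampb_def[abs_def] intro!: continuous_intros)

text \<open>A Weierstrass polynomial has a bounded derivative on the interval, and composing it with
  the nonexpansive \<open>clampb\<close> makes it bounded and Lipschitz on the whole line.\<close>

lemma lipschitz_approx:
 fixes g :: "real => real"
 assumes b: "0 < b" and g: "continuous_on {0..b} g" and e: "0 < e"
 obtains p L C where "!!x y. \<bar>p x - p y\<bar> <= L * \<bar>x - y\<bar>" "!!x. \<bar>p x\<bar> <= C"
  "!!x. \<bar>g (clampb b x) - p x\<bar> <= e"
proof -
 obtain r where r: "polynomial_function r" "!!x. x \<in> {0..b} ==> norm (g x - r x) < e"
  using Stone_Weierstrass_polynomial_function[OF _ g e] by auto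
 obtain r' where r': "polynomial_function r'" "!!x. (r has_vector_derivative r' x) (at x)"
  using has_vector_derivative_polynomial_function[OF r(1)] by blast
 have bdd: "\<exists>C. \<forall>x\<in>{0..b}. \<bar>h x\<bar> <= C" if "polynomial_function h" for h :: "real => real"
 proof -
  have "bounded (h ` {0..b})"
   by (intro compact_imp_bounded compact_continuous_image continuous_on_polymonial_function that) auto
  then show ?thesis by (auto simp: bounded_iff)
 qed
 obtain L where L: "!!x. x \<in> {0..b} ==> \<bar>r' x\<bar> <= L" using bdd[OF r'(1)] by blast
 obtain C where C: "!!x. x \<in> {0..b} ==> \<bar>r x\<bar> <= C" using bdd[OF r(1)] by blast
 have L0: "0 <= L" using L[of 0] b by (auto intro: order_trans[OF abs_ge_zero])
 show ?thesis
 proof (rule that[of "\<lambda>x. r (clampb b x)" L C])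
  fix x y
  have "norm (r (clampb b x) - r (clampb b y)) <= L * norm (clampb b x - clampb b y)"
   by (rule field_differentiable_bound[of "{0..b}" r r'])
     (use r'(2) L clampb(1)[OF b] in \<open>auto simp: has_real_derivative_iff_has_vector_derivative intro: has_vector_derivative_at_within\<close>)
  also have "\<dots> <= L * \<bar>x - y\<bar>" using clampb(3)[of b x y] L0 by (auto intro: mult_left_mono)
  finally show "\<bar>r (clampb b x) - r (clampb b y)\<bar> <= L * \<bar>x - y\<bar>" by simp
  show "\<bar>r (clampb b x)\<bar> <= C" by (rule C[OF clampb(1)[OF b]])
  show "\<bar>g (clampb b x) - r (clampb b x)\<bar> <= e" using r(2)[OF clampb(1)[OF b], of x] by simp
 qed
qed

text \<open>\<open>bound\<close> with the constants of the scheme written out, so that it is an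
  explicit function of \<open>\<epsilon>\<close> and can be compared across schemes.\<close>

definition err_bound :: "real => real => real => real => real => real => real => real => real => real" where
 "err_bound t c1 \<epsilon> \<Delta> tm l1 l2 l3 y0 =
   t * ((l1 + (y0 + t * l3) * \<epsilon>) / (1 / 2 - \<epsilon> / (2 * \<Delta>)) * c1 + (y0 + t * l3) * (tm * (\<epsilon> / (1 - \<epsilon>) + \<epsilon>)) + l2)
   + (l1 + (y0 + t * l3) * \<epsilon>) / (1 / 2 - \<epsilon> / (2 * \<Delta>)) + (y0 + t * l3) * (\<epsilon> / (1 - \<epsilon>))"

text \<open>The only denominators tend to 1/2 and 1; every summand has a factor that tends to
  0.\<close>

lemma err_bound_tendsto:
 assumes \<epsilon>: "\<epsilon> \<longlonglongrightarrow> 0" and \<Delta>: "0 < \<Delta>" and l: "l1 \<longlonglongrightarrow> 0" "l2 \<longlonglongrightarrow> 0"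
 shows "(\<lambda>p. err_bound t c1 (\<epsilon> p) \<Delta> tm (l1 p) (l2 p) l3 y0) \<longlonglongrightarrow> 0"
proof -
 have k: "(\<lambda>p. 1 / 2 - \<epsilon> p / (2 * \<Delta>)) \<longlonglongrightarrow> 1 / 2 - 0 / (2 * \<Delta>)"
  using \<Delta> by (intro tendsto_intros \<epsilon>) auto
 have e: "(\<lambda>p. \<epsilon> p / (1 - \<epsilon> p)) \<longlonglongrightarrow> 0 / (1 - 0)" by (intro tendsto_intros \<epsilon>) auto
 have "(\<lambda>p. err_bound t c1 (\<epsilon> p) \<Delta> tm (l1 p) (l2 p) l3 y0) \<longlonglongrightarrow>
   t * ((0 + (y0 + t * l3) * 0) / (1 / 2 - 0 / (2 * \<Delta>)) * c1 + (y0 + t * l3) * (tm * (0 / (1 - 0) + 0)) + 0)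
   + (0 + (y0 + t * l3) * 0) / (1 / 2 - 0 / (2 * \<Delta>)) + (y0 + t * l3) * (0 / (1 - 0))"
  unfolding err_bound_def by (intro tendsto_add tendsto_mult tendsto_divide[OF _ k] tendsto_const e \<epsilon> l) simp_all
 then show ?thesis by simp
qed

context qbd_scheme begin

lemma Vop_clampb:
 assumes "x \<in> idx" shows "Vop (\<lambda>x j. f (clampb b x) j) x = Vop f x"
 using assms
proof (cases rule: idx_cases)
 case (bottom i)
 then show ?thesis using b_pos by (simp add: Vop_bottom clampb_def)
next
 case (top i)
 then show ?thesis unfolding top(1) Vop_top using b_pos by (simp add: clampb_def)
next
 case (inner k i n)
 have "f (clampb b x) i = f x i" if "x \<in> cell c b K k i" for x
  using that gridpt_range[OF inner(2)] by (auto simp: cell_def clampb(2) split: if_splits)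
 then show ?thesis using inner
  by (auto simp: closing_op_def cell_def intro!: set_lebesgue_integral_cong)
qed

text \<open>The mesh part of the tolerance gives \<open>d = \<delta> / 2\<close>, and
  \<open>\<epsilon> < \<Delta>\<close> makes the drop \<open>\<kappa>\<close> positive; then
  \<open>scheme_error\<close> applies to the clamped test function.\<close>

lemma matrix_value_error:
 fixes \<phi> :: "real => 'w => 's"
 assumes \<epsilon>: "\<epsilon> < \<Delta>" and t: "0 <= t" and ini: "initial_index c b K q \<tau> x0 i k n" and tol: "has_tolerance \<delta> \<epsilon> q \<alpha> S \<tau>"
  and h: "lipb L C h" and fq: "fluid_queue M T c b x0 i X \<phi>"
  and cont: "!!i. continuous_on {0..b} (\<lambda>x. f x i)" and gf: "!!x i. \<bar>f (clampb b x) i - h x i\<bar> <= e"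
 shows "\<bar>qbd_matrix_value T c b K q \<alpha> S D (k, i, n) t f - (\<integral>om. h (X t om) (\<phi> t om) \<partial>M)\<bar>
  <= e + (L * (\<epsilon> / (1 - \<epsilon>) + \<delta> / 2) + err_bound t (cm / (2 * \<Delta>) + tm) \<epsilon> \<Delta> tm (L * \<epsilon>) (L * (tm * (\<epsilon> / (1 - \<epsilon>) + \<epsilon>))) (L * tm) 0
    + err_bound t (cm / (2 * \<Delta>) + tm) \<epsilon> \<Delta> tm 0 0 0 (2 * L))"
proof -
 have x: "(k, i, n) \<in> idx" by (rule initial_in_idx[OF ini])
 have \<kappa>: "0 < \<kappa>" using \<epsilon> \<Delta>_pos by (simp add: \<kappa>_def field_simps)
 have d: "\<tau> (n + 1) - \<tau> n <= \<delta> / 2" if "n \<in> I" for n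
 proof -
  have "\<bar>\<tau> n - \<tau> (n + 1)\<bar> < \<delta> / 2" using tol that unfolding has_tolerance_def by blast
  then show ?thesis by linarith
 qed
 have cont': "continuous_on UNIV (\<lambda>x. f (clampb b x) i)" for i
  by (rule continuous_on_compose2[OF cont clampb(4)]) (use clampb(1)[OF b_pos] in auto)
 have "mat_vec idx (mat_exp idx B t) (Vop (\<lambda>x j. f (clampb b x) j)) = mat_vec idx (mat_exp idx B t) (Vop f)"
  by (rule mat_vec_cong) (rule Vop_clampb)
 then have "qbd_matrix_value T c b K q \<alpha> S D (k, i, n) t f = mat_vec idx (mat_exp idx B t) (Vop (\<lambda>x j. f (clampb b x) j)) (k, i, n)"
  by (simp add: qbd_matrix_value_eq[OF x])
 then show ?thesis
  using scheme_error[OF \<kappa> t ini h d fluid_queue_limit(1)[OF fq t h] cont' gf]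
  unfolding bound_def err_bound_def e1_def \<eta>2_def \<kappa>_def c1_def by simp
qed

end

theorem theorem5p5:
  fixes T :: "'s::finite \<Rightarrow> 's \<Rightarrow> real" and c :: "'s \<Rightarrow> real" and b :: real and K :: nat
    and Q :: "nat \<Rightarrow> 'z measure" and Z :: "nat \<Rightarrow> 'z \<Rightarrow> real"
    and q :: "nat \<Rightarrow> nat" and \<alpha> :: "nat \<Rightarrow> nat \<Rightarrow> real" and S :: "nat \<Rightarrow> nat \<Rightarrow> nat \<Rightarrow> real"
    and \<tau> :: "nat \<Rightarrow> nat \<Rightarrow> real" and \<delta> \<epsilon> :: "nat \<Rightarrow> real" and D :: "nat \<Rightarrow> nat \<Rightarrow> nat \<Rightarrow> real"
    and M :: "'w measure" and X :: "real \<Rightarrow> 'w \<Rightarrow> real" and \<phi> :: "real \<Rightarrow> 'w \<Rightarrow> 's"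
    and x0 t :: real and i :: 's and f :: "real \<Rightarrow> 's \<Rightarrow> real" and k n :: "nat \<Rightarrow> nat"
  assumes "generator T" and "\<And>j. c j \<noteq> 0" and "0 < b" and "1 \<le> K"
    and "\<And>p. \<epsilon> p = eps (Q p) (Z p)"
    and "\<And>p. me_construction (Q p) (Z p) (b / real K) (q p) (\<alpha> p) (S p) (\<tau> p)"
    and "\<And>p. has_tolerance (\<delta> p) (\<epsilon> p) (q p) (\<alpha> p) (S p) (\<tau> p)"
    and "\<And>p. D p = D_mat (b / real K) (\<epsilon> p) (q p) (\<alpha> p) (S p)"
    and "mono q"
    and "(\<lambda>p. prob_space.variance (Q p) (Z p)) \<longlonglongrightarrow> 0"
    and "\<delta> \<longlonglongrightarrow> 0"
    and "x0 \<in> {0..b}" and "0 \<le> t"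
    and "fluid_queue M T c b x0 i X \<phi>"
    and "\<And>p. initial_index c b K (q p) (\<tau> p) x0 i (k p) (n p)"
    and "\<And>j. continuous_on {0..b} (\<lambda>x. f x j)"
    and "\<exists>C. \<forall>x\<in>{0..b}. \<forall>j. \<bar>f x j\<bar> \<le> C"
  shows "(\<forall>(N :: nat \<Rightarrow> 'v measure) L A \<psi>.
            (\<forall>p. qbd_rap (N p) T c K (q p) (\<alpha> p) (S p) (D p) (k p, i, n p) (L p) (A p) (\<psi> p)) \<longrightarrow>
            (\<lambda>p. qbd_expectation (N p) c b K (q p) (S p) (L p) (A p) (\<psi> p) t f)
              \<longlonglongrightarrow> prob_space.expectation M (\<lambda>\<omega>. f (X t \<omega>) (\<phi> t \<omega>)) \<and>
            (\<forall>p. qbd_expectation (N p) c b K (q p) (S p) (L p) (A p) (\<psi> p) t f =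
                 qbd_matrix_value T c b K (q p) (\<alpha> p) (S p) (D p) (k p, i, n p) t f)) \<and>
         (\<lambda>p. qbd_matrix_value T c b K (q p) (\<alpha> p) (S p) (D p) (k p, i, n p) t f)
           \<longlonglongrightarrow> prob_space.expectation M (\<lambda>\<omega>. f (X t \<omega>) (\<phi> t \<omega>))"
proof -
 let ?\<Delta> = "b / real K"
 have \<Delta>: "0 < ?\<Delta>" using assms(3,4) by simp
 have scheme: "qbd_scheme (Q p) (Z p) ?\<Delta> (\<epsilon> p) (q p) (\<alpha> p) (S p) (\<tau> p) T c b K" for p
  by (intro qbd_scheme.intro me_scheme.intro qbd_scheme_axioms.intro assms(1-6) \<Delta> refl)
 have eq: "qbd_expectation N c b K (q p) (S p) L A \<psi> t f = qbd_matrix_value T c b K (q p) (\<alpha> p) (S p) (D p) (k p, i, n p) t f"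
  if "qbd_rap N T c K (q p) (\<alpha> p) (S p) (D p) (k p, i, n p) L A \<psi>" for N :: "'v measure" and L A \<psi> p
  unfolding assms(8)
  by (rule qbd_scheme.qbd_expectation_eq[OF scheme that[unfolded assms(8)]
     qbd_scheme.initial_in_idx[OF scheme assms(15)] assms(13)])
 have \<epsilon>0: "\<epsilon> \<longlonglongrightarrow> 0"
 proof -
  have "\<epsilon> = (\<lambda>p. root 3 (prob_space.variance (Q p) (Z p)))" using assms(5) by (simp add: eps_def fun_eq_iff)
  then show ?thesis using tendsto_real_root[OF assms(10), of 3] by simp
 qed
 interpret M: prob_space M using assms(14) by (simp add: fluid_queue_def ctmc_def)
 have X: "X t \<in> borel_measurable M" "\<phi> t \<in> measurable M (count_space UNIV)"
  and Xb: "!!om. om \<in> space M ==> X t om \<in> {0..b}"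
  using assms(13,14) by (auto simp: fluid_queue_def ctmc_def)
 obtain C where C: "!!x j. x \<in> {0..b} ==> \<bar>f x j\<bar> <= C" using assms(17) by blast
 \<comment> \<open>Joint measurability is obtained phase by phase: the phase takes finitely many
   values and each section is continuous after clamping.\<close>
 have f_int: "integrable M (\<lambda>om. f (clampb b (X t om)) (\<phi> t om))"
 proof (rule M.integrable_const_bound[where B = C])
  have "(\<lambda>x. f (clampb b x) j) \<in> borel_measurable borel" for j
   by (intro borel_measurable_continuous_onI continuous_on_compose2[OF assms(16) clampb(4)])
     (use clampb(1)[OF assms(3)] in auto)
  then have "(\<lambda>om. f (clampb b (X t om)) j) \<in> borel_measurable M" for j
   by (rule measurable_compose[OF X(1)])
  then show "(\<lambda>om. f (clampb b (X t om)) (\<phi> t om)) \<in> borel_measurable M"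
   by (rule measurable_compose_countable[OF _ X(2)])
 qed (use C clampb(1)[OF assms(3)] in auto)
 have Ef: "(\<integral>om. f (X t om) (\<phi> t om) \<partial>M) = (\<integral>om. f (clampb b (X t om)) (\<phi> t om) \<partial>M)"
  by (rule Bochner_Integration.integral_cong) (use Xb clampb(2) in auto)
 have lim: "(\<lambda>p. qbd_matrix_value T c b K (q p) (\<alpha> p) (S p) (D p) (k p, i, n p) t f)
   \<longlonglongrightarrow> (\<integral>om. f (X t om) (\<phi> t om) \<partial>M)"
 proof (rule LIMSEQ_I)
  fix e0 :: real assume "0 < e0"
  \<comment> \<open>One third each for replacing \<open>f\<close> by \<open>h\<close> in the scheme,
    replacing it in the fluid queue, and the error of the scheme for \<open>h\<close>.\<close>
  define e where "e = e0 / 3"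
  have e: "0 < e" using \<open>0 < e0\<close> by (simp add: e_def)
  have "\<exists>p L C. (\<forall>x y. \<bar>p x - p y\<bar> <= L * \<bar>x - y\<bar>) \<and> (\<forall>x. \<bar>p x\<bar> <= C) \<and> (\<forall>x. \<bar>f (clampb b x) j - p x\<bar> <= e)" for j
   by (rule lipschitz_approx[OF assms(3) assms(16)[of j] e]) blast
  then obtain h Lj Cj where h: "!!j x y. \<bar>h j x - h j y\<bar> <= Lj j * \<bar>x - y\<bar>" "!!j x. \<bar>h j x\<bar> <= Cj j"
   "!!j x. \<bar>f (clampb b x) j - h j x\<bar> <= e" by metis
  \<comment> \<open>Sums over the phases turn the constants of the single approximations into common
    ones.\<close>
  define L where "L = (\<Sum>j\<in>UNIV. \<bar>Lj j\<bar>)"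
  define Ch where "Ch = (\<Sum>j\<in>UNIV. \<bar>Cj j\<bar>)"
  \<comment> \<open>\<open>lipb\<close> does not depend on the scheme; the instance at index 0 only
    gives access to its definition.\<close>
  have lip: "qbd_scheme.lipb L Ch (\<lambda>x j. h j x)"
   unfolding qbd_scheme.lipb_def[OF scheme[of 0]]
  proof (intro conjI allI)
   fix x y j
   have "Lj j <= L" unfolding L_def using member_le_sum[of j UNIV "\<lambda>j. \<bar>Lj j\<bar>"] by simp
   then show "\<bar>h j x - h j y\<bar> <= L * \<bar>x - y\<bar>" using h(1)[of j x y] mult_right_mono[of "Lj j" L "\<bar>x - y\<bar>"] by linarith
   have "Cj j <= Ch" unfolding Ch_def using member_le_sum[of j UNIV "\<lambda>j. \<bar>Cj j\<bar>"] by simp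
   then show "\<bar>h j x\<bar> <= Ch" using h(2)[of j x] by linarith
  qed
  let ?Eh = "\<integral>om. h (\<phi> t om) (X t om) \<partial>M"
  have h_int: "integrable M (\<lambda>om. h (\<phi> t om) (X t om))"
  proof (rule M.integrable_const_bound[where B = Ch])
   show "(\<lambda>om. h (\<phi> t om) (X t om)) \<in> borel_measurable M"
    by (rule qbd_scheme.fluid_queue_limit(2)[OF scheme[of 0] assms(14,13) lip])
   show "AE om in M. norm (h (\<phi> t om) (X t om)) <= Ch"
    using lip unfolding qbd_scheme.lipb_def[OF scheme[of 0]] by auto
  qed
  have "\<bar>(\<integral>om. f (clampb b (X t om)) (\<phi> t om) \<partial>M) - ?Eh\<bar> <= e"
  proof -
   have "(\<integral>om. f (clampb b (X t om)) (\<phi> t om) \<partial>M) - ?Eh = (\<integral>om. f (clampb b (X t om)) (\<phi> t om) - h (\<phi> t om) (X t om) \<partial>M)"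
    using f_int h_int by simp
   also have "norm \<dots> <= (\<integral>om. norm (f (clampb b (X t om)) (\<phi> t om) - h (\<phi> t om) (X t om)) \<partial>M)"
    by (rule integral_norm_bound)
   also have "\<dots> <= (\<integral>om. e \<partial>M)"
    by (rule integral_mono) (use f_int h_int h(3) in auto)
   finally show ?thesis by (simp add: M.prob_space)
  qed
  then have 1: "\<bar>(\<integral>om. f (X t om) (\<phi> t om) \<partial>M) - ?Eh\<bar> <= e" unfolding Ef .
  \<comment> \<open>\<open>tm\<close> and \<open>cm\<close> are functions of \<open>T\<close> and
    \<open>c\<close> alone, so the error depends on \<open>p\<close> only through
    \<open>\<epsilon> p\<close> and \<open>\<delta> p\<close>.\<close>
  define tm where "tm = qbd_scheme.tm T"
  define c1 where "c1 = qbd_scheme.cm c / (2 * ?\<Delta>) + tm"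
  let ?err = "\<lambda>p. L * (\<epsilon> p / (1 - \<epsilon> p) + \<delta> p / 2) + err_bound t c1 (\<epsilon> p) ?\<Delta> tm (L * \<epsilon> p) (L * (tm * (\<epsilon> p / (1 - \<epsilon> p) + \<epsilon> p))) (L * tm) 0
    + err_bound t c1 (\<epsilon> p) ?\<Delta> tm 0 0 0 (2 * L)"
  have "?err \<longlonglongrightarrow> L * (0 / (1 - 0) + 0 / 2) + 0 + 0"
  proof (intro tendsto_add err_bound_tendsto \<epsilon>0 \<Delta> tendsto_const)
   have e1: "(\<lambda>p. \<epsilon> p / (1 - \<epsilon> p)) \<longlonglongrightarrow> 0 / (1 - 0)" by (intro tendsto_intros \<epsilon>0) auto
   show "(\<lambda>p. L * (\<epsilon> p / (1 - \<epsilon> p) + \<delta> p / 2)) \<longlonglongrightarrow> L * (0 / (1 - 0) + 0 / 2)"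
    by (intro tendsto_intros e1 assms(11)) auto
   show "(\<lambda>p. L * \<epsilon> p) \<longlonglongrightarrow> 0" using tendsto_mult_left[OF \<epsilon>0, of L] by simp
   have "(\<lambda>p. L * (tm * (\<epsilon> p / (1 - \<epsilon> p) + \<epsilon> p))) \<longlonglongrightarrow> L * (tm * (0 / (1 - 0) + 0))"
    by (intro tendsto_intros e1 \<epsilon>0)
   then show "(\<lambda>p. L * (tm * (\<epsilon> p / (1 - \<epsilon> p) + \<epsilon> p))) \<longlonglongrightarrow> 0" by simp
  qed
  then have "?err \<longlonglongrightarrow> 0" by simp
  then have "eventually (\<lambda>p. ?err p < e) sequentially" by (rule order_tendstoD) (rule e)
  then obtain p0 where p0: "!!p. p0 <= p ==> ?err p < e" by (auto simp: eventually_sequentially)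
  have "norm (qbd_matrix_value T c b K (q p) (\<alpha> p) (S p) (D p) (k p, i, n p) t f - (\<integral>om. f (X t om) (\<phi> t om) \<partial>M)) < e0"
   if p: "p0 <= p" for p
  proof -
   have "\<bar>qbd_matrix_value T c b K (q p) (\<alpha> p) (S p) (D p) (k p, i, n p) t f - ?Eh\<bar> <= e + ?err p"
    unfolding assms(8) tm_def c1_def
    by (rule qbd_scheme.matrix_value_error[OF scheme me_scheme.eps_bounds(3) assms(13,15,7) lip assms(14,16) h(3)])
      (rule qbd_scheme.axioms(1)[OF scheme])
   then show ?thesis using 1 p0[OF p] unfolding e_def real_norm_def by linarith
  qed
  then show "\<exists>p0. \<forall>p\<ge>p0. norm (qbd_matrix_value T c b K (q p) (\<alpha> p) (S p) (D p) (k p, i, n p) t f - (\<integral>om. f (X t om) (\<phi> t om) \<partial>M)) < e0"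
   by blast
 qed
 show ?thesis
 proof (intro conjI allI impI)
  fix N :: "nat => 'v measure" and L A \<psi>
  assume rap: "\<forall>p. qbd_rap (N p) T c K (q p) (\<alpha> p) (S p) (D p) (k p, i, n p) (L p) (A p) (\<psi> p)"
  show "qbd_expectation (N p) c b K (q p) (S p) (L p) (A p) (\<psi> p) t f =
    qbd_matrix_value T c b K (q p) (\<alpha> p) (S p) (D p) (k p, i, n p) t f" for p
   by (rule eq) (use rap in blast)
  then show "(\<lambda>p. qbd_expectation (N p) c b K (q p) (S p) (L p) (A p) (\<psi> p) t f)
    \<longlonglongrightarrow> (\<integral>om. f (X t om) (\<phi> t om) \<partial>M)"
   using lim by simp
 qed (rule lim)
qed

end
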